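(* Let $X$ be a real algebraic curve, let $s$ be the number of connected components of $X(\mathbb{R})$, and let $D$ be a non-simple very special divisor of degree $d$ on $X$. Then $\delta(D)=s$ and $\dim|D|=\frac12(d-\delta(D))+1$. Moreover $D$ is base point free.
   Context: A real algebraic curve is a smooth proper geometrically integral scheme of dimension $1$ over $\mathbb{R}$. $\mathrm{Div}(X)$ is the free abelian group on the closed points of $X$. For $D\in\mathrm{Div}(X)$, $\ell(D)=\dim_{\mathbb{R}}H^0(X,\mathcal{O}(D))$, $|D|$ is the complete linear system of $D$, and $\dim|D|=\ell(D)-1$ when $\ell(D)>0$. $\delta(D)$ is the number of connected components $C$ of $X(\mathbb{R})$ such that the degree of the restriction of $D$ to $C$ is odd. With $K$ a canonical divisor, $D$ is special if $\ell(K-D)>0$. A divisor $D$ of degree $d$ is very special if it is effective, special, and $\dim|D|>\frac12(d-\delta(D))$. $|D|$ (or $D$) is base point free if $\ell(D-P)\neq\ell(D)$ for all closed points $P$ of $X$; in general $|D|=E+|D_0|$ with $E\ge 0$ the base divisor and $|D_0|$ base point free. A divisor $D$ with $\dim|D|=r\ge1$ is simple if the morphism $X\to\mathbb{P}^r_{\mathbb{R}}$ defined by $|D|$ (by its base point free part if $|D|$ has base points) is birational onto its image, and non-simple otherwise. *)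

theory Defs
  imports
    "HOL-Analysis.Analysis"
    "HOL-Algebra.QuotRing"
    "HOL-Algebra.Embedded_Algebras"
    "HOL-Algebra.Generated_Rings"
    "HOL-Algebra.Free_Abelian_Groups"
begin

section \<open>Ringed spaces and schemes\<close>

record ('p, 's) ringed_space =
  space_top :: "'p topology"
  sections :: "'p set \<Rightarrow> 's ring"
  restr :: "'p set \<Rightarrow> 'p set \<Rightarrow> 's \<Rightarrow> 's"

definition sheaf_of_rings :: "('p, 's, 'm) ringed_space_scheme \<Rightarrow> bool" where
  "sheaf_of_rings X \<longleftrightarrow>
     (\<forall>U. openin (space_top X) U \<longrightarrow> cring (sections X U)) \<and>
     (\<forall>U V. openin (space_top X) U \<and> openin (space_top X) V \<and> V \<subseteq> U \<longrightarrow>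
        restr X U V \<in> ring_hom (sections X U) (sections X V)) \<and>
     (\<forall>U s. openin (space_top X) U \<and> s \<in> carrier (sections X U) \<longrightarrow> restr X U U s = s) \<and>
     (\<forall>U V W s. openin (space_top X) U \<and> openin (space_top X) V \<and> openin (space_top X) W \<and>
        W \<subseteq> V \<and> V \<subseteq> U \<and> s \<in> carrier (sections X U) \<longrightarrow>
        restr X V W (restr X U V s) = restr X U W s) \<and>
     (\<forall>\<U> s. (\<forall>U\<in>\<U>. openin (space_top X) U \<and> s U \<in> carrier (sections X U)) \<and>
        (\<forall>U\<in>\<U>. \<forall>V\<in>\<U>. restr X U (U \<inter> V) (s U) = restr X V (U \<inter> V) (s V)) \<longrightarrow>
        (\<exists>!t. t \<in> carrier (sections X (\<Union>\<U>)) \<and> (\<forall>U\<in>\<U>. restr X (\<Union>\<U>) U t = s U)))"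

text \<open>The fraction $a/f$ in the localization $A_P$, as the class of all pairs representing it.\<close>

definition loc_frac :: "('a, 'm) ring_scheme \<Rightarrow> 'a set \<Rightarrow> 'a \<Rightarrow> 'a \<Rightarrow> ('a \<times> 'a) set" where
  "loc_frac A P a f =
     {(b, g). b \<in> carrier A \<and> g \<in> carrier A - P \<and>
        (\<exists>h \<in> carrier A - P. h \<otimes>\<^bsub>A\<^esub> (a \<otimes>\<^bsub>A\<^esub> g) = h \<otimes>\<^bsub>A\<^esub> (b \<otimes>\<^bsub>A\<^esub> f))}"

definition localization_at :: "('a, 'm) ring_scheme \<Rightarrow> 'a set \<Rightarrow> ('a \<times> 'a) set ring" where
  "localization_at A P =
     \<lparr>carrier = {loc_frac A P a f |a f. a \<in> carrier A \<and> f \<in> carrier A - P},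
      monoid.mult = (\<lambda>x y. \<Union>(a, f)\<in>x. \<Union>(b, g)\<in>y. loc_frac A P (a \<otimes>\<^bsub>A\<^esub> b) (f \<otimes>\<^bsub>A\<^esub> g)),
      monoid.one = loc_frac A P \<one>\<^bsub>A\<^esub> \<one>\<^bsub>A\<^esub>,
      ring.zero = loc_frac A P \<zero>\<^bsub>A\<^esub> \<one>\<^bsub>A\<^esub>,
      ring.add = (\<lambda>x y. \<Union>(a, f)\<in>x. \<Union>(b, g)\<in>y.
               loc_frac A P ((a \<otimes>\<^bsub>A\<^esub> g) \<oplus>\<^bsub>A\<^esub> (b \<otimes>\<^bsub>A\<^esub> f)) (f \<otimes>\<^bsub>A\<^esub> g))\<rparr>"

definition spec_top :: "('a, 'm) ring_scheme \<Rightarrow> 'a set topology" where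
  "spec_top A = topology_generated_by ((\<lambda>f. {P. primeideal P A \<and> f \<notin> P}) ` carrier A)"

text \<open>Sections of the structure sheaf of the spectrum are the functions $P \mapsto s(P) \in A_P$
  that are locally of the form $a/f$.\<close>

definition Spec :: "('a, 'm) ring_scheme \<Rightarrow> ('a set, 'a set \<Rightarrow> ('a \<times> 'a) set) ringed_space" where
  "Spec A =
     \<lparr>space_top = spec_top A,
      sections = (\<lambda>U.
        \<lparr>carrier = {s \<in> extensional U. \<forall>P\<in>U. \<exists>W a f.
             openin (spec_top A) W \<and> P \<in> W \<and> W \<subseteq> U \<and> a \<in> carrier A \<and> f \<in> carrier A \<and>
             (\<forall>Q\<in>W. f \<notin> Q \<and> s Q = loc_frac A Q a f)},
         monoid.mult = (\<lambda>s t. \<lambda>P\<in>U. s P \<otimes>\<^bsub>localization_at A P\<^esub> t P),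
         monoid.one = (\<lambda>P\<in>U. \<one>\<^bsub>localization_at A P\<^esub>),
         ring.zero = (\<lambda>P\<in>U. \<zero>\<^bsub>localization_at A P\<^esub>),
         ring.add = (\<lambda>s t. \<lambda>P\<in>U. s P \<oplus>\<^bsub>localization_at A P\<^esub> t P)\<rparr>),
      restr = (\<lambda>U V s. restrict s V)\<rparr>"

definition open_subspace_iso ::
    "('p, 's, 'm) ringed_space_scheme \<Rightarrow> 'p set \<Rightarrow> ('q, 't, 'n) ringed_space_scheme \<Rightarrow> bool" where
  "open_subspace_iso X U Y \<longleftrightarrow>
     (\<exists>f \<phi>. homeomorphic_map (subtopology (space_top X) U) (space_top Y) f \<and>
        (\<forall>V. openin (space_top Y) V \<longrightarrow>
           \<phi> V \<in> ring_iso (sections Y V) (sections X {x \<in> U. f x \<in> V})) \<and>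
        (\<forall>V W s. openin (space_top Y) V \<and> openin (space_top Y) W \<and> W \<subseteq> V \<and>
           s \<in> carrier (sections Y V) \<longrightarrow>
           \<phi> W (restr Y V W s) = restr X {x \<in> U. f x \<in> V} {x \<in> U. f x \<in> W} (\<phi> V s)))"

text \<open>If an open subspace is isomorphic to the spectrum of some ring, then that ring is isomorphic
  to its ring of sections, so only the latter has to be considered.  An isomorphism of ringed
  spaces between locally ringed spaces is automatically local.\<close>

definition affine_open :: "('p, 's, 'm) ringed_space_scheme \<Rightarrow> 'p set \<Rightarrow> bool" where
  "affine_open X U \<longleftrightarrow> openin (space_top X) U \<and> open_subspace_iso X U (Spec (sections X U))"

definition is_scheme :: "('p, 's, 'm) ringed_space_scheme \<Rightarrow> bool" where
  "is_scheme X \<longleftrightarrow> sheaf_of_rings X \<and> (\<forall>x \<in> topspace (space_top X). \<exists>U. affine_open X U \<and> x \<in> U)"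


section \<open>Stalks\<close>

definition germ ::
    "('p, 's, 'm) ringed_space_scheme \<Rightarrow> 'p \<Rightarrow> 'p set \<Rightarrow> 's \<Rightarrow> ('p set \<times> 's) set" where
  "germ X x U s =
     {(V, t). openin (space_top X) V \<and> x \<in> V \<and> t \<in> carrier (sections X V) \<and>
        (\<exists>W. openin (space_top X) W \<and> x \<in> W \<and> W \<subseteq> U \<inter> V \<and> restr X U W s = restr X V W t)}"

definition stalk :: "('p, 's, 'm) ringed_space_scheme \<Rightarrow> 'p \<Rightarrow> ('p set \<times> 's) set ring" where
  "stalk X x =
     \<lparr>carrier = {germ X x U s |U s. openin (space_top X) U \<and> x \<in> U \<and> s \<in> carrier (sections X U)},
      monoid.mult = (\<lambda>a b. \<Union>(U, s)\<in>a. \<Union>(V, t)\<in>b. germ X x (U \<inter> V)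
                (restr X U (U \<inter> V) s \<otimes>\<^bsub>sections X (U \<inter> V)\<^esub> restr X V (U \<inter> V) t)),
      monoid.one = germ X x (topspace (space_top X)) \<one>\<^bsub>sections X (topspace (space_top X))\<^esub>,
      ring.zero = germ X x (topspace (space_top X)) \<zero>\<^bsub>sections X (topspace (space_top X))\<^esub>,
      ring.add = (\<lambda>a b. \<Union>(U, s)\<in>a. \<Union>(V, t)\<in>b. germ X x (U \<inter> V)
                (restr X U (U \<inter> V) s \<oplus>\<^bsub>sections X (U \<inter> V)\<^esub> restr X V (U \<inter> V) t))\<rparr>"

definition stalk_max :: "('p, 's, 'm) ringed_space_scheme \<Rightarrow> 'p \<Rightarrow> ('p set \<times> 's) set set" where
  "stalk_max X x = carrier (stalk X x) - Units (stalk X x)"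

definition residue_field ::
    "('p, 's, 'm) ringed_space_scheme \<Rightarrow> 'p \<Rightarrow> ('p set \<times> 's) set set ring" where
  "residue_field X x = stalk X x Quot stalk_max X x"


section \<open>Schemes over the real numbers\<close>

definition real_ring :: "real ring" where
  "real_ring = \<lparr>carrier = UNIV, monoid.mult = (*), monoid.one = 1, ring.zero = 0, ring.add = (+)\<rparr>"

text \<open>A morphism to the spectrum of the real numbers amounts to a ring homomorphism from the real
  numbers to the global sections.\<close>

record ('p, 's) real_space = "('p, 's) ringed_space" +
  structure_hom :: "real \<Rightarrow> 's"

definition is_real_scheme :: "('p, 's, 'm) real_space_scheme \<Rightarrow> bool" where
  "is_real_scheme X \<longleftrightarrow> is_scheme X \<and>
     structure_hom X \<in> ring_hom real_ring (sections X (topspace (space_top X)))"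

definition const :: "('p, 's, 'm) real_space_scheme \<Rightarrow> 'p set \<Rightarrow> real \<Rightarrow> 's" where
  "const X U r = restr X (topspace (space_top X)) U (structure_hom X r)"

definition const_germ :: "('p, 's, 'm) real_space_scheme \<Rightarrow> 'p \<Rightarrow> real \<Rightarrow> ('p set \<times> 's) set" where
  "const_germ X x r = germ X x (topspace (space_top X)) (structure_hom X r)"

text \<open>Polynomials over a commutative ring \<open>R\<close> in the variables \<open>0, \<dots>, n - 1\<close>; monomials are
  multisets of variables.\<close>

definition mpoly_ring :: "('a, 'm) ring_scheme \<Rightarrow> nat \<Rightarrow> (nat multiset \<Rightarrow> 'a) ring" where
  "mpoly_ring R n =
     \<lparr>carrier = {p. (\<forall>m. p m \<in> carrier R) \<and> finite {m. p m \<noteq> \<zero>\<^bsub>R\<^esub>} \<and>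
                    (\<forall>m. p m \<noteq> \<zero>\<^bsub>R\<^esub> \<longrightarrow> set_mset m \<subseteq> {..<n})},
      monoid.mult = (\<lambda>p q m. finsum R (\<lambda>a. p a \<otimes>\<^bsub>R\<^esub> q (m - a)) {a. a \<subseteq># m}),
      monoid.one = (\<lambda>m. if m = {#} then \<one>\<^bsub>R\<^esub> else \<zero>\<^bsub>R\<^esub>),
      ring.zero = (\<lambda>m. \<zero>\<^bsub>R\<^esub>),
      ring.add = (\<lambda>p q m. p m \<oplus>\<^bsub>R\<^esub> q m)\<rparr>"

definition mpoly_const :: "('a, 'm) ring_scheme \<Rightarrow> 'a \<Rightarrow> nat multiset \<Rightarrow> 'a" where
  "mpoly_const R a = (\<lambda>m. if m = {#} then a else \<zero>\<^bsub>R\<^esub>)"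

text \<open>The value in \<open>S\<close> of a real polynomial at the point \<open>x\<close>, where \<open>c\<close> makes \<open>S\<close> a real algebra.\<close>

definition real_poly_eval ::
    "('a, 'm) ring_scheme \<Rightarrow> (real \<Rightarrow> 'a) \<Rightarrow> (nat \<Rightarrow> 'a) \<Rightarrow> (nat multiset \<Rightarrow> real) \<Rightarrow> 'a" where
  "real_poly_eval S c x p =
     finsum S (\<lambda>m. c (p m) \<otimes>\<^bsub>S\<^esub> finprod S (\<lambda>i. x i [^]\<^bsub>S\<^esub> count m i) (set_mset m)) {m. p m \<noteq> 0}"

definition partial_deriv :: "nat \<Rightarrow> (nat multiset \<Rightarrow> real) \<Rightarrow> nat multiset \<Rightarrow> real" where
  "partial_deriv i p = (\<lambda>m. real (count m i + 1) * p (add_mset i m))"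

definition homogeneous :: "nat \<Rightarrow> (nat multiset \<Rightarrow> real) \<Rightarrow> bool" where
  "homogeneous k p \<longleftrightarrow> (\<forall>m. p m \<noteq> 0 \<longrightarrow> size m = k)"


section \<open>Real algebraic curves\<close>

definition finite_type :: "('p, 's, 'm) real_space_scheme \<Rightarrow> bool" where
  "finite_type X \<longleftrightarrow>
     (\<exists>\<U>. finite \<U> \<and> \<Union>\<U> = topspace (space_top X) \<and>
        (\<forall>U\<in>\<U>. affine_open X U \<and>
           (\<exists>n x. (\<forall>i<n. x i \<in> carrier (sections X U)) \<and>
              real_poly_eval (sections X U) (const X U) x ` carrier (mpoly_ring real_ring n)
                = carrier (sections X U))))"

text \<open>The diagonal is a closed immersion, checked on the affine open cover of the product by the
  products of affine opens.\<close>

definition separated :: "('p, 's, 'm) real_space_scheme \<Rightarrow> bool" where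
  "separated X \<longleftrightarrow>
     (\<forall>U V. affine_open X U \<and> affine_open X V \<longrightarrow>
        affine_open X (U \<inter> V) \<and>
        generate_ring (sections X (U \<inter> V))
          (restr X U (U \<inter> V) ` carrier (sections X U) \<union> restr X V (U \<inter> V) ` carrier (sections X V))
        = carrier (sections X (U \<inter> V)))"

text \<open>The underlying space of the affine $n$-space over $X$, that is of the fibre product of $X$
  with the real affine $n$-space: its points over \<open>x\<close> are the primes of $\mathcal{O}_x[t]$
  lying over the maximal ideal of $\mathcal{O}_x$, and over an affine open \<open>U\<close> its closed sets
  are the zero sets of ideals of $\mathcal{O}(U)[t]$.\<close>

definition affine_space_points ::
    "('p, 's, 'm) real_space_scheme \<Rightarrow> nat \<Rightarrow> ('p \<times> (nat multiset \<Rightarrow> ('p set \<times> 's) set) set) set" where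
  "affine_space_points X n =
     {(x, Q). x \<in> topspace (space_top X) \<and> primeideal Q (mpoly_ring (stalk X x) n) \<and>
        (\<forall>a \<in> carrier (stalk X x). mpoly_const (stalk X x) a \<in> Q \<longleftrightarrow> a \<in> stalk_max X x)}"

definition affine_space_closed ::
    "('p, 's, 'm) real_space_scheme \<Rightarrow> nat \<Rightarrow> ('p \<times> (nat multiset \<Rightarrow> ('p set \<times> 's) set) set) set \<Rightarrow> bool" where
  "affine_space_closed X n Z \<longleftrightarrow> Z \<subseteq> affine_space_points X n \<and>
     (\<forall>U. affine_open X U \<longrightarrow>
        (\<exists>I \<subseteq> carrier (mpoly_ring (sections X U) n).
           \<forall>(x, Q) \<in> affine_space_points X n. x \<in> U \<longrightarrow>
             ((x, Q) \<in> Z \<longleftrightarrow> (\<forall>f\<in>I. (\<lambda>m. germ X x U (f m)) \<in> Q))))"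

definition affine_space_proj ::
    "('p, 's, 'm) real_space_scheme \<Rightarrow> nat \<Rightarrow> 'p \<times> (nat multiset \<Rightarrow> ('p set \<times> 's) set) set
      \<Rightarrow> (nat multiset \<Rightarrow> real) set" where
  "affine_space_proj X n =
     (\<lambda>(x, Q). {p \<in> carrier (mpoly_ring real_ring n). (\<lambda>m. const_germ X x (p m)) \<in> Q})"

text \<open>For a quasi-compact morphism it suffices to test universal closedness on base changes to
  affine spaces.\<close>

definition universally_closed :: "('p, 's, 'm) real_space_scheme \<Rightarrow> bool" where
  "universally_closed X \<longleftrightarrow>
     (\<forall>n Z. affine_space_closed X n Z \<longrightarrow>
        closedin (spec_top (mpoly_ring real_ring n)) (affine_space_proj X n ` Z))"

definition proper_scheme :: "('p, 's, 'm) real_space_scheme \<Rightarrow> bool" where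
  "proper_scheme X \<longleftrightarrow> separated X \<and> finite_type X \<and> universally_closed X"

text \<open>Locally the scheme is the spectrum of a standard smooth algebra
  $\mathbb{R}[t_0, \dots, t_{n-1}]/(f_0, \dots, f_{c-1})$: the Jacobian minor
  $(\partial f_j / \partial t_i)_{i, j < c}$ is invertible.\<close>

definition smooth_scheme :: "('p, 's, 'm) real_space_scheme \<Rightarrow> bool" where
  "smooth_scheme X \<longleftrightarrow>
     (\<forall>x \<in> topspace (space_top X). \<exists>U. x \<in> U \<and> affine_open X U \<and>
        (let A = sections X U in
         \<exists>n c t f N. c \<le> n \<and>
           (\<forall>i<n. t i \<in> carrier A) \<and>
           (\<forall>j<c. f j \<in> carrier (mpoly_ring real_ring n)) \<and>
           real_poly_eval A (const X U) t ` carrier (mpoly_ring real_ring n) = carrier A \<and>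
           {p \<in> carrier (mpoly_ring real_ring n). real_poly_eval A (const X U) t p = \<zero>\<^bsub>A\<^esub>}
             = Idl\<^bsub>mpoly_ring real_ring n\<^esub> (f ` {..<c}) \<and>
           (\<forall>i<c. \<forall>k<c. N i k \<in> carrier A) \<and>
           (\<forall>j<c. \<forall>k<c.
              finsum A (\<lambda>i. real_poly_eval A (const X U) t (partial_deriv i (f j)) \<otimes>\<^bsub>A\<^esub> N i k) {..<c}
              = (if j = k then \<one>\<^bsub>A\<^esub> else \<zero>\<^bsub>A\<^esub>))))"

definition complexification :: "('a, 'm) ring_scheme \<Rightarrow> ('a \<times> 'a) ring" where
  "complexification A =
     \<lparr>carrier = carrier A \<times> carrier A,
      monoid.mult = (\<lambda>(a, b) (c, d). ((a \<otimes>\<^bsub>A\<^esub> c) \<ominus>\<^bsub>A\<^esub> (b \<otimes>\<^bsub>A\<^esub> d), (a \<otimes>\<^bsub>A\<^esub> d) \<oplus>\<^bsub>A\<^esub> (b \<otimes>\<^bsub>A\<^esub> c))),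
      monoid.one = (\<one>\<^bsub>A\<^esub>, \<zero>\<^bsub>A\<^esub>),
      ring.zero = (\<zero>\<^bsub>A\<^esub>, \<zero>\<^bsub>A\<^esub>),
      ring.add = (\<lambda>(a, b) (c, d). (a \<oplus>\<^bsub>A\<^esub> c, b \<oplus>\<^bsub>A\<^esub> d))\<rparr>"

text \<open>The complexification of $\mathcal{O}(U)$ is the ring of sections of the base change
  $X_{\mathbb{C}}$ over the preimage of \<open>U\<close>; such preimages suffice for integrality because
  $X_{\mathbb{C}} \to X$ is open and affine.\<close>

definition geometrically_integral :: "('p, 's, 'm) real_space_scheme \<Rightarrow> bool" where
  "geometrically_integral X \<longleftrightarrow> topspace (space_top X) \<noteq> {} \<and>
     (\<forall>U. openin (space_top X) U \<and> U \<noteq> {} \<longrightarrow> domain (complexification (sections X U)))"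

definition irreducible_closed :: "'p topology \<Rightarrow> 'p set \<Rightarrow> bool" where
  "irreducible_closed T Z \<longleftrightarrow> closedin T Z \<and> Z \<noteq> {} \<and>
     (\<forall>A B. closedin T A \<and> closedin T B \<and> Z = A \<union> B \<longrightarrow> A = Z \<or> B = Z)"

definition krull_dim_one :: "'p topology \<Rightarrow> bool" where
  "krull_dim_one T \<longleftrightarrow>
     (\<exists>Z0 Z1. irreducible_closed T Z0 \<and> irreducible_closed T Z1 \<and> Z0 \<subset> Z1) \<and>
     \<not> (\<exists>Z0 Z1 Z2. irreducible_closed T Z0 \<and> irreducible_closed T Z1 \<and> irreducible_closed T Z2 \<and>
          Z0 \<subset> Z1 \<and> Z1 \<subset> Z2)"

definition real_algebraic_curve :: "('p, 's, 'm) real_space_scheme \<Rightarrow> bool" where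
  "real_algebraic_curve X \<longleftrightarrow> is_real_scheme X \<and> smooth_scheme X \<and> proper_scheme X \<and>
     geometrically_integral X \<and> krull_dim_one (space_top X)"


section \<open>Real points\<close>

definition residue_const ::
    "('p, 's, 'm) real_space_scheme \<Rightarrow> 'p \<Rightarrow> real \<Rightarrow> ('p set \<times> 's) set set" where
  "residue_const X x r = stalk_max X x +>\<^bsub>stalk X x\<^esub> const_germ X x r"

definition real_points :: "('p, 's, 'm) real_space_scheme \<Rightarrow> 'p set" where
  "real_points X =
     {x \<in> topspace (space_top X). range (residue_const X x) = carrier (residue_field X x)}"

definition real_value :: "('p, 's, 'm) real_space_scheme \<Rightarrow> 'p set \<Rightarrow> 's \<Rightarrow> 'p \<Rightarrow> real" where
  "real_value X U f x =
     (THE r. residue_const X x r = stalk_max X x +>\<^bsub>stalk X x\<^esub> germ X x U f)"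

text \<open>The Euclidean topology, as the coarsest one for which all Zariski open sets are open and all
  regular functions are continuous where they are defined.\<close>

definition real_points_top :: "('p, 's, 'm) real_space_scheme \<Rightarrow> 'p topology" where
  "real_points_top X = topology_generated_by
     {{x \<in> real_points X \<inter> U. real_value X U f x \<in> V} |U f V.
        openin (space_top X) U \<and> f \<in> carrier (sections X U) \<and> open V}"

definition real_components :: "('p, 's, 'm) real_space_scheme \<Rightarrow> 'p set set" where
  "real_components X = connected_components_of (real_points_top X)"


section \<open>Rational functions and divisors\<close>

definition generic_point :: "('p, 's, 'm) ringed_space_scheme \<Rightarrow> 'p" where
  "generic_point X = (THE x. x \<in> topspace (space_top X) \<and>
     (\<forall>U. openin (space_top X) U \<and> U \<noteq> {} \<longrightarrow> x \<in> U))"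

abbreviation function_field :: "('p, 's, 'm) ringed_space_scheme \<Rightarrow> ('p set \<times> 's) set ring" where
  "function_field X \<equiv> stalk X (generic_point X)"

abbreviation ff_const :: "('p, 's, 'm) real_space_scheme \<Rightarrow> real \<Rightarrow> ('p set \<times> 's) set" where
  "ff_const X \<equiv> const_germ X (generic_point X)"

definition real_dim :: "('a, 'm) ring_scheme \<Rightarrow> (real \<Rightarrow> 'a) \<Rightarrow> 'a set \<Rightarrow> nat" where
  "real_dim R c E = (THE n. ring.dimension R n (range c) E)"

definition closed_points :: "('p, 's, 'm) ringed_space_scheme \<Rightarrow> 'p set" where
  "closed_points X = {x \<in> topspace (space_top X). closedin (space_top X) {x}}"

definition point_degree :: "('p, 's, 'm) real_space_scheme \<Rightarrow> 'p \<Rightarrow> nat" where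
  "point_degree X x = real_dim (residue_field X x) (residue_const X x) (carrier (residue_field X x))"

abbreviation Div :: "('p, 's, 'm) ringed_space_scheme \<Rightarrow> ('p \<Rightarrow>\<^sub>0 int) set" where
  "Div X \<equiv> carrier (free_Abelian_group (closed_points X))"

definition div_degree :: "('p, 's, 'm) real_space_scheme \<Rightarrow> ('p \<Rightarrow>\<^sub>0 int) \<Rightarrow> int" where
  "div_degree X D = (\<Sum>P \<in> Poly_Mapping.keys D. Poly_Mapping.lookup D P * int (point_degree X P))"

definition effective :: "('p \<Rightarrow>\<^sub>0 int) \<Rightarrow> bool" where
  "effective D \<longleftrightarrow> (\<forall>P. Poly_Mapping.lookup D P \<ge> 0)"

text \<open>The injection of the local ring at \<open>P\<close> into the function field.\<close>

definition stalk_to_ff ::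
    "('p, 's, 'm) ringed_space_scheme \<Rightarrow> ('p set \<times> 's) set \<Rightarrow> ('p set \<times> 's) set" where
  "stalk_to_ff X a = (\<Union>(U, s)\<in>a. germ X (generic_point X) U s)"

text \<open>Generators, as elements of the function field, of the maximal ideal of the discrete valuation
  ring $\mathcal{O}_P$.\<close>

definition uniformizer :: "('p, 's, 'm) ringed_space_scheme \<Rightarrow> 'p \<Rightarrow> ('p set \<times> 's) set \<Rightarrow> bool" where
  "uniformizer X P t \<longleftrightarrow> t \<in> carrier (function_field X) \<and>
     stalk_to_ff X ` stalk_max X P =
       {t \<otimes>\<^bsub>function_field X\<^esub> a |a. a \<in> stalk_to_ff X ` carrier (stalk X P)}"

definition ord_at :: "('p, 's, 'm) ringed_space_scheme \<Rightarrow> 'p \<Rightarrow> ('p set \<times> 's) set \<Rightarrow> int" where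
  "ord_at X P f = (THE n. \<exists>t u. uniformizer X P t \<and> u \<in> stalk_to_ff X ` Units (stalk X P) \<and>
     f = u \<otimes>\<^bsub>function_field X\<^esub> (t [^]\<^bsub>function_field X\<^esub> n))"

text \<open>$H^0(X, \mathcal{O}(D))$ as a space of rational functions.\<close>

definition global_sections ::
    "('p, 's, 'm) ringed_space_scheme \<Rightarrow> ('p \<Rightarrow>\<^sub>0 int) \<Rightarrow> ('p set \<times> 's) set set" where
  "global_sections X D = {f \<in> carrier (function_field X). f \<noteq> \<zero>\<^bsub>function_field X\<^esub> \<longrightarrow>
     (\<forall>P \<in> closed_points X. ord_at X P f + Poly_Mapping.lookup D P \<ge> 0)}"

definition ell :: "('p, 's, 'm) real_space_scheme \<Rightarrow> ('p \<Rightarrow>\<^sub>0 int) \<Rightarrow> nat" where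
  "ell X D = real_dim (function_field X) (ff_const X) (global_sections X D)"

definition linear_system ::
    "('p, 's, 'm) ringed_space_scheme \<Rightarrow> ('p \<Rightarrow>\<^sub>0 int) \<Rightarrow> ('p \<Rightarrow>\<^sub>0 int) set" where
  "linear_system X D = {D' \<in> Div X. effective D' \<and>
     (\<exists>f \<in> carrier (function_field X) - {\<zero>\<^bsub>function_field X\<^esub>}. \<forall>P \<in> closed_points X.
        Poly_Mapping.lookup D' P = Poly_Mapping.lookup D P + ord_at X P f)}"

definition dim_linear_system :: "('p, 's, 'm) real_space_scheme \<Rightarrow> ('p \<Rightarrow>\<^sub>0 int) \<Rightarrow> int" where
  "dim_linear_system X D = int (ell X D) - 1"

text \<open>Real points have degree 1, so the degree of \<open>D\<close> on a component is a plain sum of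
  multiplicities.\<close>

definition delta :: "('p, 's, 'm) real_space_scheme \<Rightarrow> ('p \<Rightarrow>\<^sub>0 int) \<Rightarrow> nat" where
  "delta X D =
     card {C \<in> real_components X. odd (\<Sum>P \<in> Poly_Mapping.keys D \<inter> C. Poly_Mapping.lookup D P)}"

definition ff_derivation ::
    "('p, 's, 'm) real_space_scheme \<Rightarrow> (('p set \<times> 's) set \<Rightarrow> ('p set \<times> 's) set) \<Rightarrow> bool" where
  "ff_derivation X d \<longleftrightarrow> (let K = function_field X in
     (\<forall>f \<in> carrier K. d f \<in> carrier K) \<and>
     (\<forall>f \<in> carrier K. \<forall>g \<in> carrier K. d (f \<oplus>\<^bsub>K\<^esub> g) = d f \<oplus>\<^bsub>K\<^esub> d g) \<and>
     (\<forall>f \<in> carrier K. \<forall>g \<in> carrier K.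
        d (f \<otimes>\<^bsub>K\<^esub> g) = (f \<otimes>\<^bsub>K\<^esub> d g) \<oplus>\<^bsub>K\<^esub> (g \<otimes>\<^bsub>K\<^esub> d f)) \<and>
     (\<forall>r. d (ff_const X r) = \<zero>\<^bsub>K\<^esub>))"

text \<open>Divisors of nonzero rational differentials $g\,df$.  At \<open>P\<close>, with uniformizer $t$, one has
  $g\,df = g\,(df/dt)\,dt$, where $d/dt$ is the derivation of the function field mapping $t$ to 1.\<close>

definition canonical_divisor :: "('p, 's, 'm) real_space_scheme \<Rightarrow> ('p \<Rightarrow>\<^sub>0 int) \<Rightarrow> bool" where
  "canonical_divisor X \<kappa> \<longleftrightarrow> \<kappa> \<in> Div X \<and> (let K = function_field X in
     \<exists>f \<in> carrier K. \<exists>g \<in> carrier K - {\<zero>\<^bsub>K\<^esub>}.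
       (\<exists>d. ff_derivation X d \<and> d f \<noteq> \<zero>\<^bsub>K\<^esub>) \<and>
       (\<forall>P \<in> closed_points X. \<exists>t d. uniformizer X P t \<and> ff_derivation X d \<and> d t = \<one>\<^bsub>K\<^esub> \<and>
          Poly_Mapping.lookup \<kappa> P = ord_at X P (g \<otimes>\<^bsub>K\<^esub> d f)))"

definition special :: "('p, 's, 'm) real_space_scheme \<Rightarrow> ('p \<Rightarrow>\<^sub>0 int) \<Rightarrow> bool" where
  "special X D \<longleftrightarrow> (\<exists>\<kappa>. canonical_divisor X \<kappa> \<and> ell X (\<kappa> - D) > 0)"

definition very_special :: "('p, 's, 'm) real_space_scheme \<Rightarrow> ('p \<Rightarrow>\<^sub>0 int) \<Rightarrow> bool" where
  "very_special X D \<longleftrightarrow> D \<in> Div X \<and> effective D \<and> special X D \<and>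
     real_of_int (dim_linear_system X D) > (real_of_int (div_degree X D) - real (delta X D)) / 2"

definition base_point_free :: "('p, 's, 'm) real_space_scheme \<Rightarrow> ('p \<Rightarrow>\<^sub>0 int) \<Rightarrow> bool" where
  "base_point_free X D \<longleftrightarrow> (\<forall>P \<in> closed_points X. ell X (D - Poly_Mapping.single P 1) \<noteq> ell X D)"

definition base_decomposition ::
    "('p, 's, 'm) real_space_scheme \<Rightarrow> ('p \<Rightarrow>\<^sub>0 int) \<Rightarrow> ('p \<Rightarrow>\<^sub>0 int) \<Rightarrow> ('p \<Rightarrow>\<^sub>0 int) \<Rightarrow> bool" where
  "base_decomposition X D E D0 \<longleftrightarrow> E \<in> Div X \<and> D0 \<in> Div X \<and> effective E \<and>
     linear_system X D = (\<lambda>D'. E + D') ` linear_system X D0 \<and> base_point_free X D0"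

text \<open>Let $\varphi$ be the morphism to projective space given by rational functions
  $s_0, \dots, s_r$.  The function field of the (reduced) image of $\varphi$ is the residue field
  at the image of the generic point; its elements are the quotients $F/G$ of real forms of the
  same degree with $G(s) \neq 0$, and pulling back along $\varphi$ sends $F/G$ to $F(s)/G(s)$.
  Birationality onto the image means that this pullback is onto the function field of $X$.\<close>

definition birational_onto_image ::
    "('p, 's, 'm) real_space_scheme \<Rightarrow> ('p set \<times> 's) set list \<Rightarrow> bool" where
  "birational_onto_image X s \<longleftrightarrow> (let K = function_field X; n = length s;
       ev = real_poly_eval K (ff_const X) (\<lambda>i. s ! i) in
     carrier K = {ev F \<otimes>\<^bsub>K\<^esub> inv\<^bsub>K\<^esub> (ev G) |F G k.
       F \<in> carrier (mpoly_ring real_ring n) \<and> G \<in> carrier (mpoly_ring real_ring n) \<and>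
       homogeneous k F \<and> homogeneous k G \<and> ev G \<noteq> \<zero>\<^bsub>K\<^esub>})"

definition simple_divisor :: "('p, 's, 'm) real_space_scheme \<Rightarrow> ('p \<Rightarrow>\<^sub>0 int) \<Rightarrow> bool" where
  "simple_divisor X D \<longleftrightarrow> dim_linear_system X D \<ge> 1 \<and>
     (\<exists>E D0 s. base_decomposition X D E D0 \<and>
        set s \<subseteq> carrier (function_field X) \<and>
        ring.independent (function_field X) (range (ff_const X)) s \<and>
        ring.Span (function_field X) (range (ff_const X)) s = global_sections X D0 \<and>
        birational_onto_image X s)"

definition non_simple_divisor :: "('p, 's, 'm) real_space_scheme \<Rightarrow> ('p \<Rightarrow>\<^sub>0 int) \<Rightarrow> bool" where
  "non_simple_divisor X D \<longleftrightarrow> dim_linear_system X D \<ge> 1 \<and> \<not> simple_divisor X D"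

end

theory Submission imports Defs "HOL-Computational_Algebra.Fundamental_Theorem_Algebra" "HOL-Algebra.Weak_Morphisms" begin
text \<open>The germs at the closed points form discrete valuation rings of the function field; this turns the
  curve into an abstract function field, and Riemann's theorem holds there.  Call a divisor $D$ non-birational if
  the quotients of forms of equal degree in the sections of $D$ make up a proper subfield; then so is $D - P$.  If
  $D$ is base point free and, for some $P$, $D - P$ has sections but no base point, then $D$ is birational.
  Hence, from a non-birational $D$ one subtracts a real point and then meets a base point.  Induction shows, with
  $a = \deg D - \delta(D)$, that $a \ge 2\dim|D| - 2$, and $a \ge 2\dim|D|$ if $D$ has a base point or even degree
  on some component; since $a$ is even for effective $D$, the theorem follows.  The number $a$ only depends on the
  class of $D$ because functions have even degree on every real component: by the Stone--Weierstrass theorem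
  on the compact space of real places, a function can be modified so that it keeps its zeros on one component and
  has none on the others, and the total real degree is even.\<close>

text \<open>Most of the work is to reach the function field. A field type \<open>'k\<close> receives
  it, and all rings become subsets of that type: a point is its local ring, an affine open set its
  ring of functions. Each property of the curve then has a concrete effect: smoothness makes the
  local rings discrete valuation rings, separatedness makes them pairwise incomparable, universal
  closedness makes functions without poles constant, geometric integrality excludes a square root of
  -1. The use of dimension one and the determination of the residue fields rest on counting:
  algebras of finite type have countable dimension, but there are uncountably many real numbers. The
  criterion for birationality comes from Nakayama's lemma: if the sections of $D - P$ have no base
  point, the map separates $P$ from everything else, and the functions on the image already fill the
  local ring at $P$. Real places are compact because a limit of them is again a valuation ring, and
  every valuation ring over the reals is that of a point. The bound on $a$ works because subtracting
  a real point lowers $a$ by 2 or not at all, depending on the parity on its component.\<close>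

abbreviation (input) iffA :: "bool => bool => bool" (infixr "<->" 25) where "A <-> B == A = B"
abbreviation "lk == Poly_Mapping.lookup"
abbreviation "kys == Poly_Mapping.keys"
abbreviation "sgl == Poly_Mapping.single"
\<comment> \<open>An ASCII spelling of the structure subscript: \<open>\<one>$$R\<close> is the unit
  of \<open>R\<close>.\<close>
syntax "_index" :: "logic => index" ("$$_" [1000] 1000)
type_synonym ('p, 's) ffg = "('p set \<times> 's) set"
type_synonym ('p, 's) exr = "('p, 's) ffg + real"
type_synonym 'q dvt = "'q \<Rightarrow>\<^sub>0 int"
abbreviation "RX == mpoly_ring real_ring"
lemmas als = algebra_simps
lemmas p2 = power2_eq_square
lemmas sdl = sum_distrib_left
lemmas sdr = sum_distrib_right
lemmas scr = scaleR_conv_of_real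
lemmas crs = cring.cring_simprules
lemmas ifi = infinite_finite_induct

text \<open>Operations on fractions and on germs are defined as unions over all representatives;
  such a union collapses once the result does not depend on them.\<close>

lemma UN2_const: "p:x ==> q:y ==> (!!a f b g. (a, f):x ==> (b, g):y ==> F a f b g = C) ==>
 (UN (a, f):x. UN (b, g):y. F a f b g) = C" by blast

section \<open>Localizations and the spectrum of a domain\<close>

context domain
begin

lemma prime_zero_one: assumes "primeideal P R" shows "\<zero>:P" "\<one> ~: P" "P <= carrier R"
proof -
 interpret primeideal P R by fact
 show "\<zero>:P" by simp
 show "\<one> ~: P" using I_notcarr one_imp_carrier by auto
 show "P <= carrier R" by auto
qed

lemma zero_prime: "primeideal {\<zero>} R" by (rule zeroprimeideal)

text \<open>The factor \<open>h\<close> in the definition of a fraction lies outside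
  \<open>P\<close>, hence is nonzero and cancels in a domain.\<close>

lemma loc_frac_alt: assumes P: "primeideal P R" and a: "a:carrier R" and f: "f:carrier R - P"
 shows "loc_frac R P a f = {(b, g). b:carrier R & g:carrier R - P & a \<otimes> g = b \<otimes> f}"
proof -
 have "(EX h:carrier R - P. h \<otimes> (a \<otimes> g) = h \<otimes> (b \<otimes> f)) <-> a \<otimes> g = b \<otimes> f" if "b:carrier R" "g:carrier R - P" for b g
 proof
 assume "EX h:carrier R - P. h \<otimes> (a \<otimes> g) = h \<otimes> (b \<otimes> f)"
 then obtain h where h: "h:carrier R" "h ~: P" "h \<otimes> (a \<otimes> g) = h \<otimes> (b \<otimes> f)" by auto
 have "h ~= \<zero>" using prime_zero_one[OF P] h by auto
 thus "a \<otimes> g = b \<otimes> f" using h a f that m_lcancel by auto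
 next
 assume "a \<otimes> g = b \<otimes> f"
 hence "\<one> \<otimes> (a \<otimes> g) = \<one> \<otimes> (b \<otimes> f)" by simp
 moreover have "\<one>:carrier R - P" using prime_zero_one[OF P] by simp
 ultimately show "EX h:carrier R - P. h \<otimes> (a \<otimes> g) = h \<otimes> (b \<otimes> f)" by auto
 qed
 thus ?thesis unfolding loc_frac_def by auto
qed

lemma frac_trans: assumes "a:carrier R" "f:carrier R" "b:carrier R" "g:carrier R" "c:carrier R" "k:carrier R"
 "f ~= \<zero>" "a \<otimes> g = b \<otimes> f" "a \<otimes> k = c \<otimes> f" shows "b \<otimes> k = c \<otimes> g"
proof -
 have "f \<otimes> (b \<otimes> k) = (b \<otimes> f) \<otimes> k" using assms(1-6) by (simp add: m_ac)
 also have "... = (a \<otimes> k) \<otimes> g" using assms(1-6) by (simp add: assms(8)[symmetric] m_ac)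
 also have "... = f \<otimes> (c \<otimes> g)" unfolding assms using assms(1-6) by (simp add: m_ac)
 finally show ?thesis using assms m_lcancel by auto
qed

lemma loc_frac_eq: assumes P: "primeideal P R" and "a:carrier R" "f:carrier R - P" "b:carrier R" "g:carrier R - P"
 shows "loc_frac R P a f = loc_frac R P b g <-> a \<otimes> g = b \<otimes> f"
proof
 assume "loc_frac R P a f = loc_frac R P b g"
 moreover have "(b, g):loc_frac R P b g" using assms by (simp add: loc_frac_alt)
 ultimately have "(b, g):loc_frac R P a f" by simp
 thus "a \<otimes> g = b \<otimes> f" using assms by (simp add: loc_frac_alt)
next
 have nz: "f ~= \<zero>" "g ~= \<zero>" using prime_zero_one assms by auto
 assume e: "a \<otimes> g = b \<otimes> f"
 have "a \<otimes> k = c \<otimes> f <-> b \<otimes> k = c \<otimes> g" if "c:carrier R" "k:carrier R" for c k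
 using frac_trans[of a f b g c k] frac_trans[of b g a f c k] nz e[symmetric] e assms that by fast
 thus "loc_frac R P a f = loc_frac R P b g" using assms by (auto simp: loc_frac_alt)
qed

lemma prime_mult_notin: assumes "primeideal P R" "f:carrier R - P" "g:carrier R - P" shows "f \<otimes> g:carrier R - P"
 using primeideal.I_prime[OF assms(1)] assms by auto

lemma loc_mult: assumes P: "primeideal P R" and c: "a:carrier R" "f:carrier R - P" "b:carrier R" "g:carrier R - P"
 shows "loc_frac R P a f \<otimes>$$(localization_at R P) loc_frac R P b g = loc_frac R P (a \<otimes> b) (f \<otimes> g)"
proof -
 have 1: "loc_frac R P (a' \<otimes> b') (f' \<otimes> g') = loc_frac R P (a \<otimes> b) (f \<otimes> g)"
 if "(a', f'):loc_frac R P a f" "(b', g'):loc_frac R P b g" for a' f' b' g'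
 proof -
 have d: "a':carrier R" "f':carrier R - P" "a \<otimes> f' = a' \<otimes> f" "b':carrier R" "g':carrier R - P" "b \<otimes> g' = b' \<otimes> g"
  using that c P by (auto simp: loc_frac_alt)
 have "a' \<otimes> b' \<otimes> (f \<otimes> g) = (a' \<otimes> f) \<otimes> (b' \<otimes> g)" using c d by (simp add: m_ac)
 also have "... = a \<otimes> b \<otimes> (f' \<otimes> g')" using c d by (simp add: d(3,6)[symmetric] m_ac)
 finally show ?thesis using c d prime_mult_notin[OF P] by (subst loc_frac_eq[OF P]) auto
 qed
 have "(a, f):loc_frac R P a f" "(b, g):loc_frac R P b g" using c P by (auto simp: loc_frac_alt)
 thus ?thesis unfolding localization_at_def by (simp only: monoid.simps ring.simps) (rule UN2_const, assumption, assumption, rule 1)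
qed

lemma loc_add: assumes P: "primeideal P R" and c: "a:carrier R" "f:carrier R - P" "b:carrier R" "g:carrier R - P"
 shows "loc_frac R P a f \<oplus>$$(localization_at R P) loc_frac R P b g = loc_frac R P (a \<otimes> g \<oplus> b \<otimes> f) (f \<otimes> g)"
proof -
 have 1: "loc_frac R P (a' \<otimes> g' \<oplus> b' \<otimes> f') (f' \<otimes> g') = loc_frac R P (a \<otimes> g \<oplus> b \<otimes> f) (f \<otimes> g)"
 if "(a', f'):loc_frac R P a f" "(b', g'):loc_frac R P b g" for a' f' b' g'
 proof -
 have d: "a':carrier R" "f':carrier R - P" "a \<otimes> f' = a' \<otimes> f" "b':carrier R" "g':carrier R - P" "b \<otimes> g' = b' \<otimes> g"
  using that c P by (auto simp: loc_frac_alt)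
 have "(a' \<otimes> g' \<oplus> b' \<otimes> f') \<otimes> (f \<otimes> g) = (a' \<otimes> f) \<otimes> (g \<otimes> g') \<oplus> (b' \<otimes> g) \<otimes> (f \<otimes> f')"
  using c d by (simp add: l_distr) (simp add: m_ac)
 also have "... = (a \<otimes> g \<oplus> b \<otimes> f) \<otimes> (f' \<otimes> g')" using c d by (simp add: d(3,6)[symmetric] l_distr) (simp add: m_ac)
 finally show ?thesis using c d prime_mult_notin[OF P] by (subst loc_frac_eq[OF P]) auto
 qed
 have "(a, f):loc_frac R P a f" "(b, g):loc_frac R P b g" using c P by (auto simp: loc_frac_alt)
 thus ?thesis unfolding localization_at_def by (simp only: monoid.simps ring.simps) (rule UN2_const, assumption, assumption, rule 1)
qed

lemma topspace_spec: "topspace (spec_top R) = {P. primeideal P R}"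
proof -
 have "EX f:carrier R. f ~: P" if "primeideal P R" for P using prime_zero_one[OF that] by auto
 thus ?thesis unfolding spec_top_def by auto
qed

lemma spec_basic_open: "f:carrier R ==> openin (spec_top R) {P. primeideal P R & f ~: P}" unfolding spec_top_def by (intro topology_generated_by_Basis) auto

lemma spec_open_basis: assumes "openin (spec_top R) V" "P:V" shows "EX f:carrier R. f ~: P & {Q. primeideal Q R & f ~: Q} <= V"
proof -
 have "generate_topology_on ((%f. {P. primeideal P R & f ~: P}) ` carrier R) V" using assms unfolding spec_top_def by (simp add: openin_topology_generated_by_iff)
 thus ?thesis using assms(2)
 proof (induction arbitrary: P rule: generate_topology_on.induct)
 case (Int a b)
 hence pP: "primeideal P R"
 proof -
  obtain f where "f:carrier R" "f ~: P" using Int by blast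
  have "openin (spec_top R) a" using Int unfolding spec_top_def by (simp add: openin_topology_generated_by_iff)
  thus ?thesis using Int.prems openin_subset topspace_spec by auto
 qed
 obtain f g where fg: "f:carrier R" "f ~: P" "{Q. primeideal Q R & f ~: Q} <= a" "g:carrier R" "g ~: P" "{Q. primeideal Q R & g ~: Q} <= b" using Int by blast
 have "f \<otimes> g:carrier R - P" using prime_mult_notin[OF pP] fg by auto
 moreover have "{Q. primeideal Q R & f \<otimes> g ~: Q} <= a Int b"
 proof
  fix Q assume "Q:{Q. primeideal Q R & f \<otimes> g ~: Q}"
  hence Q: "primeideal Q R" "f \<otimes> g ~: Q" by auto
  then interpret primeideal Q R by simp
  have "f ~: Q" "g ~: Q" using Q fg I_l_closed I_r_closed by auto
  thus "Q:a Int b" using fg Q by auto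
 qed
 ultimately show ?case by auto
 next
 case (UN K)
 then obtain k where k: "k:K" "P:k" by auto
 show ?case using UN.IH[OF k] k by auto
 qed auto
qed

text \<open>A nonempty open set contains a nonempty basic one, given by some nonzero
  \<open>f\<close>, and the zero ideal does not contain \<open>f\<close>.\<close>

lemma spec_open_zero: "openin (spec_top R) V ==> V ~= {} ==> {\<zero>}:V"
proof -
 assume V: "openin (spec_top R) V" "V ~= {}"
 then obtain P where "P:V" by auto
 then obtain f where f: "f:carrier R" "f ~: P" "{Q. primeideal Q R & f ~: Q} <= V" using spec_open_basis V by metis
 have "primeideal P R" using V `P:V` openin_subset topspace_spec by auto
 hence "f ~= \<zero>" using f prime_zero_one by auto
 thus ?thesis using f zero_prime by auto
qed

lemma carrier_Spec: "carrier (sections (Spec R) U) = {s:extensional U. ALL P:U. EX W a f.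
    openin (spec_top R) W & P:W & W <= U & a:carrier R & f:carrier R &
    (ALL Q:W. f ~: Q & s Q = loc_frac R Q a f)}" by (simp add: Spec_def)

text \<open>Both open sets contain the zero prime, where a fraction \<open>a/f\<close> vanishes only
  if \<open>a = 0\<close>. Every local form of \<open>s\<close> is defined at the zero prime as
  well, so its numerator is zero.\<close>

lemma spec_section_zero: assumes "openin (spec_top R) U" "openin (spec_top R) V" "V <= U" "V ~= {}"
 "s:carrier (sections (Spec R) U)" "restr (Spec R) U V s = \<zero>$$(sections (Spec R) V)" shows "s = \<zero>$$(sections (Spec R) U)"
proof -
 have z: "{\<zero>}:V" using spec_open_zero assms by auto
 have l0: "\<zero>$$(localization_at R Q) = loc_frac R Q \<zero> \<one>" for Q by (simp add: localization_at_def)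
 have ext: "s:extensional U" using assms by (simp add: carrier_Spec)
 have "s {\<zero>} = loc_frac R {\<zero>} \<zero> \<one>" using fun_cong[OF assms(6), of "{\<zero>}"] z by (simp add: Spec_def l0)
 have "s P = loc_frac R P \<zero> \<one>" if P: "P:U" for P
 proof -
 obtain W a f where W: "openin (spec_top R) W" "P:W" "W <= U" "a:carrier R" "f:carrier R"
  "ALL Q:W. f ~: Q & s Q = loc_frac R Q a f" using assms(5) P unfolding carrier_Spec by auto
 have pP: "primeideal P R" using W openin_subset topspace_spec by fast
 have zW: "{\<zero>}:W" using spec_open_zero W by auto
 hence "loc_frac R {\<zero>} a f = loc_frac R {\<zero>} \<zero> \<one>" using W `s {\<zero>} = _` by auto
 hence "a \<otimes> \<one> = \<zero> \<otimes> f" using loc_frac_eq[OF zero_prime, of a f \<zero> \<one>] W zW by auto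
 hence "a = \<zero>" using W by simp
 thus ?thesis using W prime_zero_one[OF pP] by (simp add: loc_frac_eq[OF pP])
 qed
 thus ?thesis using ext by (auto simp: Spec_def l0 extensional_def fun_eq_iff)
qed

end

section \<open>Integral schemes: gluing, irreducibility, charts\<close>

locale integral_scheme =
 fixes X :: "('p, 's, 'm) ringed_space_scheme" assumes sheaf: "sheaf_of_rings X" and aff_cover: "x:topspace (space_top X) ==> EX U. affine_open X U & x:U"
 and sec_domain: "openin (space_top X) U ==> U ~= {} ==> domain (sections X U)" and nonempty: "topspace (space_top X) ~= {}"
begin

abbreviation "opn == openin (space_top X)"
abbreviation "Sec == sections X"
abbreviation "car U == carrier (sections X U)"
abbreviation "topX == topspace (space_top X)"
abbreviation "st == stalk X"
abbreviation "cst x == carrier (stalk X x)"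
abbreviation "un U == \<one>$$(sections X U)"
abbreviation "zr U == \<zero>$$(sections X U)"
abbreviation "spo U == openin (spec_top (sections X U))"
abbreviation "SpS U == sections (Spec (sections X U))"
lemma sec_cring: "opn U ==> cring (Sec U)" using sheaf[unfolded sheaf_of_rings_def, THEN conjunct1, rule_format] by simp
lemmas sheafD = sheaf[unfolded sheaf_of_rings_def, THEN conjunct2]
lemma res_hom: "opn U ==> opn V ==> V <= U ==> restr X U V:ring_hom (Sec U) (Sec V)" using sheafD by simp
lemma res_id: "opn U ==> s:car U ==> restr X U U s = s" using sheafD by simp

lemma res_res: "opn U ==> opn V ==> opn W ==> W <= V ==> V <= U ==> s:car U ==>
 restr X V W (restr X U V s) = restr X U W s" using sheafD by simp

lemma res_closed: "opn U ==> opn V ==> V <= U ==> s:car U ==> restr X U V s:car V" using res_hom by (rule ring_hom_closed)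

lemma glue: assumes "!!U. U:UU ==> opn U" "!!U. U:UU ==> s U:car U" "!!U V. U:UU ==> V:UU ==> restr X U (U Int V) (s U) = restr X V (U Int V) (s V)"
 shows "EX! t. t:car (\<Union>UU) & (ALL U:UU. restr X (\<Union>UU) U t = s U)"
proof -
 have "(ALL U:UU. opn U & s U:car U) & (ALL U:UU. ALL V:UU. restr X U (U Int V) (s U) = restr X V (U Int V) (s V))" using assms by auto
 thus ?thesis by (rule sheafD[THEN conjunct2, THEN conjunct2, THEN conjunct2, THEN spec, THEN spec, THEN mp])
qed

lemma glue_unique: assumes "!!U. U:UU ==> opn U" "t:car (\<Union>UU)" "t':car (\<Union>UU)"
 "!!U. U:UU ==> restr X (\<Union>UU) U t = restr X (\<Union>UU) U t'" shows "t = t'"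
proof -
 have o: "opn (\<Union>UU)" using assms by auto
 have "EX! t. t:car (\<Union>UU) & (ALL U:UU. restr X (\<Union>UU) U t = restr X (\<Union>UU) U t')"
 proof (rule glue)
 show "opn U" if "U:UU" for U using assms that by simp
 show "restr X (\<Union>UU) U t':car U" if "U:UU" for U using res_closed[OF o assms(1)[OF that] _ assms(3)] that by auto
 show "restr X U (U Int V) (restr X (\<Union>UU) U t') = restr X V (U Int V) (restr X (\<Union>UU) V t')" if "U:UU" "V:UU" for U V
 proof -
  have "opn (U Int V)" using assms that by auto
  moreover have "U <= \<Union>UU" "V <= \<Union>UU" using that by auto
  ultimately show ?thesis using res_res[OF o assms(1)[OF that(1)] _ _ _ assms(3), of "U Int V"]
  res_res[OF o assms(1)[OF that(2)] _ _ _ assms(3), of "U Int V"] by simp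
 qed
 qed
 thus ?thesis using assms by fast
qed

text \<open>On disjoint nonempty open sets, gluing 1 with 0 and 0 with 1 would produce zero divisors
  over the union.\<close>

lemma irreducible: assumes "opn U" "opn V" "U ~= {}" "V ~= {}" shows "U Int V ~= {}"
proof
 assume d: "U Int V = {}"
 interpret U: domain "Sec U" using assms by (intro sec_domain)
 interpret V: domain "Sec V" using assms by (intro sec_domain)
 interpret W: domain "Sec (U Un V)" using assms by (intro sec_domain) auto
 \<comment> \<open>Gluing over the empty cover: there is only one section over the empty set, so any
   two sections agree on a disjoint intersection.\<close>
 have "EX! t. t:car (\<Union>{}) & (ALL U:{}. restr X (\<Union>{}) U t = undefined U)" by (rule glue) auto
 hence e: "t = t'" if "t:car {}" "t':car {}" for t t' using that by auto
 have ne: "U ~= V" using d assms by auto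
 have ex: "EX t. t:car (U Un V) & restr X (U Un V) U t = a & restr X (U Un V) V t = b" if ab: "a:car U" "b:car V" for a b
 proof -
 have "EX! t. t:car (\<Union>{U, V}) & (ALL W:{U, V}. restr X (\<Union>{U, V}) W t = (if W = U then a else b))"
 proof (rule glue)
  fix A B assume AB: "A:{U, V}" "B:{U, V}"
  show "restr X A (A Int B) (if A = U then a else b) = restr X B (A Int B) (if B = U then a else b)"
  proof (cases "A = B")
  case False
  hence "A Int B = {}" using AB d by auto
  thus ?thesis using AB ab assms by (intro e) (auto intro!: res_closed)
  qed auto
 qed (use ab assms in auto)
 thus ?thesis using ne by auto
 qed
 obtain t where t: "t:car (U Un V)" "restr X (U Un V) U t = un U" "restr X (U Un V) V t = \<zero>$$(Sec V)" using ex by auto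
 obtain t' where t': "t':car (U Un V)" "restr X (U Un V) U t' = zr U" "restr X (U Un V) V t' = \<one>$$(Sec V)" using ex by auto
 have hU: "restr X (U Un V) U:ring_hom (Sec (U Un V)) (Sec U)" and hV: "restr X (U Un V) V:ring_hom (Sec (U Un V)) (Sec V)" using assms by (auto intro!: res_hom)
 interpret hU: ring_hom_ring "Sec (U Un V)" "Sec U" "restr X (U Un V) U" using hU by unfold_locales
 interpret hV: ring_hom_ring "Sec (U Un V)" "Sec V" "restr X (U Un V) V" using hV by unfold_locales
 have "t \<otimes>$$(Sec (U Un V)) t' = \<zero>$$(Sec (U Un V))" by (rule glue_unique[of "{U, V}"]) (use assms t t' in \<open>auto simp: hV.hom_mult\<close>)
 hence "t = \<zero>$$(Sec (U Un V)) | t' = \<zero>$$(Sec (U Un V))" using W.integral t t' by simp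
 thus False using t t' by auto
qed

text \<open>The witnesses of \<open>affine_open\<close> made explicit, with the empty set excluded
  because only nonempty open sets have domains as section rings.\<close>

definition chart :: "'p set => ('p => 's set) => ('s set set => ('s set => ('s \<times> 's) set) => 's) => bool" where
 "chart U f fy <-> opn U & U ~= {} & homeomorphic_map (subtopology (space_top X) U) (spec_top (Sec U)) f &
  (ALL V. spo U V -->
   fy V:ring_iso (SpS U V) (Sec {x:U. f x:V})) &
  (ALL V W s. spo U V & spo U W & W <= V &
   s:carrier (SpS U V) -->
   fy W (restr (Spec (Sec U)) V W s) = restr X {x:U. f x:V} {x:U. f x:W} (fy V s))"

lemma affine_chart: assumes "affine_open X U" "U ~= {}" obtains f fy where "chart U f fy"
proof -
 have "space_top (Spec (Sec U)) = spec_top (Sec U)" by (simp add: Spec_def)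
 thus ?thesis using assms that unfolding affine_open_def open_subspace_iso_def chart_def by auto
qed

lemma affine_opn: "affine_open X U ==> opn U" by (simp add: affine_open_def)

context
 fixes U f fy assumes ch: "chart U f fy"
begin

lemma chart_opn: "opn U" and chart_ne: "U ~= {}" and chart_hom: "homeomorphic_map (subtopology (space_top X) U) (spec_top (Sec U)) f" using ch by (auto simp: chart_def)
lemma chart_iso: "spo U V ==> fy V:ring_iso (SpS U V) (Sec {x:U. f x:V})" using ch unfolding chart_def by simp

lemma chart_restr: "spo U V ==> spo U W ==> W <= V ==>
 s:carrier (SpS U V) ==>
   fy W (restr (Spec (Sec U)) V W s) = restr X {x:U. f x:V} {x:U. f x:W} (fy V s)" using ch unfolding chart_def by simp

lemma chart_dom: "domain (Sec U)" using sec_domain chart_opn chart_ne by auto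
lemma U_top: "topspace (subtopology (space_top X) U) = U" using openin_subset[OF chart_opn] by auto
lemma chart_image: "f ` U = {P. primeideal P (Sec U)}" using homeomorphic_imp_surjective_map[OF chart_hom] domain.topspace_spec[OF chart_dom] U_top by simp
lemma chart_prime: "x:U ==> primeideal (f x) (Sec U)" using chart_image by auto
lemma chart_inj: "inj_on f U" using homeomorphic_imp_injective_map[OF chart_hom] U_top by simp

lemma chart_pre_opn: "spo U V ==> opn {x:U. f x:V}" using openin_continuous_map_preimage[OF homeomorphic_imp_continuous_map[OF chart_hom], of V]
 by (simp only: U_top) (blast intro: openin_trans_full[OF _ chart_opn])

lemma chart_img_opn: assumes "opn W" "W <= U" shows "spo U (f ` W)" "{x:U. f x:f ` W} = W"
proof -
 have "openin (subtopology (space_top X) U) W" using assms by (simp add: openin_open_subtopology chart_opn)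
 thus "spo U (f ` W)" using homeomorphic_imp_open_map[OF chart_hom] by (auto simp: open_map_def)
 show "{x:U. f x:f ` W} = W" using assms chart_inj by (auto simp: inj_on_def)
qed

lemma Spec_sec_zero_mem: "spo U V ==> \<zero>$$(SpS U V):carrier (SpS U V)"
proof -
 assume V: "spo U V"
 interpret D: domain "Sec U" by (rule chart_dom)
 have p: "primeideal P (Sec U)" if "P:V" for P using openin_subset[OF V] that D.topspace_spec by auto
 have n1: "ALL P:V. (un U) ~: P" using D.prime_zero_one p by auto
 have e: "\<zero>$$(SpS U V) = (\<lambda>P\<in>V. loc_frac (Sec U) P (zr U) (un U))" by (simp add: Spec_def localization_at_def)
 show ?thesis unfolding D.carrier_Spec e
 proof (intro CollectI conjI ballI)
 fix P assume "P:V"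
 thus "EX W a f. spo U W & P:W & W <= V & a:car U & f:car U &
    (ALL Q:W. f ~: Q & (\<lambda>P\<in>V. loc_frac (Sec U) P (zr U) (un U)) Q = loc_frac (Sec U) Q a f)" using V n1 by auto
 qed simp
qed

lemma chart_restr_zero: assumes "opn W" "W <= U" "opn V" "V <= W" "V ~= {}" "s:car W" "restr X W V s = \<zero>$$(Sec V)" shows "s = \<zero>$$(Sec W)"
proof -
 interpret D: domain "Sec U" by (rule chart_dom)
 note W = chart_img_opn[OF assms(1,2)]
 have "V <= U" using assms by auto
 note V = chart_img_opn[OF assms(3) this]
 have iW: "fy (f ` W):ring_iso (SpS U (f ` W)) (Sec W)" using chart_iso[OF W(1)] W by simp
 have iV: "fy (f ` V):ring_iso (SpS U (f ` V)) (Sec V)" using chart_iso[OF V(1)] V by simp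
 obtain si where s: "si:carrier (SpS U (f ` W))" "fy (f ` W) si = s"
 proof -
 have "fy (f ` W) ` carrier (SpS U (f ` W)) = car W" using iW unfolding ring_iso_def bij_betw_def by simp
 hence "s:fy (f ` W) ` carrier (SpS U (f ` W))" using assms by simp
 thus ?thesis using that by auto
 qed
 have sub: "f ` V <= f ` W" using assms by auto
 have "fy (f ` V) (restr (Spec (Sec U)) (f ` W) (f ` V) si) = \<zero>$$(Sec V)" using chart_restr[OF W(1) V(1) sub s(1)] s V W assms by simp
 \<comment> \<open>The sections of the spectrum have not been shown to form a ring, so preservation
   of zero is read off from the equation 0 + 0 = 0.\<close>
 moreover have zz: "fy (f ` Y) \<zero>$$(SpS U (f ` Y)) = \<zero>$$(Sec Y)" if Y: "opn Y" "Y <= U" for Y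
 proof -
 note Y' = chart_img_opn[OF Y]
 have iY: "fy (f ` Y):ring_iso (SpS U (f ` Y)) (Sec Y)" using chart_iso[OF Y'(1)] Y' by simp
 let ?z = "\<zero>$$(SpS U (f ` Y))"
 have c: "?z:carrier (SpS U (f ` Y))" by (rule Spec_sec_zero_mem[OF Y'(1)])
 have h: "fy (f ` Y):ring_hom (SpS U (f ` Y)) (Sec Y)" using iY by (simp add: ring_iso_def)
 interpret Y: cring "Sec Y" using Y by (intro sec_cring)
 have "?z \<oplus>$$(SpS U (f ` Y)) ?z = ?z"
 proof -
  have "\<zero>$$(localization_at (Sec U) P) \<oplus>$$(localization_at (Sec U) P) \<zero>$$(localization_at (Sec U) P) = \<zero>$$(localization_at (Sec U) P)"
  if "P:f ` Y" for P
  proof -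
  have pP: "primeideal P (Sec U)" using that Y chart_prime by auto
  have "\<zero>$$(localization_at (Sec U) P) = loc_frac (Sec U) P (zr U) (un U)" by (simp add: localization_at_def)
  thus ?thesis using D.loc_add[OF pP, of "zr U" "un U" "zr U" "un U"] D.prime_zero_one[OF pP] by simp
  qed
  thus ?thesis unfolding Spec_def by (auto intro!: restrict_ext)
 qed
 hence "fy (f ` Y) ?z \<oplus>$$(Sec Y) fy (f ` Y) ?z = fy (f ` Y) ?z" using ring_hom_add[OF h c c] by simp
 thus ?thesis using ring_hom_closed[OF h c] by simp
 qed
 ultimately have "fy (f ` V) (restr (Spec (Sec U)) (f ` W) (f ` V) si) = fy (f ` V) \<zero>$$(SpS U (f ` V))" using assms by simp
 moreover have "restr (Spec (Sec U)) (f ` W) (f ` V) si:carrier (SpS U (f ` V))"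
 proof -
 have "EX D a g. spo U D & P:D & D <= f ` V & a:car U & g:car U &
    (ALL Q:D. g ~: Q & restrict si (f ` V) Q = loc_frac (Sec U) Q a g)" if P: "P:f ` V" for P
 proof -
  obtain D a g where D: "spo U D" "P:D" "D <= f ` W" "a:car U" "g:car U" "ALL Q:D. g ~: Q & si Q = loc_frac (Sec U) Q a g"
  using s(1)[unfolded D.carrier_Spec, THEN CollectD, THEN conjunct2, rule_format, OF subsetD[OF sub P]] by auto
  hence "ALL Q:D Int f ` V. g ~: Q & restrict si (f ` V) Q = loc_frac (Sec U) Q a g" by simp
  moreover have "spo U (D Int f ` V)" using V D by auto
  ultimately show ?thesis using D P by blast
 qed
 thus ?thesis by (auto simp: Spec_def)
 qed
 ultimately have "restr (Spec (Sec U)) (f ` W) (f ` V) si = \<zero>$$(SpS U (f ` V))"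
 using iV Spec_sec_zero_mem[OF V(1)] unfolding ring_iso_def bij_betw_def inj_on_def by auto
 hence "si = \<zero>$$(SpS U (f ` W))" using D.spec_section_zero[OF W(1) V(1) sub _ s(1)] assms by auto
 thus ?thesis using zz[OF assms(1,2)] s by simp
qed

end

text \<open>Inside a chart this is \<open>chart_restr_zero\<close>. By irreducibility
  \<open>V\<close> meets every member of a cover of \<open>U\<close> by pieces of charts, and the
  sheaf axiom joins the pieces.\<close>

lemma restr_zero: assumes "opn U" "opn V" "V <= U" "V ~= {}" "s:car U" "restr X U V s = \<zero>$$(Sec V)" shows "s = zr U"
proof -
 define WC where "WC = {W. opn W & W <= U & (EX Y f fy. chart Y f fy & W <= Y) & W ~= {}}"
 have "EX W:WC. x:W" if "x:U" for x
 proof -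
 have "x:topX" using that assms openin_subset by auto
 then obtain Y where Y: "affine_open X Y" "x:Y" using aff_cover by auto
 then obtain f fy where "chart Y f fy" using affine_chart by auto
 moreover have "opn (Y Int U)" using Y assms affine_opn by auto
 ultimately have "Y Int U:WC" using Y that unfolding WC_def by auto
 thus ?thesis using Y that by (intro bexI[of _ "Y Int U"]) auto
 qed
 moreover have "\<Union>WC <= U" unfolding WC_def by auto
 ultimately have U: "\<Union>WC = U" by auto
 have z: "restr X U W s = \<zero>$$(Sec W)" if WW: "W:WC" for W
 proof -
 have "EX Y f fy. chart Y f fy & W <= Y" using WW unfolding WC_def by simp
 then obtain Y f fy where Y: "chart Y f fy" "W <= Y" by auto
 have W: "opn W" "W <= U" "W ~= {}" using WW unfolding WC_def by auto
 have o: "opn (W Int V)" using W assms by auto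
 have ne: "W Int V ~= {}" using irreducible W assms by auto
 have "restr X W (W Int V) (restr X U W s) = restr X V (W Int V) (restr X U V s)" using res_res assms W o by (metis Int_lower1 Int_lower2)
 also have "... = \<zero>$$(Sec (W Int V))" using assms o by (simp add: ring_hom_zero[OF res_hom] cring.axioms sec_cring)
 finally show ?thesis using chart_restr_zero[OF Y(1) W(1) Y(2) o _ ne] res_closed assms W by auto
 qed
 show ?thesis
 proof (rule glue_unique[of WC])
 show "opn W" if "W:WC" for W using that unfolding WC_def by auto
 show "restr X (\<Union>WC) W s = restr X (\<Union>WC) W (zr U)" if "W:WC" for W using z U that assms unfolding WC_def
  by (simp add: ring_hom_zero[OF res_hom] cring.axioms sec_cring)
 qed (use U assms in \<open>auto simp: cring.axioms(1) ring.ring_simprules(2) sec_cring\<close>)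
qed

lemma restr_inj: assumes "opn U" "opn V" "V <= U" "V ~= {}" "s:car U" "t:car U" "restr X U V s = restr X U V t" shows "s = t"
proof -
 interpret U: cring "Sec U" using assms by (intro sec_cring)
 interpret V: cring "Sec V" using assms by (intro sec_cring)
 interpret h: ring_hom_ring "Sec U" "Sec V" "restr X U V" using res_hom[OF assms(1-3)] by unfold_locales
 have "restr X U V (s \<ominus>$$(Sec U) t) = \<zero>$$(Sec V)" using assms by (simp add: U.minus_eq V.r_neg)
 hence "s \<ominus>$$(Sec U) t = zr U" using restr_zero assms by auto
 thus ?thesis using assms by simp
qed

text \<open>Restriction to nonempty open sets is injective, so agreement on some neighbourhood
  spreads to the whole intersection.\<close>

lemma germ_alt: assumes "opn U" "x:U" "s:car U" shows "germ X x U s = {(V, t). opn V & x:V & t:car V & restr X U (U Int V) s = restr X V (U Int V) t}"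
proof -
 have "(EX W. opn W & x:W & W <= U Int V & restr X U W s = restr X V W t) <-> restr X U (U Int V) s = restr X V (U Int V) t" if V: "opn V" "x:V" "t:car V" for V t
 proof
 have o: "opn (U Int V)" using assms V by auto
 assume "EX W. opn W & x:W & W <= U Int V & restr X U W s = restr X V W t"
 then obtain W where W: "opn W" "x:W" "W <= U Int V" "restr X U W s = restr X V W t" by auto
 show "restr X U (U Int V) s = restr X V (U Int V) t"
 proof (rule restr_inj[of "U Int V" W])
  show "restr X (U Int V) W (restr X U (U Int V) s) = restr X (U Int V) W (restr X V (U Int V) t)"
  using res_res[OF assms(1) o W(1,3) _ assms(3)] res_res[OF V(1) o W(1,3) _ V(3)] W by auto
 qed (use W o assms V in \<open>auto intro: res_closed\<close>)
 next
 assume "restr X U (U Int V) s = restr X V (U Int V) t"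
 thus "EX W. opn W & x:W & W <= U Int V & restr X U W s = restr X V W t" using assms V by auto
 qed
 thus ?thesis unfolding germ_def by auto
qed

lemma germ_self: "opn U ==> x:U ==> s:car U ==> (U, s):germ X x U s" by (simp add: germ_alt)
lemma germ_memD: "(V, t):germ X x U s ==> opn V & x:V & t:car V" unfolding germ_def by auto

lemma germ_restr: assumes "opn U" "opn V" "x:V" "V <= U" "s:car U" shows "germ X x V (restr X U V s) = germ X x U s"
proof -
 have "restr X V (V Int W) (restr X U V s) = restr X W (V Int W) t <-> restr X U (U Int W) s = restr X W (U Int W) t" if W: "opn W" "x:W" "t:car W" for W t
 proof -
 have o: "opn (V Int W)" "opn (U Int W)" using assms W by auto
 have sb: "V Int W <= U Int W" using assms by auto
 have 1: "restr X V (V Int W) (restr X U V s) = restr X (U Int W) (V Int W) (restr X U (U Int W) s)"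
  using res_res[OF assms(1,2) o(1) _ _ assms(5)] res_res[OF assms(1) o(2,1) sb _ assms(5)] assms by simp
 have 2: "restr X W (V Int W) t = restr X (U Int W) (V Int W) (restr X W (U Int W) t)" using res_res[OF W(1) o(2,1) sb _ W(3)] by simp
 show ?thesis unfolding 1 2 using restr_inj[OF o(2,1), of "restr X U (U Int W) s" "restr X W (U Int W) t"] assms W o res_closed by auto
 qed
 thus ?thesis using assms by (auto simp: germ_alt res_closed)
qed

lemma germ_inj: assumes "opn U" "x:U" "s:car U" "t:car U" "germ X x U s = germ X x U t" shows "s = t"
proof -
 have "(U, t):germ X x U s" using germ_self assms by simp
 thus ?thesis using assms(1-4) by (simp add: germ_alt res_id)
qed

lemma germ_mem: "(V, t):germ X x U s ==> opn U ==> x:U ==> s:car U ==> germ X x V t = germ X x U s"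
proof -
 assume a: "(V, t):germ X x U s" and U: "opn U" "x:U" "s:car U"
 have V: "opn V" "x:V" "t:car V" "restr X U (U Int V) s = restr X V (U Int V) t" using a U by (auto simp: germ_alt)
 have "opn (U Int V)" "x:U Int V" using U V by auto
 thus ?thesis using germ_restr germ_restr[of U "U Int V" x s] U V by auto
qed

end

section \<open>The stalks as rings\<close>

context integral_scheme
begin

lemma germ_same_restr: assumes "opn U" "x:U" "s:car U" "(U', s'):germ X x U s" "opn W" "W <= U" "W <= U'" shows "restr X U' W s' = restr X U W s"
proof -
 have U': "opn U'" "s':car U'" "restr X U (U Int U') s = restr X U' (U Int U') s'" using assms by (auto simp: germ_alt)
 have o: "opn (U Int U')" using assms U' by auto
 have sb: "W <= U Int U'" using assms by auto
 show ?thesis using res_res[OF assms(1) o assms(5) sb _ assms(3)] res_res[OF U'(1) o assms(5) sb _ U'(2)] U' by simp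
qed

text \<open>Independence of the representatives for any operation \<open>op\<close> that commutes
  with restriction; it serves both the product and the sum of germs.\<close>

lemma stalk_op_aux: assumes c: "opn U" "x:U" "s:car U" "opn V" "x:V" "t:car V" and op: "!!W. opn W ==> op W:car W \<rightarrow> car W \<rightarrow> car W"
  "!!Y W a b. opn Y ==> opn W ==> W <= Y ==> a:car Y ==> b:car Y ==> restr X Y W (op Y a b) = op W (restr X Y W a) (restr X Y W b)"
 and g: "(U', s'):germ X x U s" "(V', t'):germ X x V t" shows "germ X x (U' Int V') (op (U' Int V') (restr X U' (U' Int V') s') (restr X V' (U' Int V') t')) =
 germ X x (U Int V) (op (U Int V) (restr X U (U Int V) s) (restr X V (U Int V) t))"
proof -
 have U': "opn U'" "x:U'" "s':car U'" and V': "opn V'" "x:V'" "t':car V'" using g by (auto dest: germ_memD)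
 define W where "W = U Int V Int (U' Int V')"
 have W: "opn W" "x:W" using c U' V' unfolding W_def by auto
 have main: "germ X x (A Int B) (op (A Int B) (restr X A (A Int B) a) (restr X B (A Int B) b)) = germ X x W (op W (restr X A W a) (restr X B W b))"
 if AB: "opn A" "opn B" "W <= A" "W <= B" "a:car A" "b:car B" for A B a b
 proof -
 have o: "opn (A Int B)" "W <= A Int B" using AB by auto
 have cl: "restr X A (A Int B) a:car (A Int B)" "restr X B (A Int B) b:car (A Int B)" using AB by (auto intro: res_closed)
 have c2: "op (A Int B) (restr X A (A Int B) a) (restr X B (A Int B) b):car (A Int B)" using op[OF o(1)] cl by auto
 have "germ X x (A Int B) (op (A Int B) (restr X A (A Int B) a) (restr X B (A Int B) b)) =
  germ X x W (restr X (A Int B) W (op (A Int B) (restr X A (A Int B) a) (restr X B (A Int B) b)))" using germ_restr[OF o(1) W o(2) c2] by simp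
 also have "... = germ X x W (op W (restr X A W a) (restr X B W b))"
  using op(2)[OF o(1) W(1) o(2) cl] res_res[OF AB(1) o(1) W(1) o(2) _ AB(5)] res_res[OF AB(2) o(1) W(1) o(2) _ AB(6)] by simp
 finally show ?thesis .
 qed
 have e1: "restr X U' W s' = restr X U W s" by (rule germ_same_restr[OF c(1-3) g(1) W(1)]) (auto simp: W_def)
 have e2: "restr X V' W t' = restr X V W t" by (rule germ_same_restr[OF c(4-6) g(2) W(1)]) (auto simp: W_def)
 show ?thesis using main[OF U'(1) V'(1) _ _ U'(3) V'(3)] main[OF c(1,4) _ _ c(3,6)] e1 e2 by (auto simp: W_def)
qed

lemma stalk_mult: assumes c: "opn U" "x:U" "s:car U" "opn V" "x:V" "t:car V"
 shows "germ X x U s \<otimes>$$(st x) germ X x V t = germ X x (U Int V) (restr X U (U Int V) s \<otimes>$$(Sec (U Int V)) restr X V (U Int V) t)"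
 unfolding stalk_def monoid.simps
proof (rule UN2_const)
 show "(U, s):germ X x U s" "(V, t):germ X x V t" using c germ_self by auto
 show "germ X x (U' Int V') (restr X U' (U' Int V') s' \<otimes>$$(Sec (U' Int V')) restr X V' (U' Int V') t') =
 germ X x (U Int V) (restr X U (U Int V) s \<otimes>$$(Sec (U Int V)) restr X V (U Int V) t)"
 if "(U', s'):germ X x U s" "(V', t'):germ X x V t" for U' s' V' t' by (rule stalk_op_aux[OF c _ _ that, where op = "%W. monoid.mult (Sec W)"])
  (auto simp: crs sec_cring ring_hom_mult[OF res_hom])
qed

lemma stalk_add: assumes c: "opn U" "x:U" "s:car U" "opn V" "x:V" "t:car V"
 shows "germ X x U s \<oplus>$$(st x) germ X x V t = germ X x (U Int V) (restr X U (U Int V) s \<oplus>$$(Sec (U Int V)) restr X V (U Int V) t)"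
 unfolding stalk_def ring.simps
proof (rule UN2_const)
 show "(U, s):germ X x U s" "(V, t):germ X x V t" using c germ_self by auto
 show "germ X x (U' Int V') (restr X U' (U' Int V') s' \<oplus>$$(Sec (U' Int V')) restr X V' (U' Int V') t') =
 germ X x (U Int V) (restr X U (U Int V) s \<oplus>$$(Sec (U Int V)) restr X V (U Int V) t)"
 if "(U', s'):germ X x U s" "(V', t'):germ X x V t" for U' s' V' t' by (rule stalk_op_aux[OF c _ _ that, where op = "%W. ring.add (Sec W)"])
  (auto simp: crs sec_cring ring_hom_add[OF res_hom])
qed

lemma stalk_mult1: "opn U ==> x:U ==> s:car U ==> t:car U ==>
 germ X x U s \<otimes>$$(st x) germ X x U t = germ X x U (s \<otimes>$$(Sec U) t)" by (simp add: stalk_mult res_id)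

lemma stalk_add1: "opn U ==> x:U ==> s:car U ==> t:car U ==>
 germ X x U s \<oplus>$$(st x) germ X x U t = germ X x U (s \<oplus>$$(Sec U) t)" by (simp add: stalk_add res_id)

lemma stalk_car: "cst x = {germ X x U s |U s. opn U & x:U & s:car U}" by (simp add: stalk_def)
lemma germ_car: "opn U ==> x:U ==> s:car U ==> germ X x U s:cst x" unfolding stalk_car by auto
lemma topspace_opn: "opn (topX)" by simp
lemma in_top: "opn U ==> U <= topX" by (rule openin_subset)

lemma stalk_one: "opn U ==> x:U ==> \<one>$$(st x) = germ X x U (un U)" using germ_restr[OF topspace_opn, of U x "\<one>$$(Sec (topX))"] in_top
 by (simp add: stalk_def ring_hom_one[OF res_hom] crs sec_cring)

lemma stalk_zero: "opn U ==> x:U ==> \<zero>$$(st x) = germ X x U (zr U)" using germ_restr[OF topspace_opn, of U x "\<zero>$$(Sec (topX))"] in_top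
 by (simp add: stalk_def ring_hom_zero[OF res_hom] crs sec_cring cring.axioms)

lemma stalk_repE: assumes "a:cst x"
 obtains U s where "opn U" "x:U" "s:car U" "a = germ X x U s" using assms unfolding stalk_car by auto

lemma stalk_rep3E: assumes "a:cst x" "b:cst x" "c:cst x"
 obtains U s t u where "opn U" "x:U" "s:car U" "a = germ X x U s" "t:car U" "b = germ X x U t" "u:car U" "c = germ X x U u"
proof -
 obtain U s where U: "opn U" "x:U" "s:car U" "a = germ X x U s" using assms(1) by (rule stalk_repE)
 obtain V t where V: "opn V" "x:V" "t:car V" "b = germ X x V t" using assms(2) by (rule stalk_repE)
 obtain Z u where Z: "opn Z" "x:Z" "u:car Z" "c = germ X x Z u" using assms(3) by (rule stalk_repE)
 let ?W = "U Int V Int Z"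
 have W: "opn ?W" "x:?W" using U V Z by auto
 show thesis
 proof (rule that[OF W])
 show "restr X U ?W s:car ?W" "restr X V ?W t:car ?W" "restr X Z ?W u:car ?W" using U V Z by (auto intro: res_closed)
 show "a = germ X x ?W (restr X U ?W s)" "b = germ X x ?W (restr X V ?W t)" "c = germ X x ?W (restr X Z ?W u)"
  using U V Z germ_restr[OF U(1) W _ U(3)] germ_restr[OF V(1) W _ V(3)] germ_restr[OF Z(1) W _ Z(3)] by auto
 qed
qed

lemma stalk_cring: assumes x: "x:topX" shows "cring (st x)"
proof -
 have o: "\<one>$$(st x):cst x" "\<zero>$$(st x):cst x" using stalk_one[OF topspace_opn x] stalk_zero[OF topspace_opn x] germ_car[OF topspace_opn x]
 by (simp_all add: crs sec_cring)
 note simps = stalk_mult1 stalk_add1 stalk_one stalk_zero germ_car sec_cring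
 have ab: "abelian_group (st x)"
 proof (rule abelian_groupI)
 fix a b c assume "a:cst x" "b:cst x" "c:cst x"
 then obtain U s t u where U: "opn U" "x:U" "s:car U" "a = germ X x U s" "t:car U" "b = germ X x U t" "u:car U" "c = germ X x U u" by (rule stalk_rep3E)
 interpret cring "Sec U" using U by (intro sec_cring)
 show "a \<oplus>$$(st x) b \<oplus>$$(st x) c = a \<oplus>$$(st x) (b \<oplus>$$(st x) c)" using U by (simp add: simps a_assoc)
 next
 fix a b assume "a:cst x" "b:cst x"
 then obtain U s t where U: "opn U" "x:U" "s:car U" "a = germ X x U s" "t:car U" "b = germ X x U t" by (metis stalk_rep3E)
 interpret cring "Sec U" using U by (intro sec_cring)
 show "a \<oplus>$$(st x) b = b \<oplus>$$(st x) a" "a \<oplus>$$(st x) b:cst x" using U by (simp_all add: simps a_comm)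
 next
 fix a assume "a:cst x"
 then obtain U s where U: "opn U" "x:U" "s:car U" "a = germ X x U s" by (rule stalk_repE)
 interpret cring "Sec U" using U by (intro sec_cring)
 show "\<zero>$$(st x) \<oplus>$$(st x) a = a" using U by (simp add: simps)
 show "EX y:cst x. y \<oplus>$$(st x) a = \<zero>$$(st x)" using U by (intro bexI[of _ "germ X x U (\<ominus>$$(Sec U) s)"]) (simp_all add: simps l_neg)
 qed (use o in auto)
 have mo: "comm_monoid (st x)"
 proof (rule comm_monoidI)
 fix a b c assume "a:cst x" "b:cst x" "c:cst x"
 then obtain U s t u where U: "opn U" "x:U" "s:car U" "a = germ X x U s" "t:car U" "b = germ X x U t" "u:car U" "c = germ X x U u" by (rule stalk_rep3E)
 interpret cring "Sec U" using U by (intro sec_cring)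
 show "a \<otimes>$$(st x) b \<otimes>$$(st x) c = a \<otimes>$$(st x) (b \<otimes>$$(st x) c)" using U by (simp add: simps m_assoc)
 next
 fix a b assume "a:cst x" "b:cst x"
 then obtain U s t where U: "opn U" "x:U" "s:car U" "a = germ X x U s" "t:car U" "b = germ X x U t" by (metis stalk_rep3E)
 interpret cring "Sec U" using U by (intro sec_cring)
 show "a \<otimes>$$(st x) b = b \<otimes>$$(st x) a" "a \<otimes>$$(st x) b:cst x" using U by (simp_all add: simps m_comm)
 next
 fix a assume "a:cst x"
 then obtain U s where U: "opn U" "x:U" "s:car U" "a = germ X x U s" by (rule stalk_repE)
 interpret cring "Sec U" using U by (intro sec_cring)
 show "\<one>$$(st x) \<otimes>$$(st x) a = a" using U by (simp add: simps)
 qed (use o in auto)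
 show ?thesis
 proof (rule cringI[OF ab mo])
 fix a b c assume "a:cst x" "b:cst x" "c:cst x"
 then obtain U s t u where U: "opn U" "x:U" "s:car U" "a = germ X x U s" "t:car U" "b = germ X x U t" "u:car U" "c = germ X x U u" by (rule stalk_rep3E)
 interpret cring "Sec U" using U by (intro sec_cring)
 show "(a \<oplus>$$(st x) b) \<otimes>$$(st x) c = a \<otimes>$$(st x) c \<oplus>$$(st x) b \<otimes>$$(st x) c" using U by (simp add: simps l_distr)
 qed
qed

section \<open>Charts compared with stalks\<close>

context
 fixes U f fy assumes ch: "chart U f fy"
begin

definition frac :: "'s set set => 's => 's => 's set => ('s \<times> 's) set" where "frac V a g = (\<lambda>P\<in>V. loc_frac (Sec U) P a g)"
abbreviation "spopn == spo U"
abbreviation "pre V == {x:U. f x:V}"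
definition L :: "'s set set => 's => 's => 's" where "L V a g = fy V (frac V a g)"
text \<open>A chart identifies \<open>U\<close> with the spectrum of \<open>Sec U\<close>, but
  nothing in its definition makes the induced endomorphism \<open>tq\<close> of \<open>Sec U\<close>
  the identity. It is carried along until \<open>AA_psi\<close>, where it turns out to be
  onto.\<close>

definition tq :: "'s => 's" where "tq a = L {P. primeideal P (Sec U)} a (un U)"
definition good :: "'s set set => 's => 's => bool" where "good V a g <-> spopn V & a:car U & g:car U & (ALL Q:V. g ~: Q)"
lemma spopn_prime: "spopn V ==> P:V ==> primeideal P (Sec U)" using openin_subset domain.topspace_spec[OF chart_dom[OF ch]] by auto

lemma frac_car: "good V a g ==> frac V a g:carrier (SpS U V)"
proof -
 assume g: "good V a g"
 show ?thesis unfolding domain.carrier_Spec[OF chart_dom[OF ch]] frac_def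
 proof (intro CollectI conjI ballI)
 fix P assume "P:V"
 thus "EX W b h. spo U W & P:W & W <= V & b:car U & h:car U &
    (ALL Q:W. h ~: Q & (\<lambda>P\<in>V. loc_frac (Sec U) P a g) Q = loc_frac (Sec U) Q b h)" using g unfolding good_def by auto
 qed simp
qed

lemma L_car: "good V a g ==> L V a g:car (pre V)" using ring_hom_closed[OF _ frac_car] chart_iso[OF ch, of V] unfolding L_def good_def ring_iso_def by blast

lemma L_restr: "good V a g ==> spopn W ==> W <= V ==> restr X (pre V) (pre W) (L V a g) = L W a g"
proof -
 assume a: "good V a g" "spopn W" "W <= V"
 have "restr (Spec (Sec U)) V W (frac V a g) = frac W a g" using a by (auto simp: Spec_def frac_def fun_eq_iff)
 thus ?thesis using chart_restr[OF ch _ a(2,3) frac_car[OF a(1)]] a unfolding L_def good_def by simp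
qed

lemma L_mult: assumes "good V a g" "good V b h"
 shows "L V a g \<otimes>$$(Sec (pre V)) L V b h = L V (a \<otimes>$$(Sec U) b) (g \<otimes>$$(Sec U) h)" "good V (a \<otimes>$$(Sec U) b) (g \<otimes>$$(Sec U) h)"
proof -
 interpret D: domain "Sec U" by (rule chart_dom[OF ch])
 have V: "spopn V" using assms by (simp add: good_def)
 have "frac V a g \<otimes>$$(SpS U V) frac V b h = frac V (a \<otimes>$$(Sec U) b) (g \<otimes>$$(Sec U) h)"
 unfolding frac_def Spec_def using assms spopn_prime by (auto simp: good_def D.loc_mult intro!: restrict_ext)
 thus "L V a g \<otimes>$$(Sec (pre V)) L V b h = L V (a \<otimes>$$(Sec U) b) (g \<otimes>$$(Sec U) h)"
 unfolding L_def using ring_hom_mult[OF _ frac_car[OF assms(1)] frac_car[OF assms(2)]] chart_iso[OF ch V] unfolding ring_iso_def by force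
 show "good V (a \<otimes>$$(Sec U) b) (g \<otimes>$$(Sec U) h)" using assms D.prime_mult_notin spopn_prime unfolding good_def by auto
qed

lemma L_add: assumes "good V a g" "good V b g" shows "L V a g \<oplus>$$(Sec (pre V)) L V b g = L V (a \<oplus>$$(Sec U) b) g" "good V (a \<oplus>$$(Sec U) b) g"
proof -
 interpret D: domain "Sec U" by (rule chart_dom[OF ch])
 have V: "spopn V" using assms by (simp add: good_def)
 show g: "good V (a \<oplus>$$(Sec U) b) g" using assms unfolding good_def by auto
 have "loc_frac (Sec U) P a g \<oplus>$$(localization_at (Sec U) P) loc_frac (Sec U) P b g = loc_frac (Sec U) P (a \<oplus>$$(Sec U) b) g" if "P:V" for P
 proof -
 have pP: "primeideal P (Sec U)" using spopn_prime[OF V that] .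
 have c: "a:car U" "b:car U" "g:car U - P" using assms that by (auto simp: good_def)
 have "(a \<otimes>$$(Sec U) g \<oplus>$$(Sec U) b \<otimes>$$(Sec U) g) \<otimes>$$(Sec U) g = (a \<oplus>$$(Sec U) b) \<otimes>$$(Sec U) (g \<otimes>$$(Sec U) g)"
  using c by (simp add: D.l_distr D.m_assoc)
 thus ?thesis using c D.prime_mult_notin[OF pP c(3) c(3)] by (subst D.loc_add[OF pP]) (auto simp: D.loc_frac_eq[OF pP])
 qed
 hence "frac V a g \<oplus>$$(SpS U V) frac V b g = frac V (a \<oplus>$$(Sec U) b) g" unfolding frac_def Spec_def by force
 thus "L V a g \<oplus>$$(Sec (pre V)) L V b g = L V (a \<oplus>$$(Sec U) b) g"
 unfolding L_def using ring_hom_add[OF _ frac_car[OF assms(1)] frac_car[OF assms(2)]] chart_iso[OF ch V] unfolding ring_iso_def by force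
qed

lemma L_eq: assumes "good V a g" "good V b h" "V ~= {}" shows "L V a g = L V b h <-> a \<otimes>$$(Sec U) h = b \<otimes>$$(Sec U) g"
proof -
 interpret D: domain "Sec U" by (rule chart_dom[OF ch])
 have V: "spopn V" using assms by (simp add: good_def)
 have "L V a g = L V b h <-> frac V a g = frac V b h" unfolding L_def using chart_iso[OF ch V] frac_car[OF assms(1)] frac_car[OF assms(2)]
 unfolding ring_iso_def bij_betw_def inj_on_def by auto
 also have "... <-> (ALL P:V. loc_frac (Sec U) P a g = loc_frac (Sec U) P b h)" unfolding frac_def by (auto simp: fun_eq_iff)
 also have "... <-> (ALL P:V. a \<otimes>$$(Sec U) h = b \<otimes>$$(Sec U) g)" using assms spopn_prime by (intro ball_cong refl D.loc_frac_eq) (auto simp: good_def)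
 finally show ?thesis using assms by auto
qed

lemma L_one: "spopn V ==> L V (un U) (un U) = \<one>$$(Sec (pre V))"
proof -
 assume V: "spopn V"
 have "frac V (un U) (un U) = \<one>$$(SpS U V)" by (simp add: frac_def Spec_def localization_at_def)
 thus ?thesis using ring_hom_one chart_iso[OF ch V] unfolding L_def ring_iso_def by auto
qed

lemma good_one: "spopn V ==> a:car U ==> good V a (un U)"
 using domain.prime_zero_one[OF chart_dom[OF ch] spopn_prime] crs(6)[OF sec_cring[OF chart_opn[OF ch]]] unfolding good_def by auto

lemma spopn_all: "spopn {P. primeideal P (Sec U)}" using domain.topspace_spec[OF chart_dom[OF ch]] openin_topspace[of "spec_top (Sec U)"] by simp
lemma pre_all: "pre {P. primeideal P (Sec U)} = U" using chart_prime[OF ch] by auto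
lemma pre_opn: "spopn V ==> opn (pre V)" by (rule chart_pre_opn[OF ch])
lemma tq_car: "a:car U ==> tq a:car U" using L_car[OF good_one[OF spopn_all], of a] unfolding tq_def pre_all by simp

lemma tq_restr: "a:car U ==> spopn V ==> restr X U (pre V) (tq a) = L V a (un U)"
 using L_restr[OF good_one[OF spopn_all], of a V] spopn_prime unfolding tq_def pre_all by auto

lemma tq_hom: "tq:ring_hom (Sec U) (Sec U)"
proof -
 interpret D: domain "Sec U" by (rule chart_dom[OF ch])
 note g = good_one[OF spopn_all]
 show ?thesis
 proof (rule ring_hom_memI)
 show "tq x:car U" if "x:car U" for x using tq_car that .
 show "tq (x \<otimes>$$(Sec U) y) = tq x \<otimes>$$(Sec U) tq y" if "x:car U" "y:car U" for x y using L_mult[OF g g, OF that] unfolding tq_def pre_all by simp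
 show "tq (x \<oplus>$$(Sec U) y) = tq x \<oplus>$$(Sec U) tq y" if "x:car U" "y:car U" for x y using L_add[OF g g, OF that] unfolding tq_def pre_all by simp
 show "tq (un U) = un U" using L_one[OF spopn_all] unfolding tq_def pre_all .
 qed
qed

lemma tq_inj: "a:car U ==> b:car U ==> tq a = tq b ==> a = b"
proof -
 interpret D: domain "Sec U" by (rule chart_dom[OF ch])
 assume "a:car U" "b:car U" "tq a = tq b"
 moreover have "{P. primeideal P (Sec U)} ~= {}" using D.zero_prime by auto
 ultimately show ?thesis using L_eq[OF good_one[OF spopn_all] good_one[OF spopn_all], of a b] unfolding tq_def by simp
qed

lemma local_form: assumes "opn W" "W <= U" "x:W" "t:car W" shows "EX V a g. good V a g & f x:V & pre V <= W & restr X W (pre V) t = L V a g"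
proof -
 interpret D: domain "Sec U" by (rule chart_dom[OF ch])
 note W = chart_img_opn[OF ch assms(1,2)]
 have iW: "fy (f ` W):ring_iso (SpS U (f ` W)) (Sec W)" using chart_iso[OF ch W(1)] W by simp
 hence "fy (f ` W) ` carrier (SpS U (f ` W)) = car W" unfolding ring_iso_def bij_betw_def by simp
 then obtain si where s: "si:carrier (SpS U (f ` W))" "fy (f ` W) si = t" using assms(4) by force
 have fx: "f x:f ` W" using assms by simp
 obtain V a g where V: "spopn V" "f x:V" "V <= f ` W" "a:car U" "g:car U" "ALL Q:V. g ~: Q & si Q = loc_frac (Sec U) Q a g"
 using s(1)[unfolded D.carrier_Spec, THEN CollectD, THEN conjunct2, rule_format, OF fx] by auto
 have "restr (Spec (Sec U)) (f ` W) V si = frac V a g" using V by (auto simp: Spec_def frac_def intro!: restrict_ext)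
 hence "restr X W (pre V) t = L V a g" using chart_restr[OF ch W(1) V(1,3) s(1)] W s unfolding L_def by simp
 moreover have "pre V <= W" using V W by auto
 ultimately show ?thesis using V unfolding good_def by blast
qed

text \<open>A germ has a local form \<open>a/g\<close> near \<open>x\<close>, with \<open>g\<close>
  outside the prime of \<open>x\<close>; multiplying by \<open>g\<close> clears the
  denominator.\<close>

lemma stalk_form: assumes x: "x:U" and "b:cst x" shows "EX a:car U. EX g:car U. g ~: f x & germ X x U (tq g) \<otimes>$$(st x) b = germ X x U (tq a)"
proof -
 interpret D: domain "Sec U" by (rule chart_dom[OF ch])
 obtain W t where W: "opn W" "x:W" "t:car W" "b = germ X x W t" using assms(2) by (rule stalk_repE)
 have o: "opn (W Int U)" using W chart_opn[OF ch] by auto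
 have "restr X W (W Int U) t:car (W Int U)" using W o by (auto intro: res_closed)
 then obtain V a g where V: "good V a g" "f x:V" "pre V <= W Int U" "restr X (W Int U) (pre V) (restr X W (W Int U) t) = L V a g"
 using local_form[OF o _ _ , of x "restr X W (W Int U) t"] W x by auto
 have sV: "spopn V" and ag: "a:car U" "g:car U" "g ~: f x" using V by (auto simp: good_def)
 have xV: "x:pre V" using x V by simp
 have b: "b = germ X x (pre V) (L V a g)" using V res_res[OF W(1) o pre_opn[OF sV] V(3) _ W(3)] germ_restr[OF W(1) pre_opn[OF sV] xV _ W(3)] W by auto
 have th: "germ X x U (tq c) = germ X x (pre V) (L V c (un U))" if "c:car U" for c
 using germ_restr[OF chart_opn[OF ch] pre_opn[OF sV] xV _ tq_car[OF that]] tq_restr[OF that sV] by auto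
 have gg: "good V c (un U)" if "c:car U" for c using good_one[OF sV that] .
 have "germ X x U (tq g) \<otimes>$$(st x) b = germ X x (pre V) (L V (g \<otimes>$$(Sec U) a) ((un U) \<otimes>$$(Sec U) g))"
 unfolding b th[OF ag(2)] using stalk_mult1[OF pre_opn[OF sV] xV L_car[OF gg[OF ag(2)]] L_car[OF V(1)]] L_mult[OF gg[OF ag(2)] V(1)] by simp
 also have "L V (g \<otimes>$$(Sec U) a) ((un U) \<otimes>$$(Sec U) g) = L V a (un U)"
 using L_eq[OF L_mult(2)[OF gg[OF ag(2)] V(1)] gg[OF ag(1)]] V ag by (auto simp: D.m_comm)
 finally show ?thesis using th ag by auto
qed

text \<open>If \<open>g\<close> is outside the prime, it is invertible on the basic open set that it
  defines. Conversely, clearing the denominator of an inverse gives \<open>g \<otimes> a = h\<close>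
  with \<open>h\<close> outside the prime.\<close>

lemma tq_unit: assumes x: "x:U" and g: "g:car U" shows "germ X x U (tq g):Units (st x) <-> g ~: f x"
proof
 interpret D: domain "Sec U" by (rule chart_dom[OF ch])
 have xt: "x:topX" using in_top[OF chart_opn[OF ch]] x by auto
 interpret S: cring "st x" using stalk_cring[OF xt] .
 assume "g ~: f x"
 define V where "V = {P. primeideal P (Sec U) & g ~: P}"
 have sV: "spopn V" unfolding V_def by (rule D.spec_basic_open[OF g])
 have xV: "x:pre V" using x `g ~: f x` chart_prime[OF ch] unfolding V_def by auto
 have 1: "good V (un U) g" using sV g unfolding good_def V_def by auto
 have 2: "good V g (un U)" using good_one[OF sV g] .
 have th: "germ X x U (tq g) = germ X x (pre V) (L V g (un U))" using germ_restr[OF chart_opn[OF ch] pre_opn[OF sV] xV _ tq_car[OF g]] tq_restr[OF g sV] by auto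
 have "germ X x U (tq g) \<otimes>$$(st x) germ X x (pre V) (L V (un U) g) = germ X x (pre V) (L V (g \<otimes>$$(Sec U) (un U)) ((un U) \<otimes>$$(Sec U) g))"
 unfolding th using stalk_mult1[OF pre_opn[OF sV] xV L_car[OF 2] L_car[OF 1]] L_mult[OF 2 1] by simp
 also have "L V (g \<otimes>$$(Sec U) (un U)) ((un U) \<otimes>$$(Sec U) g) = L V (un U) (un U)" using L_eq[OF L_mult(2)[OF 2 1] good_one[OF sV, of "un U"]] xV g by auto
 also have "germ X x (pre V) (L V (un U) (un U)) = \<one>$$(st x)" using L_one[OF sV] stalk_one[OF pre_opn[OF sV] xV] by simp
 finally show "germ X x U (tq g):Units (st x)" using germ_car[OF chart_opn[OF ch] x tq_car[OF g]] germ_car[OF pre_opn[OF sV] xV L_car[OF 1]]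
 unfolding Units_def using S.m_comm[of "germ X x U (tq g)" "germ X x (pre V) (L V (un U) g)"] by auto
next
 interpret D: domain "Sec U" by (rule chart_dom[OF ch])
 have xt: "x:topX" using in_top[OF chart_opn[OF ch]] x by auto
 interpret S: cring "st x" using stalk_cring[OF xt] .
 assume "germ X x U (tq g):Units (st x)"
 then obtain b where b: "b:cst x" "germ X x U (tq g) \<otimes>$$(st x) b = \<one>$$(st x)" unfolding Units_def by auto
 obtain a h where ah: "a:car U" "h:car U" "h ~: f x" "germ X x U (tq h) \<otimes>$$(st x) b = germ X x U (tq a)" using stalk_form[OF x b(1)] by auto
 have c: "germ X x U (tq g):cst x" "germ X x U (tq h):cst x" "germ X x U (tq a):cst x" using germ_car[OF chart_opn[OF ch] x tq_car] g ah by auto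
 have "germ X x U (tq (g \<otimes>$$(Sec U) a)) = germ X x U (tq g) \<otimes>$$(st x) germ X x U (tq a)"
 using stalk_mult1[OF chart_opn[OF ch] x tq_car[OF g] tq_car[OF ah(1)]] ring_hom_mult[OF tq_hom g ah(1)] by simp
 also have "... = germ X x U (tq h) \<otimes>$$(st x) (germ X x U (tq g) \<otimes>$$(st x) b)" using c b(1) by (simp only: ah(4)[symmetric] S.m_lcomm)
 also have "... = germ X x U (tq h)" using b c by simp
 finally have "tq (g \<otimes>$$(Sec U) a) = tq h" using germ_inj[OF chart_opn[OF ch] x] tq_car g ah by auto
 hence "g \<otimes>$$(Sec U) a = h" using tq_inj g ah by auto
 moreover have "ideal (f x) (Sec U)" using chart_prime[OF ch x] by (rule primeideal.axioms(1))
 ultimately show "g ~: f x" using ah ideal.I_r_closed by fast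
qed

end
end

section \<open>Subrings, ideals and primes as subsets of a field\<close>

definition subr :: "'k::field set => bool" where "subr A <-> 0:A & 1:A & (ALL a:A. ALL b:A. a + b:A & a * b:A) & (ALL a:A. - a:A)"
definition idl :: "'k::field set => 'k set => bool" where "idl I A <-> I <= A & 0:I & (ALL a:I. ALL b:I. a + b:I) & (ALL a:A. ALL b:I. a * b:I)"
definition prm :: "'k::field set => 'k set => bool" where "prm P A <-> idl P A & 1 ~: P & (ALL a:A. ALL b:A. a * b:P --> a:P | b:P)"

lemma subrD: assumes "subr A" shows "0:A" "1:A" "a:A ==> b:A ==> a + b:A" "a:A ==> b:A ==> a * b:A" "a:A ==> - a:A" "a:A ==> b:A ==> a - b:A" "a:A ==> a ^ n:A"
proof -
 show 0: "0:A" "1:A" "a:A ==> b:A ==> a + b:A" "a:A ==> b:A ==> a * b:A" "a:A ==> - a:A" for a b using assms unfolding subr_def by auto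
 show "a:A ==> b:A ==> a - b:A" using 0(3)[of a "- b"] 0 by simp
 show "a:A ==> a ^ n:A" by (induction n) (auto intro: 0)
qed

lemma subr_sum: "subr A ==> (!!i. i:S ==> f i:A) ==> sum f S:A" by (induction S rule: ifi) (auto intro: subrD)
lemma subr_prod: "subr A ==> (!!i. i:S ==> f i:A) ==> prod f S:A" by (induction S rule: ifi) (auto intro: subrD)

lemma idlD: assumes "idl I A" shows "a:I ==> a:A" "0:I" "a:I ==> b:I ==> a + b:I" "c:A ==> b:I ==> c * b:I" "b:I ==> c:A ==> b * c:I"
 using assms unfolding idl_def by (auto simp: mult.commute)

lemma idl_minus: assumes "subr A" "idl I A" "a:I" shows "- a:I" using idlD(4)[OF assms(2) subrD(5)[OF assms(1) subrD(2)[OF assms(1)]] assms(3)] by simp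
lemma idl_diff: assumes "subr A" "idl I A" "a:I" "b:I" shows "a - b:I" using idlD(3)[OF assms(2,3) idl_minus[OF assms(1,2,4)]] by simp
lemma idl_sum: "idl I A ==> (!!i. i:S ==> f i:I) ==> sum f S:I" by (induction S rule: ifi) (auto intro: idlD)
lemma prmD: assumes "prm P A" shows "idl P A" "1 ~: P" "a:A ==> b:A ==> a * b:P ==> a:P | b:P" "0:P" "P <= A" using assms unfolding prm_def idl_def by auto

text \<open>An ideal that is maximal among those missing the multiplicative set \<open>S\<close> is
  prime: two elements outside it, each added to the ideal, would yield a product in
  \<open>S\<close>. The maximality is part of the conclusion because with \<open>S = {1}\<close> it
  gives maximal ideals.\<close>

lemma prime_avoid: assumes A: "subr A" and I: "idl I A" and S: "S <= A" "1:S" "!!a b. a:S ==> b:S ==> a * b:S" and d: "I Int S = {}"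
 obtains P where "prm P A" "I <= P" "P Int S = {}" "!!J. idl J A ==> P <= J ==> J Int S = {} ==> J = P"
proof -
 define II where "II = {J. idl J A & I <= J & J Int S = {}}"
 have "EX M:II. ALL J:II. M <= J --> J = M"
 proof (rule subset_Zorn_nonempty)
 show "II ~= {}" using I d unfolding II_def by auto
 fix C assume C: "C ~= {}" "subset.chain II C"
 have "idl (\<Union>C) A" unfolding idl_def
 proof (intro conjI ballI)
  have cI: "!!J. J:C ==> idl J A" using C unfolding subset.chain_def II_def by auto
  show "\<Union>C <= A" using cI unfolding idl_def by fast
  show "0:\<Union>C" using cI C unfolding idl_def by auto
  show "a + b:\<Union>C" if "a:\<Union>C" "b:\<Union>C" for a b
  proof -
  obtain J K where JK: "J:C" "a:J" "K:C" "b:K" using `a:\<Union>C` `b:\<Union>C` by auto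
  hence "J <= K | K <= J" using C unfolding subset.chain_def by auto
  thus ?thesis
  proof
   assume "J <= K" hence "a + b:K" using cI JK idlD(3) by fast
   thus ?thesis using JK by auto
  next
   assume "K <= J" hence "a + b:J" using cI JK idlD by blast
   thus ?thesis using JK by auto
  qed
  qed
  show "a * b:\<Union>C" if "a:A" "b:\<Union>C" for a b using that cI idlD by fast
 qed
 moreover have "I <= \<Union>C" "\<Union>C Int S = {}"
 proof -
  have *: "C <= II" using C unfolding subset.chain_def by auto
  obtain J where "J:C" using C by auto
  thus "I <= \<Union>C" using * unfolding II_def by auto
  show "\<Union>C Int S = {}" using * unfolding II_def by auto
 qed
 ultimately show "\<Union>C:II" unfolding II_def by auto
 qed
 then obtain P where P: "idl P A" "I <= P" "P Int S = {}" and max: "!!J. idl J A ==> I <= J ==> J Int S = {} ==> P <= J ==> J = P" unfolding II_def by auto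
 have *: "EX p:P. EX c:A. p + c * a:S" if a: "a:A" "a ~: P" for a
 proof (rule ccontr)
 assume n: "~ (EX p:P. EX c:A. p + c * a:S)"
 define J where "J = {p + c * a |p c. p:P & c:A}"
 have "idl J A" unfolding idl_def
 proof (intro conjI ballI)
  show "J <= A" unfolding J_def using a by (auto intro!: subrD[OF A] dest: idlD(1)[OF P(1)])
  show "0:J" unfolding J_def using idlD(2)[OF P(1)] subrD(1)[OF A] by force
  show "x + y:J" if xy: "x:J" "y:J" for x y
  proof -
  obtain p c p' c' where e: "x = p + c * a" "y = p' + c' * a" "p:P" "p':P" "c:A" "c':A" using xy unfolding J_def by auto
  have "x + y = (p + p') + (c + c') * a" using e by (simp add: als)
  thus ?thesis using e P A unfolding J_def by (blast intro: idlD subrD)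
  qed
  show "x * y:J" if xy: "x:A" "y:J" for x y
  proof -
  obtain p c where e: "y = p + c * a" "p:P" "c:A" using xy unfolding J_def by auto
  have "x * y = x * p + (x * c) * a" using e by (simp add: als)
  thus ?thesis using e P A xy unfolding J_def by (blast intro: idlD subrD)
  qed
 qed
 moreover have "P <= J"
 proof
  fix p assume "p:P" hence "p + 0 * a:J" unfolding J_def using subrD[OF A] by fast
  thus "p:J" by simp
 qed
 moreover have "J Int S = {}" using n unfolding J_def by auto
 ultimately have "J = P" using max P by simp
 moreover have "a:J" unfolding J_def using idlD(2)[OF P(1)] subrD(2)[OF A] by force
 ultimately show False using a by auto
 qed
 have "prm P A" unfolding prm_def
 proof (intro conjI ballI impI)
 show "1 ~: P" using P S by auto
 fix a b assume ab: "a:A" "b:A" "a * b:P"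
 show "a:P | b:P"
 proof (rule ccontr)
  assume "~ (a:P | b:P)"
  then obtain p c p' c' where e: "p:P" "c:A" "p + c * a:S" "p':P" "c':A" "p' + c' * b:S" using * ab by metis
  have "(p + c * a) * (p' + c' * b) = (p' + c' * b) * p + (c * a) * p' + (c * c') * (a * b)" by (simp add: als)
  moreover have "...:P"
  proof -
  have "(p' + c' * b) * p:P" using e S by (intro idlD(4)[OF P(1)]) auto
  moreover have "(c * a) * p':P" using e ab subrD[OF A] by (intro idlD(4)[OF P(1)]) auto
  moreover have "(c * c') * (a * b):P" by (rule idlD(4)[OF P(1)]) (use e ab subrD(4)[OF A] in auto)
  ultimately show ?thesis by (intro idlD(3)[OF P(1)])
  qed
  ultimately show False using S(3)[OF e(3,6)] P by auto
 qed
 qed (use P in auto)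
 thus thesis using that P max by simp
qed

section \<open>The generic point and the function field\<close>

context integral_scheme
begin

abbreviation "gp == generic_point X"
abbreviation "K == stalk X gp"

text \<open>The zero prime belongs to every nonempty open subset of the spectrum, and by
  irreducibility every nonempty open set meets \<open>U\<close>.\<close>

lemma zero_in_all: assumes ch: "chart U f fy" and x: "x:U" "f x = {zr U}" and V: "opn V" "V ~= {}" shows "x:V"
proof -
 have ne: "V Int U ~= {}" "opn (V Int U)" using irreducible[OF V(1) chart_opn[OF ch] V(2) chart_ne[OF ch]] V chart_opn[OF ch] by auto
 have "spo U (f ` (V Int U))" using chart_img_opn[OF ch ne(2)] by auto
 hence "{zr U}:f ` (V Int U)" using domain.spec_open_zero[OF chart_dom[OF ch]] ne by auto
 then obtain y where y: "y:V" "y:U" "f y = f x" using x by auto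
 hence "y = x" using x chart_inj[OF ch] by (auto simp: inj_on_def)
 thus ?thesis using y by simp
qed

lemma all_zero: assumes ch: "chart U f fy" and x: "!!V. opn V ==> V ~= {} ==> x:V" shows "x:U" "f x = {zr U}"
proof -
 interpret D: domain "Sec U" by (rule chart_dom[OF ch])
 show xU: "x:U" using x chart_opn[OF ch] chart_ne[OF ch] by auto
 have pr: "primeideal (f x) (Sec U)" by (rule chart_prime[OF ch xU])
 have "g ~: f x" if g: "g:car U" "g ~= zr U" for g
 proof -
 let ?V = "{P. primeideal P (Sec U) & g ~: P}"
 have "{zr U}:?V" using D.zero_prime g by auto
 then obtain y where "y:U" "f y:?V" using chart_image[OF ch] by (metis (mono_tags, lifting) imageE mem_Collect_eq)
 hence "{y:U. f y:?V} ~= {}" by auto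
 moreover have "opn {y:U. f y:?V}" by (rule chart_pre_opn[OF ch D.spec_basic_open[OF g(1)]])
 ultimately have "x:{y:U. f y:?V}" using x by auto
 thus ?thesis by simp
 qed
 thus "f x = {zr U}" using D.prime_zero_one[OF pr] by auto
qed

lemma ex_chart: assumes "x:topX" obtains U f fy where "chart U f fy" "x:U" "affine_open X U"
proof -
 obtain U where "affine_open X U" "x:U" using aff_cover assms by auto
 thus ?thesis using affine_chart that by (metis empty_iff)
qed

lemma gp: "opn V ==> V ~= {} ==> gp:V" and gp_top: "gp:topX"
proof -
 obtain x0 where "x0:topX" using nonempty by fast
 then obtain U f fy where U: "chart U f fy" using ex_chart by metis
 interpret D: domain "Sec U" by (rule chart_dom[OF U])
 obtain x where x: "x:U" "f x = {zr U}" using chart_image[OF U] D.zero_prime by (metis imageE mem_Collect_eq)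
 have "EX! x. x:topX & (ALL U. opn U & U ~= {} --> x:U)"
 proof (rule ex1I[of _ x])
 show "x:topX & (ALL U. opn U & U ~= {} --> x:U)" using zero_in_all[OF U x] in_top[OF chart_opn[OF U]] x by auto
 fix y assume "y:topX & (ALL U. opn U & U ~= {} --> y:U)"
 hence "y:U" "f y = {zr U}" using all_zero[OF U, of y] by auto
 thus "y = x" using x chart_inj[OF U] by (auto simp: inj_on_def)
 qed
 from theI'[OF this] have *: "gp:topX & (ALL U. opn U & U ~= {} --> gp:U)" unfolding generic_point_def .
 show "gp:topX" using * by simp
 show "opn V ==> V ~= {} ==> gp:V" using * by simp
qed

text \<open>In a chart the generic point has the zero prime, so by \<open>tq_unit\<close> every
  nonzero numerator and denominator gives a unit of the stalk.\<close>

lemma ff_field: "field K"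
proof -
 interpret S: cring K by (rule stalk_cring[OF gp_top])
 obtain U f fy where U: "chart U f fy" "gp:U" using ex_chart[OF gp_top] by metis
 interpret D: domain "Sec U" by (rule chart_dom[OF U(1)])
 have f0: "f gp = {zr U}" using all_zero[OF U(1) gp] by auto
 have oU: "opn U" by (rule chart_opn[OF U(1)])
 have "\<zero>$$K ~= \<one>$$K" unfolding stalk_zero[OF oU U(2)] stalk_one[OF oU U(2)] using germ_inj[OF oU U(2) D.zero_closed D.one_closed] by auto
 moreover have "b:Units K" if b: "b:carrier K" "b ~= \<zero>$$K" for b
 proof -
 obtain a g where ag: "a:car U" "g:car U" "g ~: f gp" "germ X gp U (tq U fy g) \<otimes>$$K b = germ X gp U (tq U fy a)" using stalk_form[OF U b(1)] by auto
 have gu: "germ X gp U (tq U fy g):Units K" using tq_unit[OF U ag(2)] ag by simp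
 have "a ~= zr U"
 proof
  assume "a = zr U"
  hence "germ X gp U (tq U fy a) = \<zero>$$K" using ring_hom_zero[OF tq_hom[OF U(1)] D.ring_axioms D.ring_axioms] stalk_zero[OF oU U(2)] by simp
  hence "b = \<zero>$$K" using ag gu S.Units_closed S.Units_l_cancel[OF gu b(1) S.zero_closed] by simp
  thus False using b by simp
 qed
 hence au: "germ X gp U (tq U fy a):Units K" using tq_unit[OF U ag(1)] f0 by simp
 have "b = inv$$K (germ X gp U (tq U fy g)) \<otimes>$$K germ X gp U (tq U fy a)" unfolding ag(4)[symmetric] using gu b by (simp add: S.m_assoc[symmetric] S.Units_closed)
 thus ?thesis using au gu by simp
 qed
 ultimately show ?thesis by (intro S.cring_fieldI2) (auto simp: Units_def)
qed

lemma germ_gp: assumes "opn U" "x:U" "s:car U" shows "stalk_to_ff X (germ X x U s) = germ X gp U s"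
proof -
 have "germ X gp V t = germ X gp U s" if "(V, t):germ X x U s" for V t
 proof -
 have V: "opn V" "x:V" "t:car V" "restr X U (U Int V) s = restr X V (U Int V) t" using that assms by (auto simp: germ_alt)
 have "gp:V" "gp:U" using gp V assms by auto
 hence "(V, t):germ X gp U s" using V assms by (simp add: germ_alt)
 thus ?thesis using germ_mem assms `gp:U` by simp
 qed
 moreover have "(U, s):germ X x U s" using germ_self assms by simp
 ultimately have "(UN p:germ X x U s. germ X gp (fst p) (snd p)) = germ X gp U s" by (metis (no_types, lifting) SUP_eq_const empty_iff prod.collapse)
 thus ?thesis unfolding stalk_to_ff_def by (simp add: case_prod_beta)
qed

end

section \<open>The function field as a type, and the local rings inside it\<close>

locale scheme_model = integral_scheme X for X :: "('p, 's, 'm) ringed_space_scheme" +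
 fixes h :: "('p, 's) ffg => 'k::field" assumes h_bij: "bij_betw h (carrier (stalk X (generic_point X))) UNIV"
 and h_mult: "a:carrier (stalk X (generic_point X)) ==> b:carrier (stalk X (generic_point X)) ==> h (a \<otimes>$$(stalk X (generic_point X)) b) = h a * h b"
 and h_add: "a:carrier (stalk X (generic_point X)) ==> b:carrier (stalk X (generic_point X)) ==> h (a \<oplus>$$(stalk X (generic_point X)) b) = h a + h b"
 and h_one: "h \<one>$$(stalk X (generic_point X)) = 1"
begin

sublocale K: field K by (rule ff_field)

lemma h_zero: "h \<zero>$$K = 0"
proof -
 have "h \<zero>$$K + h \<zero>$$K = h \<zero>$$K + 0" using h_add[of "\<zero>$$K" "\<zero>$$K"] by simp
 thus ?thesis by (rule add_left_imp_eq)
qed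

lemma h_inj: "a:carrier K ==> b:carrier K ==> h a = h b ==> a = b" using h_bij by (auto simp: bij_betw_def inj_on_def)
text \<open>All sections are embedded into one field, so that restriction maps become inclusions and
  \<open>Ost x\<close> is the union of the rings \<open>AA U\<close> over the neighbourhoods of
  \<open>x\<close>.\<close>

definition sval :: "'p set => 's => 'k" where "sval U s = h (germ X gp U s)"
definition AA :: "'p set => 'k set" where "AA U = sval U ` car U"
definition Ost :: "'p => 'k set" where "Ost x = {sval U s |U s. opn U & x:U & s:car U}"
definition Mst :: "'p => 'k set" where "Mst x = {a:Ost x. a = 0 | inverse a ~: Ost x}"
abbreviation "MU U x == AA U Int Mst x"

context
 fixes U assumes U: "opn U" "U ~= {}"
begin
lemma gpU: "gp:U" using gp U by auto

lemma sval_mult: "s:car U ==> t:car U ==> sval U (s \<otimes>$$(Sec U) t) = sval U s * sval U t"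
 unfolding sval_def using h_mult[OF germ_car germ_car] stalk_mult1 U gpU by metis
lemma sval_add: "s:car U ==> t:car U ==> sval U (s \<oplus>$$(Sec U) t) = sval U s + sval U t"
 unfolding sval_def using h_add[OF germ_car germ_car] stalk_add1 U gpU by metis
lemma sval_one: "sval U (un U) = 1" unfolding sval_def using h_one stalk_one[OF U(1) gpU] by simp
lemma sval_zero: "sval U (zr U) = 0" unfolding sval_def using h_zero stalk_zero[OF U(1) gpU] by simp
lemma sval_inj: "s:car U ==> t:car U ==> sval U s = sval U t ==> s = t" unfolding sval_def using h_inj[OF germ_car germ_car] germ_inj U gpU by simp
lemma sval_neg: "s:car U ==> sval U (\<ominus>$$(Sec U) s) = - sval U s"
proof -
 interpret cring "Sec U" using U sec_cring by auto
 assume s: "s:car U"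
 hence "sval U s + sval U (\<ominus>$$(Sec U) s) = 0" using sval_add[of s "\<ominus>$$(Sec U) s"] sval_zero by (simp add: r_neg)
 thus ?thesis by (simp add: eq_neg_iff_add_eq_0 add.commute)
qed
lemma sval_restr: "opn V ==> V ~= {} ==> V <= U ==> s:car U ==> sval V (restr X U V s) = sval U s" unfolding sval_def using germ_restr[OF U(1)] gp by simp
lemma AA_subr: "subr (AA U)"
proof -
 interpret cring "Sec U" using U sec_cring by auto
 show ?thesis unfolding subr_def
 proof (intro conjI ballI)
 show "0:AA U" unfolding AA_def by (rule image_eqI[where f="sval U", OF sval_zero[symmetric] zero_closed])
 show "1:AA U" unfolding AA_def by (rule image_eqI[where f="sval U", OF sval_one[symmetric] one_closed])
 fix a assume "a:AA U"
 then obtain s where s: "s:car U" "a = sval U s" unfolding AA_def by auto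
 show "- a:AA U" unfolding AA_def s by (rule image_eqI[where f="sval U", OF sval_neg[OF s(1), symmetric] a_inv_closed[OF s(1)]])
 fix b assume "b:AA U"
 then obtain t where t: "t:car U" "b = sval U t" unfolding AA_def by auto
 show "a + b:AA U" unfolding AA_def s t by (rule image_eqI[where f="sval U", OF sval_add[OF s(1) t(1), symmetric] a_closed[OF s(1) t(1)]])
 show "a * b:AA U" unfolding AA_def s t by (rule image_eqI[where f="sval U", OF sval_mult[OF s(1) t(1), symmetric] m_closed[OF s(1) t(1)]])
 qed
qed
end

lemma Ost_mem: "opn U ==> x:U ==> s:car U ==> sval U s:Ost x" unfolding Ost_def by auto
lemma Ost_AA: "opn U ==> x:U ==> AA U <= Ost x" unfolding AA_def using Ost_mem by auto
definition shom :: "('p, 's) ffg => 'k" where "shom a = h (stalk_to_ff X a)"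
lemma shom_germ: "opn U ==> x:U ==> s:car U ==> shom (germ X x U s) = sval U s" unfolding shom_def sval_def using germ_gp by simp

lemma shom_mult: "a:cst x ==> b:cst x ==> shom (a \<otimes>$$(st x) b) = shom a * shom b"
proof -
 assume "a:cst x" "b:cst x"
 then obtain U s t where U: "opn U" "x:U" "s:car U" "a = germ X x U s" "t:car U" "b = germ X x U t" by (metis stalk_rep3E)
 have "U ~= {}" using U by auto
 thus ?thesis using U sval_mult by (simp add: stalk_mult1 shom_germ crs sec_cring)
qed

lemma shom_add: "a:cst x ==> b:cst x ==> shom (a \<oplus>$$(st x) b) = shom a + shom b"
proof -
 assume "a:cst x" "b:cst x"
 then obtain U s t where U: "opn U" "x:U" "s:car U" "a = germ X x U s" "t:car U" "b = germ X x U t" by (metis stalk_rep3E)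
 have "U ~= {}" using U by auto
 thus ?thesis using U sval_add by (simp add: stalk_add1 shom_germ crs sec_cring)
qed

lemma shom_inj: "a:cst x ==> b:cst x ==> shom a = shom b ==> a = b"
proof -
 assume "a:cst x" "b:cst x" and e: "shom a = shom b"
 then obtain U s t where U: "opn U" "x:U" "s:car U" "a = germ X x U s" "t:car U" "b = germ X x U t" by (metis stalk_rep3E)
 have "U ~= {}" using U by auto
 thus ?thesis using U sval_inj e by (auto simp: shom_germ)
qed

lemma shom_img: "shom ` cst x = Ost x"
proof
 show "shom ` cst x <= Ost x"
 proof
 fix k assume "k:shom ` cst x"
 then obtain a where "a:cst x" "k = shom a" by auto
 thus "k:Ost x" by (elim stalk_repE) (auto simp: shom_germ Ost_def)
 qed
 show "Ost x <= shom ` cst x"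
 proof
 fix k assume "k:Ost x"
 then obtain U s where U: "opn U" "x:U" "s:car U" "k = sval U s" unfolding Ost_def by auto
 thus "k:shom ` cst x" using shom_germ germ_car by (metis image_eqI)
 qed
qed

lemma shom_one: "x:topX ==> shom \<one>$$(st x) = 1"
 using stalk_one[OF topspace_opn] shom_germ sval_one[OF topspace_opn nonempty] crs(6)[OF sec_cring[OF topspace_opn]] by simp

lemma Ost_subr: assumes x: "x:topX" shows "subr (Ost x)"
proof -
 interpret S: cring "st x" by (rule stalk_cring[OF x])
 have z: "shom \<zero>$$(st x) = 0"
 proof -
 have "shom \<zero>$$(st x) + shom \<zero>$$(st x) = shom \<zero>$$(st x) + 0" using shom_add[of "\<zero>$$(st x)" x "\<zero>$$(st x)"] by simp
 thus ?thesis by (rule add_left_imp_eq)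
 qed
 have n: "shom (\<ominus>$$(st x) a) = - shom a" if "a:cst x" for a
 using shom_add[of a x "\<ominus>$$(st x) a"] that z by (simp add: S.r_neg eq_neg_iff_add_eq_0 add.commute)
 show ?thesis unfolding subr_def shom_img[symmetric]
 proof (intro conjI ballI)
 let ?A = "shom ` cst x"
 show "0:?A" by (rule image_eqI[where f=shom, OF z[symmetric] S.zero_closed])
 show "1:?A" by (rule image_eqI[where f=shom, OF shom_one[OF x, symmetric] S.one_closed])
 fix a assume "a:?A"
 then obtain s where s: "s:cst x" "a = shom s" by auto
 show "- a:?A" unfolding s by (rule image_eqI[where f=shom, OF n[OF s(1), symmetric] S.a_inv_closed[OF s(1)]])
 fix b assume "b:?A"
 then obtain t where t: "t:cst x" "b = shom t" by auto
 show "a + b:?A" unfolding s t by (rule image_eqI[where f=shom, OF shom_add[OF s(1) t(1), symmetric] S.a_closed[OF s(1) t(1)]])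
 show "a * b:?A" unfolding s t by (rule image_eqI[where f=shom, OF shom_mult[OF s(1) t(1), symmetric] S.m_closed[OF s(1) t(1)]])
 qed
qed

lemma shom_unit: assumes x: "x:topX" and a: "a:cst x" shows "a:Units (st x) <-> shom a ~: Mst x"
proof -
 interpret S: cring "st x" by (rule stalk_cring[OF x])
 have "a:Units (st x) <-> (EX b:cst x. a \<otimes>$$(st x) b = \<one>$$(st x))" using a S.m_comm unfolding Units_def by auto
 also have "... <-> (EX b:cst x. shom a * shom b = 1)" using shom_mult shom_one[OF x] shom_inj a by (metis S.m_closed S.one_closed)
 also have "... <-> (EX c:Ost x. shom a * c = 1)" unfolding shom_img[symmetric] by auto
 also have "... <-> shom a ~= 0 & inverse (shom a):Ost x" by (metis inverse_unique left_inverse mult_zero_left zero_neq_one)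
 also have "... <-> shom a ~: Mst x" using a shom_img unfolding Mst_def by auto
 finally show ?thesis .
qed

lemma shom_max: "x:topX ==> shom ` stalk_max X x = Mst x"
proof -
 assume x: "x:topX"
 have "Mst x <= shom ` cst x" unfolding shom_img Mst_def by auto
 thus ?thesis using shom_unit[OF x] unfolding stalk_max_def by auto
qed

lemma Ost_gp: "Ost gp = UNIV" "Mst gp = {0}"
proof -
 show 1: "Ost gp = UNIV"
 proof -
 have "k:Ost gp" for k
 proof -
  have "k:h ` carrier K" using h_bij unfolding bij_betw_def by simp
  then obtain a where "a:carrier K" "h a = k" by auto
  thus ?thesis unfolding Ost_def sval_def by (elim stalk_repE) auto
 qed
 thus ?thesis by auto
 qed
 show "Mst gp = {0}" unfolding Mst_def 1 by auto
qed

end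

context scheme_model
begin

context
 fixes U f fy assumes ch: "chart U f fy"
begin

definition psi :: "'s => 'k" where "psi a = sval U (tq U fy a)"
lemma psi_dom: "domain (Sec U)" by (rule chart_dom[OF ch])
lemma psi_opn: "opn U" "U ~= {}" using chart_opn[OF ch] chart_ne[OF ch] by auto

lemma psi_mult: "a:car U ==> b:car U ==> psi (a \<otimes>$$(Sec U) b) = psi a * psi b"
 unfolding psi_def using sval_mult[OF psi_opn] tq_car[OF ch] ring_hom_mult[OF tq_hom[OF ch]] by simp
lemma psi_add: "a:car U ==> b:car U ==> psi (a \<oplus>$$(Sec U) b) = psi a + psi b"
 unfolding psi_def using sval_add[OF psi_opn] tq_car[OF ch] ring_hom_add[OF tq_hom[OF ch]] by simp
lemma psi_one: "psi (un U) = 1" unfolding psi_def using sval_one[OF psi_opn] ring_hom_one[OF tq_hom[OF ch]] by simp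
lemma psi_zero: "psi (zr U) = 0"
proof -
 interpret D: domain "Sec U" by (rule psi_dom)
 have "psi (zr U) + psi (zr U) = psi (zr U) + 0" using psi_add[of "zr U" "zr U"] by simp
 thus ?thesis by (rule add_left_imp_eq)
qed
lemma psi_neg: "a:car U ==> psi (\<ominus>$$(Sec U) a) = - psi a"
proof -
 interpret D: domain "Sec U" by (rule psi_dom)
 show "a:car U ==> psi (\<ominus>$$(Sec U) a) = - psi a" using psi_add[of a "\<ominus>$$(Sec U) a"] psi_zero by (simp add: D.r_neg eq_neg_iff_add_eq_0 add.commute)
qed
lemma psi_AA: "a:car U ==> psi a:AA U" unfolding psi_def AA_def using tq_car[OF ch] by auto

lemma psi_form: assumes x: "x:U" and b: "b:Ost x" shows "EX a:car U. EX g:car U. g ~: f x & psi g * b = psi a"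
proof -
 obtain b' where b': "b':cst x" "shom b' = b" using b shom_img by force
 obtain a g where ag: "a:car U" "g:car U" "g ~: f x" "germ X x U (tq U fy g) \<otimes>$$(st x) b' = germ X x U (tq U fy a)" using stalk_form[OF ch x b'(1)] by auto
 have "shom (germ X x U (tq U fy g)) * b = shom (germ X x U (tq U fy a))" using shom_mult[OF germ_car[OF psi_opn(1) x tq_car[OF ch ag(2)]] b'(1)] ag b' by simp
 thus ?thesis using ag shom_germ[OF psi_opn(1) x] tq_car[OF ch] unfolding psi_def by auto
qed

lemma psi_unit: assumes x: "x:U" and g: "g:car U" shows "psi g:Mst x <-> g:f x"
proof -
 have "x:topX" using in_top[OF psi_opn(1)] x by auto
 thus ?thesis using shom_unit[OF _ germ_car[OF psi_opn(1) x tq_car[OF ch g]]] tq_unit[OF ch x g] shom_germ[OF psi_opn(1) x tq_car[OF ch g]] unfolding psi_def by auto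
qed

lemma psi_subr: "subr (psi ` car U)"
proof -
 interpret D: domain "Sec U" by (rule psi_dom)
 show ?thesis unfolding subr_def
 proof (intro conjI ballI)
 show "0:psi ` car U" by (rule image_eqI[where f=psi, OF psi_zero[symmetric] D.zero_closed])
 show "1:psi ` car U" by (rule image_eqI[where f=psi, OF psi_one[symmetric] D.one_closed])
 fix a assume "a:psi ` car U"
 then obtain s where s: "s:car U" "a = psi s" by auto
 show "- a:psi ` car U" unfolding s by (rule image_eqI[where f=psi, OF psi_neg[OF s(1), symmetric] D.a_inv_closed[OF s(1)]])
 fix b assume "b:psi ` car U"
 then obtain t where t: "t:car U" "b = psi t" by auto
 show "a + b:psi ` car U" unfolding s t by (rule image_eqI[where f=psi, OF psi_add[OF s(1) t(1), symmetric] D.a_closed[OF s(1) t(1)]])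
 show "a * b:psi ` car U" unfolding s t by (rule image_eqI[where f=psi, OF psi_mult[OF s(1) t(1), symmetric] D.m_closed[OF s(1) t(1)]])
 qed
qed

lemma psi_prime: assumes P: "prm P (psi ` car U)" shows "primeideal {g:car U. psi g:P} (Sec U)"
proof -
 interpret D: domain "Sec U" by (rule psi_dom)
 note I = prmD(1)[OF P]
 have "ideal {g:car U. psi g:P} (Sec U)"
 proof (rule idealI)
 show "ring (Sec U)" by (rule D.ring_axioms)
 show "subgroup {g:car U. psi g:P} (add_monoid (Sec U))"
 proof
  show "inv$$(add_monoid (Sec U)) x:{g:car U. psi g:P}" if "x:{g:car U. psi g:P}" for x using that psi_neg idl_minus[OF psi_subr I] unfolding a_inv_def[symmetric] by auto
 qed (auto simp: psi_add psi_zero idlD[OF I])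
 show "a:{g:car U. psi g:P} ==> x:car U ==> x \<otimes>$$(Sec U) a:{g:car U. psi g:P}" for a x by (auto simp: psi_mult idlD[OF I])
 show "a:{g:car U. psi g:P} ==> x:car U ==> a \<otimes>$$(Sec U) x:{g:car U. psi g:P}" for a x by (auto simp: psi_mult idlD[OF I])
 qed
 thus ?thesis
 proof (rule primeidealI[OF _ D.cring_axioms])
 show "car U ~= {g:car U. psi g:P}" using psi_one prmD(2)[OF P] by force
 show "a:{g:car U. psi g:P} | b:{g:car U. psi g:P}" if "a:car U" "b:car U" "a \<otimes>$$(Sec U) b:{g:car U. psi g:P}" for a b
  using that psi_mult prmD(3)[OF P, of "psi a" "psi b"] by auto
 qed
qed

lemma psi_point: assumes P: "prm P (psi ` car U)" obtains x where "x:U" "f x = {g:car U. psi g:P}"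
 using psi_prime[OF P] chart_image[OF ch] that by (metis (mono_tags, lifting) imageE mem_Collect_eq)

text \<open>For \<open>t\<close> in \<open>AA U\<close> the denominators of \<open>t\<close> form an
  ideal. No prime contains it: a prime belongs to a point \<open>x\<close> of \<open>U\<close>, and
  \<open>psi_form\<close> supplies a denominator outside it. So 1 is a denominator. Hence
  \<open>tq\<close> is onto and sections need not be distinguished from their images under the
  chart.\<close>

lemma AA_psi: "AA U = psi ` car U"
proof
 show "psi ` car U <= AA U" using psi_AA by auto
 show "AA U <= psi ` car U"
 proof
 fix t assume t: "t:AA U"
 let ?B = "psi ` car U"
 define I where "I = {b:?B. b * t:?B}"
 note B = subrD[OF psi_subr]
 have I: "idl I ?B" unfolding idl_def I_def using B by (auto simp: distrib_right mult.assoc)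
 have "1:I"
 proof (rule ccontr)
  assume "1 ~: I"
  have S: "{1} <= ?B" "1:{1::'k}" "!!a b. a:{1::'k} ==> b:{1} ==> a * b:{1}" "I Int {1} = {}" using B(2) `1 ~: I` by auto
  obtain P where P: "prm P ?B" "I <= P" by (rule prime_avoid[OF psi_subr I S])
  obtain x where x: "x:U" "f x = {g:car U. psi g:P}" using psi_point[OF P(1)] .
  have "t:Ost x" using t Ost_AA[OF psi_opn(1) x(1)] by auto
  then obtain a g where ag: "a:car U" "g:car U" "g ~: f x" "psi g * t = psi a" using psi_form[OF x(1)] by fast
  hence "psi g:I" unfolding I_def by auto
  thus False using P ag x by auto
 qed
 thus "t:?B" unfolding I_def by simp
 qed
qed

end

context
 fixes U assumes aff: "affine_open X U" "U ~= {}"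
begin

text \<open>With \<open>aff_Ost\<close>, \<open>aff_point\<close>, \<open>aff_inj\<close>,
  \<open>aff_basic_open\<close> and \<open>aff_basis\<close> this forms a dictionary between the
  points of \<open>U\<close> and the primes of \<open>AA U\<close>, after which charts can be
  forgotten.\<close>

lemma aff_prime: "x:U ==> prm (MU U x) (AA U)"
proof -
 assume x: "x:U"
 obtain f fy where ch: "chart U f fy" using affine_chart aff by auto
 interpret D: domain "Sec U" by (rule psi_dom[OF ch])
 interpret P: primeideal "f x" "Sec U" by (rule chart_prime[OF ch x])
 have e: "psi U fy g:Mst x <-> g:f x" if "g:car U" for g using psi_unit[OF ch x that] .
 have fx: "f x <= car U" by auto
 have A: "MU U x = psi U fy ` f x" unfolding AA_psi[OF ch] using e by auto
 show ?thesis unfolding prm_def idl_def A unfolding AA_psi[OF ch]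
 proof (intro conjI ballI impI)
 show "psi U fy ` f x <= psi U fy ` car U" by auto
 show "0:psi U fy ` f x" using psi_zero[OF ch] by simp
 show "1 ~: psi U fy ` f x"
 proof
  assume "1:psi U fy ` f x"
  hence "psi U fy (un U):Mst x" using A psi_one[OF ch] by auto
  thus False using e D.prime_zero_one[OF chart_prime[OF ch x]] by auto
 qed
 fix a b assume "a:psi U fy ` f x" "b:psi U fy ` f x"
 then obtain s t where "s:f x" "t:f x" "a = psi U fy s" "b = psi U fy t" by auto
 thus "a + b:psi U fy ` f x" using psi_add[OF ch, of s t] fx P.a_closed by (metis image_eqI subsetD)
 next
 fix a b assume "a:psi U fy ` car U" "b:psi U fy ` f x"
 then obtain s t where "s:car U" "t:f x" "a = psi U fy s" "b = psi U fy t" by auto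
 thus "a * b:psi U fy ` f x" using psi_mult[OF ch, of s t] P.I_l_closed by force
 next
 fix a b assume "a:psi U fy ` car U" "b:psi U fy ` car U" and ab: "a * b:psi U fy ` f x"
 then obtain s t where st: "s:car U" "t:car U" "a = psi U fy s" "b = psi U fy t" by auto
 hence "psi U fy (s \<otimes>$$(Sec U) t):Mst x" using psi_mult[OF ch] ab A by auto
 hence "s \<otimes>$$(Sec U) t:f x" using e st by auto
 thus "a:psi U fy ` f x | b:psi U fy ` f x" using P.I_prime st by auto
 qed
qed

lemma aff_Ost: "x:U ==> b:Ost x <-> (EX a:AA U. EX g:AA U. g ~: Mst x & g ~= 0 & b = a / g)"
proof
 assume x: "x:U"
 have xt: "x:topX" using in_top[OF affine_opn] x aff by auto
 obtain f fy where ch: "chart U f fy" using affine_chart aff by auto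
 have zm: "0:Mst x" using subrD[OF Ost_subr[OF xt]] by (simp add: Mst_def)
 { assume "b:Ost x"
 then obtain a g where ag: "a:car U" "g:car U" "g ~: f x" "psi U fy g * b = psi U fy a" using psi_form[OF ch x] by fast
 hence "psi U fy g ~: Mst x" using psi_unit[OF ch x] by auto
 moreover from this have "psi U fy g ~= 0" using zm by auto
 moreover from this have "b = psi U fy a / psi U fy g" using ag by (simp add: field_simps)
 ultimately show "EX a:AA U. EX g:AA U. g ~: Mst x & g ~= 0 & b = a / g" using ag psi_AA[OF ch] by auto }
 { assume "EX a:AA U. EX g:AA U. g ~: Mst x & g ~= 0 & b = a / g"
 then obtain a g where ag: "a:AA U" "g:AA U" "g ~: Mst x" "g ~= 0" "b = a / g" by auto
 have "a:Ost x" "g:Ost x" using ag Ost_AA[OF affine_opn[OF aff(1)] x] by auto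
 moreover from this have "inverse g:Ost x" using ag unfolding Mst_def by auto
 ultimately show "b:Ost x" using subrD[OF Ost_subr[OF xt]] ag by (simp add: divide_inverse) }
qed

lemma aff_point: assumes "prm P (AA U)" shows "EX x:U. P = MU U x"
proof -
 obtain f fy where ch: "chart U f fy" using affine_chart aff by auto
 have P: "prm P (psi U fy ` car U)" using assms AA_psi[OF ch] by simp
 obtain x where x: "x:U" "f x = {g:car U. psi U fy g:P}" using psi_point[OF ch P] .
 have "P = MU U x" unfolding AA_psi[OF ch] using prmD[OF P] psi_unit[OF ch x(1)] x by auto
 thus ?thesis using x by auto
qed

lemma aff_inj: assumes "x:U" "y:U" "MU U x = MU U y" shows "x = y"
proof -
 obtain f fy where ch: "chart U f fy" using affine_chart aff by auto
 have "f x = f y"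
 proof -
 have "g:f z <-> g:car U & psi U fy g:MU U z" if "z:U" for z g
  using psi_unit[OF ch that] psi_AA[OF ch] domain.prime_zero_one[OF psi_dom[OF ch] chart_prime[OF ch that]] by auto
 thus ?thesis using assms by auto
 qed
 thus ?thesis using chart_inj[OF ch] assms by (auto simp: inj_on_def)
qed

lemma aff_basic_open: assumes "g:AA U" shows "opn {x:U. g ~: Mst x}"
proof -
 obtain f fy where ch: "chart U f fy" using affine_chart aff by auto
 obtain a where a: "a:car U" "g = psi U fy a" using assms AA_psi[OF ch] by auto
 have "{x:U. g ~: Mst x} = {x:U. f x:{P. primeideal P (Sec U) & a ~: P}}" using psi_unit[OF ch _ a(1)] a chart_prime[OF ch] by auto
 thus ?thesis using chart_pre_opn[OF ch domain.spec_basic_open[OF psi_dom[OF ch] a(1)]] by simp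
qed

lemma aff_basis: assumes "opn W" "W <= U" "x:W" shows "EX g:AA U. g ~: Mst x & {y:U. g ~: Mst y} <= W"
proof -
 obtain f fy where ch: "chart U f fy" using affine_chart aff by auto
 note W = chart_img_opn[OF ch assms(1,2)]
 obtain a where a: "a:car U" "a ~: f x" "{Q. primeideal Q (Sec U) & a ~: Q} <= f ` W" using domain.spec_open_basis[OF psi_dom[OF ch] W(1), of "f x"] assms by auto
 have "psi U fy a ~: Mst x" using psi_unit[OF ch _ a(1)] a assms by auto
 moreover have "{y:U. psi U fy a ~: Mst y} <= W"
 proof
 fix y assume "y:{y:U. psi U fy a ~: Mst y}"
 hence y: "y:U" "a ~: f y" using psi_unit[OF ch _ a(1)] by auto
 hence "f y:f ` W" using a chart_prime[OF ch] by auto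
 hence "y:{x:U. f x:f ` W}" using y by simp
 thus "y:W" using W by simp
 qed
 ultimately show ?thesis using psi_AA[OF ch a(1)] by auto
qed

end

text \<open>Elements of the local ring are fractions over \<open>AA U\<close> with denominator
  outside the prime of \<open>x\<close>, and such a fraction is a nonunit exactly when its numerator
  lies in that prime. So the ideal laws follow from those in \<open>AA U\<close> by common
  denominators.\<close>

lemma Mst_idl: assumes x: "x:topX" shows "prm (Mst x) (Ost x)"
proof -
 obtain U where U: "affine_open X U" "x:U" using aff_cover[OF x] by auto
 have ne: "U ~= {}" using U by auto
 note P = aff_prime[OF U(1) ne U(2)] and O = Ost_subr[OF x]
 have zm: "0:Mst x" using subrD[OF O] by (simp add: Mst_def)
 have AO: "AA U <= Ost x" by (rule Ost_AA[OF affine_opn[OF U(1)] U(2)])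
 have frac: "a / g:Mst x <-> a:Mst x" if "a:AA U" "g:AA U" "g ~: Mst x" for a g
 proof -
 have g0: "g ~= 0" "inverse g:Ost x" using that AO unfolding Mst_def by auto
 have "inverse a:Ost x <-> inverse (a / g):Ost x"
 proof -
  have "inverse (a / g) = g * inverse a" "inverse a = inverse g * inverse (a / g)" using g0 by (auto simp: field_simps)
  thus ?thesis using subrD[OF O] that AO g0 by (metis subsetD)
 qed
 moreover have "a / g:Ost x" using subrD(4)[OF O, of a "inverse g"] that AO g0 by (auto simp: divide_inverse)
 ultimately show ?thesis using that AO unfolding Mst_def by auto
 qed
 have rep: "EX a:AA U. EX g:AA U. g ~: Mst x & g ~= 0 & b = a / g" if "b:Ost x" for b using iffD1[OF aff_Ost[OF U(1) ne U(2)] that] .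
 have MO: "Mst x <= Ost x" unfolding Mst_def by auto
 note A = AA_subr[OF affine_opn[OF U(1)] ne]
 have gh: "g * k ~: Mst x" if "g:AA U" "g ~: Mst x" "k:AA U" "k ~: Mst x" for g k using prmD(3)[OF P, of g k] that subrD[OF A] by auto
 show ?thesis unfolding prm_def idl_def
 proof (intro conjI ballI impI)
 show "1 ~: Mst x" unfolding Mst_def by auto
 show "a + b:Mst x" if ab: "a:Mst x" "b:Mst x" for a b
 proof -
  obtain a' g b' k where e: "a':AA U" "g:AA U" "g ~: Mst x" "g ~= 0" "a = a' / g" "b':AA U" "k:AA U" "k ~: Mst x" "k ~= 0" "b = b' / k" using rep ab MO by (meson subsetD)
  have "a':Mst x" "b':Mst x" using frac e ab by auto
  hence "k * a' + g * b':MU U x" using e by (intro idlD(3)[OF prmD(1)[OF P]] idlD(4)[OF prmD(1)[OF P]]) auto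
  hence "(k * a' + g * b') / (g * k):Mst x" using frac gh e subrD[OF A] by auto
  thus ?thesis using e by (simp add: add_frac_eq mult.commute)
 qed
 have key: "a * b:Mst x <-> a:Mst x | b:Mst x" if ab: "a:Ost x" "b:Ost x" for a b
 proof -
  obtain a' g b' k where e: "a':AA U" "g:AA U" "g ~: Mst x" "g ~= 0" "a = a' / g" "b':AA U" "k:AA U" "k ~: Mst x" "k ~= 0" "b = b' / k" using rep ab by meson
  have "a * b = (a' * b') / (g * k)" using e by simp
  hence "a * b:Mst x <-> a' * b':Mst x" using frac gh e subrD[OF A] by auto
  also have "... <-> a':Mst x | b':Mst x"
  using prmD(3)[OF P, of a' b'] idlD(4)[OF prmD(1)[OF P], of a' b'] idlD(5)[OF prmD(1)[OF P], of a' b'] e subrD(4)[OF A, of a' b'] by auto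
  finally show ?thesis using frac e by auto
 qed
 show "a * b:Mst x" if "a:Ost x" "b:Mst x" for a b using key that MO by auto
 show "a:Mst x | b:Mst x" if "a:Ost x" "b:Ost x" "a * b:Mst x" for a b using key that by auto
 qed (use zm MO in auto)
qed

end

hide_const (open) Module.smult up_ring.coeff up_ring.monom

section \<open>Real polynomials, and a Nullstellensatz by counting\<close>

definition pev :: "real poly => 'k::real_field => 'k" where "pev p x = poly (map_poly of_real p) x"
lemma pev_0 [simp]: "pev 0 x = 0" by (simp add: pev_def)
lemma pev_pCons [simp]: "pev (pCons a p) x = of_real a + x * pev p x" by (simp add: pev_def map_poly_pCons)
lemma pev_1 [simp]: "pev 1 x = 1" by (simp add: one_pCons)
lemma pev_add: "pev (p + q) x = pev p x + pev q x" by (induction p q rule: poly_induct2) (simp_all add: als)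
lemma pev_smult: "pev (smult c p) x = of_real c * pev p x" by (induction p) (simp_all add: als)
lemma pev_mult: "pev (p * q) x = pev p x * pev q x" by (induction p) (simp_all add: als pev_add pev_smult)
lemma pev_uminus: "pev (- p) x = - pev p x" using pev_smult[of "-1" p x] by simp
lemma pev_sum: "pev (sum f S) x = (SUM i:S. pev (f i) x)" by (induction S rule: ifi) (simp_all add: pev_add)
lemma pev_prod: "pev (prod f S) x = (PROD i:S. pev (f i) x)" by (induction S rule: ifi) (simp_all add: pev_mult)
lemma pev_power: "pev (p ^ n) x = pev p x ^ n" by (induction n) (simp_all add: pev_mult)
lemma pev_real: "pev p (of_real c) = of_real (poly p c)" by (induction p) simp_all
definition ralg :: "'k::real_field set => bool" where "ralg A <-> subr A & (ALL r. of_real r:A)"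
lemma ralgD: "ralg A ==> subr A" "ralg A ==> of_real r:A" by (auto simp: ralg_def)
lemma pev_mem: "ralg A ==> x:A ==> pev p x:A" by (induction p) (auto intro: subrD ralgD)
definition ev2 :: "real poly poly => 'k::real_field => 'k => 'k" where "ev2 G x y = poly (map_poly (%q. pev q x) G) y"
lemma ev2_0 [simp]: "ev2 0 x y = 0" by (simp add: ev2_def)
lemma ev2_pCons [simp]: "ev2 (pCons a p) x y = pev a x + y * ev2 p x y" by (simp add: ev2_def map_poly_pCons)
lemma ev2_add: "ev2 (p + q) x y = ev2 p x y + ev2 q x y" by (induction p q rule: poly_induct2) (simp_all add: als pev_add)
lemma ev2_smult: "ev2 (smult c p) x y = pev c x * ev2 p x y" by (induction p) (simp_all add: als pev_mult)
lemma ev2_mult: "ev2 (p * q) x y = ev2 p x y * ev2 q x y" by (induction p) (simp_all add: als ev2_add ev2_smult)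
lemma ev2_1 [simp]: "ev2 1 x y = 1" by (simp add: one_pCons)
lemma ev2_sum: "ev2 (sum f S) x y = (SUM i:S. ev2 (f i) x y)" by (induction S rule: ifi) (simp_all add: ev2_add)
lemma ev2_prod: "ev2 (prod f S) x y = (PROD i:S. ev2 (f i) x y)" by (induction S rule: ifi) (simp_all add: ev2_mult)
definition algdep :: "'k::real_field => 'k => bool" where "algdep x y <-> (EX G. G ~= 0 & ev2 G x y = 0)"

lemma family_dependent:
 fixes a :: "'i => 'v::real_vector" assumes "finite B" "finite S" "card B < card S" "!!i. i:S ==> a i:span B"
 obtains l where "EX i:S. l i ~= (0::real)" "(SUM i:S. l i *\<^sub>R a i) = 0"
proof (cases "inj_on a S")
 case False
 then obtain i j where ij: "i:S" "j:S" "i ~= j" "a i = a j" by (auto simp: inj_on_def)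
 define l where "l k = (if k = i then 1 else if k = j then - 1 else 0::real)" for k
 have "(SUM k:S. l k *\<^sub>R a k) = (SUM k:{i, j}. l k *\<^sub>R a k)" using ij assms by (intro sum.mono_neutral_right) (auto simp: l_def)
 also have "... = 0" using ij by (simp add: l_def)
 finally have "(SUM k:S. l k *\<^sub>R a k) = 0" .
 moreover have "EX k:S. l k ~= 0" using ij by (intro bexI[of _ i]) (auto simp: l_def)
 ultimately show ?thesis using that by simp
next
 case True
 have "dependent (a ` S)"
 proof (rule ccontr)
 assume i: "~ dependent (a ` S)"
 have "card (a ` S) <= card B" using independent_span_bound[OF assms(1) i] assms by auto
 thus False using assms card_image[OF True] by simp
 qed
 then obtain u where u: "EX v:a ` S. u v ~= 0" "(SUM v:a ` S. u v *\<^sub>R v) = 0" using dependent_finite[of "a ` S"] assms by auto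
 show ?thesis using that u by (auto simp: sum.reindex[OF True])
qed

text \<open>The real line is not a countable union of finite sets.\<close>

lemma uncountable_level: assumes "!!c::real. EX N. Q c (N::nat)" obtains N where "infinite {c. Q c N}"
proof -
 have "~ (ALL N. finite {c. Q c N})"
 proof
 assume "ALL N. finite {c. Q c N}"
 hence "countable (\<Union>N. {c. Q c N})" by (intro countable_UN countableI_type countable_finite) auto
 moreover have "(\<Union>N. {c. Q c N}) = UNIV" using assms by auto
 ultimately show False using uncountable_UNIV_real by simp
 qed
 thus ?thesis using that by auto
qed

text \<open>The form in which countable dimension is used: a countable family of finite-dimensional
  levels that covers \<open>A\<close>.\<close>

definition filt :: "(nat => 'k::real_field set) => 'k set => bool" where "filt B A <-> (ALL N. finite (B N)) & A <= (\<Union>N. span (B N))"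

text \<open>Some level of the filtration contains \<open>a c\<close> for infinitely many
  \<open>c\<close>, hence for more of them than its dimension.\<close>

lemma counting:
 fixes a :: "real => 'k::real_field" assumes "filt B A" "!!c. a c:A"
 obtains S l where "finite S" "EX c:S. l c ~= 0" "(SUM c:S. of_real (l c) * a c) = 0"
proof -
 have "EX N. a c:span (B N)" for c using assms unfolding filt_def by fast
 then obtain N where N: "infinite {c. a c:span (B N)}" by (rule uncountable_level)
 then obtain S where S: "finite S" "S <= {c. a c:span (B N)}" "card S = Suc (card (B N))" using infinite_arbitrarily_large by metis
 obtain l where "EX i:S. l i ~= 0" "(SUM i:S. l i *\<^sub>R a i) = 0" using family_dependent[of "B N" S a] assms(1) S unfolding filt_def by auto
 thus ?thesis using that S by (simp add: scr)
qed

text \<open>Evaluation at \<open>c\<close> kills every summand but the one whose product omits the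
  factor of \<open>c\<close>.\<close>

lemma lagrange_ne:
 fixes c :: real assumes "finite S" "c:S" shows "(SUM c:S. smult (l c) (PROD c':S-{c}. [:- c', 1:])) = 0 ==> l c = 0"
proof -
 assume e: "(SUM c:S. smult (l c) (PROD c':S-{c}. [:- c', 1:])) = (0 :: real poly)"
 have "0 = poly (SUM c:S. smult (l c) (PROD c':S-{c}. [:- c', 1:])) c" unfolding e by simp
 also have "... = (SUM d:S. l d * (PROD c':S-{d}. c - c'))" by (simp add: poly_sum poly_prod)
 also have "... = (SUM d:{c}. l d * (PROD c':S-{d}. c - c'))" using assms by (intro sum.mono_neutral_right) auto
 finally have "l c * (PROD c':S-{c}. c - c') = 0" by simp
 moreover have "(PROD c':S-{c}. c - c') ~= 0" using assms by auto
 ultimately show "l c = 0" by simp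
qed

text \<open>The inverses modulo \<open>P\<close> of the elements \<open>x - c\<close>, one for each
  real \<open>c\<close>, are linearly dependent by counting. Multiplying a relation by all the
  \<open>x - c\<close> that occur in it leaves a nonzero polynomial in \<open>x\<close>.\<close>

lemma nullstellensatz:
 fixes A :: "'k::real_field set" assumes A: "ralg A" and F: "filt B A" and P: "idl P A" and x: "x:A" and inv: "!!c. EX a:A. a * (x - of_real c) - 1:P"
 shows "EX q. q ~= 0 & pev q x:P"
proof -
 obtain a where a: "!!c. a c:A" "!!c. a c * (x - of_real c) - 1:P" using inv by metis
 obtain S l where S: "finite S" "EX c:S. l c ~= 0" "(SUM c:S. of_real (l c) * a c) = 0" by (rule counting[OF F a(1)])
 define q where "q = (SUM c:S. smult (l c) (PROD c':S-{c}. [:- c', 1:]))"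
 have "q ~= 0" using lagrange_ne S unfolding q_def by auto
 have 1: "pev q x = (SUM c:S. of_real (l c) * (PROD c':S-{c}. x - of_real c'))" unfolding q_def by (simp add: pev_sum pev_smult pev_prod)
 have 2: "(SUM c:S. of_real (l c) * a c) * (PROD c':S. x - of_real c') = (SUM c:S. of_real (l c) * (PROD c':S-{c}. x - of_real c') * (a c * (x - of_real c)))"
 unfolding sdr using S by (intro sum.cong refl) (simp add: prod.remove)
 have 3: "(SUM c:S. f c * (u c - 1)) = (SUM c:S. f c * u c) - sum f S" for f u :: "real => 'k" by (simp add: right_diff_distrib sum_subtractf)
 have "- pev q x = (SUM c:S. of_real (l c) * (PROD c':S-{c}. x - of_real c') * (a c * (x - of_real c) - 1))" unfolding 3 2[symmetric] S 1 by simp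
 also have "...:P" using a x by (intro idl_sum[OF P] idlD(4)[OF P]) (auto intro!: subrD subr_prod ralgD[OF A])
 finally have "pev q x:P" using idl_minus[OF ralgD(1)[OF A] P] by force
 thus ?thesis using `q ~= 0` by auto
qed

lemma idl_add_principal: assumes A: "subr A" and I: "idl I A" and z: "z:A"
 shows "idl {p + c * z |p c. p:I & c:A} A" "I <= {p + c * z |p c. p:I & c:A}" "z:{p + c * z |p c. p:I & c:A}"
proof -
 let ?J = "{p + c * z |p c. p:I & c:A}"
 have "!!p. p:I ==> p + 0 * z:?J" using subrD[OF A] by fast
 thus "I <= ?J" by auto
 have "0 + 1 * z:?J" using subrD[OF A] idlD[OF I] by fast
 thus "z:?J" by simp
 show "idl ?J A" unfolding idl_def
 proof (intro conjI ballI)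
 show "?J <= A" using idlD[OF I] subrD[OF A] z by auto
 show "0:?J" using `I <= ?J` idlD[OF I] by fast
 fix a b assume "b:?J" then obtain p c where b: "b = p + c * z" "p:I" "c:A" by auto
 { assume "a:?J" then obtain p' c' where a: "a = p' + c' * z" "p':I" "c':A" by auto
  have "a + b = (p' + p) + (c' + c) * z" using a b by (simp add: als)
  thus "a + b:?J" using a b idlD(3)[OF I] subrD[OF A] by blast }
 { assume "a:A"
  have "a * b = a * p + (a * c) * z" using b by (simp add: als)
  thus "a * b:?J" using `a:A` b idlD[OF I] subrD(4)[OF A] by fast }
 qed
qed

lemma max_exists: assumes A: "subr A" and I: "idl I A" "1 ~: I"
 obtains P where "prm P A" "I <= P" "!!J. idl J A ==> P <= J ==> 1 ~: J ==> J = P"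
proof -
 have S: "{1} <= A" "1:{1::'a}" "!!a b. a:{1::'a} ==> b:{1} ==> a * b:{1}" "I Int {1} = {}" using subrD[OF A] I by auto
 obtain P where "prm P A" "I <= P" "P Int {1} = {}" "!!J. idl J A ==> P <= J ==> J Int {1} = {} ==> J = P" using prime_avoid[OF A I(1) S] by auto
 thus ?thesis using that by auto
qed

text \<open>Two algebraically independent elements force dimension at least two: \<open>p\<close> is
  a prime that contains some \<open>y - c\<close> but no nonzero polynomial in \<open>x\<close>, and
  \<open>m\<close> contains in addition some \<open>x - d\<close>. In dimension one this yields
  algebraic dependence.\<close>

lemma two_step_chain:
 fixes A :: "'k::real_field set" assumes A: "ralg A" and F: "filt B A" and xy: "x:A" "y:A" "~ algdep x y"
 obtains p m where "prm p A" "prm m A" "p ~= {0}" "p \<subset> m"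
proof -
 note SA = ralgD(1)[OF A]
 have dep: "G = 0" if "ev2 G x y = 0" for G using xy that unfolding algdep_def by auto
 define S where "S = {pev q x |q. q ~= 0}"
 have S: "S <= A" "1:S" "!!a b. a:S ==> b:S ==> a * b:S"
 proof -
 show "S <= A" unfolding S_def using pev_mem[OF A xy(1)] by auto
 show "1:S" unfolding S_def by (auto intro!: exI[of _ 1])
 show "a * b:S" if ab: "a:S" "b:S" for a b
 proof -
  obtain q q' where "a = pev q x" "b = pev q' x" "q ~= 0" "q' ~= 0" using ab unfolding S_def by auto
  thus ?thesis unfolding S_def by (auto intro!: exI[of _ "q * q'"] simp: pev_mult)
 qed
 qed
 \<comment> \<open>If every \<open>y - c\<close> divided a nonzero polynomial in \<open>x\<close>,
   the quotients would be dependent by counting, and clearing denominators would give an algebraic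
   relation between \<open>x\<close> and \<open>y\<close>.\<close>
 have "EX c. ALL a:A. a * (y - of_real c) ~: S"
 proof (rule ccontr)
 assume "~ ?thesis"
 hence "ALL c. EX a q. a:A & q ~= 0 & a * (y - of_real c) = pev q x" unfolding S_def by fast
 then obtain a q where a: "!!c. a c:A" "!!c. q c ~= 0" "!!c. a c * (y - of_real c) = pev (q c) x" by metis
 obtain T l where T: "finite T" "EX c:T. l c ~= 0" "(SUM c:T. of_real (l c) * a c) = 0" by (rule counting[OF F a(1)])
 define G where "G = (SUM c:T. smult (smult (l c) (q c)) (PROD c':T-{c}. [:[:- c':], 1:]))"
 have "ev2 G x y = (SUM c:T. of_real (l c) * pev (q c) x * (PROD c':T-{c}. y - of_real c'))" unfolding G_def by (simp add: ev2_sum ev2_smult pev_smult ev2_prod)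
 also have "... = (SUM c:T. of_real (l c) * a c) * (PROD c':T. y - of_real c')" unfolding sdr a(3)[symmetric] using T by (intro sum.cong refl) (simp add: prod.remove)
 finally have G0: "G = 0" using T dep by simp
 obtain c where c: "c:T" "l c ~= 0" using T by auto
 have "0 = poly G [:c:]" unfolding G0 by simp
 also have "... = (SUM d:T. smult (l d) (q d) * (PROD c':T-{d}. [:c - c':]))" unfolding G_def by (simp add: poly_sum poly_prod)
 also have "... = (SUM d:{c}. smult (l d) (q d) * (PROD c':T-{d}. [:c - c':]))" using T c by (intro sum.mono_neutral_right) auto
 finally have "smult (l c) (q c) * (PROD c':T-{c}. [:c - c':]) = 0" by simp
 moreover have "(PROD c':T-{c}. [:c - c':]) ~= 0" using T by auto
 ultimately show False using c a by auto
 qed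
 then obtain c where c: "!!a. a:A ==> a * (y - of_real c) ~: S" by auto
 have yc: "y - of_real c:A" using xy A by (auto intro: subrD ralgD)
 define I where "I = {p + a * (y - of_real c) |p a. p:{0} & a:A}"
 have "idl {0} A" using subrD[OF SA] unfolding idl_def by auto
 note I = idl_add_principal[OF SA this yc, folded I_def]
 have "I Int S = {}" using c unfolding I_def by auto
 then obtain p where p: "prm p A" "I <= p" "p Int S = {}" using prime_avoid[OF SA I(1) S] by metis
 have "y - of_real c ~= 0" using dep[of "[:[:-c:], 1:]"] by auto
 hence pn: "p ~= {0}" using p I by auto
 \<comment> \<open>Otherwise the Nullstellensatz would put a nonzero polynomial in \<open>x\<close>
   into \<open>p\<close>.\<close>
 have "EX d. ALL a:A. a * (x - of_real d) - 1 ~: p"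
 proof (rule ccontr)
 assume "~ ?thesis"
 hence "EX q. q ~= 0 & pev q x:p" by (intro nullstellensatz[OF A F prmD(1)[OF p(1)] xy(1)]) auto
 then obtain q where "q ~= 0" "pev q x:p" by auto
 thus False using p unfolding S_def by auto
 qed
 then obtain d where d: "!!a. a:A ==> a * (x - of_real d) - 1 ~: p" by auto
 have xd: "x - of_real d:A" using xy A by (auto intro: subrD ralgD)
 define J where "J = {q + a * (x - of_real d) |q a. q:p & a:A}"
 note J = idl_add_principal[OF SA prmD(1)[OF p(1)] xd, folded J_def]
 have "1 ~: J"
 proof
 assume "1:J"
 then obtain q a where "1 = q + a * (x - of_real d)" "q:p" "a:A" unfolding J_def by auto
 hence "a * (x - of_real d) - 1 = - q" by (simp add: als)
 thus False using d[OF `a:A`] idl_minus[OF SA prmD(1)[OF p(1)] `q:p`] by simp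
 qed
 then obtain m where m: "prm m A" "J <= m" using max_exists[OF SA J(1)] by metis
 have "x - of_real d ~: p"
 proof
 assume "x - of_real d:p"
 moreover have "x - of_real d:S" unfolding S_def by (auto intro!: exI[of _ "[:- d, 1:]"])
 ultimately show False using p by auto
 qed
 hence "p \<subset> m" using J m by auto
 thus ?thesis using that p m pn by simp
qed

text \<open>A complex root of \<open>q\<close> splits off a real factor of degree one or two. As
  \<open>P\<close> is prime, this factor or the cofactor, which has smaller degree, takes a value in
  \<open>P\<close>. A quadratic factor with nonreal roots is a sum of two squares.\<close>

lemma residue_quadratic:
 fixes A :: "'k::real_field set" assumes A: "ralg A" and P: "prm P A" and a: "a:A" and q: "q ~= 0" "pev q a:P"
 shows "(EX r. a - of_real r:P) | (EX u w. w ~= 0 & (a - of_real u)^2 + of_real (w^2):P)" using q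
proof (induction "degree q" arbitrary: q rule: less_induct)
 case less
 note SA = ralgD(1)[OF A]
 show ?case
 proof (cases "degree q = 0")
 case True
 then obtain c where c: "q = [:c:]" by (metis degree_eq_zeroE)
 hence "of_real c:P" "c ~= 0" using less by auto
 hence "of_real (inverse c) * of_real c:P" using idlD(4)[OF prmD(1)[OF P] ralgD(2)[OF A]] by fast
 hence "1:P" using `c ~= 0` by simp
 thus ?thesis using prmD[OF P] by simp
 next
 case False
 let ?Q = "map_poly complex_of_real q"
 have "degree ?Q = degree q" by (rule degree_map_poly) auto
 hence "~ Fundamental_Theorem_Algebra.constant (poly ?Q)" using False constant_degree[of ?Q] by simp
 then obtain z where z: "poly ?Q z = 0" using fundamental_theorem_of_algebra by auto
 hence z': "pev q z = 0" unfolding pev_def .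
 have step: ?thesis if g: "q = g * q'" "degree g > 0" "pev g a:P ==> ?thesis" for g q'
 proof -
  have ne: "q' ~= 0" "g ~= 0" using g less by auto
  have "pev g a * pev q' a:P" using less g by (simp add: pev_mult)
  hence "pev g a:P | pev q' a:P" using prmD[OF P] pev_mem[OF A a] by simp
  moreover have "degree q' < degree q" using g ne by (simp add: degree_mult_eq)
  ultimately show ?thesis using less g by auto
 qed
 show ?thesis
 proof (cases "Im z = 0")
  case True
  hence "z = of_real (Re z)" by (simp add: complex_eq_iff)
  hence "complex_of_real (poly q (Re z)) = 0" using z' pev_real by metis
  hence "poly q (Re z) = 0" by simp
  then obtain q' where "q = [:- Re z, 1:] * q'" by (metis dvdE poly_eq_0_iff_dvd)
  thus ?thesis by (rule step) auto
 next
  case False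
  define g where "g = [:(Re z)^2 + (Im z)^2, - 2 * Re z, 1:]"
  have gz: "pev g z = 0" unfolding g_def by (simp add: complex_eq_iff p2)
  have gne: "g ~= 0" "degree g = 2" unfolding g_def by auto
  define r where "r = q mod g"
  have r: "q = g * (q div g) + r" unfolding r_def by simp
  have "pev r z = 0" using z' gz arg_cong[OF r, of "%p. pev p z"] by (simp add: pev_add pev_mult)
  have "degree r < 2 | r = 0" using degree_mod_less[OF gne(1), of q] gne unfolding r_def by auto
  hence "r = [:coeff r 0, coeff r 1:]" by (auto simp: poly_eq_iff coeff_pCons coeff_eq_0 split: nat.splits)
  hence "of_real (coeff r 0) + z * of_real (coeff r 1) = 0" using `pev r z = 0` by (metis add_0_right mult_zero_right pev_0 pev_pCons)
  hence "coeff r 1 = 0" "coeff r 0 = 0" using False by (auto simp: complex_eq_iff)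
  hence "r = 0" using `r = [:coeff r 0, coeff r 1:]` by simp
  hence "q = g * (q div g)" using r by simp
  thus ?thesis
  proof (rule step)
  assume "pev g a:P"
  moreover have "pev g a = (a - of_real (Re z))^2 + of_real ((Im z)^2)" unfolding g_def by (simp add: p2 als)
  ultimately show ?thesis using False by auto
  qed (simp add: gne)
 qed
 qed
qed

section \<open>Multivariate polynomials and their evaluation\<close>

locale mp_emb = R?: cring R for R :: "('a, 'r) ring_scheme" (structure) +
 fixes ka :: "'a => 'b::comm_ring_1" assumes k_mult: "a:carrier R ==> b:carrier R ==> ka (a \<otimes> b) = ka a * ka b"
 and k_add: "a:carrier R ==> b:carrier R ==> ka (a \<oplus> b) = ka a + ka b" and k_one: "ka \<one> = 1"
 and k_inj: "a:carrier R ==> b:carrier R ==> ka a = ka b ==> a = b"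
begin
abbreviation "MP == mpoly_ring R"

lemma k_zero: "ka \<zero> = 0"
proof -
 have "ka \<zero> + ka \<zero> = ka \<zero> + 0" using k_add[of \<zero> \<zero>] by simp
 thus ?thesis by simp
qed

lemma k_neg: "a:carrier R ==> ka (\<ominus> a) = - ka a" using k_add[of a "\<ominus> a"] by (simp add: r_neg k_zero eq_neg_iff_add_eq_0 add.commute)
lemma k_eq0: "a:carrier R ==> ka a = 0 <-> a = \<zero>" using k_inj k_zero by auto

lemma k_finsum: "finite S ==> (!!i. i:S ==> f i:carrier R) ==> ka (finsum R f S) = (SUM i:S. ka (f i))"
proof (induction S rule: finite_induct)
 case (insert x F)
 hence "finsum R f (insert x F) = f x \<oplus> finsum R f F" by simp
 thus ?case using insert by (auto simp: k_add)
qed (simp add: k_zero)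

lemma k_finprod: "finite S ==> (!!i. i:S ==> f i:carrier R) ==> ka (finprod R f S) = (PROD i:S. ka (f i))"
proof (induction S rule: finite_induct)
 case (insert x F)
 hence "finprod R f (insert x F) = f x \<otimes> finprod R f F" by simp
 thus ?case using insert by (auto simp: k_mult)
qed (simp add: k_one)

lemma k_pow: "a:carrier R ==> ka (a [^] (n::nat)) = ka a ^ n" by (induction n) (simp_all add: k_one k_mult)
definition E :: "(nat multiset => 'a) => nat multiset \<Rightarrow>\<^sub>0 'b" where "E p = Abs_poly_mapping (%m. ka (p m))"

lemma mp_car: "p:carrier (MP n) <-> (ALL m. p m:carrier R) & finite {m. p m ~= \<zero>} &
     (ALL m. p m ~= \<zero> --> set_mset m <= {..<n})" by (simp add: mpoly_ring_def)

lemma lookup_E: "p:carrier (MP n) ==> lk (E p) m = ka (p m)"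
proof -
 assume p: "p:carrier (MP n)"
 have "{m. ka (p m) ~= 0} = {m. p m ~= \<zero>}" using p k_eq0 unfolding mp_car by auto
 thus ?thesis unfolding E_def using p by (subst lookup_Abs_poly_mapping) (auto simp: mp_car)
qed

lemma keys_E: "p:carrier (MP n) ==> kys (E p) = {m. p m ~= \<zero>}" using k_eq0 by (auto simp: in_keys_iff lookup_E mp_car)
lemma E_inj: "p:carrier (MP n) ==> q:carrier (MP n) ==> E p = E q ==> p = q" using lookup_E k_inj by (metis ext mp_car)

lemma finite_submsets: "finite {a. a <=# (m :: nat multiset)}"
proof (rule finite_subset)
 show "{a. a <=# m} <= mset ` {xs. set xs <= set_mset m & length xs <= size m}"
 proof
 fix a assume "a:{a. a <=# m}"
 moreover obtain xs where "a = mset xs" by (metis ex_mset)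
 ultimately show "a:mset ` {xs. set xs <= set_mset m & length xs <= size m}" using size_mset_mono[of a m] set_mset_mono[of a m] by auto
 qed
qed (simp add: finite_lists_length_le)

lemma mpoly_mult_car: assumes p: "p:carrier (MP n)" and q: "q:carrier (MP n)"
 shows "lk (E p * E q) m = ka ((p \<otimes>$$(MP n) q) m)" "(p \<otimes>$$(MP n) q) m:carrier R"
proof -
 have c: "p a:carrier R" "q a:carrier R" for a using p q by (auto simp: mp_car)
 have e: "(p \<otimes>$$(MP n) q) m = finsum R (%a. p a \<otimes> q (m - a)) {a. a <=# m}" by (simp add: mpoly_ring_def)
 show "(p \<otimes>$$(MP n) q) m:carrier R" unfolding e using c by simp
 have in1: "(SUM r. lk (E q) r when m = l + r) = (if l <=# m then ka (q (m - l)) else 0)" for l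
 proof (cases "l <=# m")
 case True
 hence "(%r. lk (E q) r when m = l + r) = (%r. lk (E q) r when r = m - l)" by (intro ext) (auto simp: when_def)
 hence "(SUM r. lk (E q) r when m = l + r) = (SUM r. lk (E q) r when r = m - l)" by (rule arg_cong)
 also have "... = lk (E q) (m - l)" by simp
 finally show ?thesis using True lookup_E[OF q] by simp
 next
 case False
 hence "(%r. lk (E q) r when m = l + r) = (%r. 0)" by (intro ext) (auto simp: when_def)
 hence "(SUM r. lk (E q) r when m = l + r) = (SUM r::nat multiset. 0)" by (rule arg_cong)
 thus ?thesis using False by simp
 qed
 have "lk (E p * E q) m = (SUM l. ka (p l) * (if l <=# m then ka (q (m - l)) else 0))" unfolding lookup_mult in1 lookup_E[OF p] ..
 also have "... = (SUM l:{a. a <=# m}. ka (p l) * (if l <=# m then ka (q (m - l)) else 0))" by (rule Sum_any.expand_superset[OF finite_submsets]) auto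
 also have "... = (SUM l:{a. a <=# m}. ka (p l \<otimes> q (m - l)))" using c by (intro sum.cong refl) (simp add: k_mult)
 also have "... = ka ((p \<otimes>$$(MP n) q) m)" unfolding e using c finite_submsets by (intro k_finsum[symmetric]) auto
 finally show "lk (E p * E q) m = ka ((p \<otimes>$$(MP n) q) m)" .
qed

lemma mpoly_closed: assumes p: "p:carrier (MP n)" and q: "q:carrier (MP n)"
 shows "p \<otimes>$$(MP n) q:carrier (MP n)" "p \<oplus>$$(MP n) q:carrier (MP n)" "(%m. \<ominus> p m):carrier (MP n)"
proof -
 have nz: "(p \<otimes>$$(MP n) q) m ~= \<zero> <-> m:kys (E p * E q)" for m using mpoly_mult_car[OF p q, of m] k_eq0 by (auto simp: in_keys_iff)
 hence "{m. (p \<otimes>$$(MP n) q) m ~= \<zero>} = kys (E p * E q)" by auto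
 hence f: "finite {m. (p \<otimes>$$(MP n) q) m ~= \<zero>}" by simp
 have "set_mset m <= {..<n}" if m: "(p \<otimes>$$(MP n) q) m ~= \<zero>" for m
 proof -
 obtain a b where "m = a + b" "a:kys (E p)" "b:kys (E q)" using keys_mult[of "E p" "E q"] nz m by auto
 thus ?thesis using keys_E[OF p] keys_E[OF q] p q unfolding mp_car by auto
 qed
 thus "p \<otimes>$$(MP n) q:carrier (MP n)" using f mpoly_mult_car[OF p q] unfolding mp_car by auto
 have "{m. (p \<oplus>$$(MP n) q) m ~= \<zero>} <= {m. p m ~= \<zero>} Un {m. q m ~= \<zero>}" by (auto simp: mpoly_ring_def)
 moreover have "finite ({m. p m ~= \<zero>} Un {m. q m ~= \<zero>})" using p q by (auto simp: mp_car)
 ultimately have f2: "finite {m. (p \<oplus>$$(MP n) q) m ~= \<zero>}" by (rule finite_subset)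
 have pl: "(p \<oplus>$$(MP n) q) m = p m \<oplus> q m" for m by (simp add: mpoly_ring_def)
 have "set_mset m <= {..<n}" if m: "p m \<oplus> q m ~= \<zero>" for m
 proof -
 have "p m ~= \<zero> | q m ~= \<zero>" using m by auto
 thus ?thesis using p q unfolding mp_car by auto
 qed
 thus "p \<oplus>$$(MP n) q:carrier (MP n)" using f2 p q unfolding mp_car pl by simp
 have "(\<ominus> p m ~= \<zero>) = (p m ~= \<zero>)" for m using p unfolding mp_car by simp
 thus "(%m. \<ominus> p m):carrier (MP n)" using p unfolding mp_car by simp
qed

lemma mpoly_const_closed: "mpoly_const R a:carrier (MP n)" if "a:carrier R"
proof -
 have "{m. (if m = {#} then a else \<zero>) ~= \<zero>} <= {{#}}" by auto
 hence "finite {m. (if m = {#} then a else \<zero>) ~= \<zero>}" by simp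
 thus ?thesis using that unfolding mp_car mpoly_const_def by auto
qed

lemma mpoly_one: "\<one>$$(MP n) = mpoly_const R \<one>" and mpoly_zero: "\<zero>$$(MP n) = mpoly_const R \<zero>" by (auto simp: mpoly_ring_def mpoly_const_def)

lemma E_const: "a:carrier R ==> E (mpoly_const R a) = sgl 0 (ka a)"
 by (intro poly_mapping_eqI) (simp add: lookup_E[OF mpoly_const_closed[where n=0]] lookup_single when_def, simp add: mpoly_const_def k_zero)

lemma E_hom: assumes p: "p:carrier (MP n)" and q: "q:carrier (MP n)" shows "E (p \<otimes>$$(MP n) q) = E p * E q" "E (p \<oplus>$$(MP n) q) = E p + E q"
 "E (%m. \<ominus> p m) = - E p" "E \<one>$$(MP n) = 1" "E \<zero>$$(MP n) = 0"
proof -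
 show "E (p \<otimes>$$(MP n) q) = E p * E q" by (intro poly_mapping_eqI) (simp add: lookup_E[OF mpoly_closed(1)[OF p q]] mpoly_mult_car[OF p q])
 have pl: "(p \<oplus>$$(MP n) q) m = p m \<oplus> q m" for m by (simp add: mpoly_ring_def)
 show "E (p \<oplus>$$(MP n) q) = E p + E q" using p q by (intro poly_mapping_eqI) (auto simp: lookup_E[OF mpoly_closed(2)[OF p q]] lookup_add lookup_E pl k_add mp_car)
 show "E (%m. \<ominus> p m) = - E p" using p by (intro poly_mapping_eqI) (auto simp: lookup_E k_neg mp_car)
 show "E \<one>$$(MP n) = 1" "E \<zero>$$(MP n) = 0" unfolding mpoly_one mpoly_zero by (simp_all add: E_const k_one k_zero)
qed

text \<open>All ring laws are pulled back along the injective map \<open>E\<close>, whose values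
  belong to a type of class \<open>comm_ring_1\<close>.\<close>

lemma mpoly_cring: "cring (MP n)"
proof -
 let ?M = "MP n"
 have o: "\<one>$$?M:carrier ?M" "\<zero>$$?M:carrier ?M" unfolding mpoly_one mpoly_zero by (auto intro: mpoly_const_closed)
 note cl = mpoly_closed[where n = n]
 note hom = E_hom[where n = n]
 have ab: "abelian_group ?M"
 proof (rule abelian_groupI)
 fix p assume p: "p:carrier ?M"
 show "EX y:carrier ?M. y \<oplus>$$?M p = \<zero>$$?M" using p by (intro bexI[of _ "%m. \<ominus> p m"] E_inj[of _ n]) (simp_all add: cl o hom)
 qed (auto intro!: E_inj[of _ n] simp: cl o hom als)
 have mo: "comm_monoid ?M" by (rule comm_monoidI) (auto intro!: E_inj[of _ n] simp: cl o hom)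
 show ?thesis by (rule cringI[OF ab mo]) (auto intro!: E_inj[of _ n] simp: cl hom als)
qed

end

definition rhom :: "('b::comm_ring_1 => 'k::comm_ring_1) => bool" where "rhom c <-> c 0 = 0 & c 1 = 1 & (ALL a b. c (a + b) = c a + c b & c (a * b) = c a * c b)"

definition mev :: "('b::comm_ring_1 => 'k::comm_ring_1) => (nat => 'k) => (nat multiset \<Rightarrow>\<^sub>0 'b) => 'k" where
 "mev c t p = (SUM m:kys p. c (lk p m) * (PROD i:#m. t i))"

text \<open>The value at \<open>t\<close> of the partial derivative in the variable
  \<open>j\<close>. If \<open>j\<close> does not occur in \<open>m\<close>, the factor
  \<open>count m j\<close> is zero, so the truncated subtraction of \<open>{#j#}\<close> is
  harmless.\<close>

definition dmev :: "nat => ('b::comm_ring_1 => 'k::comm_ring_1) => (nat => 'k) => (nat multiset \<Rightarrow>\<^sub>0 'b) => 'k" where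
 "dmev j c t p = (SUM m:kys p. c (lk p m) * (of_nat (count m j) * (PROD i:#(m - {#j#}). t i)))"

lemma pm_sum_single: "p = (SUM m:kys p. sgl m (lk p m))"
proof (rule poly_mapping_eqI)
 fix k
 have "lk (SUM m:kys p. sgl m (lk p m)) k =
 (SUM m:kys p. if m = k then lk p m else 0)" by (simp add: lookup_sum lookup_single when_def)
 also have "... = lk p k" by (simp add: in_keys_iff)
 finally show "lk p k = lk (SUM m:kys p. sgl m (lk p m)) k" by simp
qed

context
 fixes c :: "'b::comm_ring_1 => 'k::comm_ring_1" assumes c: "rhom c"
begin

lemma c_simps: "c 0 = 0" "c 1 = 1" "c (a + b) = c a + c b" "c (a * b) = c a * c b" using c by (auto simp: rhom_def)

lemma lin_superset: "finite S ==> kys p <= S ==>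
 (SUM m:kys p. c (lk p m) * w m) = (SUM m:S. c (lk p m) * w m)" by (rule sum.mono_neutral_left) (auto simp: in_keys_iff c_simps)

lemma lin_add: "(SUM m:kys (p + q). c (lk (p + q) m) * w m) =
 (SUM m:kys p. c (lk p m) * w m) + (SUM m:kys q. c (lk q m) * w m)"
proof -
 let ?S = "kys p Un kys q"
 have "finite ?S" by simp
 note s = lin_superset[OF this]
 show ?thesis using s[of "p + q" w] s keys_add[of p q] by (simp add: lookup_add c_simps als sum.distrib)
qed

lemma lin_sum: "finite S ==> (SUM m:kys (sum f S). c (lk (sum f S) m) * w m) =
 (SUM i:S. SUM m:kys (f i). c (lk (f i) m) * w m)" by (induction S rule: finite_induct) (simp_all add: lin_add)

lemma lin_single: "(SUM m:kys (sgl k a). c (lk (sgl k a) m) * w m) = c a * w k" by (cases "a = 0") (simp_all add: c_simps)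

lemma lin_mult: "(SUM m:kys (p * q). c (lk (p * q) m) * w m) =
 (SUM a:kys p. SUM b:kys q. c (lk p a) * c (lk q b) * w (a + b))"
proof -
 have "p * q = (SUM a:kys p. sgl a (lk p a)) * (SUM b:kys q. sgl b (lk q b))" using pm_sum_single[of p] pm_sum_single[of q] by simp
 also have "... = (SUM a:kys p. SUM b:kys q. sgl (a + b) (lk p a * lk q b))" by (simp add: sum_product mult_single)
 finally have e: "p * q = ..." .
 show ?thesis unfolding e by (simp only: lin_sum finite_keys lin_single c_simps)
qed

lemma mev_add: "mev c t (p + q) = mev c t p + mev c t q" unfolding mev_def by (rule lin_add)
lemma mev_single: "mev c t (sgl k a) = c a * (PROD i:#k. t i)" unfolding mev_def by (rule lin_single)
lemma mev_zero [simp]: "mev c t 0 = 0" by (simp add: mev_def)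
lemma mev_one: "mev c t 1 = 1" using mev_single[of t 0 1] by (simp add: c_simps)
lemma mev_mult: "mev c t (p * q) = mev c t p * mev c t q" unfolding mev_def lin_mult by (simp add: sum_product als)
lemma dmev_add: "dmev j c t (p + q) = dmev j c t p + dmev j c t q" unfolding dmev_def by (rule lin_add)
lemma dmev_single: "dmev j c t (sgl k a) = c a * (of_nat (count k j) * (PROD i:#(k - {#j#}). t i))" unfolding dmev_def by (rule lin_single)

lemma dmon_add: "of_nat (count (a + b) j) * (PROD i:#(a + b - {#j#}). t i) =
 (of_nat (count a j) * (PROD i:#(a - {#j#}). t i)) * (PROD i:#b. t i) + (PROD i:#a. t i) * (of_nat (count b j) * (PROD i:#(b - {#j#}). t i :: 'k))"
proof -
 have 1: "of_nat (count a j) * (PROD i:#(a + b - {#j#}). t i) = of_nat (count a j) * (PROD i:#(a - {#j#}). t i) * (PROD i:#b. t i)" for a b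
 proof (cases "j:# a")
 case True
 hence "a + b - {#j#} = (a - {#j#}) + b" by simp
 thus ?thesis by simp
 next
 case False thus ?thesis by (simp add: not_in_iff)
 qed
 show ?thesis using 1 1[of b a] by (simp add: als)
qed

lemma dmev_mult: "dmev j c t (p * q) = dmev j c t p * mev c t q + mev c t p * dmev j c t q"
proof -
 have "dmev j c t (p * q) = (SUM a:kys p. SUM b:kys q.
  (c (lk p a) * (of_nat (count a j) * (PROD i:#(a - {#j#}). t i))) * (c (lk q b) * (PROD i:#b. t i)) +
  (c (lk p a) * (PROD i:#a. t i)) * (c (lk q b) * (of_nat (count b j) * (PROD i:#(b - {#j#}). t i))))"
 unfolding dmev_def lin_mult dmon_add by (intro sum.cong refl) (simp add: als)
 also have "... = dmev j c t p * mev c t q + mev c t p * dmev j c t q" unfolding dmev_def mev_def sum_product by (simp add: sum.distrib)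
 finally show ?thesis .
qed

end

lemma rhom_of_real: "rhom (of_real :: real => 'k::real_field)" by (simp add: rhom_def)
lemma rhom_id: "rhom id" by (simp add: rhom_def)

lemma prod_mset_count: "(PROD i:#m. t i) = (PROD i:set_mset m. t i ^ count m i)" for t :: "nat => 'k::comm_monoid_mult"
proof (induction m)
 case (add x m)
 show ?case
 proof (cases "x:# m")
 case True
 hence "(PROD i:set_mset m. t i ^ count (add_mset x m) i) = t x * (PROD i:set_mset m. t i ^ count m i)" by (subst (1 2) prod.remove[of _ x]) (auto simp: mult.assoc)
 thus ?thesis using add True by (simp add: insert_absorb)
 next
 case False
 hence "(PROD i:set_mset m. t i ^ count (add_mset x m) i) = (PROD i:set_mset m. t i ^ count m i)" by (intro prod.cong) auto
 thus ?thesis using add False by (simp add: not_in_iff)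
 qed
qed simp

lemma real_ring_cring: "cring real_ring" by (rule cringI; (rule abelian_groupI comm_monoidI)?) (auto simp: real_ring_def als intro: exI[of _ "- _"])

interpretation RR: mp_emb real_ring "id :: real => real" using real_ring_cring by (simp add: mp_emb_def mp_emb_axioms_def real_ring_def)

lemma RR_zero: "\<zero>$$real_ring = 0" by (simp add: real_ring_def)

lemma pd_closed: "F:carrier (RX n) ==> partial_deriv j F:carrier (RX n)"
proof -
 assume F: "F:carrier (RX n)"
 have "{m. partial_deriv j F m ~= 0} <= (%m. m - {#j#}) ` {m. F m ~= 0}"
 proof
 fix m assume "m:{m. partial_deriv j F m ~= 0}"
 hence "F (add_mset j m) ~= 0" by (simp add: partial_deriv_def)
 thus "m:(%m. m - {#j#}) ` {m. F m ~= 0}" by force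
 qed
 moreover have "finite {m. F m ~= 0}" using F by (simp add: RR.mp_car RR_zero)
 ultimately have "finite {m. partial_deriv j F m ~= 0}" using finite_surj by simp
 moreover have "set_mset m <= {..<n}" if "partial_deriv j F m ~= 0" for m
 proof -
 have "F (add_mset j m) ~= 0" using that by (simp add: partial_deriv_def)
 hence "set_mset (add_mset j m) <= {..<n}" using F unfolding RR.mp_car RR_zero by fast
 thus ?thesis by simp
 qed
 ultimately show ?thesis unfolding RR.mp_car by (simp add: real_ring_def)
qed

lemma mev_pd: "F:carrier (RX n) ==> mev of_real t (RR.E (partial_deriv j F)) = (dmev j of_real t (RR.E F) :: 'k::real_field)"
proof -
 assume F: "F:carrier (RX n)"
 let ?S = "{m. F m ~= 0}"
 have fin: "finite ?S" using F by (simp add: RR.mp_car RR_zero)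
 have "dmev j of_real t (RR.E F) = (SUM m:?S. of_real (F m) * (of_nat (count m j) * (PROD i:#(m - {#j#}). t i)))"
 unfolding dmev_def RR.keys_E[OF F] by (simp add: RR.lookup_E[OF F] RR_zero)
 also have "... = (SUM m:{m:?S. j:# m}. of_real (F m) * (of_nat (count m j) * (PROD i:#(m - {#j#}). t i)))"
 proof (rule sum.mono_neutral_right[OF fin])
 show "ALL m:?S - {m:?S. j:# m}. of_real (F m) * (of_nat (count m j) * (PROD i:#(m - {#j#}). t i)) = 0" by auto
 qed auto
 also have "... = (SUM m:{m. partial_deriv j F m ~= 0}. of_real (partial_deriv j F m) * (PROD i:#m. t i))"
 by (rule sum.reindex_bij_witness[of _ "add_mset j" "%m. m - {#j#}"]) (auto simp: partial_deriv_def)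
 also have "... = mev of_real t (RR.E (partial_deriv j F))" unfolding mev_def RR.keys_E[OF pd_closed[OF F]] by (simp add: RR.lookup_E[OF pd_closed[OF F]] RR_zero)
 finally show ?thesis by simp
qed

text \<open>Carries the evaluation used in the definitions over to \<open>mev\<close>, whose sums
  and products are those of a type class.\<close>

lemma (in mp_emb) eval_link:
 fixes ka' :: "'a => 'b" assumes F: "F:carrier (RX n)" and cc: "!!r. cst r:carrier R" "!!r. ka (cst r) = cr r" and x: "!!i. i < n ==> x i:carrier R"
 shows "ka (real_poly_eval R cst x F) = mev cr (ka o x) (RR.E F)" "real_poly_eval R cst x F:carrier R"
proof -
 let ?S = "{m. F m ~= 0}"
 have fin: "finite ?S" using F by (simp add: RR.mp_car RR_zero)
 have xi: "x i:carrier R" if "m:?S" "i:# m" for m i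
 proof -
 have "set_mset m <= {..<n}" using F that by (simp add: RR.mp_car RR_zero)
 thus ?thesis using x that by auto
 qed
 have pc: "finprod R (%i. x i [^] count m i) (set_mset m):carrier R" if "m:?S" for m using xi[OF that] by simp
 have tc: "cst (F m) \<otimes> finprod R (%i. x i [^] count m i) (set_mset m):carrier R" if "m:?S" for m using pc[OF that] cc by auto
 show "real_poly_eval R cst x F:carrier R" unfolding real_poly_eval_def using tc by simp
 have "ka (real_poly_eval R cst x F) = (SUM m:?S. ka (cst (F m) \<otimes> finprod R (%i. x i [^] count m i) (set_mset m)))"
 unfolding real_poly_eval_def by (rule k_finsum[OF fin tc])
 also have "... = (SUM m:?S. cr (F m) * (PROD i:#m. (ka o x) i))"
 proof (intro sum.cong refl)
 fix m assume m: "m:?S"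
 have "ka (finprod R (%i. x i [^] count m i) (set_mset m)) = (PROD i:set_mset m. ka (x i) ^ count m i)" using xi[OF m] by (subst k_finprod) (auto simp: k_pow)
 thus "ka (cst (F m) \<otimes> finprod R (%i. x i [^] count m i) (set_mset m)) = cr (F m) * (PROD i:#m. (ka o x) i)"
  using pc[OF m] cc by (simp add: k_mult prod_mset_count)
 qed
 also have "... = mev cr (ka o x) (RR.E F)" unfolding mev_def RR.keys_E[OF F] by (simp add: RR.lookup_E[OF F] RR_zero comp_def)
 finally show "ka (real_poly_eval R cst x F) = mev cr (ka o x) (RR.E F)" .
qed

section \<open>Discrete valuation rings in a field\<close>

definition mx :: "'k::field set => 'k set" where "mx Ol = {a:Ol. a = 0 | inverse a ~: Ol}"
definition unf :: "'k::field set => 'k => bool" where "unf Ol t <-> t ~= 0 & mx Ol = {t * a |a. a:Ol}"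
definition dvr :: "'k::field set => bool" where "dvr Ol <-> subr Ol & (EX t. unf Ol t & (ALL f. f ~= 0 --> (EX (n::int) u. u:Ol & u ~: mx Ol & f = u * t powi n)))"
text \<open>Follows the shape of \<open>ord_at\<close>, so that the two can be compared condition by
  condition. For a discrete valuation ring the value at 0 is unspecified.\<close>

definition vl :: "'k::field set => 'k => int" where "vl Ol f = (THE n. EX t u. unf Ol t & u:Ol & u ~: mx Ol & f = u * t powi n)"
lemma unit_mult: "subr Ol ==> u:Ol - mx Ol ==> w:Ol - mx Ol ==> u * w:Ol - mx Ol" using subrD by (auto simp: mx_def)
lemma unit_inv: "u:Ol - mx Ol ==> inverse u:Ol - mx Ol" by (auto simp: mx_def)

context
 fixes Ol :: "'k::field set" assumes O: "subr Ol"
begin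

lemma unf_mem: "unf Ol t ==> t:mx Ol" unfolding unf_def using subrD[OF O] by simp
lemma one_unit: "1:Ol - mx Ol" using subrD[OF O] by (auto simp: mx_def)

text \<open>If a positive power of the uniformizer were a unit, the uniformizer would be one too;
  negative powers are treated through their inverses.\<close>

lemma unf_powi_unit: assumes t: "unf Ol t" and u: "t powi n:Ol - mx Ol" shows "n = 0"
proof -
 have aux: False if "t ^ Suc k:Ol - mx Ol" for k
 proof -
 have tO: "t:Ol" using unf_mem[OF t] by (auto simp: mx_def)
 have "t ^ k * inverse (t ^ Suc k):Ol" using that subrD(4)[OF O subrD(7)[OF O tO]] by (auto simp: mx_def)
 moreover have "t ^ k * inverse (t ^ Suc k) = inverse t" using t by (simp add: unf_def)
 ultimately have "inverse t:Ol" by (simp only:)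
 moreover have "t ~= 0" using t by (simp add: unf_def)
 ultimately show False using unf_mem[OF t] unfolding mx_def by simp
 qed
 show ?thesis
 proof (cases n "0 :: int" rule: linorder_cases)
 case greater
 then obtain k where "n = int (Suc k)" by (metis Suc_pred nat_0_le order_less_imp_le zero_less_nat_eq)
 thus ?thesis using u aux by (simp del: of_nat_Suc)
 next
 case less
 then obtain k where k: "- n = int (Suc k)" by (metis Suc_pred nat_0_le neg_0_less_iff_less order_less_imp_le zero_less_nat_eq)
 have "t powi (- n):Ol - mx Ol" using unit_inv[OF u] by (simp add: power_int_minus)
 thus ?thesis unfolding k using aux[of k] by (simp del: of_nat_Suc)
 qed
qed

lemma unf_unit: assumes "unf Ol t" "unf Ol t'" shows "t' / t:Ol - mx Ol"
proof -
 obtain a where a: "t' = t * a" "a:Ol" using unf_mem[OF assms(2)] assms(1) by (auto simp: unf_def)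
 obtain b where b: "t = t' * b" "b:Ol" using unf_mem[OF assms(1)] assms by (auto simp: unf_def)
 have nz: "t ~= 0" "t' ~= 0" using assms by (auto simp: unf_def)
 have "a = t' / t" using a nz by simp
 moreover have "b = t / t'" by (subst b(1)) (use nz in simp)
 ultimately have "t' / t:Ol" "inverse (t' / t):Ol" using a(2) b(2) by auto
 thus ?thesis using nz unfolding mx_def by simp
qed

lemma unit_powi: "u:Ol - mx Ol ==> u powi n:Ol - mx Ol"
proof -
 have p: "u ^ k:Ol - mx Ol" if "u:Ol - mx Ol" for u k by (induction k) (use one_unit unit_mult[OF O that] in auto)
 show "u:Ol - mx Ol ==> u powi n:Ol - mx Ol" using p p[OF unit_inv, of u "nat (- n)"] by (auto simp: power_int_def)
qed

lemma vl_eqI: assumes t: "unf Ol t" and u: "u:Ol - mx Ol" shows "vl Ol (u * t powi n) = n" unfolding vl_def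
proof (rule the_equality)
 show "EX t' u'. unf Ol t' & u':Ol & u' ~: mx Ol & u * t powi n = u' * t' powi n" using t u by auto
 fix k assume "EX t' u'. unf Ol t' & u':Ol & u' ~: mx Ol & u * t powi n = u' * t' powi k"
 then obtain t' u' where t': "unf Ol t'" "u':Ol - mx Ol" "u * t powi n = u' * t' powi k" by auto
 define w where "w = t' / t"
 have w: "w:Ol - mx Ol" unfolding w_def by (rule unf_unit[OF t t'(1)])
 have nz: "t ~= 0" "u ~= 0" "u' ~= 0" using t t' by (auto simp: unf_def)
 have "t' = w * t" using nz by (simp add: w_def)
 hence "u * t powi n = u' * w powi k * t powi k" using t' by (simp add: power_int_mult_distrib)
 hence "t powi (n - k) = inverse u * (u' * w powi k)" using nz by (simp add: power_int_diff field_simps)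
 moreover have "inverse u * (u' * w powi k):Ol - mx Ol" using unit_mult[OF O] unit_inv[OF u] t' unit_powi[OF w] by simp
 ultimately have "n - k = 0" using unf_powi_unit[OF t, of "n - k"] by simp
 thus "k = n" by simp
qed

end

context
 fixes Ol :: "'k::field set" assumes D: "dvr Ol"
begin

lemma dvr_subr: "subr Ol" using D by (simp add: dvr_def)
lemma dvr_unf: obtains t where "unf Ol t" "!!f. f ~= 0 ==> EX (n::int) u. u:Ol - mx Ol & f = u * t powi n" using D unfolding dvr_def by auto

lemma dvr_rep: assumes t: "unf Ol t" and f: "f ~= 0" shows "f / t powi (vl Ol f):Ol - mx Ol"
proof -
 obtain s where s: "unf Ol s" "!!f. f ~= 0 ==> EX (n::int) u. u:Ol - mx Ol & f = u * s powi n" by (rule dvr_unf) auto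
 obtain n u where nu: "u:Ol - mx Ol" "f = u * s powi n" using s(2)[OF f] by auto
 have v: "vl Ol f = n" unfolding nu by (rule vl_eqI[OF dvr_subr s(1) nu(1)])
 define w where "w = s / t"
 have w: "w:Ol - mx Ol" unfolding w_def by (rule unf_unit[OF dvr_subr t s(1)])
 have "s = w * t" using t by (simp add: w_def unf_def)
 hence "f / t powi n = u * w powi n" using nu t by (simp add: power_int_mult_distrib unf_def)
 thus ?thesis unfolding v using unit_mult[OF dvr_subr nu(1) unit_powi[OF dvr_subr w]] by simp
qed

lemma vl_mult: assumes "f ~= 0" "g ~= 0" shows "vl Ol (f * g) = vl Ol f + vl Ol g"
proof -
 obtain t where t: "unf Ol t" by (rule dvr_unf)
 have nz: "t ~= 0" using t by (simp add: unf_def)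
 have "f * g = (f / t powi (vl Ol f) * (g / t powi (vl Ol g))) * t powi (vl Ol f + vl Ol g)" using nz by (simp add: power_int_add)
 thus ?thesis using vl_eqI[OF dvr_subr t unit_mult[OF dvr_subr dvr_rep[OF t assms(1)] dvr_rep[OF t assms(2)]]] by metis
qed

lemma vl_unit: "u:Ol - mx Ol ==> vl Ol u = 0"
proof -
 obtain t where t: "unf Ol t" by (rule dvr_unf)
 show "u:Ol - mx Ol ==> vl Ol u = 0" using vl_eqI[OF dvr_subr t, of u 0] by simp
qed

lemma vl_unf: "unf Ol t ==> vl Ol t = 1" using vl_eqI[OF dvr_subr _ one_unit[OF dvr_subr], of t 1] by simp

lemma vl_nonneg: assumes f: "f ~= 0" shows "f:Ol <-> 0 <= vl Ol f" "f:mx Ol <-> 0 < vl Ol f"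
proof -
 obtain t where t: "unf Ol t" by (rule dvr_unf)
 have tO: "t:Ol" "t ~= 0" using unf_mem[OF dvr_subr t] t by (auto simp: mx_def unf_def)
 define u where "u = f / t powi (vl Ol f)"
 have u: "u:Ol - mx Ol" unfolding u_def by (rule dvr_rep[OF t f])
 have fu: "f = u * t powi (vl Ol f)" using tO by (simp add: u_def)
 have pos: "g:mx Ol" if "g ~= 0" "0 < vl Ol g" for g
 proof -
 have "g = t * (g / t powi (vl Ol g) * t powi (vl Ol g - 1))" using tO by (simp add: power_int_diff)
 moreover have "g / t powi (vl Ol g) * t powi (vl Ol g - 1):Ol"
 proof -
  have "t powi (vl Ol g - 1) = t ^ nat (vl Ol g - 1)" using that by (simp add: power_int_def)
  thus ?thesis using subrD(4)[OF dvr_subr, of "g / t powi (vl Ol g)" "t ^ nat (vl Ol g - 1)"] dvr_rep[OF t that(1)] subrD(7)[OF dvr_subr tO(1)] by simp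
 qed
 ultimately show ?thesis using t unfolding unf_def by auto
 qed
 have neg: "g ~: Ol" if g: "g ~= 0" "vl Ol g < 0" for g
 proof
 assume "g:Ol"
 have "vl Ol (inverse g) = - vl Ol g" using vl_mult[of g "inverse g"] g vl_unit[OF one_unit[OF dvr_subr]] by simp
 hence "inverse g:mx Ol" using pos g by simp
 thus False using `g:Ol` g by (auto simp: mx_def)
 qed
 have zero: "f:Ol - mx Ol" if "vl Ol f = 0" using u fu that by simp
 have sub: "g:mx Ol ==> g:Ol" for g by (simp add: mx_def)
 consider "vl Ol f < 0" | "vl Ol f = 0" | "0 < vl Ol f" by force
 hence "(f:Ol <-> 0 <= vl Ol f) & (f:mx Ol <-> 0 < vl Ol f)"
 proof cases
 case 1 thus ?thesis using neg[OF f] sub by auto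
 next
 case 2 thus ?thesis using zero by auto
 next
 case 3 thus ?thesis using pos[OF f] sub by auto
 qed
 thus "f:Ol <-> 0 <= vl Ol f" "f:mx Ol <-> 0 < vl Ol f" by auto
qed

lemma vl_add: assumes "f ~= 0" "g ~= 0" "f + g ~= 0" shows "min (vl Ol f) (vl Ol g) <= vl Ol (f + g)"
proof -
 have main: "vl Ol f <= vl Ol (f + g)" if "vl Ol f <= vl Ol g" "f ~= 0" "g ~= 0" "f + g ~= 0" for f g
 proof -
 have i: "vl Ol (inverse f) = - vl Ol f" using vl_mult[of f "inverse f"] that vl_unit[OF one_unit[OF dvr_subr]] by simp
 have "vl Ol (g * inverse f) >= 0" using vl_mult that i by simp
 hence "g * inverse f:Ol" using vl_nonneg that by simp
 hence "1 + g * inverse f:Ol" using subrD[OF dvr_subr] by simp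
 moreover have e: "f + g = f * (1 + g * inverse f)" using that by (simp add: field_simps)
 moreover have "1 + g * inverse f ~= 0" using e that by auto
 ultimately show ?thesis using vl_mult vl_nonneg that by simp
 qed
 show ?thesis using main main[of g f] assms by (simp add: add.commute min_def)
qed

end

section \<open>Nakayama's lemma, and square matrices over a field\<close>

lemma nakayama1: assumes O: "subr Ol" and m: "idl m Ol" and loc: "!!a. a:m ==> 1 - a ~= 0 & inverse (1 - a):Ol"
 and pi: "pj:Ol" and I: "finite I" and y: "!!i. i:I ==> EX p:Ol. EX c. (ALL j:I. c j:m) & y i = p * pj + (SUM j:I. c j * y j)"
 shows "ALL i:I. EX p:Ol. y i = p * pj" using I y
proof (induction I rule: finite_induct)
 case (insert k I)
 obtain p c where pc: "p:Ol" "ALL j:insert k I. c j:m" "y k = p * pj + (SUM j:insert k I. c j * y j)" using insert.prems[of k] by auto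
 define u where "u = inverse (1 - c k)"
 have u: "u:Ol" "u * (1 - c k) = 1" using loc pc by (auto simp: u_def)
 have "(1 - c k) * y k = p * pj + (SUM j:I. c j * y j)" using pc insert.hyps by (simp add: als)
 hence "u * ((1 - c k) * y k) = u * (p * pj + (SUM j:I. c j * y j))" by simp
 hence yk: "y k = (u * p) * pj + (SUM j:I. (u * c j) * y j)" using u by (simp add: mult.assoc[symmetric] distrib_left sdl)
 have "ALL i:I. EX p:Ol. y i = p * pj"
 proof (rule insert.IH)
 fix i assume i: "i:I"
 obtain q d where qd: "q:Ol" "ALL j:insert k I. d j:m" "y i = q * pj + (SUM j:insert k I. d j * y j)" using insert.prems[of i] i by auto
 have "y i = q * pj + d k * y k + (SUM j:I. d j * y j)" using qd insert.hyps by simp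
 also have "... = (q + d k * (u * p)) * pj + (SUM j:I. (d j + d k * (u * c j)) * y j)" by (subst yk) (simp add: als sum.distrib sdl)
 finally have "y i = (q + d k * (u * p)) * pj + (SUM j:I. (d j + d k * (u * c j)) * y j)" .
 moreover have "q + d k * (u * p):Ol" using qd pc u idlD[OF m] by (auto intro!: subrD[OF O])
 moreover have "ALL j:I. d j + d k * (u * c j):m" using qd pc u by (auto intro!: idlD(3)[OF m] idlD(4)[OF m] dest: idlD(1)[OF m])
 ultimately show "EX p:Ol. EX c. (ALL j:I. c j:m) & y i = p * pj + (SUM j:I. c j * y j)" by fast
 qed
 then obtain q where q: "ALL i:I. q i:Ol & y i = q i * pj" by metis
 have "y k = (u * p + (SUM j:I. u * c j * q j)) * pj"
 proof -
 have "(SUM j:I. (u * c j) * y j) = (SUM j:I. u * c j * q j) * pj" unfolding sdr using q by (intro sum.cong refl) (simp add: mult.assoc)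
 thus ?thesis using yk by (simp add: distrib_right)
 qed
 moreover have "u * p + (SUM j:I. u * c j * q j):Ol" using u pc q by (auto intro!: subrD[OF O] subr_sum[OF O] dest: idlD(1)[OF m])
 ultimately show ?case using q by auto
qed simp

text \<open>A row \<open>g\<close> is recovered from its product with \<open>J\<close> by
  multiplying with \<open>N\<close>; in particular the rows of \<open>J\<close> are
  independent.\<close>

lemma right_inverse_apply:
 fixes J N :: "nat => nat => 'k::field" assumes "!!j k. j < c ==> k < c ==> (SUM i<c. J j i * N i k) = (if j = k then 1 else 0)" and "k < c"
 shows "g k = (SUM i<c. (SUM j<c. g j * J j i) * N i k)"
proof -
 have "g k = (SUM j<c. g j * (if j = k then 1 else 0))" using assms(2) by (simp add: if_distrib cong: if_cong)
 also have "... = (SUM j<c. g j * (SUM i<c. J j i * N i k))" using assms by simp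
 finally show ?thesis unfolding sdl sdr by (subst sum.swap) (simp add: mult.assoc)
qed

lemma homogeneous_system:
 fixes M :: "'i => 'j => 'k::field" assumes "finite I" "finite J" "card I < card J" shows "EX x. (EX j:J. x j ~= 0) & (ALL i:I. (SUM j:J. M i j * x j) = 0)" using assms
proof (induction I arbitrary: J M rule: finite_induct)
 case empty
 then obtain j where "j:J" by force
 thus ?case by (intro exI[of _ "%_. 1"]) auto
next
 case (insert i I)
 show ?case
 proof (cases "ALL j:J. M i j = 0")
 case True
 have "card I < card J" using insert by simp
 then obtain x where x: "EX j:J. x j ~= 0" "ALL k:I. (SUM j:J. M k j * x j) = 0" using insert.IH insert.prems by blast
 thus ?thesis using True by auto
 next
 case False
 then obtain p where p: "p:J" "M i p ~= 0" by auto
 define M' where "M' k j = M k j - M k p * M i j / M i p" for k j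
 have "card I < card (J - {p})" using insert p by simp
 then obtain x where x: "EX j:J-{p}. x j ~= 0" "ALL k:I. (SUM j:J-{p}. M' k j * x j) = 0" using insert.IH[of "J - {p}" M'] insert.prems by auto
 define s where "s = - (SUM j:J-{p}. M i j * x j) / M i p"
 define z where "z = x(p := s)"
 have sm: "(SUM j:J. M k j * z j) = M k p * s + (SUM j:J-{p}. M k j * x j)" for k using insert.prems p by (subst sum.remove[of _ p]) (auto simp: z_def)
 have "(SUM j:J. M k j * z j) = 0" if k: "k:insert i I" for k
 proof (cases "k = i")
  case True thus ?thesis unfolding sm s_def using p by simp
 next
  case False
  hence "(SUM j:J-{p}. M' k j * x j) = 0" using x k by auto
  thus ?thesis unfolding sm M'_def s_def by (simp add: sum_subtractf sum_divide_distrib sdl als)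
 qed
 moreover have "EX j:J. z j ~= 0" using x by (auto simp: z_def)
 ultimately show ?thesis by auto
 qed
qed

text \<open>The rows of \<open>J\<close> are independent because of the right inverse, so the unit
  row \<open>k\<close> is a combination of them with coefficients \<open>a\<close>; multiplying by
  \<open>N\<close> identifies \<open>a\<close> with row \<open>k\<close> of
  \<open>N\<close>.\<close>

lemma right_inverse_left:
 fixes J N :: "nat => nat => 'k::field" assumes JN: "!!j k. j < c ==> k < c ==> (SUM i<c. J j i * N i k) = (if j = k then 1 else 0)"
 and "k < c" "i < c" shows "(SUM j<c. N k j * J j i) = (if k = i then 1 else 0)"
proof -
 have inj: "g j = 0" if "!!i. i < c ==> (SUM j<c. g j * J j i) = 0" "j < c" for g j using right_inverse_apply[of c J N j g, OF JN that(2)] that by simp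
 \<comment> \<open>One row more than there are columns: the rows of \<open>J\<close>, and the unit
   row \<open>k\<close> at index \<open>c\<close>.\<close>
 have "EX x. (EX j:{..c}. x j ~= 0) & (ALL i:{..<c}. (SUM j:{..c}. (if j = c then (if i = k then 1 else 0) else J j i) * x j) = 0)" by (rule homogeneous_system) auto
 then obtain x where x: "EX j<=c. x j ~= 0" "!!i. i < c ==> (SUM j<=c. (if j = c then (if i = k then 1 else 0) else J j i) * x j) = 0" by auto
 have x': "(SUM j<c. x j * J j i) + (if i = k then 1 else 0) * x c = 0" if "i < c" for i
 proof -
 have "(SUM j<=c. (if j = c then (if i = k then 1 else 0) else J j i) * x j) = (SUM j<c. x j * J j i) + (if i = k then 1 else 0) * x c"
  unfolding lessThan_Suc_atMost[symmetric] sum.lessThan_Suc by (intro arg_cong2[where f="(+)"] sum.cong) auto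
 thus ?thesis using x(2)[OF that] by simp
 qed
 have xc: "x c ~= 0"
 proof
 assume "x c = 0"
 hence "x j = 0" if "j < c" for j using inj x' that by simp
 thus False using x `x c = 0` by (metis le_neq_implies_less)
 qed
 define a where "a j = - x j / x c" for j
 have a: "(SUM j<c. a j * J j i) = (if i = k then 1 else 0)" if "i < c" for i
 proof -
 have "(SUM j<c. a j * J j i) = - (SUM j<c. x j * J j i) / x c" by (simp add: a_def sum_divide_distrib sum_negf)
 moreover have "(SUM j<c. x j * J j i) = - ((if i = k then 1 else 0) * x c)" using x'[OF that] by (rule eq_neg_iff_add_eq_0[THEN iffD2])
 ultimately show ?thesis using xc by simp
 qed
 have "a l = N k l" if "l < c" for l
 proof -
 have "a l = (SUM i<c. (SUM j<c. a j * J j i) * N i l)" by (rule right_inverse_apply[OF JN that])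
 also have "... = (SUM i<c. (if i = k then 1 else 0) * N i l)" using a by simp
 also have "... = (SUM i<c. if i = k then N i l else 0)" by (intro sum.cong) auto
 also have "... = N k l" using assms by simp
 finally show ?thesis .
 qed
 hence "(SUM j<c. N k j * J j i) = (SUM j<c. a j * J j i)" by simp
 thus ?thesis using a[OF assms(3)] by auto
qed

abbreviation "mp n == carrier (RX n)"
abbreviation "toE == mp_emb.E (id :: real => real)"
abbreviation "rev_at == mev (of_real :: real => 'k::real_field)"

definition alg_gen :: "'k::real_field set => nat => (nat => 'k) => bool" where
 "alg_gen A n t <-> ralg A & (ALL i<n. t i:A) & (ALL a:A. EX F:mp n. a = mev of_real t (toE F))"

text \<open>Of the condition that the \<open>f j\<close> generate all relations only the consequence
  for gradients is kept: at \<open>t\<close> the gradient of every relation is a combination of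
  those of the \<open>f j\<close>. The coefficients \<open>g j\<close> range over the whole
  field.\<close>

definition smooth_pres :: "'k::real_field set => nat => nat => (nat => 'k) => (nat => nat multiset => real) => (nat => nat => 'k) => bool" where
 "smooth_pres A n c t f N <-> alg_gen A n t & c <= n & (ALL j<c. f j:mp n & mev of_real t (toE (f j)) = 0) &
  (ALL F:mp n. mev of_real t (toE F) = 0 --> (EX g. ALL i. dmev i of_real t (toE F) = (SUM j<c. g j * dmev i of_real t (toE (f j))))) &
  (ALL i<c. ALL k<c. N i k:A) &
  (ALL j<c. ALL k<c. (SUM i<c. dmev i of_real t (toE (f j)) * N i k) = (if j = k then 1 else 0))"

definition VS :: "nat => (nat multiset \<Rightarrow>\<^sub>0 real) set" where "VS n = {p. ALL m:kys p. set_mset m <= {..<n}}"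
lemma VS_add: "p:VS n ==> q:VS n ==> p + q:VS n" using keys_add[of p q] unfolding VS_def by auto
lemma VS_mult: "p:VS n ==> q:VS n ==> p * q:VS n" using keys_mult unfolding VS_def by force
lemma VS_single: "set_mset m <= {..<n} ==> sgl m a:VS n" unfolding VS_def by simp
lemma VS_zero: "0:VS n" unfolding VS_def by simp

lemma VS_mp: "p:VS n ==> lk p:mp n" "p:VS n ==> toE (lk p) = p"
proof -
 have "lk p m ~= 0 <-> m:kys p" for m by (simp add: in_keys_iff)
 hence "{m. lk p m ~= 0} = kys p" by auto
 thus "p:VS n ==> lk p:mp n" unfolding RR.mp_car VS_def by (auto simp: real_ring_def)
 show "toE (lk p) = p" by (simp add: RR.E_def)
qed

lemma mp_VS: "F:mp n ==> toE F:VS n" unfolding VS_def using RR.keys_E[of F n] unfolding RR.mp_car by auto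
definition pm1 :: "nat => real poly => nat multiset \<Rightarrow>\<^sub>0 real" where "pm1 c q = poly (map_poly (sgl 0) q) (sgl {#c#} 1)"
definition pm2 :: "nat => nat => real poly poly => nat multiset \<Rightarrow>\<^sub>0 real" where "pm2 c d G = poly (map_poly (pm1 c) G) (sgl {#d#} 1)"
lemma pm1_0 [simp]: "pm1 c 0 = 0" by (simp add: pm1_def)
lemma pm1_pCons: "pm1 c (pCons a q) = sgl 0 a + sgl {#c#} 1 * pm1 c q" by (simp add: pm1_def map_poly_pCons)
lemma pm2_0 [simp]: "pm2 c d 0 = 0" by (simp add: pm2_def)
lemma pm2_pCons: "pm2 c d (pCons q G) = pm1 c q + sgl {#d#} 1 * pm2 c d G" by (simp add: pm2_def map_poly_pCons)
lemma pm1_VS: "c < n ==> pm1 c q:VS n" by (induction q) (auto simp: pm1_pCons VS_zero intro!: VS_add VS_mult VS_single)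
lemma pm2_VS: "c < n ==> d < n ==> pm2 c d G:VS n" by (induction G) (auto simp: pm2_pCons VS_zero intro!: VS_add VS_mult VS_single pm1_VS)
lemmas mev_r = mev_add[OF rhom_of_real] mev_mult[OF rhom_of_real] mev_single[OF rhom_of_real] mev_zero[OF rhom_of_real]
 dmev_add[OF rhom_of_real] dmev_mult[OF rhom_of_real] dmev_single[OF rhom_of_real]

lemma dmev_zero [simp]: "dmev i c t 0 = 0" by (simp add: dmev_def)
lemma mev_pm1: "mev of_real t (pm1 c q) = pev q (t c)" by (induction q) (simp_all add: pm1_pCons mev_r)
lemma mev_pm2: "mev of_real t (pm2 c d G) = ev2 G (t c) (t d)" by (induction G) (simp_all add: pm2_pCons mev_r mev_pm1)
lemma dmev_pm1: "dmev i of_real t (pm1 c q) = (if i = c then pev (pderiv q) (t c) else 0)" by (induction q) (simp_all add: pm1_pCons mev_r pderiv_pCons pev_add mev_pm1)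
lemma dmev_pm2: "i ~= c ==> dmev i of_real t (pm2 c d G) = (if i = d then ev2 (pderiv G) (t c) (t d) else 0)"
 by (induction G) (simp_all add: pm2_pCons mev_r pderiv_pCons ev2_add mev_pm2 dmev_pm1)

text \<open>The levels are spanned by the monomials of bounded degree in the generators.\<close>

lemma alg_gen_filt: assumes "alg_gen A n t" obtains B where "filt B A"
proof -
 define B where "B N = (%m. PROD i:#m. t i) ` {m. set_mset m <= {..<n} & size m <= N}" for N
 have "finite {m. set_mset m <= {..<n} & size m <= N}" for N
 proof (rule finite_subset)
 show "{m. set_mset m <= {..<n} & size m <= N} <= mset ` {xs. set xs <= {..<n} & length xs <= N}"
 proof
  fix m assume "m:{m. set_mset m <= {..<n} & size m <= N}"
  moreover obtain xs where "m = mset xs" by (metis ex_mset)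
  ultimately show "m:mset ` {xs. set xs <= {..<n} & length xs <= N}" by auto
 qed
 qed (simp add: finite_lists_length_le)
 hence fB: "finite (B N)" for N unfolding B_def by simp
 have "a:(\<Union>N. span (B N))" if aA: "a:A" for a
 proof -
 obtain F where F: "F:mp n" "a = mev of_real t (toE F)" using assms aA unfolding alg_gen_def by auto
 define N where "N = Max (insert 0 (size ` kys (toE F)))"
 have "(PROD i:#m. t i):B N" if m: "m:kys (toE F)" for m
 proof -
  have "size m <= N" unfolding N_def using m by simp
  thus ?thesis using mp_VS[OF F(1)] m unfolding B_def VS_def by auto
 qed
 hence "a:span (B N)" unfolding F mev_def by (intro span_sum) (simp add: scr[symmetric] span_scale span_base)
 thus ?thesis by auto
 qed
 hence "filt B A" using fB unfolding filt_def by auto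
 thus ?thesis by (rule that)
qed

text \<open>Otherwise \<open>t c\<close> and \<open>t (Suc c)\<close> would be algebraically
  independent. A relation between these two alone has no partial derivatives in the first
  \<open>c\<close> variables, hence no gradient at all; so its derivatives are relations again, and
  the degree can be lowered until a nonzero constant would have to vanish.\<close>

lemma smooth_rel_dim: assumes S: "smooth_pres A n c t f N" and dep: "!!x y. x:A ==> y:A ==> algdep x y" shows "n <= Suc c"
proof (rule ccontr)
 assume "~ n <= Suc c"
 hence n: "c < n" "Suc c < n" by auto
 let ?x = "t c" and ?y = "t (Suc c)"
 define J where "J j i = dmev i of_real t (toE (f j))" for j i
 have JN: "(SUM i<c. J j i * N i k) = (if j = k then 1 else 0)" if "j < c" "k < c" for j k using S that unfolding smooth_pres_def J_def by simp
 \<comment> \<open>The invertible minor in the first \<open>c\<close> variables forces all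
   coefficients \<open>g\<close> to vanish when those partial derivatives do.\<close>
 have grad: "dmev i of_real t p = 0" if p: "p:VS n" "mev of_real t p = 0" "!!i. i < c ==> dmev i of_real t p = 0" for p i
 proof -
 have "EX g. ALL i. dmev i of_real t (toE (lk p)) = (SUM j<c. g j * J j i)"
 proof -
  have "lk p:mp n" "mev of_real t (toE (lk p)) = 0" using VS_mp p by auto
  thus ?thesis using S unfolding smooth_pres_def J_def by simp
 qed
 then obtain g where g: "!!i. dmev i of_real t p = (SUM j<c. g j * J j i)" using VS_mp[OF p(1)] by auto
 have "g k = 0" if "k < c" for k using right_inverse_apply[of c J N k g, OF JN that] g p by simp
 thus ?thesis unfolding g by simp
 qed
 have dY: "ev2 (pderiv G) ?x ?y = 0" if "ev2 G ?x ?y = 0" for G using grad[OF pm2_VS[OF n, of G], of "Suc c"] that by (simp add: mev_pm2 dmev_pm2)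
 have dX: "pev (pderiv q) ?x = 0" if "pev q ?x = 0" for q using grad[OF pm1_VS[OF n(1), of q], of c] that by (simp add: mev_pm1 dmev_pm1)
 have X: "q = 0" if "pev q ?x = 0" for q using that
 proof (induction "degree q" arbitrary: q rule: less_induct)
 case less
 show ?case
 proof (cases "degree q = 0")
  case True
  then obtain a where "q = [:a:]" by (metis degree_eq_zeroE)
  thus ?thesis using less.prems by simp
 next
  case False
  hence "degree (pderiv q) < degree q" by (simp add: degree_pderiv)
  hence "pderiv q = 0" using less dX by simp
  thus ?thesis using False by (simp add: pderiv_eq_0_iff)
 qed
 qed
 have "G = 0" if "ev2 G ?x ?y = 0" for G using that
 proof (induction "degree G" arbitrary: G rule: less_induct)
 case less
 show ?case
 proof (cases "degree G = 0")
  case True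
  then obtain a where "G = [:a:]" by (metis degree_eq_zeroE)
  thus ?thesis using less.prems X by simp
 next
  case False
  hence "degree (pderiv G) < degree G" by (simp add: degree_pderiv)
  hence "pderiv G = 0" using less dY by simp
  thus ?thesis using False by (simp add: pderiv_eq_0_iff)
 qed
 qed
 moreover have "?x:A" "?y:A" using S n unfolding smooth_pres_def alg_gen_def by auto
 ultimately show False using dep unfolding algdep_def by auto
qed

section \<open>The maximal ideal at a smooth point is principal\<close>

definition m2 :: "'k::field set => 'k set" where "m2 m = {s. EX xs. set xs <= m \<times> m & s = (SUM (a, b)<-xs. a * b)}"
lemma m2_prod: "a:m ==> b:m ==> a * b:m2 m" unfolding m2_def by (intro CollectI exI[of _ "[(a, b)]"]) auto

lemma m2_idl: assumes O: "subr Ol" and m: "idl m Ol" shows "idl (m2 m) Ol" "m2 m <= m"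
proof -
 have in1: "(SUM (a, b)<-xs. a * b):m" if "set xs <= m \<times> m" for xs using that by (induction xs) (auto intro!: idlD[OF m])
 thus sub: "m2 m <= m" unfolding m2_def by auto
 show "idl (m2 m) Ol" unfolding idl_def
 proof (intro conjI ballI)
 show "m2 m <= Ol" using sub idlD[OF m] by auto
 show "0:m2 m" unfolding m2_def by (intro CollectI exI[of _ "[]"]) auto
 fix a b assume b: "b:m2 m"
 then obtain ys where ys: "set ys <= m \<times> m" "b = (SUM (a, b)<-ys. a * b)" unfolding m2_def by auto
 { assume "a:m2 m"
  then obtain xs where "set xs <= m \<times> m" "a = (SUM (a, b)<-xs. a * b)" unfolding m2_def by auto
  thus "a + b:m2 m" unfolding m2_def using ys by (intro CollectI exI[of _ "xs @ ys"]) auto }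
 { assume a: "a:Ol"
  have "a * b = (SUM (x, y)<-map (%(x, y). (a * x, y)) ys. x * y)" unfolding ys by (induction ys) (auto simp: als)
  moreover have "set (map (%(x, y). (a * x, y)) ys) <= m \<times> m" using ys idlD(4)[OF m a] by auto
  ultimately show "a * b:m2 m" unfolding m2_def by fast }
 qed
qed

lemma m2_combination: assumes O: "subr Ol" and m: "idl m Ol" and fin: "finite I"
 and gen: "!!b. b:m ==> EX o'. (ALL i:I. o' i:Ol) & b = (SUM i:I. o' i * y i)" and s: "s:m2 m" shows "EX c. (ALL i:I. c i:m) & s = (SUM i:I. c i * y i)"
proof -
 obtain xs where xs: "set xs <= m \<times> m" "s = (SUM (a, b)<-xs. a * b)" using s unfolding m2_def by auto
 show ?thesis unfolding xs(2) using xs(1)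
 proof (induction xs)
 case Nil thus ?case by (intro exI[of _ "%_. 0"]) (auto intro: idlD[OF m])
 next
 case (Cons p xs)
 obtain a b where p: "p = (a, b)" "a:m" "b:m" using Cons.prems by auto
 obtain c where c: "ALL i:I. c i:m" "(SUM (a, b)<-xs. a * b) = (SUM i:I. c i * y i)" using Cons by auto
 obtain o' where o': "ALL i:I. o' i:Ol" "b = (SUM i:I. o' i * y i)" using gen[OF p(3)] by auto
 have "(SUM (a, b)<-p # xs. a * b) = (SUM i:I. (a * o' i + c i) * y i)" using c by (simp add: p) (simp add: o' sdl distrib_right sum.distrib mult.assoc)
 moreover have "ALL i:I. a * o' i + c i:m" using c o' p by (auto intro!: idlD(3)[OF m] idlD(5)[OF m])
 ultimately show ?case by auto
 qed
qed

text \<open>First-order expansion modulo the square of \<open>m\<close>. The derivatives are taken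
  at \<open>t\<close> instead of the base point \<open>e\<close>, which changes only terms of second
  order.\<close>

lemma taylor: assumes O: "subr Ol" and m: "idl m Ol" and R: "!!r. of_real r:(Ol :: 'k::real_field set)"
 and t: "!!i. i < n ==> t i:Ol" "!!i. i < n ==> e i:Ol" "!!i. i < n ==> t i - e i:m" and p: "p:VS n"
 shows "mev of_real t p - mev of_real e p - (SUM i<n. dmev i of_real t p * (t i - e i)):m2 m" "!!i. dmev i of_real t p:Ol"
proof -
 note M2 = m2_idl[OF O m]
 have pr: "(PROD i:#k. t i):Ol" "(PROD i:#k. e i):Ol" if "set_mset k <= {..<n}" for k using that by (induction k) (auto intro!: subrD[OF O] t)
 have nat: "of_nat j:Ol" for j using R[of "of_nat j"] by simp
 define d where "d k i = of_nat (count k i) * (PROD i:#(k - {#i#}). t i)" for k i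
 have dO: "d k i:Ol" if "set_mset k <= {..<n}" for k i
 proof -
 have "set_mset (k - {#i#}) <= {..<n}" using that in_diffD by fast
 thus ?thesis unfolding d_def using nat pr by (intro subrD(4)[OF O]) auto
 qed
 have mono: "(PROD i:#k. t i) - (PROD i:#k. e i) - (SUM i<n. d k i * (t i - e i)):m2 m" if "set_mset k <= {..<n}" for k using that
 proof (induction k)
 case empty thus ?case by (simp add: d_def idlD[OF M2(1)])
 next
 case (add x k)
 have x: "x < n" and k: "set_mset k <= {..<n}" using add.prems by auto
 let ?T = "PROD i:#k. t i" and ?F = "PROD i:#k. e i"
 define q where "q = ?T - ?F - (SUM i<n. d k i * (t i - e i))"
 have q: "q:m2 m" unfolding q_def using add by simp
 have "(SUM i<n. d k i * (t i - e i)):m" using dO[OF k] t by (intro idl_sum[OF m] idlD(4)[OF m]) auto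
 hence TF: "?T - ?F:m" using q M2 idlD(3)[OF m, of q "SUM i<n. d k i * (t i - e i)"] unfolding q_def by auto
 have dd: "d (add_mset x k) i = t x * d k i + (if i = x then ?T else 0)" for i using dmon_add[OF rhom_of_real, of "{#x#}" k i t] by (auto simp: d_def add.commute)
 have "(SUM i<n. d (add_mset x k) i * (t i - e i)) = t x * (SUM i<n. d k i * (t i - e i)) + (SUM i<n. if i = x then ?T * (t i - e i) else 0)"
  unfolding dd sdl sum.distrib[symmetric] by (intro sum.cong refl) (auto simp: als)
 also have "(SUM i<n. if i = x then ?T * (t i - e i) else 0) = ?T * (t x - e x)" using x by simp
 finally have "(PROD i:#add_mset x k. t i) - (PROD i:#add_mset x k. e i) - (SUM i<n. d (add_mset x k) i * (t i - e i)) =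
  t x * q - (t x - e x) * (?T - ?F)" unfolding q_def by (simp add: als)
 also have "...:m2 m" using q TF t x by (intro idl_diff[OF O M2(1)] idlD(4)[OF M2(1)] m2_prod) auto
 finally show ?case .
 qed
 have e1: "mev of_real t p - mev of_real e p - (SUM i<n. dmev i of_real t p * (t i - e i)) =
  (SUM k:kys p. of_real (lk p k) * ((PROD i:#k. t i) - (PROD i:#k. e i) - (SUM i<n. d k i * (t i - e i))))"
 unfolding mev_def dmev_def d_def sdr right_diff_distrib sum_subtractf sdl by (simp add: mult.assoc sum.swap[of _ "kys p" "{..<n}"])
 show "mev of_real t p - mev of_real e p - (SUM i<n. dmev i of_real t p * (t i - e i)):m2 m"
 unfolding e1 using p R mono by (intro idl_sum[OF M2(1)] idlD(4)[OF M2(1)]) (auto simp: VS_def)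
 show "dmev i of_real t p:Ol" for i unfolding dmev_def d_def[symmetric] using p R dO by (intro subr_sum[OF O] subrD(4)[OF O]) (auto simp: VS_def)
qed

text \<open>\<open>E\<close> acts as a set of constants that represents the residue field and is
  closed under products up to multiples of \<open>w\<close>; this leaves room for complex residue
  fields, where a root of -1 is available only modulo the square of \<open>m\<close>. With
  \<open>e i\<close> the constant next to \<open>t i\<close>, the relations give \<open>c\<close>
  independent linear equations modulo that square between the at most \<open>c + 1\<close>
  differences \<open>t i - e i\<close>. So one of them generates \<open>m\<close> modulo its square,
  and Nakayama's lemma finishes.\<close>

lemma cotangent: assumes S: "smooth_pres A n c t f N" and nc: "n <= Suc c"
 and O: "subr Ol" and AO: "A <= Ol" and m: "idl m Ol" and loc: "!!a. a:m ==> 1 - a ~= 0 & inverse (1 - a):Ol"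
 and frac: "!!b. b:Ol ==> EX a:A. EX g:A. g ~= 0 & inverse g:Ol & b = a / g"
 and E: "E <= Ol" "!!r. of_real r:E" "!!a b. a:E ==> b:E ==> a + b:E" "!!a b. a:E ==> b:E ==> EX o':Ol. a * b + w * o':E"
  "E Int m = {0}" "!!a. a:A ==> EX e:E. a - e:m" and w: "w:m2 m" shows "EX pj:m. ALL b:m. EX p:Ol. b = p * pj"
proof -
 note M2 = m2_idl[OF O m]
 have R: "of_real r:Ol" for r using E by auto
 have wm: "w:m" using w M2 by auto
 have tA: "t i:A" if "i < n" for i using S that unfolding smooth_pres_def alg_gen_def by auto
 hence "ALL i. EX x. i < n --> x:E & t i - x:m" using E(6) by auto
 then obtain e where "ALL i. i < n --> e i:E & t i - e i:m" by metis
 hence e: "!!i. i < n ==> e i:E" "!!i. i < n ==> t i - e i:m" by auto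
 have te: "!!i. i < n ==> t i:Ol" "!!i. i < n ==> e i:Ol" using tA AO e E by auto
 define EW where "EW = {a:Ol. EX o':Ol. a + w * o':E}"
 have EE: "E <= EW" unfolding EW_def using E(1) subrD(1)[OF O] by force
 have EW_add: "a + b:EW" if ab: "a:EW" "b:EW" for a b
 proof -
 obtain p q where pq: "p:Ol" "q:Ol" "a + w * p:E" "b + w * q:E" "a:Ol" "b:Ol" using ab unfolding EW_def by auto
 have "(a + b) + w * (p + q):E" using E(3)[OF pq(3,4)] by (simp add: als)
 thus ?thesis unfolding EW_def using pq subrD[OF O] by auto
 qed
 have EW_mult: "a * b:EW" if ab: "a:EW" "b:EW" for a b
 proof -
 obtain p q where pq: "p:Ol" "q:Ol" "a + w * p:E" "b + w * q:E" "a:Ol" "b:Ol" using ab unfolding EW_def by auto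
 obtain o' where o': "o':Ol" "(a + w * p) * (b + w * q) + w * o':E" using E(4)[OF pq(3,4)] by auto
 have "(a + w * p) * (b + w * q) + w * o' = a * b + w * (p * b + q * a + w * p * q + o')" by (simp add: als)
 moreover have "p * b + q * a + w * p * q + o':Ol" using pq o' wm idlD[OF m] by (auto intro!: subrD[OF O])
 ultimately show ?thesis unfolding EW_def using o' pq subrD[OF O] by auto
 qed
 have EW0: "0:EW" "1:EW" using EE E(2)[of 0] E(2)[of 1] by auto
 have EWsum: "(!!i. i:S ==> g i:EW) ==> sum g S:EW" for g and S :: "nat multiset set" by (induction S rule: ifi) (auto intro: EW0 EW_add)
 have EWprod: "set_mset k <= {..<n} ==> (PROD i:#k. e i):EW" for k using EE e by (induction k) (auto intro!: EW0 EW_mult)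
 have mevE: "mev of_real e p:EW" if "p:VS n" for p unfolding mev_def using that EE E EWprod by (intro EWsum EW_mult) (auto simp: VS_def)
 define ta where "ta i = t i - e i" for i
 \<comment> \<open>The ideal \<open>m\<close> is generated by the differences
   \<open>t i - e i\<close> together with \<open>w\<close>, which gets the index
   \<open>n\<close>.\<close>
 have fj: "EX o'. (ALL i<=n. o' i:Ol) & b = (SUM i<=n. o' i * (if i = n then w else ta i))" if bm: "b:m" for b
 proof -
 have ring_gen: "EX o'. (ALL i<n. o' i:Ol) & mev of_real t p = mev of_real e p + (SUM i<n. o' i * ta i)" if "p:VS n" for p
 proof -
  have mono: "set_mset k <= {..<n} ==> EX o'. (ALL i<n. o' i:Ol) & (PROD i:#k. t i) = (PROD i:#k. e i) + (SUM i<n. o' i * ta i)" for k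
  proof (induction k)
  case empty thus ?case by (intro exI[of _ "%_. 0"]) (auto intro: subrD[OF O])
  next
  case (add x k)
  then obtain o' where o': "ALL i<n. o' i:Ol" "(PROD i:#k. t i) = (PROD i:#k. e i) + (SUM i<n. o' i * ta i)" by auto
  have x: "x < n" and k: "set_mset k <= {..<n}" using add.prems by auto
  have kO: "(PROD i:#k. e i):Ol" using EWprod[OF k] unfolding EW_def by auto
  have "(PROD i:#add_mset x k. t i) = (PROD i:#add_mset x k. e i) + (ta x * (PROD i:#k. e i) + t x * (SUM i<n. o' i * ta i))" using o' by (simp add: ta_def als)
  also have "ta x * (PROD i:#k. e i) = (SUM i<n. (if i = x then (PROD i:#k. e i) else 0) * ta i)"
  proof -
   have "(SUM i<n. (if i = x then (PROD i:#k. e i) else 0) * ta i) = (SUM i<n. if i = x then ta i * (PROD i:#k. e i) else 0)" by (intro sum.cong) auto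
   thus ?thesis using x by simp
  qed
  also have "... + t x * (SUM i<n. o' i * ta i) = (SUM i<n. ((if i = x then (PROD i:#k. e i) else 0) + t x * o' i) * ta i)"
   by (simp add: sdl distrib_right sum.distrib mult.assoc)
  finally show ?case using o' kO te x by (intro exI[of _ "%i. (if i = x then (PROD i:#k. e i) else 0) + t x * o' i"]) (auto intro!: subrD[OF O])
  qed
  then obtain o' where o': "!!k. set_mset k <= {..<n} ==> (ALL i<n. o' k i:Ol) & (PROD i:#k. t i) = (PROD i:#k. e i) + (SUM i<n. o' k i * ta i)" by metis
  have "mev of_real t p = (SUM k:kys p. of_real (lk p k) * ((PROD i:#k. e i) + (SUM i<n. o' k i * ta i)))"
  unfolding mev_def using o' that by (intro sum.cong refl) (auto simp: VS_def)
  also have "... = mev of_real e p + (SUM i<n. (SUM k:kys p. of_real (lk p k) * o' k i) * ta i)"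
  unfolding mev_def by (simp add: distrib_left sum.distrib sdl sdr mult.assoc) (rule sum.swap)
  finally show ?thesis using o' that R by (intro exI[of _ "%i. SUM k:kys p. of_real (lk p k) * o' k i"])
   (auto simp: VS_def intro!: subr_sum[OF O] subrD[OF O])
 qed
 obtain a g where ag: "a:A" "g:A" "g ~= 0" "inverse g:Ol" "b = a / g" using frac bm idlD[OF m] by metis
 have am: "a:m" using idlD(5)[OF m bm, of g] ag AO by auto
 obtain F where F: "F:mp n" "a = mev of_real t (toE F)" using S ag unfolding smooth_pres_def alg_gen_def by auto
 obtain o' where o': "ALL i<n. o' i:Ol" "a = mev of_real e (toE F) + (SUM i<n. o' i * ta i)" using ring_gen[OF mp_VS[OF F(1)]] F by auto
 obtain v where v: "v:Ol" "mev of_real e (toE F) + w * v:E" using mevE[OF mp_VS[OF F(1)]] unfolding EW_def by auto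
 have "(SUM i<n. o' i * ta i):m" using o' e unfolding ta_def by (intro idl_sum[OF m] idlD(4)[OF m]) auto
 hence "mev of_real e (toE F):m" using idl_diff[OF O m am] o' by force
 hence "mev of_real e (toE F) + w * v:m" using wm v by (intro idlD(3)[OF m] idlD(5)[OF m])
 hence "mev of_real e (toE F) + w * v = 0" using v E by auto
 hence "mev of_real e (toE F) = - v * w" by (simp add: eq_neg_iff_add_eq_0 mult.commute)
 hence "b = inverse g * (- v * w + (SUM i<n. o' i * ta i))" using ag o' by (simp add: divide_inverse)
 also have "... = (SUM i<=n. inverse g * (if i = n then - v else o' i) * (if i = n then w else ta i))"
  unfolding lessThan_Suc_atMost[symmetric] by (simp add: right_diff_distrib sdl mult.assoc)
 finally show ?thesis using o' ag v by (intro exI[of _ "%i. inverse g * (if i = n then - v else o' i)"]) (auto intro!: subrD[OF O])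
 qed
 define y where "y i = (if i = n then w else ta i)" for i
 have gen: "EX o'. (ALL i:{..n}. o' i:Ol) & b = (SUM i:{..n}. o' i * y i)" if "b:m" for b using fj[OF that] unfolding y_def by auto
 define J where "J j i = dmev i of_real t (toE (f j))" for j i
 have JO: "J j i:Ol" if "j < c" for j i unfolding J_def using S that by (intro taylor(2)[OF O m R te e(2)] mp_VS) (auto simp: smooth_pres_def)
 have JN: "(SUM i<c. J j i * N i k) = (if j = k then 1 else 0)" if "j < c" "k < c" for j k using S that unfolding smooth_pres_def J_def by simp
 have NO: "N i k:Ol" if "i < c" "k < c" for i k using S that AO unfolding smooth_pres_def by auto
 have cn: "c <= n" using S unfolding smooth_pres_def by auto
 \<comment> \<open>Taylor expansion of the relation \<open>f j\<close> between \<open>t\<close> and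
   \<open>e\<close>. Its value at \<open>e\<close> is in \<open>m\<close> and differs from an
   element of \<open>E\<close> by a multiple of \<open>w\<close>; that element is in
   \<open>m\<close> and hence zero.\<close>
 have Jt: "(SUM i<n. J j i * ta i):m2 m" if j: "j < c" for j
 proof -
 have fj: "f j:mp n" "mev of_real t (toE (f j)) = 0" using S j unfolding smooth_pres_def by auto
 let ?p = "toE (f j)"
 have 1: "0 - mev of_real e ?p - (SUM i<n. J j i * ta i):m2 m"
  using taylor[where t = t and e = e and n = n and p = "toE (f j)", OF O m R te e(2) mp_VS[OF fj(1)]] fj unfolding J_def ta_def by simp
 have 2: "(SUM i<n. J j i * ta i):m" using JO[OF j] e unfolding ta_def by (intro idl_sum[OF m] idlD(4)[OF m]) auto
 have "- mev of_real e ?p:m" using idlD(3)[OF m subsetD[OF M2(2) 1] 2] by simp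
 hence em: "mev of_real e ?p:m" using idl_minus[OF O m] by force
 obtain v where v: "v:Ol" "mev of_real e ?p + w * v:E" using mevE[OF mp_VS[OF fj(1)]] unfolding EW_def by auto
 have "mev of_real e ?p + w * v:m" using em wm v by (intro idlD(3)[OF m] idlD(5)[OF m])
 hence "mev of_real e ?p + w * v = 0" using v E by auto
 hence "- mev of_real e ?p = w * v" by (rule minus_unique)
 hence "- mev of_real e ?p:m2 m" using w v idlD[OF M2(1)] by simp
 hence "- mev of_real e ?p - (0 - mev of_real e ?p - (SUM i<n. J j i * ta i)):m2 m" using 1 by (rule idl_diff[OF O M2(1)])
 thus ?thesis by simp
 qed
 \<comment> \<open>The one difference that the \<open>c\<close> equations do not eliminate; for
   \<open>n = c\<close> there is none, and then \<open>m\<close> is zero.\<close>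
 define pj where "pj = (if n = c then 0 else ta c)"
 have pm: "pj:m" unfolding pj_def ta_def using e cn idlD[OF m] by auto
 have tk: "EX p:Ol. EX q:m2 m. ta k = p * pj + q" if k: "k < n" for k
 proof (cases "k < c")
 case False
 hence "k = c" "n ~= c" using k nc by auto
 hence "ta k = 1 * pj + 0" by (simp add: pj_def)
 thus ?thesis using subrD[OF O] idlD[OF M2(1)] by fast
 next
 case True
 define q where "q = (SUM j<c. N k j * (SUM i<n. J j i * ta i))"
 have q: "q:m2 m" unfolding q_def by (rule idl_sum[OF M2(1)], rule idlD(4)[OF M2(1) NO[OF True] Jt]) auto
 define s where "s i = (SUM j<c. N k j * J j i)" for i
 have sO: "s i:Ol" for i unfolding s_def using NO JO True by (intro subr_sum[OF O] subrD(4)[OF O]) auto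
 have "q = (SUM i<n. s i * ta i)" unfolding q_def s_def sdl sdr by (subst sum.swap) (simp add: mult.assoc)
 also have "... = (SUM i<c. s i * ta i) + (if n = c then 0 else s c * ta c)"
 proof (cases "n = c")
  case False hence "n = Suc c" using nc cn by auto
  thus ?thesis by simp
 qed simp
 also have "(SUM i<c. s i * ta i) = (SUM i<c. if i = k then ta i else 0)" unfolding s_def using right_inverse_left[of c J N k, OF JN True] by (intro sum.cong refl) auto
 also have "... = ta k" using True by simp
 also have "(if n = c then 0 else s c * ta c) = s c * pj" by (simp add: pj_def)
 finally have "ta k = (- s c) * pj + q" by simp
 thus ?thesis using q sO subrD[OF O] by blast
 qed
 have "ALL i:{..n}. EX p:Ol. y i = p * pj"
 proof (rule nakayama1[OF O m loc])
 show "pj:Ol" using pm idlD[OF m] by auto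
 fix i assume i: "i:{..n}"
 have "EX p:Ol. EX q:m2 m. y i = p * pj + q"
 proof (cases "i = n")
  case True hence "y i = 0 * pj + w" by (simp add: y_def)
  thus ?thesis using w subrD[OF O] by fast
 next
  case False thus ?thesis using tk i by (simp add: y_def)
 qed
 then obtain p q where pq: "p:Ol" "q:m2 m" "y i = p * pj + q" by auto
 obtain cc where cc: "ALL j:{..n}. cc j:m" "q = (SUM j:{..n}. cc j * y j)" using m2_combination[OF O m _ gen pq(2)] by auto
 show "EX p:Ol. EX c. (ALL j:{..n}. c j:m) & y i = p * pj + (SUM j:{..n}. c j * y j)" using pq cc by auto
 qed simp_all
 then obtain p where p: "!!i. i <= n ==> p i:Ol & y i = p i * pj" by (metis atMost_iff)
 have "EX q:Ol. b = q * pj" if b: "b:m" for b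
 proof -
 obtain o' where o': "ALL i:{..n}. o' i:Ol" "b = (SUM i:{..n}. o' i * y i)" using gen[OF b] by auto
 have "b = (SUM i:{..n}. o' i * p i) * pj" unfolding o' sdr using p by (intro sum.cong refl) (simp add: mult.assoc)
 moreover have "(SUM i:{..n}. o' i * p i):Ol" using o' p by (intro subr_sum[OF O] subrD(4)[OF O]) auto
 ultimately show ?thesis by auto
 qed
 thus ?thesis using pm by auto
qed

section \<open>Residue fields and valuations at closed points\<close>

lemma residue_dichotomy:
 fixes A :: "'k::real_field set" assumes A: "ralg A" and P: "prm p A" and alg: "!!a. a:A ==> EX q. q ~= 0 & pev q a:p"
 shows "(ALL a:A. EX r. a - of_real r:p) | (EX j:A. j^2 + 1:p & (ALL a:A. EX u v. a - of_real u - of_real v * j:p))"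
proof (cases "ALL a:A. EX r. a - of_real r:p")
 case False
 note SA = ralgD(1)[OF A] and I = prmD(1)[OF P]
 have quad: "(EX r. a - of_real r:p) | (EX u v. EX j:A. a = of_real u + of_real v * j & j^2 + 1:p)" if a: "a:A" for a
 proof -
 obtain q where q: "q ~= 0" "pev q a:p" using alg[OF a] by auto
 from residue_quadratic[OF A P a q] show ?thesis
 proof
  assume "EX u w. w ~= 0 & (a - of_real u)^2 + of_real (w^2):p"
  then obtain u w where uw: "w ~= 0" "(a - of_real u)^2 + of_real (w^2):p" by auto
  define j where "j = of_real (inverse w) * (a - of_real u)"
  have jA: "j:A" unfolding j_def by (intro subrD(4)[OF SA] subrD(6)[OF SA] ralgD(2)[OF A] a)
  have "a = of_real u + of_real w * j" using uw by (simp add: j_def field_simps)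
  moreover have e: "j^2 + 1 = of_real (inverse w ^ 2) * ((a - of_real u)^2 + of_real (w^2))" using uw by (simp add: j_def power_mult_distrib distrib_left power_inverse)
  have "j^2 + 1:p" unfolding e by (rule idlD(4)[OF I ralgD(2)[OF A] uw(2)])
  ultimately show ?thesis using jA by auto
 qed auto
 qed
 obtain a0 where a0: "a0:A" "~ (EX r. a0 - of_real r:p)" using False by auto
 then obtain j where j: "j:A" "j^2 + 1:p" using quad by fast
 have "EX u v. a - of_real u - of_real v * j:p" if a: "a:A" for a using quad[OF a]
 proof
 assume "EX r. a - of_real r:p" then obtain r where "a - of_real r:p" by auto
 hence "a - of_real r - of_real 0 * j:p" by simp
 thus ?thesis by fast
 next
 assume "EX u v. EX j:A. a = of_real u + of_real v * j & j^2 + 1:p"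
 then obtain u v j' where j': "j':A" "a = of_real u + of_real v * j'" "j'^2 + 1:p" by auto
 have "(j' - j) * (j' + j) = (j'^2 + 1) - (j^2 + 1)" by (simp add: p2 als)
 hence "(j' - j) * (j' + j):p" using idl_diff[OF SA I j'(3) j(2)] by simp
 hence "j' - j:p | j' + j:p" using prmD[OF P] subrD(3,6)[OF SA j'(1) j(1)] by simp
 thus ?thesis
 proof
  assume "j' - j:p"
  hence "of_real v * (j' - j):p" by (rule idlD(4)[OF I ralgD(2)[OF A]])
  hence "a - of_real u - of_real v * j:p" using j' by (simp add: als)
  thus ?thesis by auto
 next
  assume "j' + j:p"
  hence "of_real v * (j' + j):p" by (rule idlD(4)[OF I ralgD(2)[OF A]])
  hence "a - of_real u - of_real (- v) * j:p" using j' by (simp add: als)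
  thus ?thesis by fast
 qed
 qed
 thus ?thesis using j by auto
qed simp

lemma mx_local: assumes O: "subr Ol" and m: "idl (mx Ol) Ol" shows "a:mx Ol ==> 1 - a ~= 0 & inverse (1 - a):Ol" "1 ~: mx Ol"
 "(!!r. of_real r:(Ol :: 'k::real_field set)) ==> of_real r:mx Ol ==> r = 0"
proof -
 show n1: "1 ~: mx Ol" by (simp add: mx_def)
 show "1 - a ~= 0 & inverse (1 - a):Ol" if a: "a:mx Ol"
 proof -
 have "1 - a ~: mx Ol"
 proof
  assume "1 - a:mx Ol"
  hence "(1 - a) + a:mx Ol" using a by (rule idlD(3)[OF m])
  thus False using n1 by simp
 qed
 moreover have "1 - a:Ol" using subrD[OF O] idlD(1)[OF m a] by auto
 ultimately show ?thesis by (auto simp: mx_def)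
 qed
 show "r = 0" if R: "!!r. of_real r:(Ol :: 'k::real_field set)" and "of_real r:mx Ol"
 proof (rule ccontr)
 assume "r ~= 0"
 thus False using that R[of "inverse r"] by (simp add: mx_def)
 qed
qed

definition residues :: "'k::real_field set => bool" where "residues Ol <-> (ALL b:Ol. EX r. b - of_real r:mx Ol) |
  (EX j:Ol. j^2 + 1:mx Ol & (ALL b:Ol. EX u v. b - of_real u - of_real v * j:mx Ol))"

context
 fixes A Ol p :: "'k::real_field set" assumes A: "ralg A" and O: "subr Ol" and AO: "A <= Ol" and m: "idl (mx Ol) Ol" and p: "p = A Int mx Ol" and P: "prm p A"
 and frac: "!!b. b:Ol ==> EX a:A. EX g:A. g ~: mx Ol & g ~= 0 & b = a / g" and alg: "!!a. a:A ==> EX q. q ~= 0 & pev q a:p"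
begin

text \<open>A nonzero complex number is inverted by its conjugate divided by its norm; here
  \<open>j\<close> stands for the imaginary unit.\<close>

lemma inverse_mod: assumes g: "g:A" "g ~: p" shows "EX z:A. z * g - 1:p"
proof -
 note SA = ralgD(1)[OF A] and I = prmD(1)[OF P]
 have real0: "r = 0" if "of_real r:p" for r using mx_local(3)[OF O m, of r] that p AO ralgD[OF A] by auto
 from residue_dichotomy[OF A P alg] show ?thesis
 proof
 assume "ALL a:A. EX r. a - of_real r:p"
 then obtain r where r: "g - of_real r:p" using g by auto
 have "r ~= 0" using r g by auto
 hence "of_real (inverse r) * g - 1 = of_real (inverse r) * (g - of_real r)" by (simp add: right_diff_distrib)
 thus ?thesis using idlD(4)[OF I ralgD(2)[OF A] r] ralgD[OF A] by metis
 next
 assume "EX j:A. j^2 + 1:p & (ALL a:A. EX u v. a - of_real u - of_real v * j:p)"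
 then obtain j u v where j: "j:A" "j^2 + 1:p" "g - of_real u - of_real v * j:p" using g by auto
 define s where "s = u^2 + v^2"
 have "s ~= 0"
 proof
  assume "s = 0" hence "u = 0" "v = 0" unfolding s_def by auto
  thus False using j g by simp
 qed
 define z where "z = of_real (inverse s) * (of_real u - of_real v * j)"
 have zA: "z:A" unfolding z_def using j by (intro subrD(4)[OF SA] subrD(6)[OF SA] ralgD(2)[OF A])
 have c: "of_real u - of_real v * j:A" using j by (intro subrD(4)[OF SA] subrD(6)[OF SA] ralgD(2)[OF A])
 have "z * g - 1 = of_real (inverse s) * ((of_real u - of_real v * j) * g - of_real s)" using `s ~= 0` by (simp add: z_def right_diff_distrib)
 also have "(of_real u - of_real v * j) * g - of_real s = (of_real u - of_real v * j) * (g - of_real u - of_real v * j) - of_real (v^2) * (j^2 + 1)"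
  by (simp add: s_def p2 als)
 also have "of_real (inverse s) * ...:p" by (intro idlD(4)[OF I ralgD(2)[OF A]] idl_diff[OF SA I] idlD(4)[OF I c] j)
 finally show ?thesis using zA by auto
 qed
qed

text \<open>Denominators are invertible modulo \<open>p\<close>, so every element of the local ring
  is congruent to an element of \<open>A\<close>.\<close>

lemma residues_local: "residues Ol"
proof -
 have red: "EX a:A. b - a:mx Ol" if b: "b:Ol" for b
 proof -
 obtain a g where ag: "a:A" "g:A" "g ~: mx Ol" "g ~= 0" "b = a / g" using frac[OF b] by auto
 obtain z where z: "z:A" "z * g - 1:p" using inverse_mod ag p by auto
 have "b - a * z = - (b * (z * g - 1))" using ag by (simp add: field_simps)
 moreover have "b * (z * g - 1):mx Ol" using z p idlD(4)[OF m b] by auto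
 ultimately have "b - a * z:mx Ol" using idl_minus[OF O m] by simp
 thus ?thesis using ag z subrD[OF ralgD(1)[OF A]] by auto
 qed
 from residue_dichotomy[OF A P alg] show ?thesis
 proof
 assume *: "ALL a:A. EX r. a - of_real r:p"
 have "EX r. b - of_real r:mx Ol" if b: "b:Ol" for b
 proof -
  obtain a r where "a:A" "b - a:mx Ol" "a - of_real r:p" using red[OF b] * by auto
  hence "(b - a) + (a - of_real r):mx Ol" using p by (intro idlD(3)[OF m]) auto
  thus ?thesis by auto
 qed
 thus ?thesis unfolding residues_def by simp
 next
 assume "EX j:A. j^2 + 1:p & (ALL a:A. EX u v. a - of_real u - of_real v * j:p)"
 then obtain j where j: "j:A" "j^2 + 1:p" "!!a. a:A ==> EX u v. a - of_real u - of_real v * j:p" by auto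
 have "EX u v. b - of_real u - of_real v * j:mx Ol" if b: "b:Ol" for b
 proof -
  obtain a u v where "a:A" "b - a:mx Ol" "a - of_real u - of_real v * j:p" using red[OF b] j by fast
  hence "(b - a) + (a - of_real u - of_real v * j):mx Ol" using p by (intro idlD(3)[OF m]) auto
  moreover have "(b - a) + (a - of_real u - of_real v * j) = b - of_real u - of_real v * j" by simp
  ultimately show ?thesis by auto
 qed
 thus ?thesis unfolding residues_def using j p AO by blast
 qed
qed

text \<open>By \<open>cotangent\<close> the maximal ideal has a generator \<open>pj\<close>. To
  write every nonzero element as a unit times a power of \<open>pj\<close>, the intersection
  \<open>J\<close> of the ideals of all powers of \<open>pj\<close> must be zero. Since
  \<open>J\<close> is prime on \<open>A\<close> and no prime lies strictly between zero and
  \<open>p\<close>, it suffices that \<open>J\<close> does not contain \<open>p\<close>.\<close>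

lemma dvr_local: assumes S: "smooth_pres A n c t f N" and dep: "!!x y. x:A ==> y:A ==> algdep x y"
 and pn: "p ~= {0}" and low: "!!q. prm q A ==> q <= p ==> q = {0} | q = p" and K: "!!k. EX a:A. EX b:A. b ~= 0 & k = a / b" shows "dvr Ol"
proof -
 have R: "of_real r:Ol" for r using AO ralgD[OF A] by auto
 note SA = ralgD(1)[OF A] and I = prmD(1)[OF P] and M2 = m2_idl[OF O m]
 have frac': "EX a:A. EX g:A. g ~= 0 & inverse g:Ol & b = a / g" if b: "b:Ol" for b
 proof -
 obtain a g where ag: "a:A" "g:A" "g ~: mx Ol" "g ~= 0" "b = a / g" using frac[OF b] by auto
 hence "inverse g:Ol" using AO by (auto simp: mx_def)
 thus ?thesis using ag by auto
 qed
 have real0: "r = 0" if "of_real r:mx Ol" for r by (rule mx_local(3)[OF O m R that])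
 note ct = cotangent[OF S smooth_rel_dim[OF S dep] O AO m mx_local(1)[OF O m] frac']
 have "EX pj:mx Ol. ALL b:mx Ol. EX p:Ol. b = p * pj" using residue_dichotomy[OF A P alg]
 proof
 assume *: "ALL a:A. EX r. a - of_real r:p"
 show ?thesis
 proof (rule ct[where E = "range of_real" and w = 0])
  show "EX o':Ol. a * b + 0 * o':range of_real" if "a:range of_real" "b:range of_real" for a b using that subrD[OF O] by (auto simp flip: of_real_mult)
  show "a + b:range of_real" if "a:range of_real" "b:range of_real" for a b :: 'k using that by (auto simp flip: of_real_add)
  show "range of_real Int mx Ol = {0}" using real0 idlD[OF m] by auto
  show "EX e:range of_real. a - e:mx Ol" if "a:A" for a using * that p by auto
  show "0:m2 (mx Ol)" by (rule idlD(2)[OF M2(1)])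
 qed (use R in auto)
 next
 assume "EX j:A. j^2 + 1:p & (ALL a:A. EX u v. a - of_real u - of_real v * j:p)"
 then obtain j where j: "j:A" "j^2 + 1:p" "!!a. a:A ==> EX u v. a - of_real u - of_real v * j:p" by auto
 \<comment> \<open>A Newton step for the root of -1: replacing \<open>j\<close> by \<open>j1\<close>
   moves the defect from the maximal ideal into its square.\<close>
 define s where "s = j^2 + 1"
 define j1 where "j1 = j + of_real (1/2) * j * s"
 have sm: "s:mx Ol" using j p unfolding s_def by auto
 have jO: "j:Ol" using j AO by auto
 have hj: "of_real (1/2) * j:Ol" using R jO by (intro subrD(4)[OF O])
 have j1m: "j - j1:mx Ol"
 proof -
  have "of_real (1/2) * j * s:mx Ol" by (rule idlD(4)[OF m hj sm])
  hence "- (of_real (1/2) * j * s):mx Ol" by (rule idl_minus[OF O m])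
  thus ?thesis by (simp add: j1_def)
 qed
 have j1O: "j1:Ol" using subrD(6)[OF O jO idlD(1)[OF m j1m]] by simp
 define w where "w = j1^2 + 1"
 have "w = s * s + of_real (1/4) * j^2 * (s * s)" unfolding w_def j1_def s_def by (simp add: p2 field_simps)
 moreover have "of_real (1/4) * j^2:Ol" using R jO by (intro subrD(4)[OF O] subrD(7)[OF O])
 ultimately have w: "w:m2 (mx Ol)" using idlD(3)[OF M2(1) m2_prod[OF sm sm] idlD(4)[OF M2(1) _ m2_prod[OF sm sm]]] by fast
 hence wm: "w:mx Ol" using M2 by auto
 let ?E = "{of_real u + of_real v * j1 |u v. True}"
 show ?thesis
 proof (rule ct[where E = ?E and w = w])
  show "?E <= Ol" using R j1O by (auto intro!: subrD[OF O])
  show "of_real r:?E" for r by (intro CollectI exI[of _ r] exI[of _ "0::real"]) simp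
  show "a + b:?E" if ab: "a:?E" "b:?E" for a b
  proof -
  obtain u v u' v' where "a = of_real u + of_real v * j1" "b = of_real u' + of_real v' * j1" using ab by auto
  hence "a + b = of_real (u + u') + of_real (v + v') * j1" by (simp add: als)
  thus ?thesis by fast
  qed
  show "EX o':Ol. a * b + w * o':?E" if ab: "a:?E" "b:?E" for a b
  proof -
  obtain u v u' v' where e: "a = of_real u + of_real v * j1" "b = of_real u' + of_real v' * j1" using ab by auto
  have "a * b + w * of_real (- v * v') = of_real (u * u' - v * v') + of_real (u * v' + u' * v) * j1" unfolding w_def e by (simp add: p2 als)
  thus ?thesis using R by fast
  qed
  show "?E Int mx Ol = {0}"
  proof
  show "{0} <= ?E Int mx Ol" using idlD[OF m] by (auto intro!: exI[of _ "0::real"])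
  show "?E Int mx Ol <= {0}"
  proof
   fix a assume "a:?E Int mx Ol"
   then obtain u v where a: "a = of_real u + of_real v * j1" "a:mx Ol" by auto
   have "of_real u - of_real v * j1:Ol" using R j1O by (intro subrD(6)[OF O] subrD(4)[OF O])
   hence "(of_real u - of_real v * j1) * a + of_real (v^2) * w:mx Ol" using a wm R by (intro idlD(3)[OF m] idlD(4)[OF m])
   moreover have "(of_real u - of_real v * j1) * a + of_real (v^2) * w = of_real (u^2 + v^2)" unfolding w_def a by (simp add: p2 als)
   ultimately have "u^2 + v^2 = 0" using real0 by metis
   hence "u = 0" "v = 0" by auto
   thus "a:{0}" using a by simp
  qed
  qed
  show "EX e:?E. a - e:mx Ol" if aA: "a:A" for a
  proof -
  obtain u v where uv: "a - of_real u - of_real v * j:mx Ol" using j(3)[OF aA] p by auto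
  have "(a - of_real u - of_real v * j) + of_real v * (j - j1):mx Ol" using uv j1m R by (intro idlD(3)[OF m] idlD(4)[OF m])
  hence "a - (of_real u + of_real v * j1):mx Ol" by (simp add: als)
  thus ?thesis by auto
  qed
  show "w:m2 (mx Ol)" by (rule w)
 qed
 qed
 then obtain pj where pi: "pj:mx Ol" "!!b. b:mx Ol ==> EX p:Ol. b = p * pj" by auto
 have pO: "pj:Ol" using pi idlD[OF m] by auto
 have p0: "pj ~= 0"
 proof
 assume "pj = 0"
 hence "mx Ol <= {0}" using pi by auto
 thus False using pn p prmD[OF P] by auto
 qed
 have u: "unf Ol pj" unfolding unf_def
 proof (intro conjI p0 equalityI subsetI)
 show "x:{pj * a |a. a:Ol}" if "x:mx Ol" for x using pi(2)[OF that] by auto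
 show "x:mx Ol" if "x:{pj * a |a. a:Ol}" for x using that idlD(5)[OF m pi(1)] by auto
 qed
 define J where "J = {b:Ol. ALL k. EX o':Ol. b = pj ^ k * o'}"
 have form: "EX k. EX u:Ol - mx Ol. x = pj ^ k * u" if x: "x:Ol" "x ~: J" for x
 proof -
 have ex: "EX k. ~ (EX o':Ol. x = pj ^ k * o')" using x unfolding J_def by auto
 define k where "k = (LEAST k. ~ (EX o':Ol. x = pj ^ k * o'))"
 have k1: "~ (EX o':Ol. x = pj ^ k * o')" unfolding k_def using ex by (rule LeastI_ex)
 have "k ~= 0" using k1 x by (metis mult_1 power_0)
 then obtain l where l: "k = Suc l" by (cases k) auto
 have "EX o':Ol. x = pj ^ l * o'" using not_less_Least[of l "%k. ~ (EX o':Ol. x = pj ^ k * o')"] l unfolding k_def by auto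
 then obtain o' where o': "o':Ol" "x = pj ^ l * o'" by auto
 have "o' ~: mx Ol"
 proof
  assume "o':mx Ol"
  then obtain q where "q:Ol" "o' = q * pj" using pi by auto
  hence "x = pj ^ k * q" using o' l by simp
  thus False using k1 `q:Ol` by auto
 qed
 thus ?thesis using o' by auto
 qed
 have nJ: "pj ^ k * u ~: J" if "u:Ol - mx Ol" for k u
 proof
 assume "pj ^ k * u:J"
 then obtain o' where "o':Ol" "pj ^ k * u = pj ^ Suc k * o'" unfolding J_def by fast
 hence "u = pj * o'" using p0 by simp
 thus False using that idlD(5)[OF m pi(1) `o':Ol`] by simp
 qed
 have Jidl: "a + b:J" "c:Ol ==> c * a:J" if ab: "a:J" "b:J" for a b c
 proof -
 have 1: "EX o':Ol. a + b = pj ^ k * o'" for k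
 proof -
  obtain o1 o2 where "o1:Ol" "o2:Ol" "a = pj ^ k * o1" "b = pj ^ k * o2" using ab unfolding J_def by fast
  thus ?thesis using subrD[OF O] by (intro bexI[of _ "o1 + o2"]) (auto simp: distrib_left)
 qed
 thus "a + b:J" using ab subrD[OF O] unfolding J_def by auto
 show "c * a:J" if c: "c:Ol"
 proof -
  have "EX o':Ol. c * a = pj ^ k * o'" for k
  proof -
  obtain o1 where "o1:Ol" "a = pj ^ k * o1" using ab unfolding J_def by auto
  thus ?thesis using subrD[OF O] c by auto
  qed
  thus ?thesis using ab c subrD[OF O] unfolding J_def by auto
 qed
 qed
 have J0: "0:J" unfolding J_def using subrD[OF O] by auto
 have Jm: "J <= mx Ol"
 proof
 fix x assume "x:J"
 hence "x:Ol" "EX o':Ol. x = pj ^ 1 * o'" unfolding J_def by blast+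
 thus "x:mx Ol" using idlD(5)[OF m pi(1)] by auto
 qed
 \<comment> \<open>Two elements outside \<open>J\<close> are units times powers of
   \<open>pj\<close>, and so is their product.\<close>
 have "prm (J Int A) A" unfolding prm_def idl_def
 proof (intro conjI ballI impI)
 show "a * b:J Int A" if "a:A" "b:J Int A" for a b using that Jidl AO subrD[OF SA] by auto
 show "1 ~: J Int A" using Jm mx_local[OF O m] by auto
 show "a:J Int A | b:J Int A" if ab: "a:A" "b:A" "a * b:J Int A" for a b
 proof (rule ccontr)
  assume "~ ?thesis"
  hence "a ~: J" "b ~: J" using ab by auto
  then obtain k u l v where "u:Ol - mx Ol" "v:Ol - mx Ol" "a = pj ^ k * u" "b = pj ^ l * v" using form ab AO by (metis subsetD)
  hence "a * b = pj ^ (k + l) * (u * v)" "u * v:Ol - mx Ol" using unit_mult[OF O, of u v] by (simp_all add: power_add)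
  thus False using nJ ab by simp
 qed
 qed (use Jidl(1) J0 subrD[OF SA] in auto)
 moreover have "J Int A <= p" using Jm p by auto
 ultimately have "J Int A = {0} | J Int A = p" using low by simp
 \<comment> \<open>Write \<open>pj\<close> as \<open>a / g\<close> with \<open>g\<close> a unit:
   then \<open>a\<close> is in \<open>p\<close>, and as \<open>pj\<close> times a unit it is outside
   \<open>J\<close>.\<close>
 moreover have "J Int A ~= p"
 proof
 assume e: "J Int A = p"
 obtain a g where ag: "a:A" "g:A" "g ~: mx Ol" "g ~= 0" "pj = a / g" using frac[OF pO] by auto
 hence a: "a = pj ^ 1 * g" by simp
 have gO: "g:Ol" using AO ag by auto
 have "a:mx Ol" unfolding a using idlD(5)[OF m pi(1) gO] by simp
 hence "a:J" using e ag p by auto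
 thus False using nJ[of g 1] gO ag  by simp
 qed
 ultimately have JA: "J Int A = {0}" by simp
 have "J <= {0}"
 proof
 fix x assume x: "x:J"
 hence "x:Ol" unfolding J_def by auto
 then obtain a g where ag: "a:A" "g:A" "g ~= 0" "x = a / g" using frac by fast
 hence "g * x = a" by simp
 hence "a:J" using Jidl(2)[OF x x, of g] ag AO by auto
 thus "x:{0}" using JA ag by auto
 qed
 hence form0: "EX k. EX u:Ol - mx Ol. x = pj ^ k * u" if "x:Ol" "x ~= 0" for x using form that by auto
 have "EX (n::int) u. u:Ol & u ~: mx Ol & f = u * pj powi n" if f: "f ~= 0" for f
 proof -
 obtain a b where ab: "a:A" "b:A" "b ~= 0" "f = a / b" using K by fast
 hence "a ~= 0" using f by auto
 then obtain k u l v where e: "u:Ol - mx Ol" "v:Ol - mx Ol" "a = pj ^ k * u" "b = pj ^ l * v" using form0 ab AO by (metis subsetD)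
 have "f = (u * inverse v) * pj powi (int k - int l)" using ab e p0 by (simp add: power_int_diff field_simps)
 moreover have "u * inverse v:Ol - mx Ol" using e unit_mult[OF O] unit_inv by auto
 ultimately show ?thesis by auto
 qed
 thus ?thesis unfolding dvr_def using O u by auto
qed

end

text \<open>The value 0 marks a real residue field. It cannot be confused with a chosen root of -1,
  because 1 is not in the maximal ideal.\<close>

definition resj :: "'k::real_field set => 'k" where "resj Ol = (if ALL b:Ol. EX r. b - of_real r:mx Ol then 0
  else SOME j. j:Ol & j^2 + 1:mx Ol & (ALL b:Ol. EX u v. b - of_real u - of_real v * j:mx Ol))"

text \<open>The residue as a complex number. For a complex residue field the identification depends
  on the chosen root \<open>resj\<close>; the opposite root would conjugate it.\<close>

definition res :: "'k::real_field set => 'k => complex" where "res Ol b = (THE z. b - of_real (Re z) - of_real (Im z) * resj Ol:mx Ol & (resj Ol = 0 --> Im z = 0))"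

context
 fixes Ol :: "'k::real_field set" assumes O: "subr Ol" and m: "idl (mx Ol) Ol" and R: "!!r. of_real r:Ol" and D: "residues Ol"
begin

lemma resj_cases: "(resj Ol = 0 & (ALL b:Ol. EX r. b - of_real r:mx Ol)) |
 (resj Ol ~= 0 & resj Ol:Ol & resj Ol ^ 2 + 1:mx Ol & (ALL b:Ol. EX u v. b - of_real u - of_real v * resj Ol:mx Ol))"
proof (cases "ALL b:Ol. EX r. b - of_real r:mx Ol")
 case True thus ?thesis by (simp add: resj_def)
next
 case False
 hence "EX j. j:Ol & j^2 + 1:mx Ol & (ALL b:Ol. EX u v. b - of_real u - of_real v * j:mx Ol)" using D unfolding residues_def by auto
 from someI_ex[OF this] have *: "resj Ol:Ol & resj Ol ^ 2 + 1:mx Ol & (ALL b:Ol. EX u v. b - of_real u - of_real v * resj Ol:mx Ol)"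
 unfolding resj_def using False by auto
 moreover have "resj Ol ~= 0" using * mx_local[OF O m] by auto
 ultimately show ?thesis by simp
qed

lemma resj_mem: "resj Ol:Ol" using resj_cases subrD[OF O] by auto
lemma real_mx: "of_real r:mx Ol <-> r = 0" using mx_local(3)[OF O m R] idlD[OF m] by auto

text \<open>Multiplication by the conjugate leaves the real number \<open>u^2 + v^2\<close> in the
  maximal ideal.\<close>

lemma res_unique: assumes "of_real u + of_real v * resj Ol:mx Ol" "resj Ol = 0 --> v = 0" shows "u = 0 & v = 0"
proof (cases "resj Ol = 0")
 case True thus ?thesis using assms real_mx by simp
next
 case False
 let ?j = "resj Ol"
 have j: "?j ^ 2 + 1:mx Ol" using resj_cases False by auto
 have "of_real u - of_real v * ?j:Ol" using R resj_mem by (intro subrD(6)[OF O] subrD(4)[OF O])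
 hence "(of_real u - of_real v * ?j) * (of_real u + of_real v * ?j) + of_real (v^2) * (?j^2 + 1):mx Ol" by (rule idlD(3)[OF m idlD(4)[OF m _ assms(1)] idlD(4)[OF m R j]])
 moreover have "(of_real u - of_real v * ?j) * (of_real u + of_real v * ?j) + of_real (v^2) * (?j^2 + 1) = of_real (u^2 + v^2)" by (simp add: p2 als)
 ultimately have "u^2 + v^2 = 0" using real_mx by metis
 thus ?thesis by simp
qed

lemma res_ex: "b:Ol ==> EX z. b - of_real (Re z) - of_real (Im z) * resj Ol:mx Ol & (resj Ol = 0 --> Im z = 0)"
proof -
 assume b: "b:Ol"
 from resj_cases show ?thesis
 proof
 assume *: "resj Ol = 0 & (ALL b:Ol. EX r. b - of_real r:mx Ol)"
 then obtain r where "b - of_real r:mx Ol" using b by auto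
 thus ?thesis by (intro exI[of _ "complex_of_real r"]) (simp add: *)
 next
 assume *: "resj Ol ~= 0 & resj Ol:Ol & resj Ol ^ 2 + 1:mx Ol & (ALL b:Ol. EX u v. b - of_real u - of_real v * resj Ol:mx Ol)"
 then obtain u v where "b - of_real u - of_real v * resj Ol:mx Ol" using b by auto
 thus ?thesis by (intro exI[of _ "Complex u v"]) (simp add: *)
 qed
qed

lemma res_eqI: assumes "b - of_real (Re z) - of_real (Im z) * resj Ol:mx Ol" "resj Ol = 0 --> Im z = 0" shows "res Ol b = z" unfolding res_def
proof (rule the_equality)
 show "b - of_real (Re z) - of_real (Im z) * resj Ol:mx Ol & (resj Ol = 0 --> Im z = 0)" using assms by simp
 fix y assume y: "b - of_real (Re y) - of_real (Im y) * resj Ol:mx Ol & (resj Ol = 0 --> Im y = 0)"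
 hence "(b - of_real (Re z) - of_real (Im z) * resj Ol) - (b - of_real (Re y) - of_real (Im y) * resj Ol):mx Ol" using idl_diff[OF O m assms(1)] by fast
 hence "of_real (Re y - Re z) + of_real (Im y - Im z) * resj Ol:mx Ol" by (simp add: als)
 hence "Re y - Re z = 0 & Im y - Im z = 0" using y assms by (intro res_unique) auto
 thus "y = z" by (simp add: complex_eq_iff)
qed

lemma res_spec: "b:Ol ==> b - of_real (Re (res Ol b)) - of_real (Im (res Ol b)) * resj Ol:mx Ol" "b:Ol ==> resj Ol = 0 ==> Im (res Ol b) = 0" using res_ex res_eqI by auto

lemma res_add: assumes "a:Ol" "b:Ol" shows "res Ol (a + b) = res Ol a + res Ol b"
proof (rule res_eqI)
 have "(a - of_real (Re (res Ol a)) - of_real (Im (res Ol a)) * resj Ol) + (b - of_real (Re (res Ol b)) - of_real (Im (res Ol b)) * resj Ol):mx Ol"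
 using assms res_spec by (intro idlD(3)[OF m])
 thus "a + b - of_real (Re (res Ol a + res Ol b)) - of_real (Im (res Ol a + res Ol b)) * resj Ol:mx Ol" by (simp add: als)
qed (use res_spec(2) assms in auto)

lemma res_mult: assumes "a:Ol" "b:Ol" shows "res Ol (a * b) = res Ol a * res Ol b"
proof (rule res_eqI)
 let ?x = "of_real (Re (res Ol a)) + of_real (Im (res Ol a)) * resj Ol"
 let ?y = "of_real (Re (res Ol b)) + of_real (Im (res Ol b)) * resj Ol"
 have xy: "a - ?x:mx Ol" "b - ?y:mx Ol" using assms res_spec by (simp_all add: als)
 have xO: "?x:Ol" using R resj_mem by (intro subrD(3)[OF O] subrD(4)[OF O])
 have 1: "b * (a - ?x) + ?x * (b - ?y):mx Ol" using xy assms xO by (intro idlD(3)[OF m] idlD(4)[OF m])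
 have 2: "of_real (Im (res Ol a) * Im (res Ol b)) * (resj Ol ^ 2 + 1):mx Ol"
 proof (cases "resj Ol = 0")
 case True thus ?thesis using res_spec[OF assms(1)] idlD[OF m] by simp
 next
 case False thus ?thesis using resj_cases idlD(4)[OF m R[of "Im (res Ol a) * Im (res Ol b)"]] by auto
 qed
 have "a * b - of_real (Re (res Ol a * res Ol b)) - of_real (Im (res Ol a * res Ol b)) * resj Ol =
 (b * (a - ?x) + ?x * (b - ?y)) + of_real (Im (res Ol a) * Im (res Ol b)) * (resj Ol ^ 2 + 1)" by (simp add: p2 als)
 also have "...:mx Ol" using 1 2 by (rule idlD(3)[OF m])
 finally show "a * b - of_real (Re (res Ol a * res Ol b)) - of_real (Im (res Ol a * res Ol b)) * resj Ol:mx Ol" .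
qed (use res_spec(2) assms in auto)

lemma res_real: "res Ol (of_real r) = of_real r" by (rule res_eqI) (auto intro: idlD[OF m])
lemma res_zero_iff: "b:Ol ==> res Ol b = 0 <-> b:mx Ol" using res_spec[of b] res_eqI[of b 0] by auto

lemma res_range: "(ALL b:Ol. Im (res Ol b) = 0) | (ALL z. EX b:Ol. res Ol b = z)"
proof (cases "resj Ol = 0")
 case False
 have "EX b:Ol. res Ol b = z" for z
 proof
 show "of_real (Re z) + of_real (Im z) * resj Ol:Ol" using R resj_mem by (intro subrD(3)[OF O] subrD(4)[OF O])
 show "res Ol (of_real (Re z) + of_real (Im z) * resj Ol) = z" by (rule res_eqI) (use False idlD(2)[OF m] in auto)
 qed
 thus ?thesis by simp
qed (use res_spec(2) in auto)

lemma res_mev: assumes "!!i. i < n ==> t i:Ol" "p:VS n" shows "mev of_real t p:Ol" "res Ol (mev of_real t p) = mev of_real (%i. res Ol (t i)) p"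
proof -
 have mon: "(PROD i:#k. t i):Ol & res Ol (PROD i:#k. t i) = (PROD i:#k. res Ol (t i))" if "set_mset k <= {..<n}" for k using that
 proof (induction k)
 case empty thus ?case using res_real[of 1] subrD[OF O] by simp
 next
 case (add x k) thus ?case using assms subrD[OF O] by (simp add: res_mult)
 qed
 have tm: "of_real c * (PROD i:#k. t i):Ol & res Ol (of_real c * (PROD i:#k. t i)) = of_real c * (PROD i:#k. res Ol (t i))" if "set_mset k <= {..<n}" for k c
 using mon[OF that] R subrD[OF O] by (simp add: res_mult res_real)
 have sm: "(SUM k:S. g k):Ol & res Ol (SUM k:S. g k) = (SUM k:S. res Ol (g k))" if "finite S" "!!k. k:S ==> g k:Ol" for S :: "nat multiset set" and g using that
 proof (induction S rule: finite_induct)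
 case empty thus ?case using res_real[of 0] subrD[OF O] by simp
 next
 case (insert x S) thus ?case using subrD[OF O] by (simp add: res_add)
 qed
 have "(ALL k:kys p. set_mset k <= {..<n})" using assms by (simp add: VS_def)
 thus "mev of_real t p:Ol" "res Ol (mev of_real t p) = mev of_real (%i. res Ol (t i)) p" using sm tm unfolding mev_def by auto
qed

end

section \<open>Relations between two functions\<close>

lemma algdep_reduced: assumes x: "x ~= 0" and d: "algdep x (y :: 'k::real_field)"
 obtains q G' where "q ~= 0" "pev q y = x * ev2 G' x y"
proof -
 obtain G where G: "G ~= 0" "ev2 G x y = 0" using d unfolding algdep_def by auto
 have "EX G. map_poly (%p. poly p 0) G ~= 0 & ev2 G x y = 0" using G
 \<comment> \<open>As long as all coefficients vanish at 0, the relation can be divided by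
   \<open>x\<close>, which lowers the degree of the leading coefficient. Once some coefficient does
   not vanish at 0, setting \<open>x = 0\<close> in the coefficients gives a nonzero polynomial in
   \<open>y\<close>.\<close>
 proof (induction "degree (lead_coeff G)" arbitrary: G rule: less_induct)
 case less
 show ?case
 proof (cases "map_poly (%p. poly p 0) G = 0")
  case True
  have z: "poly (coeff G i) 0 = 0" for i using arg_cong[OF True, of "%p. coeff p i"] by (simp add: coeff_map_poly)
  define H where "H = map_poly (%p. p div [:0, 1:]) G"
  have ci: "coeff G i = [:0, 1:] * coeff H i" for i
  proof -
  have "[:0, 1:] dvd coeff G i" using z poly_eq_0_iff_dvd[of "coeff G i" 0] by simp
  thus ?thesis unfolding H_def by (simp add: coeff_map_poly del: mult_pCons_left)
  qed
  hence GH: "G = Polynomial.smult [:0, 1:] H" by (intro poly_eqI) (simp only: coeff_smult)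
  hence H0: "H ~= 0" using less.prems by auto
  have "ev2 G x y = x * ev2 H x y" unfolding GH by (simp add: ev2_smult)
  hence "ev2 H x y = 0" using less.prems x by simp
  moreover have "degree (lead_coeff H) < degree (lead_coeff G)"
  proof -
  have "degree H = degree G" unfolding GH by simp
  hence "lead_coeff G = [:0, 1:] * lead_coeff H" using ci by simp
  thus ?thesis using H0 by simp
  qed
  ultimately show ?thesis using less.hyps H0 by simp
 qed (use less in auto)
 qed
 then obtain G where G: "map_poly (%p. poly p 0) G ~= 0" "ev2 G x y = 0" by auto
 have "EX G'. ev2 G x y = pev (map_poly (%p. poly p 0) G) y + x * ev2 G' x y" for G
 proof (induction G)
 case (pCons a G)
 then obtain G' where G': "ev2 G x y = pev (map_poly (%p. poly p 0) G) y + x * ev2 G' x y" by auto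
 obtain c b where a: "a = pCons c b" by (cases a) auto
 have "ev2 (pCons a G) x y = pev (map_poly (%p. poly p 0) (pCons a G)) y + x * ev2 (pCons b G') x y" using G' by (simp add: a map_poly_pCons als)
 thus ?case by fast
 qed (auto intro: exI[of _ 0])
 then obtain G' where "ev2 G x y = pev (map_poly (%p. poly p 0) G) y + x * ev2 G' x y" by auto
 hence "pev (- map_poly (%p. poly p 0) G) y = x * ev2 G' x y" using G by (simp add: pev_uminus minus_unique)
 thus ?thesis using that[of "- map_poly (%p. poly p 0) G"] G by auto
qed

text \<open>Ensures that the cofactor \<open>ev2 G' x y\<close> of \<open>algdep_reduced\<close>
  stays in the algebra, so that \<open>q\<close> evaluated at \<open>y\<close> is a multiple of
  \<open>x\<close> there.\<close>

lemma ev2_mem: "ralg A ==> x:A ==> y:A ==> ev2 G x y:A" by (induction G) (auto intro!: subrD ralgD pev_mem)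

lemma pev_finite_roots: assumes "q ~= 0" shows "finite {z :: complex. pev q z = 0}"
proof -
 have "map_poly complex_of_real q ~= 0" using assms by (simp add: map_poly_eq_0_iff)
 thus ?thesis unfolding pev_def by (rule poly_roots_finite)
qed

section \<open>Curves: closed points and their local rings\<close>

lemma curve_integral: assumes "real_algebraic_curve X" shows "integral_scheme X"
proof (rule integral_scheme.intro)
 have sch: "is_scheme X" and gi: "geometrically_integral X" using assms by (auto simp: real_algebraic_curve_def is_real_scheme_def)
 show sh: "sheaf_of_rings X" using sch by (simp add: is_scheme_def)
 show "EX U. affine_open X U & x:U" if "x:topspace (space_top X)" for x using sch that by (auto simp: is_scheme_def)
 show "topspace (space_top X) ~= {}" using gi by (simp add: geometrically_integral_def)
 \<comment> \<open>The ring of sections sits in its complexification as the pairs with second entry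
   zero, and so inherits the absence of zero divisors.\<close>
 show "domain (sections X U)" if U: "openin (space_top X) U" "U ~= {}" for U
 proof -
 interpret A: cring "sections X U" using sh[unfolded sheaf_of_rings_def, THEN conjunct1] U by auto
 interpret C: domain "complexification (sections X U)" using gi[unfolded geometrically_integral_def, THEN conjunct2] U by auto
 show ?thesis
 proof (intro domain.intro A.cring_axioms domain_axioms.intro)
 show "\<one>$$(sections X U) ~= \<zero>$$(sections X U)" using C.one_not_zero by (simp add: complexification_def)
 fix a b assume "a \<otimes>$$(sections X U) b = \<zero>$$(sections X U)" "a:carrier (sections X U)" "b:carrier (sections X U)"
 thus "a = \<zero>$$(sections X U) | b = \<zero>$$(sections X U)"
  using C.integral[of "(a, \<zero>$$(sections X U))" "(b, \<zero>$$(sections X U))"] by (simp add: complexification_def)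
 qed
 qed
qed

lemma ideal_from: assumes "cring M" "I <= carrier M" "\<zero>$$M:I" "!!a b. a:I ==> b:I ==> a \<oplus>$$M b:I"
 "!!a b. a:carrier M ==> b:I ==> a \<otimes>$$M b:I" shows "ideal I M"
proof -
 interpret cring M by fact
 have inv: "\<ominus>$$M b:I" if "b:I" for b using assms(5)[of "\<ominus>$$M \<one>$$M" b] that assms(2) l_minus by auto
 show ?thesis
 proof (rule idealI)
 show "subgroup I (add_monoid M)" by (rule add.subgroupI) (use assms inv in \<open>auto simp: a_inv_def\<close>)
 fix a x assume ax: "a:I" "x:carrier M"
 thus "x \<otimes>$$M a:I" using assms by simp
 thus "a \<otimes>$$M x:I" using ax assms m_comm[of a x] by auto
 qed (rule ring_axioms)
qed

lemma closure_point_irreducible: "x:topspace T ==> irreducible_closed T (T closure_of {x})" unfolding irreducible_closed_def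
proof (intro conjI allI impI)
 assume x: "x:topspace T"
 hence xc: "x:T closure_of {x}" using closure_of_subset[of "{x}" T] by auto
 thus "T closure_of {x} ~= {}" by auto
 fix A B assume *: "closedin T A & closedin T B & T closure_of {x} = A Un B"
 hence "x:A | x:B" using xc by auto
 thus "A = T closure_of {x} | B = T closure_of {x}" using * closure_of_minimal[of "{x}" A T] closure_of_minimal[of "{x}" B T] by auto
qed simp

locale curve_model = scheme_model X h for X :: "('p, 's, 'm) real_space_scheme" and h :: "('p, 's) ffg => 'k::real_field" +
 assumes curve: "real_algebraic_curve X" and h_real: "h (ff_const X r) = of_real r"
begin
abbreviation "pe U == real_poly_eval (Sec U) (const X U)"

lemma curveD: "structure_hom X:ring_hom real_ring (Sec topX)" "smooth_scheme X" "separated X"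
 "finite_type X" "universally_closed X" "geometrically_integral X" "krull_dim_one (space_top X)"
 using curve by (auto simp: real_algebraic_curve_def is_real_scheme_def proper_scheme_def)



lemma struct_car: "structure_hom X r:car topX" using curveD by (auto simp: ring_hom_def real_ring_def)
lemma const_car: "opn U ==> const X U r:car U" unfolding const_def using res_closed[OF openin_topspace _ _ struct_car] openin_subset by fast

lemma sval_const: "opn U ==> U ~= {} ==> sval U (const X U r) = of_real r"
 unfolding sval_def const_def using germ_restr gp struct_car openin_subset[of "space_top X" U] by (simp add: h_real[unfolded const_germ_def])

lemma AA_ralg: "opn U ==> U ~= {} ==> ralg (AA U)" unfolding ralg_def using AA_subr imageI[OF const_car, of U "sval U"] by (simp add: AA_def sval_const)

lemma sec_emb: "opn U ==> U ~= {} ==> mp_emb (Sec U) (sval U)"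
 by (intro mp_emb.intro sec_cring mp_emb_axioms.intro) (auto simp: sval_mult sval_add sval_one intro: sval_inj)

lemma eval_sec: assumes "opn U" "U ~= {}" "F:mp n" "!!i. i < n ==> x i:car U" shows "sval U (pe U x F) = rev_at (sval U o x) (toE F)" "pe U x F:car U"
 using mp_emb.eval_link[OF sec_emb[OF assms(1,2)] assms(3), of "const X U" of_real x] const_car sval_const assms by auto

lemma alg_gen_chart: assumes U: "opn U" "U ~= {}" and x: "!!i. i < n ==> x i:car U" and "pe U x ` mp n = car U" shows "alg_gen (AA U) n (sval U o x)"
 unfolding alg_gen_def
proof (intro conjI ballI)
 fix a assume "a:AA U"
 then obtain F where "F:mp n" "a = sval U (pe U x F)" unfolding AA_def assms(4)[symmetric] by auto
 thus "EX F:mp n. a = rev_at (sval U o x) (toE F)" using eval_sec[OF U, of F n x] x by auto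
qed (use AA_ralg[OF U] x in \<open>auto simp: AA_def\<close>)

text \<open>By the product rule, the relations whose gradient is a combination of those of the
  \<open>f j\<close> form an ideal. It contains the \<open>f j\<close>, hence the whole ideal of
  relations.\<close>

lemma smooth_chart: assumes x: "x:topX"
 obtains U n c t f N where "x:U" "affine_open X U" "smooth_pres (AA U) n c t f N"
proof -
 obtain U n c t f N where xU: "x:U" and aff: "affine_open X U" and c: "c <= n" and t0: "ALL i<n. t i:car U"
 and f0: "ALL j<c. f j:mp n" and img: "pe U t ` mp n = car U" and ker: "{p:mp n. pe U t p = zr U} = Idl$$(RX n) (f ` {..<c})" and N0: "ALL i<c. ALL k<c. N i k:car U"
 and J0: "ALL j<c. ALL k<c. finsum (Sec U) (%i. pe U t (partial_deriv i (f j)) \<otimes>$$(Sec U) N i k) {..<c}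
    = (if j = k then (un U) else (zr U))" using curveD(2)[unfolded smooth_scheme_def Let_def, rule_format, OF x] by auto
 note t = t0[rule_format] and f = f0[rule_format] and N = N0[rule_format] and J = J0[rule_format]
 have U: "opn U" "U ~= {}" using aff xU affine_opn by auto
 define T where "T = sval U o t"
 interpret M: cring "RX n" by (rule RR.mpoly_cring)
 have ev: "sval U (pe U t F) = rev_at T (toE F)" "pe U t F:car U" if "F:mp n" for F using eval_sec[OF U that t] by (auto simp: T_def)
 have fz: "rev_at T (toE (f j)) = 0" if "j < c" for j
 proof -
 have "f ` {..<c} <= mp n" using f by auto
 hence "f j:Idl$$(RX n) (f ` {..<c})" using that M.genideal_self by auto
 hence "pe U t (f j) = zr U" unfolding ker[symmetric] by simp
 thus ?thesis using ev[OF f[OF that]] sval_zero[OF U] by simp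
 qed
 define D where "D i F = dmev i of_real T (toE F)" for i F
 define J' where "J' = {F:mp n. rev_at T (toE F) = 0 & (EX g. ALL i. D i F = (SUM j<c. g j * D i (f j)))}"
 have "ideal J' (RX n)"
 proof (rule ideal_from[OF RR.mpoly_cring])
 show "\<zero>$$(RX n):J'" unfolding J'_def
 proof (intro CollectI conjI exI[of _ "%_. 0"])
  have z: "toE \<zero>$$(RX n) = 0" by (rule RR.E_hom(5)[OF M.zero_closed M.zero_closed])
  show "rev_at T (toE \<zero>$$(RX n)) = 0" "ALL i. D i \<zero>$$(RX n) = (SUM j<c. 0 * D i (f j))" by (simp_all add: z D_def mev_r)
 qed simp
 fix a b assume b: "b:J'"
 then obtain g where g: "!!i. D i b = (SUM j<c. g j * D i (f j))" and b': "b:mp n" "rev_at T (toE b) = 0" unfolding J'_def by auto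
 { assume a: "a:J'"
  then obtain g' where g': "!!i. D i a = (SUM j<c. g' j * D i (f j))" and a': "a:mp n" "rev_at T (toE a) = 0" unfolding J'_def by auto
  show "a \<oplus>$$(RX n) b:J'" unfolding J'_def
  proof (intro CollectI conjI exI[of _ "%j. g' j + g j"])
  have z: "toE (a \<oplus>$$(RX n) b) = toE a + toE b" by (rule RR.E_hom(2)[OF a'(1) b'(1)])
  show "rev_at T (toE (a \<oplus>$$(RX n) b)) = 0" "ALL i. D i (a \<oplus>$$(RX n) b) = (SUM j<c. (g' j + g j) * D i (f j))"
   using g g' a' b' by (simp_all add: z D_def mev_r sum.distrib als)
  qed (use a' b' in simp) }
 { assume a': "a:mp n"
  show "a \<otimes>$$(RX n) b:J'" unfolding J'_def
  proof (intro CollectI conjI exI[of _ "%j. rev_at T (toE a) * g j"])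
  have z: "toE (a \<otimes>$$(RX n) b) = toE a * toE b" by (rule RR.E_hom(1)[OF a' b'(1)])
  show "rev_at T (toE (a \<otimes>$$(RX n) b)) = 0" "ALL i. D i (a \<otimes>$$(RX n) b) = (SUM j<c. rev_at T (toE a) * g j * D i (f j))"
   using g b' by (simp_all add: z D_def mev_r sdl mult.assoc)
  qed (use a' b' in simp) }
 qed (auto simp: J'_def)
 moreover have "f ` {..<c} <= J'"
 proof
 fix F assume "F:f ` {..<c}"
 then obtain j where j: "j < c" "F = f j" by auto
 thus "F:J'" unfolding J'_def using f fz by (intro CollectI conjI exI[of _ "%k. if k = j then 1 else 0"]) (auto simp: if_distrib if_distribR cong: if_cong)
 qed
 ultimately have IJ: "Idl$$(RX n) (f ` {..<c}) <= J'" by (rule M.genideal_minimal)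
 hence kJ: "F:J'" if "F:mp n" "rev_at T (toE F) = 0" for F
 proof -
 have "pe U t F = zr U" using that ev sval_zero[OF U] sval_inj[OF U] crs(2)[OF sec_cring[OF U(1)]] by simp
 thus ?thesis using that ker IJ by auto
 qed
 interpret E: mp_emb "Sec U" "sval U" by (rule sec_emb[OF U])
 have "smooth_pres (AA U) n c T f (%i k. sval U (N i k))" unfolding smooth_pres_def
 proof (intro conjI allI impI ballI)
 show "alg_gen (AA U) n T" unfolding T_def by (rule alg_gen_chart[OF U t img])
 show "EX g. ALL i. dmev i of_real T (toE F) = (SUM j<c. g j * dmev i of_real T (toE (f j)))" if "F:mp n" "rev_at T (toE F) = 0" for F
  using kJ[OF that] unfolding J'_def D_def by simp
 fix j k assume jk: "j < c" "k < c"
 have pd: "partial_deriv i (f j):mp n" for i using pd_closed f jk by simp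
 have "(SUM i<c. dmev i of_real T (toE (f j)) * sval U (N i k)) =
  sval U (finsum (Sec U) (%i. pe U t (partial_deriv i (f j)) \<otimes>$$(Sec U) N i k) {..<c})"
  using ev pd N jk mev_pd[OF f[OF jk(1)], of T] E.k_mult by (subst E.k_finsum) auto
 thus "(SUM i<c. dmev i of_real T (toE (f j)) * sval U (N i k)) = (if j = k then 1 else 0)" using J[OF jk] sval_zero[OF U] sval_one[OF U] by auto
 qed (use c f fz N in \<open>auto simp: AA_def\<close>)
 thus ?thesis using that xU aff by simp
qed

definition goodU :: "'p set => bool" where "goodU U <-> affine_open X U & U ~= {} & (EX n t. alg_gen (AA U) n t)"

lemma good_cover: "EX UU. finite UU & \<Union>UU = topX & (ALL U:UU. goodU U)"
proof -
 obtain UU where u: "finite UU" "\<Union>UU = topX" "ALL U:UU. affine_open X U &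
   (EX n x. (ALL i<n. x i:carrier (Sec U)) &
    real_poly_eval (Sec U) (const X U) x ` carrier (RX n)
    = carrier (Sec U))" using curveD unfolding finite_type_def by auto
 have "goodU U" if "U:UU - {{}}" for U
 proof -
 have "U ~= {}" "U:UU" using that by auto
 from u(3)[rule_format, OF this(2)] show ?thesis unfolding goodU_def
  by (elim exE conjE) (intro conjI exI, assumption, rule `U ~= {}`, rule alg_gen_chart[OF affine_opn `U ~= {}`], auto)
 qed
 thus ?thesis using u by (intro exI[of _ "UU - {{}}"]) auto
qed

lemma smooth_good: "affine_open X U ==> x:U ==> smooth_pres (AA U) n c t f N ==> goodU U" unfolding goodU_def smooth_pres_def by auto

lemma goodUD: assumes "goodU U" shows "affine_open X U" "U ~= {}" "opn U" "EX B. filt B (AA U)"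
 using assms affine_opn unfolding goodU_def by (auto 0 0) (metis alg_gen_filt)

lemma aff_spec: assumes U: "affine_open X U" "U ~= {}" and xy: "x:U" "y:U" shows "y:space_top X closure_of {x} <-> MU U x <= MU U y"
proof
 assume y: "y:space_top X closure_of {x}"
 show "MU U x <= MU U y"
 proof (rule ccontr)
 assume "~ ?thesis"
 then obtain g where "g:AA U" "g:Mst x" "g ~: Mst y" by auto
 thus False using aff_basic_open[OF U, of g] y[unfolded in_closure_of, THEN conjunct2, rule_format, of "{z:U. g ~: Mst z}"] xy by auto
 qed
next
 assume s: "MU U x <= MU U y"
 have "x:W" if W: "opn W" "y:W" for W
 proof -
 have "opn (W Int U)" using W affine_opn[OF U(1)] by auto
 then obtain g where "g:AA U" "g ~: Mst y" "{z:U. g ~: Mst z} <= W Int U" using aff_basis[OF U, of "W Int U" y] W xy by auto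
 thus ?thesis using s xy by auto
 qed
 moreover have "y:topX" using xy affine_opn[OF U(1)] openin_subset by auto
 ultimately show "y:space_top X closure_of {x}" unfolding in_closure_of by simp
qed

lemma AA_gp: "opn U ==> U ~= {} ==> MU U gp = {0}" using Ost_gp subrD[OF AA_subr] by auto

text \<open>The closures of the generic point and of the points belonging to \<open>p\<close> and
  \<open>m\<close> would be three nested irreducible closed sets.\<close>

lemma no_chain: assumes U: "affine_open X U" "U ~= {}" and p: "prm p (AA U)" "prm m (AA U)" "p ~= {0}" "p \<subset> m" shows False
proof -
 obtain x where x: "x:U" "p = MU U x" using aff_point[OF U p(1)] by auto
 obtain y where y: "y:U" "m = MU U y" using aff_point[OF U p(2)] by auto
 have g: "gp:U" "MU U gp = {0}" using gp AA_gp affine_opn U by auto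
 let ?c = "%z. space_top X closure_of {z}"
 have 1: "y:?c x" "x ~: ?c y" using aff_spec[OF U] x y p by auto
 have 2: "x:?c gp" "gp ~: ?c x" using aff_spec[OF U] x g p prmD[OF p(1)] by auto
 have t: "x:topX" "y:topX" using x y openin_subset[OF affine_opn[OF U(1)]] by auto
 have s: "z:?c z" if "z:topX" for z using that by (auto simp: in_closure_of)
 have "?c y <= ?c x" "?c x <= ?c gp" using 1 2 by (simp_all add: closure_of_minimal)
 hence "?c y \<subset> ?c x" "?c x \<subset> ?c gp" using 1 2 s[OF t(1)] s[OF gp_top] by auto
 thus False using curveD(7)[unfolded krull_dim_one_def, THEN conjunct2] closure_point_irreducible[OF gp_top] closure_point_irreducible[OF t(1)]
 closure_point_irreducible[OF t(2)] by metis
qed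

lemma good_dep: assumes "goodU U" "x:AA U" "y:AA U" shows "algdep x y"
proof (rule ccontr)
 assume n: "~ ?thesis"
 note U = goodUD(1,2)[OF assms(1)]
 obtain B where B: "filt B (AA U)" using goodUD[OF assms(1)] by auto
 show False using two_step_chain[OF AA_ralg B assms(2,3) n] no_chain[OF U] affine_opn U by auto
qed

text \<open>The name anticipates \<open>closed_points_cp\<close>: in dimension one all points except
  the generic one are closed.\<close>

definition cp :: "'p set" where "cp = topX - {gp}"

lemma cp_prime: assumes U: "affine_open X U" and x: "x:U" "x:cp" shows "MU U x ~= {0}" "!!J. idl J (AA U) ==> MU U x <= J ==> 1 ~: J ==> J = MU U x"
 "!!q. prm q (AA U) ==> q <= MU U x ==> q = {0} | q = MU U x"
proof -
 have U': "U ~= {}" "opn U" using x affine_opn[OF U] by auto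
 note pr = aff_prime[OF U U'(1) x(1)]
 show n: "MU U x ~= {0}" using aff_inj[OF U U'(1) x(1), of gp] AA_gp gp U' x by (auto simp: cp_def)
 show "q = {0} | q = MU U x" if "prm q (AA U)" "q <= MU U x" for q using no_chain[OF U U'(1) that(1) pr] that by auto
 fix J assume J: "idl J (AA U)" "MU U x <= J" "1 ~: J"
 obtain P where P: "prm P (AA U)" "J <= P" using max_exists[OF AA_subr[OF U'(2,1)] J(1,3)] by metis
 thus "J = MU U x" using no_chain[OF U U'(1) pr P(1) n] J by auto
qed

lemma closed_points_cp: "closed_points X = cp"
proof
 show "closed_points X <= cp"
 proof
 fix x assume x: "x:closed_points X"
 have "x ~= gp"
 proof
  assume g: "x = gp"
  have "opn (topX - {gp})" using x g by (auto simp: closed_points_def)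
  hence "topX = {gp}" using gp gp_top by auto
  hence "Z = {gp}" if "irreducible_closed (space_top X) Z" for Z using that closedin_subset[of "space_top X" Z] unfolding irreducible_closed_def by auto
  thus False using curveD unfolding krull_dim_one_def by blast
 qed
 thus "x:cp" using x by (simp add: cp_def closed_points_def)
 qed
 show "cp <= closed_points X"
 proof
 fix x assume x: "x:cp"
 have "y = x" if y: "y:space_top X closure_of {x}" for y
 proof -
  have yt: "y:topX" using y by (simp add: in_closure_of)
  then obtain U where U: "affine_open X U" "y:U" using aff_cover by auto
  hence xU: "x:U" using y affine_opn unfolding in_closure_of by simp
  have "MU U x <= MU U y" using aff_spec[OF U(1) _ xU U(2)] y xU by auto
  moreover have "idl (MU U y) (AA U)" "1 ~: MU U y" using prmD[OF aff_prime[OF U(1) _ U(2)]] U by auto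
  ultimately show "y = x" using aff_inj[OF U(1) _ U(2) xU] cp_prime[OF U(1) xU x] U by auto
 qed
 hence "space_top X closure_of {x} = {x}" using x closure_of_subset[of "{x}" "space_top X"] by (auto simp: cp_def)
 thus "x:closed_points X" using x closedin_closure_of[of "space_top X" "{x}"] by (simp add: closed_points_def cp_def)
 qed
qed

lemma Mst_mx: "Mst x = mx (Ost x)" by (simp add: Mst_def mx_def)

text \<open>If no \<open>a - c\<close> lies in the prime, each of them is invertible modulo the
  prime because this prime is maximal, and \<open>nullstellensatz\<close> applies.\<close>

lemma cp_alg: assumes U: "goodU U" and x: "x:U" "x:cp" and a: "a:AA U" shows "EX q. q ~= 0 & pev q a:MU U x"
proof (cases "EX c. a - of_real c:MU U x")
 case True
 then obtain c where "a - of_real c:MU U x" by auto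
 thus ?thesis by (intro exI[of _ "[:- c, 1:]"]) simp
next
 case False
 note aff = goodUD(1-3)[OF U]
 obtain B where B: "filt B (AA U)" using goodUD[OF U] by auto
 note R = AA_ralg[OF aff(3,2)]
 have I: "idl (MU U x) (AA U)" using prmD(1)[OF aff_prime[OF aff(1,2) x(1)]] .
 show ?thesis
 proof (rule nullstellensatz[OF R B I a])
 fix c
 have z: "a - of_real c:AA U" using subrD(6)[OF ralgD(1)[OF R] a ralgD(2)[OF R]] .
 note J = idl_add_principal[OF ralgD(1)[OF R] I z]
 have "1:{p + b * (a - of_real c) |p b. p:MU U x & b:AA U}" using cp_prime(2)[OF aff(1) x J(1,2)] J(3) False by auto
 then obtain p b where pb: "1 = p + b * (a - of_real c)" "p:MU U x" "b:AA U" by auto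
 hence "b * (a - of_real c) - 1 = - p" by (simp add: als)
 thus "EX b:AA U. b * (a - of_real c) - 1:MU U x" using pb idl_minus[OF ralgD(1)[OF R] I] by metis
 qed
qed

lemma Ost_real: "x:topX ==> of_real r:Ost x" using ralgD[OF AA_ralg] Ost_AA[of topX x] by auto

lemma K_frac: assumes "affine_open X U" "U ~= {}" shows "EX a:AA U. EX b:AA U. b ~= 0 & k = a / b"
proof -
 have "gp:U" using gp affine_opn assms by simp
 thus ?thesis using aff_Ost[OF assms, of gp k] Ost_gp by auto
qed

lemma cp_dvr: assumes x: "x:cp" shows "dvr (Ost x)" "residues (Ost x)"
proof -
 have xt: "x:topX" using x by (simp add: cp_def)
 obtain U n c t f N where U: "x:U" "affine_open X U" "smooth_pres (AA U) n c t f N" using smooth_chart[OF xt] .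
 have g: "goodU U" using smooth_good U by simp
 have U': "opn U" "U ~= {}" using U affine_opn by auto
 have 1: "idl (mx (Ost x)) (Ost x)" using prmD[OF Mst_idl[OF xt]] by (simp add: Mst_mx)
 have 2: "prm (MU U x) (AA U)" using aff_prime[OF U(2) U'(2) U(1)] .
 have 3: "EX a:AA U. EX g:AA U. g ~: mx (Ost x) & g ~= 0 & b = a / g" if "b:Ost x" for b using aff_Ost[OF U(2) U'(2) U(1)] that by (simp add: Mst_mx)
 have 4: "MU U x = AA U Int mx (Ost x)" by (simp add: Mst_mx)
 show "residues (Ost x)" by (rule residues_local[OF AA_ralg[OF U'] Ost_subr[OF xt] Ost_AA[OF U'(1) U(1)] 1 4 2 3 cp_alg[OF g U(1) x]])
 show "dvr (Ost x)" by (rule dvr_local[OF AA_ralg[OF U'] Ost_subr[OF xt] Ost_AA[OF U'(1) U(1)] 1 4 2 3 cp_alg[OF g U(1) x] U(3) good_dep[OF g]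
  cp_prime(1)[OF U(2,1) x] cp_prime(3)[OF U(2,1) x] K_frac[OF U(2) U'(2)]])
qed

end

lemma res_pev: assumes "subr Ol" "idl (mx Ol) Ol" "!!r. of_real r:Ol" "residues Ol" "(x :: 'k::real_field):Ol" shows "pev q x:Ol & res Ol (pev q x) = pev q (res Ol x)"
proof (induction q)
 case 0 thus ?case using res_real[OF assms(1-4), of 0] subrD[OF assms(1)] by simp
next
 case (pCons a q)
 thus ?case using res_add[OF assms(1-4), of "of_real a" "x * pev q x"] res_mult[OF assms(1-4,5), of "pev q x"] assms res_real[OF assms(1-4), of a] subrD[OF assms(1)] by simp
qed

lemma mev_cong: assumes "p:VS n" "!!i. i < n ==> s i = t i" shows "mev c s p = mev c t p" unfolding mev_def
proof (rule sum.cong[OF refl])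
 fix m assume "m:kys p"
 hence "set_mset m <= {..<n}" using assms by (simp add: VS_def)
 hence "image_mset s m = image_mset t m" using assms by (intro image_mset_cong) auto
 thus "c (lk p m) * (PROD i:#m. s i) = c (lk p m) * (PROD i:#m. t i)" by simp
qed

lemma vl_div: "dvr Ol ==> a ~= 0 ==> b ~= 0 ==> vl Ol (a / b) = vl Ol a - vl Ol b" using vl_mult[of Ol "a / b" b] by simp

context curve_model
begin

lemma cp_loc: assumes "x:cp" shows "subr (Ost x)" "idl (mx (Ost x)) (Ost x)" "!!r. of_real r:Ost x" "residues (Ost x)" "x:topX"
 using assms Ost_subr prmD[OF Mst_idl] Ost_real cp_dvr by (auto simp: Mst_mx cp_def)

text \<open>By \<open>algdep_reduced\<close> some nonzero polynomial in each generator
  \<open>t i\<close> is a multiple of \<open>a\<close>. At a zero of \<open>a\<close> the residue of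
  \<open>t i\<close> is therefore one of finitely many roots, and the residues of the generators
  determine the point.\<close>

lemma finite_zeros: assumes U: "goodU U" and a: "a:AA U" "a ~= 0" shows "finite {x:U Int cp. a:Mst x}"
proof -
 note U' = goodUD(1-3)[OF U]
 obtain n t where g: "alg_gen (AA U) n t" using U unfolding goodU_def by auto
 have t: "t i:AA U" if "i < n" for i using g that by (simp add: alg_gen_def)
 have "EX q. q ~= 0 & (EX G'. pev q (t i) = a * ev2 G' a (t i))" if "i < n" for i using algdep_reduced[OF a(2) good_dep[OF U a(1) t[OF that]]] by metis
 then obtain q where q: "!!i. i < n ==> q i ~= 0 & (EX G'. pev (q i) (t i) = a * ev2 G' a (t i))" by metis
 let ?Z = "{x:U Int cp. a:Mst x}"
 let ?r = "%x. \<lambda>i\<in>{..<n}. res (Ost x) (t i)"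
 have "?r ` ?Z <= (\<Pi>\<^sub>E i\<in>{..<n}. {z. pev (q i) z = 0})"
 proof (rule image_subsetI)
 fix x assume x: "x:?Z"
 hence xc: "x:cp" and AO: "AA U <= Ost x" using Ost_AA[OF U'(3)] by auto
 have "pev (q i) (res (Ost x) (t i)) = 0" if i: "i < n" for i
 proof -
  obtain G where G: "pev (q i) (t i) = a * ev2 G a (t i)" using q[OF i] by auto
  have "ev2 G a (t i):Ost x" using ev2_mem[OF AA_ralg[OF U'(3,2)] a(1) t[OF i]] AO by auto
  hence "a * ev2 G a (t i):mx (Ost x)" using x by (intro idlD(5)[OF cp_loc(2)[OF xc]]) (auto simp: Mst_mx)
  hence "res (Ost x) (pev (q i) (t i)) = 0" unfolding G using res_zero_iff[OF cp_loc(1-4)[OF xc]] idlD[OF cp_loc(2)[OF xc]] by simp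
  thus ?thesis using res_pev[OF cp_loc(1-4)[OF xc]] t[OF i] AO by auto
 qed
 thus "?r x:(\<Pi>\<^sub>E i\<in>{..<n}. {z. pev (q i) z = 0})" by auto
 qed
 moreover have "finite (\<Pi>\<^sub>E i\<in>{..<n}. {z :: complex. pev (q i) z = 0})" using q pev_finite_roots by (intro finite_PiE) auto
 ultimately have "finite (?r ` ?Z)" by (rule finite_subset)
 \<comment> \<open>The residues of the generators decide which elements of \<open>AA U\<close>
   vanish at a point, and these make up its prime.\<close>
 moreover have "inj_on ?r ?Z"
 proof (rule inj_onI)
 fix x y assume x: "x:?Z" and y: "y:?Z" and e: "?r x = ?r y"
 have e': "res (Ost x) (t i) = res (Ost y) (t i)" if "i < n" for i using fun_cong[OF e, of i] that by simp
 have "b:Mst x <-> b:Mst y" if b: "b:AA U" for b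
 proof -
  obtain F where F: "F:mp n" "b = rev_at t (toE F)" using g b unfolding alg_gen_def by auto
  have r: "b:Mst z <-> mev of_real (%i. res (Ost z) (t i)) (toE F) = 0" if z: "z:U" "z:cp" for z
  proof -
  have ti: "t i:Ost z" if "i < n" for i using t[OF that] Ost_AA[OF U'(3) z(1)] by auto
  note * = res_mev[OF cp_loc(1-4)[OF z(2)], of n t "toE F", OF ti mp_VS[OF F(1)]]
  show ?thesis using res_zero_iff[OF cp_loc(1-4)[OF z(2)] *(1)] *(2) by (simp add: F Mst_mx)
  qed
  have "mev of_real (%i. res (Ost x) (t i)) (toE F) = mev of_real (%i. res (Ost y) (t i)) (toE F)" by (rule mev_cong[OF mp_VS[OF F(1)] e'])
  thus ?thesis using r x y by simp
 qed
 thus "x = y" using aff_inj[OF U'(1,2), of x y] x y by auto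
 qed
 ultimately show ?thesis by (rule finite_imageD)
qed

lemma finite_support: assumes "f ~= 0" shows "finite {x:cp. vl (Ost x) f ~= 0}"
proof -
 obtain UU where u: "finite UU" "\<Union>UU = topX" "!!U. U:UU ==> goodU U" using good_cover by auto
 have "finite {x:U Int cp. vl (Ost x) f ~= 0}" if "U:UU" for U
 proof -
 note U = goodUD[OF u(3)[OF that]]
 obtain a b where ab: "a:AA U" "b:AA U" "b ~= 0" "f = a / b" using K_frac[OF U(1,2), of f] by auto
 hence a0: "a ~= 0" using assms by auto
 have "vl (Ost x) c = 0" if x: "x:U" "x:cp" and c: "c:AA U" "c ~= 0" "c ~: Mst x" for c x
  using vl_unit[OF cp_dvr(1)[OF x(2)], of c] Ost_AA[OF U(3) x(1)] c by (auto simp: Mst_mx)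
 hence "{x:U Int cp. vl (Ost x) f ~= 0} <= {x:U Int cp. a:Mst x} Un {x:U Int cp. b:Mst x}" using vl_div[OF cp_dvr(1), of _ a b] ab a0 by fastforce
 thus ?thesis using finite_subset finite_UnI[OF finite_zeros[OF u(3)[OF that] ab(1) a0] finite_zeros[OF u(3)[OF that] ab(2,3)]] by auto
 qed
 hence "finite (UN U:UU. {x:U Int cp. vl (Ost x) f ~= 0})" using u by simp
 moreover have "{x:cp. vl (Ost x) f ~= 0} <= (UN U:UU. {x:U Int cp. vl (Ost x) f ~= 0})" using u by (auto simp: cp_def)
 ultimately show ?thesis by (rule finite_subset[rotated])
qed

text \<open>By separatedness the functions on \<open>U Int V\<close> are generated by those on
  \<open>U\<close> and on \<open>V\<close>, so all of them are regular at \<open>Q\<close>. The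
  functions among them vanishing at \<open>Q\<close> form a prime, hence belong to a point of
  \<open>U Int V\<close>, and comparison in \<open>V\<close> shows that this point is
  \<open>Q\<close>. Then both points lie in \<open>U\<close>, where their primes are
  comparable.\<close>

lemma indep: assumes P: "P:cp" and Q: "Q:cp" and s: "Ost P <= Ost Q" shows "P = Q"
proof -
 obtain U V where U: "affine_open X U" "P:U" and V: "affine_open X V" "Q:V" using aff_cover cp_loc P Q by meson
 let ?W = "U Int V"
 have W: "affine_open X ?W" "generate_ring (Sec ?W) (restr X U ?W ` car U Un restr X V ?W ` car V) = car ?W" using curveD[unfolded separated_def] U V by auto
 note o = affine_opn[OF U(1)] affine_opn[OF V(1)] affine_opn[OF W(1)]
 have ne: "U ~= {}" "V ~= {}" "?W ~= {}" using U V gp o by auto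
 note OQ = cp_loc[OF Q]
 have AU: "AA U <= Ost Q" "AA V <= Ost Q" using Ost_AA[OF o(1) U(2)] Ost_AA[OF o(2) V(2)] s by auto
 have "sval ?W c:Ost Q & c:car ?W" if "c:generate_ring (Sec ?W) (restr X U ?W ` car U Un restr X V ?W ` car V)" for c using that
 proof (induction rule: generate_ring.induct)
 case one thus ?case using sval_one[OF o(3) ne(3)] subrD[OF OQ(1)] crs(6)[OF sec_cring[OF o(3)]] by simp
 next
 case (incl c)
 thus ?case using sval_restr[OF o(1) ne(1) o(3) ne(3)] sval_restr[OF o(2) ne(2) o(3) ne(3)] res_closed[OF o(1,3)] res_closed[OF o(2,3)] AU by (auto simp: AA_def)
 next
 case (a_inv c) thus ?case using sval_neg[OF o(3) ne(3)] subrD[OF OQ(1)] crs(3)[OF sec_cring[OF o(3)]] by simp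
 next
 case (eng_add c d) thus ?case using sval_add[OF o(3) ne(3)] subrD[OF OQ(1)] crs(1)[OF sec_cring[OF o(3)]] by simp
 next
 case (eng_mult c d) thus ?case using sval_mult[OF o(3) ne(3)] subrD[OF OQ(1)] crs(5)[OF sec_cring[OF o(3)]] by simp
 qed
 hence AW: "AA ?W <= Ost Q" using W by (auto simp: AA_def)
 have sub: "AA V <= AA ?W" "AA U <= AA ?W" using sval_restr[OF o(1) ne(1) o(3) ne(3)] sval_restr[OF o(2) ne(2) o(3) ne(3)] res_closed[OF o(1,3)] res_closed[OF o(2,3)]
 unfolding AA_def by (force simp: image_iff)+
 have "prm (AA ?W Int Mst Q) (AA ?W)" using Mst_idl[OF OQ(5)] AW AA_subr[OF o(3) ne(3)] unfolding prm_def idl_def subr_def by (simp add: subset_iff)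
 then obtain w where w: "w:?W" "AA ?W Int Mst Q = AA ?W Int Mst w" using aff_point[OF W(1) ne(3)] by auto
 hence "AA V Int Mst Q = AA V Int Mst w" using sub by auto
 hence QU: "Q:U" using aff_inj[OF V(1) ne(2) V(2), of w] w by auto
 have "a:Mst P" if "a:Ost P" "a:Mst Q" for a using that s unfolding Mst_def by auto
 hence "MU U Q <= MU U P" using Ost_AA[OF o(1) U(2)] by auto
 hence "MU U P = MU U Q" by (rule cp_prime(2)[OF U(1) QU Q prmD(1)[OF aff_prime[OF U(1) ne(1) U(2)]] _ prmD(2)[OF aff_prime[OF U(1) ne(1) U(2)]]])
 thus ?thesis by (rule aff_inj[OF U(1) ne(1) U(2) QU])
qed

text \<open>If \<open>s\<close> is a section representing such an \<open>i\<close>, the pairs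
  \<open>(s, 1)\<close> and \<open>(s, -1)\<close> are zero divisors in the
  complexification.\<close>

lemma no_sqrt_minus_one: "(i :: 'k)^2 + 1 ~= 0"
proof
 assume i: "i^2 + 1 = 0"
 have "i:Ost gp" using Ost_gp by simp
 then obtain U s where U: "opn U" "gp:U" "s:car U" "sval U s = i" unfolding Ost_def by auto
 hence ne: "U ~= {}" by auto
 interpret C: domain "complexification (Sec U)" using curveD(6)[unfolded geometrically_integral_def, THEN conjunct2] U by auto
 interpret A: cring "Sec U" using sec_cring[OF U(1)] .
 have "sval U (s \<otimes>$$(Sec U) s \<oplus>$$(Sec U) (un U)) = sval U (zr U)" using U ne i by (simp add: sval_add sval_mult sval_one sval_zero p2)
 hence s2: "s \<otimes>$$(Sec U) s \<oplus>$$(Sec U) (un U) = zr U" by (rule sval_inj[OF U(1) ne, rotated 2]) (use U(3) in simp_all)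
 have s3: "s \<otimes>$$(Sec U) s \<ominus>$$(Sec U) (un U) \<otimes>$$(Sec U) (\<ominus>$$(Sec U) (un U)) = zr U"
 "s \<otimes>$$(Sec U) (\<ominus>$$(Sec U) (un U)) \<oplus>$$(Sec U) (un U) \<otimes>$$(Sec U) s = zr U" using U s2 by (simp_all add: A.minus_eq A.r_minus A.l_neg)
 have "(s, un U) \<otimes>$$(complexification (Sec U)) (s, \<ominus>$$(Sec U) (un U)) = \<zero>$$(complexification (Sec U))" using s3 by (simp add: complexification_def)
 hence "(s, un U) = \<zero>$$(complexification (Sec U)) | (s, \<ominus>$$(Sec U) (un U)) = \<zero>$$(complexification (Sec U))"
 using U by (intro C.integral) (auto simp: complexification_def)
 hence "sval U (un U) = 0 | sval U (\<ominus>$$(Sec U) (un U)) = 0" using sval_zero[OF U(1) ne] by (auto simp: complexification_def)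
 thus False using sval_one[OF U(1) ne] sval_neg[OF U(1) ne A.one_closed] by simp
qed

text \<open>Apply \<open>residue_quadratic\<close> to the zero ideal of the whole field: a nonreal
  algebraic element would give a square root of -1.\<close>

lemma algebraic_real: assumes "q ~= 0" "pev q (f :: 'k) = 0" shows "EX r. f = of_real r"
proof -
 have A: "ralg (UNIV :: 'k set)" "prm {0} (UNIV :: 'k set)" by (auto simp: ralg_def subr_def prm_def idl_def)
 from residue_quadratic[OF A _ assms(1), of f] assms(2)
 have "(EX r. f - of_real r = 0) | (EX u w. w ~= 0 & (f - of_real u)^2 + of_real (w^2) = 0)" by simp
 thus ?thesis
 proof
 assume "EX u w. w ~= 0 & (f - of_real u)^2 + of_real (w^2) = 0"
 then obtain u w where w: "w ~= 0" "(f - of_real u)^2 + of_real (w^2) = 0" by auto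
 hence "((f - of_real u) / of_real w)^2 + 1 = ((f - of_real u)^2 + of_real (w^2)) / of_real (w^2)" unfolding add_divide_distrib power_divide by simp
 thus ?thesis using no_sqrt_minus_one w by auto
 qed auto
qed

text \<open>The denominators of \<open>f\<close> form an ideal that is contained in the prime of no
  point, hence in no prime.\<close>

lemma regular_AA: assumes U: "affine_open X U" "U ~= {}" and f: "!!x. x:U ==> f:Ost x" shows "f:AA U"
proof -
 have A: "subr (AA U)" using AA_subr affine_opn U by simp
 let ?I = "{g:AA U. g * f:AA U}"
 have I: "idl ?I (AA U)" using A unfolding idl_def by (auto simp: subrD distrib_right mult.assoc)
 have "1:?I"
 proof (rule ccontr)
 assume "1 ~: ?I"
 from max_exists[OF A I this] obtain P where P: "prm P (AA U)" "?I <= P" by metis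
 obtain x where x: "x:U" "P = MU U x" using aff_point[OF U P(1)] by auto
 obtain a g where "a:AA U" "g:AA U" "g ~: Mst x" "g ~= 0" "f = a / g" using f[OF x(1)] aff_Ost[OF U x(1), of f] by auto
 thus False using P x by auto
 qed
 thus ?thesis by simp
qed

end

section \<open>Properness: functions without poles are constant\<close>

lemma (in mp_emb) eval_prime:
 fixes c :: "'b => 'k::field" assumes c: "rhom c" shows "primeideal {F:carrier (MP n). mev c t (E F) = 0} (MP n)" (is "primeideal ?I ?M")
proof -
 interpret M: cring ?M by (rule mpoly_cring)
 note e = E_hom(1,2)[where n = n] mev_mult[OF c] mev_add[OF c]
 have z: "E \<zero>$$?M = 0" "E \<one>$$?M = 1" using E_hom[OF M.zero_closed M.zero_closed] by auto
 have I: "ideal ?I ?M" by (rule ideal_from[OF mpoly_cring]) (auto simp: e z mev_zero[OF c])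
 show ?thesis
 proof (rule primeidealI[OF I mpoly_cring])
 show "carrier ?M ~= ?I" using mev_one[OF c, of t] z by force
 qed (auto simp: e)
qed

lemma mev_univariate: assumes "P:VS 1"
 obtains q where "!!y. mev of_real (%_. y :: 'k::real_field) P = pev q y" "q = 0 ==> P = 0"
proof
 let ?q = "SUM m:kys P. monom (lk P m) (size m)"
 have m0: "m = replicate_mset (size m) 0" if "m:kys P" for m using assms that by (intro set_mset_subset_singletonD) (auto simp: VS_def)
 have mon: "pev (monom a n) y = of_real a * y ^ n" for a n and y :: 'k by (induction n) (simp_all add: monom_0 monom_Suc)
 show "mev of_real (%_. y) P = pev ?q y" for y :: 'k unfolding mev_def pev_sum by (intro sum.cong refl) (simp add: mon)
 assume q: "?q = 0"
 show "P = 0"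
 proof (rule ccontr)
 assume "P ~= 0"
 then obtain m where m: "m:kys P" by force
 have "coeff ?q (size m) = (SUM k:kys P. if k = m then lk P m else 0)"
  unfolding coeff_sum by (intro sum.cong refl) (use m0[OF m] m0 in \<open>auto simp: coeff_monom\<close>, metis)
 also have "... = lk P m" using m by simp
 finally show False using q m by auto
 qed
qed

context curve_model
begin

lemma stalk_emb: "x:topX ==> mp_emb (st x) shom" by (intro mp_emb.intro stalk_cring mp_emb_axioms.intro) (simp_all add: shom_mult shom_add shom_one, metis shom_inj)

lemma shom_const: "x:topX ==> const_germ X x r:cst x" "x:topX ==> shom (const_germ X x r) = of_real r"
 unfolding const_germ_def using germ_car[OF openin_topspace _ struct_car, of x] shom_germ[OF openin_topspace _ struct_car, of x]
 by (simp_all add: sval_def h_real[unfolded const_germ_def])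

lemma shom_stalk_max: "x:topX ==> a:cst x ==> a:stalk_max X x <-> shom a:Mst x" using shom_unit by (auto simp: stalk_max_def)

text \<open>Consider the closed set \<open>1 - f T = 0\<close> in the product of the curve with the
  affine line. If \<open>f\<close> is not constant, its image in the line contains the generic
  point; being closed, the image then contains the origin, where \<open>1 - f T = 0\<close> is
  impossible.\<close>

theorem regular_const: assumes f: "!!x. x:cp ==> f:Ost x" shows "EX r. f = of_real r"
proof (cases "f = 0")
 case True thus ?thesis by simp
next
 case f0: False
 have fO: "f:Ost x" if "x:topX" for x using f Ost_gp that by (cases "x = gp") (auto simp: cp_def)
 define fx where "fx x = (SOME a. a:cst x & shom a = f)" for x
 have fx: "fx x:cst x" "shom (fx x) = f" if "x:topX" for x
 proof -
 have "EX a. a:cst x & shom a = f" using fO[OF that] unfolding shom_img[of x, symmetric] by auto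
 from someI_ex[OF this] show "fx x:cst x" "shom (fx x) = f" unfolding fx_def by auto
 qed
 let ?S = "%x. mpoly_ring (st x) 1"
 \<comment> \<open>The polynomial \<open>1 - f T\<close> over the stalk at \<open>x\<close>;
   \<open>Tx\<close> is the coordinate \<open>T\<close> of the line, pulled back.\<close>
 define Fx where "Fx x m = (if m = {#} then \<one>$$(st x) else if m = {#0::nat#} then \<ominus>$$(st x) fx x else \<zero>$$(st x))" for x m
 define Tx where "Tx x m = const_germ X x (if m = {#0::nat#} then 1 else 0)" for x m
 let ?E = "mp_emb.E shom"
 have Fx: "Fx x:carrier (?S x)" "?E (Fx x) = sgl 0 1 + sgl {#0#} (- f)" and Tx: "Tx x:carrier (?S x)" "?E (Tx x) = sgl {#0#} 1" if x: "x:topX" for x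
 proof -
 interpret S: mp_emb "st x" shom by (rule stalk_emb[OF x])
 have cz: "const_germ X x 0 = \<zero>$$(st x)" using shom_const[OF x, of 0] S.k_eq0 by simp
 have "{m. Fx x m ~= \<zero>$$(st x)} <= {{#}, {#0#}}" "{m. Tx x m ~= \<zero>$$(st x)} <= {{#0#}}" by (auto simp: Fx_def Tx_def cz)
 hence fin: "finite {m. Fx x m ~= \<zero>$$(st x)}" "finite {m. Tx x m ~= \<zero>$$(st x)}" by (auto intro: finite_subset)
 show F: "Fx x:carrier (?S x)" unfolding S.mp_car using fin fx[OF x] by (auto simp: Fx_def)
 show T: "Tx x:carrier (?S x)" unfolding S.mp_car using shom_const[OF x] by (auto simp: Tx_def cz)
 show "?E (Fx x) = sgl 0 1 + sgl {#0#} (- f)"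
  by (rule poly_mapping_eqI) (use fx[OF x] in \<open>auto simp: S.lookup_E[OF F] Fx_def lookup_add lookup_single lookup_one S.k_one S.k_neg S.k_zero\<close>)
 show "?E (Tx x) = sgl {#0#} 1" by (rule poly_mapping_eqI) (use shom_const[OF x] in \<open>auto simp: S.lookup_E[OF T] Tx_def lookup_single when_def\<close>)
 qed
 define Z where "Z = {(x, Q):affine_space_points X 1. Fx x:Q}"
 have Zc: "affine_space_closed X 1 Z" unfolding affine_space_closed_def
 proof (intro conjI allI impI)
 fix U assume U: "affine_open X U"
 show "EX I <= carrier (mpoly_ring (Sec U) 1). ALL (x, Q):affine_space_points X 1. x:U -->
    ((x, Q):Z <-> (ALL f:I. (%m. germ X x U (f m)):Q))"
 proof (cases "U = {}")
  case False
  note o = affine_opn[OF U]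
  interpret S: mp_emb "Sec U" "sval U" by (rule sec_emb[OF o False])
  have "f:AA U" by (rule regular_AA[OF U False fO]) (use openin_subset[OF o] in auto)
  then obtain s where s: "s:car U" "sval U s = f" by (auto simp: AA_def)
  define F where "F m = (if m = {#} then (un U) else if m = {#0::nat#} then \<ominus>$$(Sec U) s else (zr U))" for m
  have "{m. F m ~= zr U} <= {{#}, {#0#}}" by (auto simp: F_def)
  hence "finite {m. F m ~= zr U}" by (auto intro: finite_subset)
  hence Fc: "F:carrier (mpoly_ring (Sec U) 1)" unfolding S.mp_car using s by (auto simp: F_def)
  have "(%m. germ X x U (F m)) = Fx x" if xU: "x:U" for x
  proof
  fix m
  have x: "x:topX" using xU openin_subset[OF o] by auto
  interpret T: mp_emb "st x" shom by (rule stalk_emb[OF x])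
  have Fm: "F m:car U" using s by (auto simp: F_def)
  have "shom (germ X x U (F m)) = shom (Fx x m)" unfolding shom_germ[OF o xU Fm]
   using fx[OF x] s by (auto simp: F_def Fx_def S.k_one S.k_neg S.k_zero T.k_one T.k_neg T.k_zero)
  moreover have "Fx x m:cst x" using fx[OF x] by (auto simp: Fx_def)
  ultimately show "germ X x U (F m) = Fx x m" using shom_inj germ_car[OF o xU Fm] by simp
  qed
  thus ?thesis using Fc by (intro exI[of _ "{F}"]) (auto simp: Z_def)
 qed auto
 qed (auto simp: Z_def)
 let ?M = "RX 1"
 have closed: "closedin (spec_top ?M) (affine_space_proj X 1 ` Z)" using curveD Zc unfolding universally_closed_def by simp
 interpret G: mp_emb K shom by (rule stalk_emb[OF gp_top])
 \<comment> \<open>The point over the generic point of the curve given by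
   \<open>T = 1/f\<close>.\<close>
 define Q where "Q = {F:carrier (?S gp). mev id (%_. inverse f) (?E F) = 0}"
 have gQ: "(gp, Q):Z" unfolding Z_def affine_space_points_def
 proof (intro CollectI case_prodI conjI ballI)
 show "primeideal Q (?S gp)" unfolding Q_def by (rule G.eval_prime[OF rhom_id])
 show "gp:topX" by (rule gp_top)
 show "mpoly_const K a:Q <-> a:stalk_max X gp" if "a:carrier K" for a
  using G.mpoly_const_closed[OF that] shom_stalk_max[OF gp_top that] by (simp add: Q_def G.E_const[OF that] mev_single[OF rhom_id] Ost_gp)
 show "Fx gp:Q" using Fx[OF gp_top] f0 by (simp add: Q_def mev_add[OF rhom_id] mev_single[OF rhom_id] mev_one[OF rhom_id])
 qed
 show ?thesis
 proof (rule ccontr)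
 assume nr: "~ ?thesis"
 \<comment> \<open>A nonconstant \<open>f\<close> is not algebraic over the reals, so this point
   lies over the generic point of the line.\<close>
 have proj: "affine_space_proj X 1 (gp, Q) = {\<zero>$$?M}" "primeideal {\<zero>$$?M} ?M"
 proof -
  have ev: "(%m. ff_const X (p m)):carrier (?S gp)" "mev id (%_. inverse f) (?E (%m. ff_const X (p m))) = rev_at (%_. inverse f) (toE p)" if p: "p:mp 1" for p
  proof -
  have nz: "ff_const X (p m) ~= \<zero>$$K <-> p m ~= 0" for m using G.k_eq0[OF shom_const(1)[OF gp_top]] shom_const[OF gp_top] by simp
  show c: "(%m. ff_const X (p m)):carrier (?S gp)" using p shom_const[OF gp_top] unfolding G.mp_car RR.mp_car nz RR_zero by simp
  show "mev id (%_. inverse f) (?E (%m. ff_const X (p m))) = rev_at (%_. inverse f) (toE p)" unfolding mev_def G.keys_E[OF c] RR.keys_E[OF p] nz RR_zero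
   by (intro sum.cong refl) (simp add: G.lookup_E[OF c] RR.lookup_E[OF p] shom_const[OF gp_top])
  qed
  have Mz: "\<zero>$$?M:mp 1" "toE \<zero>$$?M = 0" using crs(2)[OF RR.mpoly_cring] RR.E_hom(5) by auto
  have pz: "p = \<zero>$$?M" if p: "p:mp 1" "rev_at (%_. inverse f) (toE p) = 0" for p
  proof -
  obtain q where q: "!!y :: 'k. mev of_real (%_. y) (toE p) = pev q y" "q = 0 ==> toE p = 0" using mev_univariate[OF mp_VS[OF p(1)]] by metis
  have "q = 0"
  proof (rule ccontr)
   assume "q ~= 0"
   then obtain r where "inverse f = of_real r" using algebraic_real[of q "inverse f"] q p by auto
   hence "f = of_real (inverse r)" by (metis inverse_inverse_eq of_real_inverse)
   thus False using nr by fast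
  qed
  hence "toE p = 0" using q by simp
  thus ?thesis using RR.E_inj[OF p(1) Mz(1)] Mz(2) by simp
  qed
  have pr: "affine_space_proj X 1 (gp, Q) = {p:mp 1. rev_at (%_. inverse f) (toE p) = 0}" unfolding affine_space_proj_def Q_def using ev by auto
  have "{p:mp 1. rev_at (%_. inverse f) (toE p) = 0} <= {\<zero>$$?M}" using pz by auto
  moreover have "\<zero>$$?M:{p:mp 1. rev_at (%_. inverse f) (toE p) = 0}" using Mz by (simp only: mem_Collect_eq Mz(2) mev_r)
  ultimately show z: "affine_space_proj X 1 (gp, Q) = {\<zero>$$?M}" unfolding pr by auto
  thus "primeideal {\<zero>$$?M} ?M" using RR.eval_prime[OF rhom_of_real, of 1 "%_. inverse f"]
  pr by simp
 qed
 have dom: "domain ?M"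
 proof -
  interpret primeideal "{\<zero>$$?M}" ?M by (rule proj(2))
  show ?thesis using I_notcarr one_imp_carrier I_prime by unfold_locales auto
 qed
 \<comment> \<open>The origin of the line. A point over it would have a prime containing both
   \<open>T\<close> and \<open>1 - f T\<close>, hence 1.\<close>
 define P0 where "P0 = {p:mp 1. rev_at (%_. 0 :: 'k) (toE p) = 0}"
 have P0: "primeideal P0 ?M" unfolding P0_def by (rule RR.eval_prime[OF rhom_of_real])
 have "P0:affine_space_proj X 1 ` Z"
 proof (rule ccontr)
  assume "~ ?thesis"
  hence "P0:topspace (spec_top ?M) - affine_space_proj X 1 ` Z" using P0 domain.topspace_spec[OF dom] by simp
  then obtain g where g: "g:mp 1" "g ~: P0" "{Q. primeideal Q ?M & g ~: Q} <= topspace (spec_top ?M) - affine_space_proj X 1 ` Z"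
  using domain.spec_open_basis[OF dom] closed unfolding closedin_def by meson
  have zP: "{\<zero>$$?M}:affine_space_proj X 1 ` Z" using gQ proj by auto
  have "g ~= \<zero>$$?M" using g additive_subgroup.zero_closed[OF ideal.axioms(1)[OF primeideal.axioms(1)[OF P0]]] by auto
  thus False using g zP proj by auto
 qed
 then obtain x Q' where xQ: "(x, Q'):Z" "P0 = affine_space_proj X 1 (x, Q')" by auto
 hence x: "x:topX" and Q': "primeideal Q' (?S x)" and F: "Fx x:Q'" by (auto simp: Z_def affine_space_points_def)
 interpret S: mp_emb "st x" shom by (rule stalk_emb[OF x])
 interpret Q': primeideal Q' "?S x" by (rule Q')
 define T0 :: "nat multiset => real" where "T0 m = (if m = {#0#} then 1 else 0)" for m
 have "{m. T0 m ~= 0} <= {{#0#}}" by (auto simp: T0_def)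
 hence T0: "T0:mp 1" unfolding RR.mp_car by (auto simp: T0_def real_ring_def)
 have "toE T0 = sgl {#0#} 1" by (rule poly_mapping_eqI) (auto simp: RR.lookup_E[OF T0] T0_def lookup_single)
 hence "T0:P0" using T0 by (simp add: P0_def mev_r)
 hence T: "Tx x:Q'" using xQ by (simp add: affine_space_proj_def Tx_def[abs_def] T0_def)
 have c: "mpoly_const (st x) (fx x):carrier (?S x)" using S.mpoly_const_closed fx[OF x] by simp
 have m1: "mpoly_const (st x) (fx x) \<otimes>$$(?S x) Tx x:Q'" using Q'.I_l_closed[OF T c] .
 have m2: "Fx x \<oplus>$$(?S x) (mpoly_const (st x) (fx x) \<otimes>$$(?S x) Tx x):Q'" using additive_subgroup.a_closed[OF Q'.additive_subgroup_axioms F m1] .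
 have cc: "mpoly_const (st x) (fx x) \<otimes>$$(?S x) Tx x:carrier (?S x)" using S.mpoly_closed(1)[OF c Tx(1)[OF x]] .
 have "?E (Fx x \<oplus>$$(?S x) (mpoly_const (st x) (fx x) \<otimes>$$(?S x) Tx x)) = 1"
  unfolding S.E_hom[OF Fx(1)[OF x] cc] S.E_hom[OF c Tx(1)[OF x]] Fx[OF x] Tx[OF x] S.E_const[OF fx(1)[OF x]] fx[OF x] by (simp add: mult_single flip: single_add)
 also have "... = ?E \<one>$$(?S x)" using S.E_hom[OF c c] by simp
 finally have "Fx x \<oplus>$$(?S x) (mpoly_const (st x) (fx x) \<otimes>$$(?S x) Tx x) = \<one>$$(?S x)"
  by (rule S.E_inj[OF S.mpoly_closed(2)[OF Fx(1)[OF x] cc] crs(6)[OF S.mpoly_cring]])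
 hence "\<one>$$(?S x):Q'" using m2 by simp
 thus False using Q'.one_imp_carrier Q'.I_notcarr by simp
 qed
qed

end

section \<open>Finite-dimensional subspaces\<close>

definition fin :: "'v::real_vector set => bool" where "fin V <-> (EX B. finite B & V <= span B)"

lemma fin_basis: assumes "fin V" obtains B where "finite B" "B <= V" "independent B" "V <= span B" "card B = dim V"
 using basis_exists assms independent_span_bound unfolding fin_def by (metis subset_trans)

lemma fin_mono: "fin V ==> W <= V ==> fin W" unfolding fin_def by auto

lemma indep_le_dim: assumes "fin V" "C <= V" "independent C" shows "finite C" "card C <= dim V"
 using fin_basis independent_span_bound[OF _ assms(3)] assms by (metis order_trans)+

lemma dim_mono: assumes "fin V" "W <= V" shows "dim W <= dim V" using fin_basis[OF fin_mono[OF assms]] indep_le_dim assms by (metis order_trans)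

lemma dim_strict: assumes "fin V" "W <= V" "subspace W" "v:V" "v ~: W" shows "dim W < dim V"
proof -
 obtain B where B: "finite B" "B <= W" "independent B" "W <= span B" "card B = dim W" using fin_basis[OF fin_mono[OF assms(1,2)]] .
 have "span B <= W" using B assms by (simp add: span_minimal)
 hence "v ~: span B" "v ~: B" using assms B by auto
 hence "independent (insert v B)" "card (insert v B) = Suc (dim W)" using B by (auto simp: independent_insertI)
 moreover have "insert v B <= V" using B assms by auto
 ultimately show ?thesis using indep_le_dim[OF assms(1), of "insert v B"] by simp
qed

text \<open>Rank plus nullity as an inequality. Finiteness is part of the conclusion because the
  ambient spaces may have infinite dimension.\<close>

lemma dim_kernel:
 fixes fy :: "'v::real_vector => 'w::real_vector"
 assumes V: "subspace V" and add: "!!x y. x:V ==> y:V ==> fy (x + y) = fy x + fy y" and sc: "!!r x. x:V ==> fy (r *\<^sub>R x) = r *\<^sub>R fy x"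
 and W: "fin {x:V. fy x = 0}" and E: "finite E" "fy ` V <= span E" shows "fin V & dim V <= dim {x:V. fy x = 0} + card E"
proof -
 let ?W = "{x:V. fy x = 0}"
 obtain B where B: "finite B" "B <= ?W" "independent B" "?W <= span B" "card B = dim ?W" using fin_basis[OF W] .
 obtain C where C: "C <= fy ` V" "independent C" "fy ` V <= span C" using maximal_independent_subset by auto
 have fC: "finite C & card C <= card E" using independent_span_bound[OF E(1) C(2)] C E by auto
 obtain g where g: "!!c. c:C ==> g c:V & fy (g c) = c"
 proof -
 have "ALL c:C. EX x. x:V & fy x = c" using C by auto
 thus ?thesis using that by metis
 qed
 have sm: "(SUM c:S. r c *\<^sub>R g c):V & fy (SUM c:S. r c *\<^sub>R g c) = (SUM c:S. r c *\<^sub>R c)" if "S <= C" for S r using finite_subset[OF that] fC that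
 proof (induction S rule: ifi)
 case empty thus ?case using V sc[of 0 0] by (simp add: subspace_0)
 next
 case (insert x S) thus ?case using V g by (simp add: add sc subspace_add subspace_scale)
 qed auto
 have "V <= span (B Un g ` C)"
 proof
 fix v assume v: "v:V"
 obtain r where r: "fy v = (SUM c:C. r c *\<^sub>R c)" using C v fC span_finite[of C] by auto
 let ?s = "SUM c:C. r c *\<^sub>R g c"
 have s: "?s:V" "fy ?s = fy v" using sm r by auto
 have "v - ?s:V" using V v s by (simp add: subspace_diff)
 moreover have "fy (v - ?s) = 0" using add[OF `v - ?s:V` s(1)] s by simp
 ultimately have "v - ?s:span (B Un g ` C)" using B span_mono[of B "B Un g ` C"] by auto
 moreover have "?s:span (B Un g ` C)" by (intro span_sum span_scale span_base) auto
 ultimately show "v:span (B Un g ` C)" using span_add by force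
 qed
 moreover have f: "finite (B Un g ` C)" using B fC by auto
 moreover have "card (B Un g ` C) <= dim ?W + card E" using B fC card_image_le[of C g] card_Un_le[of B "g ` C"] by simp
 ultimately show ?thesis using dim_le_card[of V "B Un g ` C"] unfolding fin_def by auto
qed

lemma dim_linear: assumes g: "linear g" and V: "fin V" shows "fin (g ` V)" "dim (g ` V) <= dim V"
proof -
 obtain B where B: "finite B" "B <= V" "independent B" "V <= span B" "card B = dim V" using fin_basis[OF V] .
 have s: "g ` V <= span (g ` B)" using B linear_span_image[OF g, of B] by auto
 thus "fin (g ` V)" using B unfolding fin_def by auto
 have "dim (g ` V) <= card (g ` B)" using dim_le_card[OF s] B by simp
 thus "dim (g ` V) <= dim V" using card_image_le[OF B(1), of g] B by simp
qed

lemma fam_dim: assumes V: "fin V" and T: "finite T" "!!t. t:T ==> a t:V" "!!r. (SUM t:T. r t *\<^sub>R a t) = 0 ==> ALL t:T. r t = 0" shows "card T <= dim V"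
proof (rule ccontr)
 assume n: "~ ?thesis"
 obtain B where B: "finite B" "V <= span B" "card B = dim V" using fin_basis[OF V] by metis
 obtain r where "EX i:T. r i ~= (0::real)" "(SUM i:T. r i *\<^sub>R a i) = 0" by (rule family_dependent[OF B(1) T(1), of a]) (use n B T(2) in auto)
 thus False using T by auto
qed

section \<open>Abstract function fields over the reals: orders, divisors, spaces of
  functions\<close>

locale ffield =
 fixes Pts :: "'q set" and Ol :: "'q => 'k::real_field set" assumes dv: "P:Pts ==> dvr (Ol P)" and rs: "P:Pts ==> residues (Ol P)" and rl: "P:Pts ==> of_real r:Ol P"
 and fs: "f ~= 0 ==> finite {P:Pts. vl (Ol P) f ~= 0}" and ind: "P:Pts ==> Q:Pts ==> Ol P <= Ol Q ==> P = Q"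
 and cn: "(!!P. P:Pts ==> f:Ol P) ==> EX r. f = of_real r" and ne: "Pts ~= {}"
begin

abbreviation v :: "'q => 'k => int" where "v P f == vl (Ol P) f"
abbreviation ev :: "'q => 'k => complex" where "ev P f == res (Ol P) f"
definition dg :: "'q => nat" where "dg P = (if ALL b:Ol P. Im (ev P b) = 0 then 1 else 2)"
text \<open>Order at least \<open>n\<close>, with 0 counted as having infinite order.\<close>

definition vg :: "'q => int => 'k => bool" where "vg P n f <-> f = 0 | n <= v P f"
definition tt :: "'q => 'k" where "tt P = (SOME t. unf (Ol P) t)"

context
 fixes P assumes P: "P:Pts"
begin

lemma sub: "subr (Ol P)" by (rule dvr_subr[OF dv[OF P]])

lemma mxI: "idl (mx (Ol P)) (Ol P)"
proof -
 obtain t where "unf (Ol P) t" using dvr_unf[OF dv[OF P]] by metis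
 hence m: "mx (Ol P) = {t * a |a. a:Ol P}" and t: "t:Ol P" using unf_mem[OF sub] by (auto simp: unf_def mx_def)
 have "t * a + t * b = t * (a + b)" "c * (t * a) = t * (c * a)" for a b c :: 'k by (simp_all add: als)
 thus ?thesis unfolding idl_def m using sub t by (auto simp: subrD)
qed

lemmas evf = res_add[OF sub mxI rl[OF P] rs[OF P]] res_mult[OF sub mxI rl[OF P] rs[OF P]] res_real[OF sub mxI rl[OF P] rs[OF P]]
 res_zero_iff[OF sub mxI rl[OF P] rs[OF P]] res_range[OF sub mxI rl[OF P] rs[OF P]]

lemma tt: "unf (Ol P) (tt P)" "tt P ~= 0" "v P (tt P) = 1"
proof -
 obtain t where "unf (Ol P) t" using dvr_unf[OF dv[OF P]] by metis
 thus u: "unf (Ol P) (tt P)" unfolding tt_def by (rule someI)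
 thus "tt P ~= 0" by (simp add: unf_def)
 show "v P (tt P) = 1" by (rule vl_unf[OF dv[OF P] u])
qed

lemmas v_mult = vl_mult[OF dv[OF P]]
lemma v_1 [simp]: "v P 1 = 0" using v_mult[of 1 1] by simp
lemma v_inv: "f ~= 0 ==> v P (inverse f) = - v P f" using v_mult[of f "inverse f"] by simp
lemma v_pow: "f ~= 0 ==> v P (f ^ n) = int n * v P f" by (induction n) (simp_all add: v_mult als)
lemma v_powi: "f ~= 0 ==> v P (f powi n) = n * v P f" by (cases "n >= 0") (simp_all add: power_int_def v_pow v_inv)
lemma vg0: "vg P 0 f <-> f:Ol P" using vl_nonneg[OF dv[OF P]] subrD[OF sub] by (cases "f = 0") (auto simp: vg_def)
lemma vg1: "vg P 1 f <-> f:mx (Ol P)" using vl_nonneg[OF dv[OF P]] idlD[OF mxI] by (cases "f = 0") (auto simp: vg_def)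
lemma vg_mult: "vg P m f ==> vg P n g ==> vg P (m + n) (f * g)" unfolding vg_def by (cases "f = 0 | g = 0") (auto simp: v_mult)
lemma vg_add: "vg P n f ==> vg P n g ==> vg P n (f + g)" using vl_add[OF dv[OF P], of f g] unfolding vg_def by force
lemma vg_real: "vg P 0 (of_real r)" using rl[OF P] vg0 by simp
lemma vg_rmult: "vg P n f ==> vg P n (of_real r * f)" using vg_mult[OF vg_real] by simp
lemma vg_zero [simp]: "vg P n 0" by (simp add: vg_def)
lemma vg_sum: "(!!i. i:S ==> vg P n (f i)) ==> vg P n (sum f S)" by (induction S rule: ifi) (auto intro: vg_add)
lemma vg_mono: "vg P n f ==> m <= n ==> vg P m f" by (auto simp: vg_def)
lemma vg_neg: "vg P n f ==> vg P n (- f)" using vg_rmult[of n f "-1"] by simp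
lemma vg_pow: "vg P n f ==> vg P (int k * n) (f ^ k)"
proof (induction k)
 case 0 thus ?case using vg_real[of 1] by simp
next
 case (Suc k) thus ?case using vg_mult by (simp add: als)
qed

text \<open>The coefficient of the \<open>n\<close>-th power of the uniformizer in the expansion of
  \<open>f\<close> at \<open>P\<close>, meaningful for \<open>f\<close> of order at least
  \<open>n\<close>.\<close>

definition lc :: "int => 'k => complex" where "lc n f = ev P (f * tt P powi (- n))"
lemma lc_mem: "vg P n f <-> f * tt P powi (- n):Ol P" unfolding vg0[symmetric] by (cases "f = 0") (simp_all add: vg_def v_mult v_powi tt)
lemma lc_add: "vg P n f ==> vg P n g ==> lc n (f + g) = lc n f + lc n g" unfolding lc_def lc_mem by (simp add: distrib_right evf)
lemma lc_rmult: "vg P n f ==> lc n (of_real r * f) = of_real r * lc n f"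
 unfolding lc_def lc_mem using evf(2)[OF rl[OF P], of "f * tt P powi (- n)" r] by (simp add: evf mult.assoc)
lemma lc_zero: "vg P n f ==> lc n f = 0 <-> vg P (n + 1) f" unfolding lc_def using vg1[of "f * tt P powi (- n)"]
 using evf(3)[of 0] by (cases "f = 0") (auto simp: vg_def v_mult v_powi tt evf lc_mem[symmetric])
lemma lc_eq: "vg P n f ==> vg P n g ==> lc n f = lc n g <-> vg P (n + 1) (f - g)" using lc_zero lc_add[of n "f - g" g] vg_add[of n f "- g"] vg_neg by auto
lemma lc_sum: "(!!i. i:S ==> vg P n (f i)) ==> lc n (sum f S) = (SUM i:S. lc n (f i))" by (induction S rule: ifi) (simp_all add: lc_zero lc_add vg_sum)
lemma lc_mult: "vg P m f ==> vg P n g ==> lc (m + n) (f * g) = lc m f * lc n g"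
 unfolding lc_def lc_mem using evf(2)[of "f * tt P powi (- m)" "g * tt P powi (- n)"] tt by (simp add: power_int_diff power_int_minus field_simps)

lemma lc_span: "EX E. finite E & card E = dg P & (ALL n f. vg P n f --> lc n f:span E)"
proof (cases "ALL b:Ol P. Im (ev P b) = 0")
 case True
 have "lc n f:span {1}" if "vg P n f" for n f
 using True that unfolding lc_mem lc_def span_singleton by (intro image_eqI[where x="Re (ev P (f * tt P powi (- n)))"]) (auto simp: complex_eq_iff)
 thus ?thesis using True by (intro exI[of _ "{1}"]) (simp add: dg_def)
next
 case False
 have "z:span {1, \<i>}" for z :: complex
 proof -
 have "z = Re z *\<^sub>R 1 + Im z *\<^sub>R \<i>" by (simp add: complex_eq_iff)
 also have "...:span {1, \<i>}" by (intro span_add span_scale span_base) auto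
 finally show ?thesis .
 qed
 thus ?thesis using False by (intro exI[of _ "{1, \<i>}"]) (simp add: dg_def)
qed

end

text \<open>The Riemann-Roch space of \<open>D\<close>; \<open>gs_H\<close> identifies it with
  \<open>global_sections\<close>.\<close>

definition H :: "'q dvt => 'k set" where "H D = {f. ALL P:Pts. vg P (- lk D P) f}"
definition l :: "'q dvt => nat" where "l D = dim (H D)"
definition dgr :: "'q dvt => int" where "dgr D = (SUM P:kys D. lk D P * int (dg P))"
definition Dv :: "'q dvt set" where "Dv = {D. kys D <= Pts}"
definition eff :: "'q dvt => bool" where "eff D <-> D:Dv & (ALL P. 0 <= lk D P)"
abbreviation pt :: "'q => 'q dvt" where "pt P == sgl P 1"


lemma dgr_superset: "finite S ==> kys D <= S ==> dgr D = (SUM P:S. lk D P * int (dg P))" unfolding dgr_def by (rule sum.mono_neutral_left) (auto simp: in_keys_iff)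
lemma dgr_add: "dgr (A + B) = dgr A + dgr B" using keys_add[of A B] by (simp add: dgr_superset[of "kys A Un kys B"] lookup_add distrib_right sum.distrib)
lemma dgr_0 [simp]: "dgr 0 = 0" by (simp add: dgr_def)
lemma dgr_minus: "dgr (A - B) = dgr A - dgr B" using dgr_add[of "A - B" B] by simp
lemma dgr_single: "dgr (sgl P n) = n * int (dg P)" by (simp add: dgr_superset[of "{P}"])
lemma Dv_iff: "D:Dv <-> (ALL P. P ~: Pts --> lk D P = 0)" by (auto simp: Dv_def in_keys_iff)
lemma Dv_add: "A:Dv ==> B:Dv ==> A + B:Dv" by (simp add: Dv_iff lookup_add)
lemma Dv_minus: "A:Dv ==> B:Dv ==> A - B:Dv" by (simp add: Dv_iff lookup_minus)
lemma Dv_pt: "P:Pts ==> sgl P n:Dv" by (auto simp: Dv_iff lookup_single when_def)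
lemma Dv_0: "0:Dv" by (simp add: Dv_def)
lemma dg_pos: "0 < dg P" "dg P <= 2" by (auto simp: dg_def)
lemma eff_dgr: "eff D ==> 0 <= dgr D" unfolding dgr_def eff_def by (intro sum_nonneg) auto

lemma eff_induct [consumes 1, case_names 0 add]: assumes "eff C" "Pr 0" "!!C Q. eff C ==> Q:Pts ==> Pr C ==> Pr (C + pt Q)" shows "Pr C" using assms(1)
proof (induction "nat (dgr C)" arbitrary: C rule: less_induct)
 case less
 show ?case
 proof (cases "C = 0")
 case False
 then obtain Q where Q: "Q:kys C" by force
 have QP: "Q:Pts" and "lk C Q ~= 0" "0 <= lk C Q" using Q less.prems unfolding eff_def Dv_def by auto
 hence Q1: "1 <= lk C Q" by simp
 let ?C = "C - pt Q"
 have e: "eff ?C" using less.prems Q1 Dv_minus[OF _ Dv_pt[OF QP]] by (auto simp: eff_def lookup_minus)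
 have "dgr C = dgr ?C + dg Q" by (simp add: dgr_minus dgr_single)
 hence "Pr ?C" using less.hyps[OF _ e] eff_dgr[OF e] dg_pos[of Q] by simp
 thus ?thesis using assms(3)[OF e QP] by simp
 qed (use assms in simp)
qed

lemma H_sub: "subspace (H D)" unfolding subspace_def H_def by (auto simp: vg_add vg_rmult scr)

lemma H_step: assumes P: "P:Pts" and f: "fin (H (D - pt P))" shows "fin (H D)" "l D <= l (D - pt P) + dg P"
proof -
 let ?n = "- lk D P"
 obtain E where E: "finite E" "card E = dg P" "!!n f. vg P n f ==> lc P n f:span E" using lc_span[OF P] by auto
 have vH: "vg P ?n f" if "f:H D" for f using that P by (auto simp: H_def)
 have ker: "{f:H D. lc P ?n f = 0} = H (D - pt P)" using lc_zero P unfolding H_def by (auto simp: lookup_minus vg_mono[OF P, of "1 - lk D P" _ ?n])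
 have "fin (H D) & dim (H D) <= dim {f:H D. lc P ?n f = 0} + card E"
 by (rule dim_kernel[OF H_sub]) (use lc_add[OF P] lc_rmult[OF P] vH f E in \<open>auto simp: ker scr\<close>)
 thus "fin (H D)" "l D <= l (D - pt P) + dg P" unfolding ker E l_def by auto
qed

lemma H_mono: assumes "!!P. P:Pts ==> lk A P <= lk B P" shows "H A <= H B" unfolding H_def using assms vg_mono by auto

lemma H_eff: assumes "eff C" "fin (H A)" shows "fin (H (A + C)) & int (l (A + C)) <= int (l A) + dgr C" using assms(1)
proof (induction C rule: eff_induct)
 case (add C Q)
 have e: "A + (C + pt Q) - pt Q = A + C" by simp
 show ?case using H_step[OF add(2), of "A + (C + pt Q)", unfolded e] add by (auto simp: dgr_add dgr_single)
qed (use assms in simp)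

lemma H_0: "H 0 = range of_real" "fin (H 0)" "l 0 = 1"
proof -
 show h: "H 0 = range of_real" using cn vg0 vg_real by (auto simp: H_def image_iff)
 have r: "range (of_real :: real => 'k) = span {1}" by (auto simp: span_singleton scr)
 show "fin (H 0)" unfolding h r fin_def by auto
 have "dim (span {1 :: 'k}) = card {1 :: 'k}" by (intro dim_span_eq_card_independent) auto
 thus "l 0 = 1" unfolding l_def h r by simp
qed

definition pos :: "'q dvt => 'q dvt" where "pos D = Poly_Mapping.map (max 0) D"
lemma lk_pos: "lk (pos D) P = max 0 (lk D P)" by (simp add: pos_def Poly_Mapping.map.rep_eq when_def)
lemma eff_pos: "D:Dv ==> eff (pos D)" by (simp add: eff_def Dv_iff lk_pos)

lemma H_fin: assumes "D:Dv" shows "fin (H D)"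
proof -
 have "fin (H (pos D))" using H_eff[OF eff_pos[OF assms] H_0(2)] by simp
 thus ?thesis by (rule fin_mono) (auto intro!: H_mono simp: lk_pos)
qed

lemma l_mono: "B:Dv ==> (!!P. P:Pts ==> lk A P <= lk B P) ==> l A <= l B" unfolding l_def using dim_mono[OF H_fin H_mono] by simp

lemma l_diff: assumes "A:Dv" "B:Dv" "!!P. P:Pts ==> lk A P <= lk B P" shows "int (l B) - int (l A) <= dgr B - dgr A"
proof -
 have "lk A P <= lk B P" for P using assms by (cases "P:Pts") (auto simp: Dv_iff)
 hence "eff (B - A)" using assms by (auto simp: eff_def Dv_minus lookup_minus)
 from H_eff[OF this H_fin[OF assms(1)]] show ?thesis by (simp add: dgr_minus)
qed

lemma l_step: "D:Dv ==> P:Pts ==> l D <= l (D - pt P) + dg P" using H_step[OF _ H_fin[OF Dv_minus[OF _ Dv_pt]]] by simp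
definition dvs :: "'k => 'q dvt" where "dvs f = Abs_poly_mapping (%P. if P:Pts then v P f else 0)"

lemma lk_dvs: "f ~= 0 ==> lk (dvs f) P = (if P:Pts then v P f else 0)"
proof -
 assume "f ~= 0"
 hence "finite {P. (if P:Pts then v P f else 0) ~= 0}" using fs by (simp add: conj_commute cong: conj_cong)
 thus ?thesis by (simp add: dvs_def)
qed

lemma dvs_Dv: "f ~= 0 ==> dvs f:Dv" by (simp add: Dv_iff lk_dvs)
lemma dvs_inv: "f ~= 0 ==> dvs (inverse f) = - dvs f" by (rule poly_mapping_eqI) (simp add: lk_dvs v_inv)
lemma H_iff: "f ~= 0 ==> f:H D <-> (ALL P:Pts. 0 <= lk (D + dvs f) P)" by (auto simp: H_def vg_def lk_dvs lookup_add)
lemma H_mult: "f:H A ==> g:H B ==> f * g:H (A + B)" unfolding H_def using vg_mult by (force simp: lookup_add)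

lemma l_equiv: assumes D: "D:Dv" and f: "f ~= 0" shows "l (D + dvs f) = l D"
proof -
 have le: "l D <= l (D + dvs f)" if D: "D:Dv" and f: "f ~= 0" for D f
 proof -
 have "x:(%x. f * x) ` H (D + dvs f)" if x: "x:H D" for x
 proof (rule image_eqI)
  have "inverse f:H (dvs f)" using f by (simp add: H_iff dvs_inv)
  from H_mult[OF x this] show "x * inverse f:H (D + dvs f)" .
 qed (use f in simp)
 hence s: "H D <= (%x. f * x) ` H (D + dvs f)" by auto
 have "linear (%x. f * x)" by simp
 note dl = dim_linear[OF this H_fin[OF Dv_add[OF D dvs_Dv[OF f]]]]
 show ?thesis using dim_mono[OF dl(1) s] dl by (simp add: l_def)
 qed
 have "l (D + dvs f) <= l (D + dvs f + dvs (inverse f))" by (rule le) (use assms in \<open>auto intro: Dv_add dvs_Dv\<close>)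
 thus ?thesis using le[OF D f] f by (simp add: dvs_inv)
qed

end

section \<open>Weak approximation, and the degree of a principal divisor\<close>

lemma pev_alt: assumes "degree p <= N" shows "pev p (z :: 'k::real_field) = (SUM k<=N. of_real (coeff p k) * z ^ k)"
proof -
 have "degree (map_poly (of_real :: real => 'k) p) = degree p" by (cases "p = 0") (auto intro: map_poly_degree_eq)
 hence "pev p z = (SUM k<=degree p. of_real (coeff p k) * z ^ k)" unfolding pev_def by (simp add: poly_altdef coeff_map_poly)
 also have "... = (SUM k<=N. of_real (coeff p k) * z ^ k)" using assms by (intro sum.mono_neutral_left) (auto simp: coeff_eq_0)
 finally show ?thesis .
qed

lemma pev_monom: "pev (monom a n) y = of_real a * y ^ n" by (induction n) (simp_all add: monom_0 monom_Suc)

context ffield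
begin

lemma vg_prod: "P:Pts ==> (!!i. i:S ==> vg P 0 (f i)) ==> vg P 0 (prod f S)" using subr_prod[OF sub] vg0 by auto

lemma weak_pair: assumes P: "P:Pts" and Q: "Q:Pts" and "P ~= Q"
 obtains z where "~ vg P 0 z" "vg Q 1 z"
proof -
 obtain a b where "a:Ol P" "a ~: Ol Q" "b:Ol Q" "b ~: Ol P" using ind[OF P Q] ind[OF Q P] assms by auto
 hence ab: "vg P 0 a" "~ vg Q 0 a" "vg Q 0 b" "~ vg P 0 b" using P Q vg0 by auto
 hence "a ~= 0" "b ~= 0" by (auto simp: vg_def)
 thus ?thesis using ab that[of "b * inverse a"] P Q by (auto simp: vg_def v_mult v_inv)
qed

text \<open>Take \<open>z\<close> with a pole at \<open>P\<close> and a zero at \<open>Q\<close>.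
  The function \<open>z / (r + z)\<close> is 1 at the poles of \<open>z\<close> and 0 at its zeros,
  and a suitable real \<open>r\<close> keeps it regular at the other points of
  \<open>S\<close>.\<close>

lemma weak_one: assumes S: "finite S" "S <= Pts" "P:S" "Q:S" "P ~= Q" shows "EX c. (ALL R:S. vg R 0 c) & vg P 1 (c - 1) & vg Q 1 c"
proof -
 have PQ: "P:Pts" "Q:Pts" using S by auto
 obtain z where z: "~ vg P 0 z" "vg Q 1 z" using weak_pair[OF PQ S(5)] .
 \<comment> \<open>Only finitely many real numbers are forbidden: 0, and those for which the real
   part of \<open>r + z\<close> vanishes at some point of \<open>S\<close>.\<close>
 have "infinite (UNIV - insert 0 ((%R. - Re (ev R z)) ` S))" using S infinite_UNIV_char_0 by simp
 hence "UNIV - insert 0 ((%R. - Re (ev R z)) ` S) ~= {}" by (metis finite.emptyI)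
 then obtain r where r: "r ~= 0" "!!R. R:S ==> r ~= - Re (ev R z)" by auto
 let ?w = "of_real r + z"
 have w0: "?w ~= 0" using z vg_real[OF PQ(1), of "- r"] by (auto simp: add_eq_0_iff)
 have iw: "vg R (- v R z) (inverse ?w)" "vg R 0 z --> vg R 0 (inverse ?w)" if R: "R:S" for R
 proof -
 have RP: "R:Pts" using R S by auto
 have 1: "vg R 0 (inverse ?w)" if z: "vg R 0 z"
 proof -
  have wO: "?w:Ol R" using vg_add[OF RP vg_real[OF RP] z] vg0[OF RP] by simp
  have "ev R ?w = of_real r + ev R z" using evf(1)[OF RP rl[OF RP]] evf[OF RP] z vg0[OF RP] by simp
  hence "Re (ev R ?w) ~= 0" using r(2)[OF R] by simp
  hence "?w ~: mx (Ol R)" using evf(4)[OF RP wO] by auto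
  hence "inverse ?w:Ol R" using wO by (auto simp: mx_def)
  thus ?thesis using vg0[OF RP] by simp
 qed
 thus "vg R 0 z --> vg R 0 (inverse ?w)" by simp
 show "vg R (- v R z) (inverse ?w)"
 proof (cases "vg R 0 z")
  case True
  have "z ~= 0" using PQ z by auto
  thus ?thesis using True vg_mono[OF RP 1[OF True], of "- v R z"] by (simp add: vg_def)
 next
  case False
  hence n: "v R z < 0" by (auto simp: vg_def)
  have "v R ?w <= v R z"
  proof (rule ccontr)
  assume "~ ?thesis"
  hence "vg R (v R z + 1) ?w" "vg R (v R z + 1) (of_real (- r))" using n vg_mono[OF RP vg_real[OF RP], of "v R z + 1" "- r"] by (auto simp: vg_def)
  from vg_add[OF RP this] show False using False by (auto simp: vg_def)
  qed
  thus ?thesis using v_inv[OF RP w0] by (auto simp: vg_def)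
 qed
 qed
 let ?c = "z * inverse ?w"
 have "vg R 0 ?c" if R: "R:S" for R
 proof -
 have RP: "R:Pts" using R S by auto
 have "vg R (v R z) z" by (simp add: vg_def)
 from vg_mult[OF RP this iw(1)[OF R]] show ?thesis by simp
 qed
 moreover have "?c - 1 = of_real (- r) * inverse ?w" using w0 by (simp add: field_simps)
 moreover have "vg P 1 (inverse ?w)" using z vg_mono[OF PQ(1) iw(1)[OF S(3)], of 1] by (auto simp: vg_def)
 moreover have "vg Q (1 + 0) ?c" using vg_mult[OF PQ(2) z(2), of 0 "inverse ?w"] iw[OF S(4)] vg_mono[OF PQ(2) z(2), of 0] by simp
 ultimately show ?thesis using vg_rmult[OF PQ(1)] by (intro exI[of _ ?c]) (metis add_0_right)
qed

text \<open>The product of the functions of \<open>weak_one\<close> over all other points of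
  \<open>S\<close>.\<close>

lemma weak: assumes S: "finite S" "S <= Pts" "P:S"
 obtains c where "!!R. R:S ==> vg R 0 c" "vg P 1 (c - 1)" "!!Q. Q:S ==> Q ~= P ==> vg Q 1 c"
proof -
 obtain c where c: "!!Q. Q:S - {P} ==> (ALL R:S. vg R 0 (c Q)) & vg P 1 (c Q - 1) & vg Q 1 (c Q)" using weak_one[OF S] by (metis DiffE singletonI)
 have PP: "P:Pts" using S by auto
 have "vg P 0 (prod c T) & vg P 1 (prod c T - 1)" if "T <= S - {P}" for T using finite_subset[OF that] S(1) that
 proof (induction T rule: ifi)
 case (insert x T)
 have x: "vg P 1 (c x - 1)" "vg P 0 (c x)" using c insert S by auto
 have T: "vg P 0 (prod c T)" "vg P 1 (prod c T - 1)" using insert by auto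
 have "c x * prod c T - 1 = c x * (prod c T - 1) + (c x - 1)" by (simp add: als)
 moreover have "vg P 1 (c x * (prod c T - 1))" using vg_mult[OF PP x(2) T(2)] by simp
 ultimately have "vg P 1 (c x * prod c T - 1)" using vg_add[OF PP _ x(1)] by metis
 thus ?case using insert vg_mult[OF PP x(2) T(1)] by simp
 qed (use vg_real[OF PP, of 1] vg_zero[OF PP] in auto)
 moreover have "vg R 0 (prod c (S - {P}))" if "R:S" for R using c that S by (intro vg_prod) auto
 moreover have "vg Q 1 (prod c (S - {P}))" if "Q:S" "Q ~= P" for Q
 proof -
 have QP: "Q:Pts" using that S by auto
 have "vg Q (1 + 0) (c Q * prod c (S - {P} - {Q}))" using c that by (intro vg_mult vg_prod QP) auto
 thus ?thesis using prod.remove[of "S - {P}" Q c] S that by simp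
 qed
 ultimately show ?thesis using that by auto
qed

text \<open>Multiply \<open>f\<close> by a high power of a function that is 1 at \<open>P\<close>
  and 0 at the other points of \<open>S\<close>.\<close>

lemma approx: assumes S: "finite S" "S <= Pts" "P:S" and f: "vg P n f"
 obtains g where "vg P n g" "lc P n g = lc P n f" "!!Q. Q:S ==> Q ~= P ==> vg Q N g"
proof -
 obtain c where c: "!!R. R:S ==> vg R 0 c" "vg P 1 (c - 1)" "!!Q. Q:S ==> Q ~= P ==> vg Q 1 c" by (rule weak[OF S]) (rule that)
 have PP: "P:Pts" using S by auto
 define e where "e = (SUM Q:S. nat (N - v Q f))"
 have c1: "lc P 0 c = 1" using lc_eq[OF PP c(1)[OF S(3)] vg_real[OF PP], of 1] c evf(3)[OF PP, of 1] by (simp add: lc_def[OF PP])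
 have ce: "vg P 0 (c ^ e) & lc P 0 (c ^ e) = 1"
 proof (induction e)
 case 0 thus ?case using vg_real[OF PP, of 1] evf(3)[OF PP, of 1] by (simp add: lc_def[OF PP])
 next
 case (Suc e) thus ?case using lc_mult[OF PP c(1)[OF S(3)], of 0 "c ^ e"] vg_mult[OF PP c(1)[OF S(3)], of 0 "c ^ e"] c1 by simp
 qed
 show ?thesis
 proof (rule that[of "c ^ e * f"])
 show "vg P n (c ^ e * f)" "lc P n (c ^ e * f) = lc P n f" using vg_mult[OF PP conjunct1[OF ce] f] lc_mult[OF PP conjunct1[OF ce] f] ce by auto
 fix Q assume Q: "Q:S" "Q ~= P"
 have QP: "Q:Pts" using Q S by auto
 have "nat (N - v Q f) <= e" unfolding e_def using S Q by (intro member_le_sum) auto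
 moreover have "vg Q (int e * 1 + v Q f) (c ^ e * f)" by (intro vg_mult vg_pow QP c Q) (simp add: vg_def)
 ultimately show "vg Q N (c ^ e * f)" using vg_mono[OF QP] by simp
 qed
qed

lemma residue_basis: assumes P: "P:Pts" shows "EX b. (ALL j<dg P. vg P 0 (b j)) & (ALL r. (SUM j<dg P. of_real (r j) * lc P 0 (b j)) = 0 --> (ALL j<dg P. r j = 0))"
proof (cases "ALL b:Ol P. Im (ev P b) = 0")
 case True
 thus ?thesis using vg_real[OF P, of 1] evf(3)[OF P, of 1] by (intro exI[of _ "%_. 1"]) (simp add: dg_def lc_def[OF P])
next
 case False
 then obtain b where b: "b:Ol P" "ev P b = \<i>" using evf(5)[OF P] by auto
 thus ?thesis using vg0[OF P] vg_real[OF P, of 1] evf(3)[OF P, of 1]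
 by (intro exI[of _ "%j. if j = 0 then 1 else b"]) (auto simp: dg_def lc_def[OF P] numeral_2_eq_2 complex_eq_iff less_Suc_eq)
qed

text \<open>Functions that are regular at the zeros of \<open>y\<close> and independent modulo
  \<open>y\<close>, as many as the degree of the zero divisor. For each zero \<open>P\<close>, each
  order \<open>k\<close> below \<open>v P y\<close> and each basis element of the residue field
  there is one with this leading term at \<open>P\<close>, vanishing to high order at the other
  zeros.\<close>

lemma semilocal_family: assumes y: "y ~= 0"
 obtains I :: "('q \<times> nat \<times> nat) set" and w where "finite I" "int (card I) = dgr (pos (dvs y))" "!!i P. i:I ==> P:Pts ==> 0 < v P y ==> vg P 0 (w i)"
 "!!r. ALL P:Pts. 0 < v P y --> vg P (v P y) (SUM i:I. of_real (r i) * w i) ==> ALL i:I. r i = 0"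
proof -
 define S where "S = {P:Pts. 0 < v P y}"
 have "finite S" using fs[OF y] by (rule finite_subset[rotated]) (auto simp: S_def)
 hence S: "finite S" "S <= Pts" by (auto simp: S_def)
 define N where "N = (SUM P:S. v P y)"
 have N: "v P y <= N" if "P:S" for P unfolding N_def using S that by (intro member_le_sum) (auto simp: S_def)
 have "ALL P. EX b. P:Pts --> (ALL j<dg P. vg P 0 (b j)) & (ALL r. (SUM j<dg P. of_real (r j) * lc P 0 (b j)) = 0 --> (ALL j<dg P. r j = 0))" using residue_basis by simp
 from choice[OF this] obtain b where b: "!!P j. P:Pts ==> j < dg P ==> vg P 0 (b P j)"
 "!!P r j. P:Pts ==> (SUM j<dg P. of_real (r j) * lc P 0 (b P j)) = 0 ==> j < dg P ==> r j = 0" by fast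
 define I where "I = (SIGMA P:S. {..<nat (v P y)} \<times> {..<dg P})"
 have "ALL P k j. EX g. P:S --> j < dg P --> vg P (int k) g & lc P (int k) g = lc P 0 (b P j) & (ALL Q:S - {P}. vg Q N g)"
 proof (intro allI)
 fix P k j
 have "EX g. vg P (int k) g & lc P (int k) g = lc P 0 (b P j) & (ALL Q:S - {P}. vg Q N g)" if P: "P:S" and j: "j < dg P"
 proof -
 have PP: "P:Pts" using P S by auto
 have t: "vg P (int k) (tt P ^ k)" using v_pow[OF PP tt(2)[OF PP]] tt[OF PP] by (simp add: vg_def)
 have t1: "lc P (int k) (tt P ^ k) = 1" using tt[OF PP] evf(3)[OF PP, of 1] by (simp add: lc_def[OF PP] power_int_minus)
 have f: "vg P (int k) (tt P ^ k * b P j)" "lc P (int k) (tt P ^ k * b P j) = lc P 0 (b P j)"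
  using vg_mult[OF PP t b(1)[OF PP j]] lc_mult[OF PP t b(1)[OF PP j]] t1 by auto
 obtain g where "vg P (int k) g" "lc P (int k) g = lc P (int k) (tt P ^ k * b P j)" "!!Q. Q:S ==> Q ~= P ==> vg Q N g" by (rule approx[OF S P f(1)]) (rule that)
 thus ?thesis using f by auto
 qed
 thus "EX g. P:S --> j < dg P --> vg P (int k) g & lc P (int k) g = lc P 0 (b P j) & (ALL Q:S - {P}. vg Q N g)" by simp
 qed
 then obtain w where w: "!!P k j. P:S ==> j < dg P ==> vg P (int k) (w P k j) & lc P (int k) (w P k j) = lc P 0 (b P j) & (ALL Q:S - {P}. vg Q N (w P k j))"
 unfolding choice_iff by fast
 let ?w = "%(P, k, j). w P k j"
 have "dgr (pos (dvs y)) = (SUM P:S. v P y * int (dg P))"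
 by (subst dgr_superset[OF S(1)]) (auto simp: in_keys_iff lk_pos lk_dvs y S_def intro!: sum.cong split: if_splits)
 hence card: "int (card I) = dgr (pos (dvs y))" unfolding I_def using S by (subst card_SigmaI) (auto simp: S_def)
 have N0: "0 <= N" using sum_nonneg[of S "%P. v P y"] by (auto simp: N_def S_def)
 show ?thesis
 proof (rule that[of I ?w])
 show "finite I" using S by (auto simp: I_def)
 show "int (card I) = dgr (pos (dvs y))" by (rule card)
 fix i P assume i: "i:I" and P: "P:Pts" "0 < v P y"
 obtain Q k j where q: "i = (Q, k, j)" "Q:S" "j < dg Q" using i by (auto simp: I_def)
 show "vg P 0 (?w i)" using w q P vg_mono[OF P(1), of "int k" _ 0] vg_mono[OF P(1), of N _ 0] N0 by (cases "P = Q") (auto simp: S_def)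
 next
 fix r assume r0: "ALL P:Pts. 0 < v P y --> vg P (v P y) (SUM i:I. of_real (r i) * ?w i)"
 note r = r0[rule_format]
 \<comment> \<open>Triangularity: once the coefficients of order below \<open>k\<close> are zero,
   those of order \<open>k\<close> appear in the leading coefficient of order \<open>k\<close> at
   \<open>P\<close>.\<close>
 have "ALL j<dg P. r (P, k, j) = 0" if P: "P:S" and k: "k < nat (v P y)" for P k using k
 proof (induction k rule: less_induct)
  case (less k)
  have PP: "P:Pts" "0 < v P y" using P by (auto simp: S_def)
  have vk: "vg P (int k) (of_real (r i) * ?w i) & lc P (int k) (of_real (r i) * ?w i) = (if fst i = P & fst (snd i) = k then of_real (r i) * lc P 0 (b P (snd (snd i))) else 0)"
  if i: "i:I" for i
  proof -
  obtain Q k' j where q: "i = (Q, k', j)" "Q:S" "j < dg Q" "k' < nat (v Q y)" using i by (auto simp: I_def)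
  note w' = w[OF q(2,3), of k']
  have hi: "vg P (int k + 1) (?w i)" if "Q ~= P | k < k'"
  proof (cases "Q = P")
   case True thus ?thesis using w' that q vg_mono[OF PP(1), of "int k'" "w P k' j" "int k + 1"] by auto
  next
   case False thus ?thesis using w' q P N[OF P] less.prems vg_mono[OF PP(1), of N "w Q k' j" "int k + 1"] by auto
  qed
  have 0: "vg P (int k) (of_real (r i) * ?w i) & lc P (int k) (of_real (r i) * ?w i) = 0" if "vg P (int k + 1) (of_real (r i) * ?w i)"
   using lc_zero[OF PP(1), of "int k"] vg_mono[OF PP(1) that, of "int k"] that by simp
  consider "Q ~= P | k < k'" | "Q = P" "k' < k" | "Q = P" "k' = k" by force
  thus ?thesis
  proof cases
   case 1 thus ?thesis using 0[OF vg_rmult[OF PP(1) hi]] q by auto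
  next
   case 2
   hence "r i = 0" using less q by simp
   thus ?thesis using 0 vg_zero[OF PP(1)] by simp
  next
   case 3 thus ?thesis using w' q vg_rmult[OF PP(1)] lc_rmult[OF PP(1), of "int k" "w P k j"] by simp
  qed
  qed
  let ?J = "(%j. (P, k, j)) ` {..<dg P}"
  have JI: "?J <= I" using P less.prems by (auto simp: I_def)
  have "vg P (int k + 1) (SUM i:I. of_real (r i) * ?w i)" using less.prems vg_mono[OF PP(1) r[OF PP]] by auto
  hence "0 = lc P (int k) (SUM i:I. of_real (r i) * ?w i)" using lc_zero[OF PP(1), of "int k"] vk vg_sum[OF PP(1), of I "int k"] by simp
  also have "... = (SUM i:I. lc P (int k) (of_real (r i) * ?w i))" using vk by (intro lc_sum[OF PP(1)]) auto
  also have "... = (SUM i:?J. of_real (r i) * lc P 0 (b P (snd (snd i))))" using vk JI S by (intro sum.mono_neutral_cong_right) (auto simp: I_def)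
  also have "... = (SUM j<dg P. of_real (r (P, k, j)) * lc P 0 (b P j))" by (subst sum.reindex) (auto simp: inj_on_def)
  finally show ?case using b(2)[OF PP(1), of "%j. r (P, k, j)"] by simp
 qed
 thus "ALL i:I. r i = 0" by (auto simp: I_def)
 qed
qed

text \<open>Independence over the polynomials in \<open>z\<close>, equivalently over the field
  generated by \<open>z\<close>. The size of such a family is bounded in terms of the poles of
  \<open>z\<close>, without the degree of a field extension.\<close>

definition zind :: "'k => 'i set => ('i => 'k) => bool" where "zind z I f <-> (ALL p. (SUM i:I. pev (p i) z * f i) = 0 --> (ALL i:I. p i = 0))"

text \<open>A relation over the polynomials in \<open>1/y\<close> of top degree \<open>d\<close>,
  multiplied by \<open>y^d\<close>, becomes modulo \<open>y\<close> a real relation between the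
  \<open>w i\<close>, which \<open>semilocal_family\<close> excludes.\<close>

lemma zind_family: assumes y: "y ~= 0"
 obtains I :: "('q \<times> nat \<times> nat) set" and w where "finite I" "int (card I) = dgr (pos (dvs y))" "zind (inverse y) I w"
proof -
 obtain I :: "('q \<times> nat \<times> nat) set" and w where I: "finite I" "int (card I) = dgr (pos (dvs y))" "!!i P. i:I ==> P:Pts ==> 0 < v P y ==> vg P 0 (w i)"
 and r: "!!r. ALL P:Pts. 0 < v P y --> vg P (v P y) (SUM i:I. of_real (r i) * w i) ==> ALL i:I. r i = 0" by (rule semilocal_family[OF y]) (rule that)
 have "zind (inverse y) I w" unfolding zind_def
 proof (intro allI impI, rule ccontr)
 fix p assume 0: "(SUM i:I. pev (p i) (inverse y) * w i) = 0" and "~ (ALL i:I. p i = 0)"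
 hence ne: "finite (degree ` p ` {i:I. p i ~= 0})" "degree ` p ` {i:I. p i ~= 0} ~= {}" using I by auto
 define d where "d = Max (degree ` p ` {i:I. p i ~= 0})"
 have "d:degree ` p ` {i:I. p i ~= 0}" unfolding d_def using Max_in[OF ne] .
 then obtain i0 where i0: "i0:I" "p i0 ~= 0" "degree (p i0) = d" by auto
 have d: "degree (p i) <= d" if "i:I" for i using that Max_ge[OF ne(1), of "degree (p i)"] unfolding d_def by force
 define s where "s i = (SUM k<d. of_real (coeff (p i) k) * y ^ (d - 1 - k))" for i
 have yd: "y ^ d * pev (p i) (inverse y) = of_real (coeff (p i) d) + y * s i" if "i:I" for i
 proof -
  have "y ^ d * pev (p i) (inverse y) = (SUM k<=d. of_real (coeff (p i) k) * y ^ (d - k))"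
  unfolding pev_alt[OF d[OF that]] sdl using y by (intro sum.cong refl) (simp add: power_diff field_simps)
  also have "... = (SUM k<d. of_real (coeff (p i) k) * (y * y ^ (d - 1 - k))) + of_real (coeff (p i) d)"
  unfolding lessThan_Suc_atMost[symmetric] by (simp add: Suc_diff_Suc flip: power_Suc)
  finally show ?thesis by (simp add: s_def sdl mult_ac)
 qed
 have "0 = y ^ d * (SUM i:I. pev (p i) (inverse y) * w i)" using 0 by simp
 also have "... = (SUM i:I. of_real (coeff (p i) d) * w i) + y * (SUM i:I. s i * w i)" using yd by (simp add: sdl mult.assoc[symmetric] distrib_right sum.distrib)
 finally have "(SUM i:I. of_real (coeff (p i) d) * w i) = y * (- (SUM i:I. s i * w i))" by (simp add: eq_neg_iff_add_eq_0)
 moreover have "vg P (v P y + 0) (y * (- (SUM i:I. s i * w i)))" if P: "P:Pts" "0 < v P y" for P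
 proof -
  have y0: "vg P 0 y" "vg P (v P y) y" using P by (auto simp: vg_def)
  have "vg P 0 (s i)" for i unfolding s_def using vg_pow[OF P(1) y0(1)] by (intro vg_sum[OF P(1)] vg_rmult[OF P(1)]) simp
  hence "vg P 0 (s i * w i)" if "i:I" for i using vg_mult[OF P(1), of 0 "s i" 0] I(3)[OF that P] by simp
  thus ?thesis by (intro vg_mult vg_neg vg_sum P y0)
 qed
 ultimately have "ALL i:I. coeff (p i) d = 0" by (intro r) simp
 thus False using i0 by auto
 qed
 thus ?thesis using that I by simp
qed

text \<open>Multiplication by \<open>z^N\<close> turns a relation over \<open>1/z\<close> into one
  over \<open>z\<close> with the coefficient lists reversed.\<close>

lemma zind_inverse: assumes z: "z ~= 0" and I: "finite I" "zind z I f" shows "zind (inverse z) I f" unfolding zind_def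
proof (intro allI impI)
 fix p assume 0: "(SUM i:I. pev (p i) (inverse z) * f i) = 0"
 define N where "N = (SUM i:I. degree (p i))"
 have N: "degree (p i) <= N" if "i:I" for i unfolding N_def using I that by (intro member_le_sum) auto
 define q where "q i = (SUM k<=N. monom (coeff (p i) k) (N - k))" for i
 have "pev (q i) z = z ^ N * pev (p i) (inverse z)" if "i:I" for i
 unfolding pev_alt[OF N[OF that]] q_def pev_sum pev_monom sdl using z by (intro sum.cong refl) (simp add: power_diff field_simps)
 hence "(SUM i:I. pev (q i) z * f i) = z ^ N * (SUM i:I. pev (p i) (inverse z) * f i)" by (simp add: sdl mult.assoc)
 hence q0: "q i = 0" if "i:I" for i using I 0 that unfolding zind_def by simp
 show "ALL i:I. p i = 0"
 proof
 fix i assume i: "i:I"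
 have "coeff (p i) k = 0" for k
 proof (cases "k <= N")
  case True
  have "coeff (q i) (N - k) = (SUM j<=N. if j = k then coeff (p i) k else 0)" unfolding q_def coeff_sum by (intro sum.cong refl) (use True in auto)
  thus ?thesis using q0[OF i] True by simp
 next
  case False thus ?thesis using N[OF i] by (simp add: coeff_eq_0)
 qed
 thus "p i = 0" by (simp add: poly_eq_iff)
 qed
qed

definition ml :: "nat => 'q dvt => 'q dvt" where "ml m A = (SUM j<m. A)"
lemma ml_simps: "ml 0 A = 0" "ml (Suc m) A = ml m A + A" by (simp_all add: ml_def)
lemma lk_ml: "lk (ml m A) P = int m * lk A P" by (induction m) (simp_all add: ml_simps lookup_add als)
lemma dgr_ml: "dgr (ml m A) = int m * dgr A" by (induction m) (simp_all add: ml_simps dgr_add als)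
lemma Dv_ml: "A:Dv ==> ml m A:Dv" by (simp add: Dv_iff lk_ml)
lemma ml_add: "ml (m + n) A = ml m A + ml n A" by (rule poly_mapping_eqI) (simp add: lk_ml lookup_add als)

lemma fam_le: assumes D: "D:Dv" and T: "finite T" "!!t. t:T ==> a t:H D" "!!r. (SUM t:T. of_real (r t) * a t) = 0 ==> ALL t:T. r t = 0"
 shows "card T <= l D" unfolding l_def by (rule fam_dim[OF H_fin[OF D] T(1,2)]) (use T(3) in \<open>auto simp: scr\<close>)

lemma zind_fam: assumes D: "D:Dv" and I: "finite I" "zind z I f" "!!i j. i:I ==> j <= m ==> f i * z ^ j:H D" shows "card I * Suc m <= l D"
proof -
 have "card (I \<times> {..m}) <= l D"
 proof (rule fam_le[OF D, of _ "%(i, j). f i * z ^ j"])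
 fix r assume "(SUM t:I \<times> {..m}. of_real (r t) * (case t of (i, j) => f i * z ^ j)) = 0"
 hence "(SUM i:I. pev (SUM j<=m. monom (r (i, j)) j) z * f i) = 0" unfolding pev_sum pev_monom sdr sum.cartesian_product by (simp add: split_def mult_ac)
 hence 0: "(SUM j<=m. monom (r (i, j)) j) = 0" if "i:I" for i using I(2)[unfolded zind_def, rule_format, of "%i. SUM j<=m. monom (r (i, j)) j"] that by simp
 have "r (i, j) = 0" if "i:I" "j <= m" for i j
 proof -
  have "coeff (SUM j<=m. monom (r (i, j)) j) j = (SUM j'<=m. if j' = j then r (i, j) else 0)" unfolding coeff_sum by simp
  thus ?thesis using 0 that by simp
 qed
 thus "ALL t:I \<times> {..m}. r t = 0" by auto
 qed (use I in auto)
 thus ?thesis by (simp only: card_cartesian_product card_atMost)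
qed

lemma zpow_H: assumes z: "z ~= 0" shows "z ^ j:H (ml j (pos (- dvs z)))" unfolding H_def
proof (intro CollectI ballI)
 fix P assume P: "P:Pts"
 have "vg P (- max 0 (- v P z)) z" by (auto simp: vg_def)
 from vg_pow[OF P this, of j] show "vg P (- lk (ml j (pos (- dvs z))) P) (z ^ j)" using P z by (simp add: lk_ml lk_pos lk_dvs)
qed

text \<open>The products \<open>f i * z^j\<close> with \<open>j \<le> m\<close> are
  \<open>card I * (m + 1)\<close> independent functions, in a space whose dimension grows by at most
  the degree of the poles of \<open>z\<close> when \<open>m\<close> grows by one.\<close>

lemma zind_le: assumes z: "z ~= 0" and I: "finite I" "zind z I f" shows "int (card I) <= dgr (pos (- dvs z))"
proof (rule ccontr)
 let ?A = "pos (- dvs z)"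
 have A: "eff ?A" using z dvs_Dv by (intro eff_pos) (simp add: Dv_iff)
 assume n: "~ ?thesis"
 have f0: "f i ~= 0" if "i:I" for i
 proof
 assume fi: "f i = 0"
 have "(SUM j:I. pev (if j = i then 1 else 0) z * f j) = 0" using fi by (intro sum.neutral) auto
 thus False using I(2)[unfolded zind_def, rule_format, of "%j. if j = i then 1 else 0", OF _ that] by simp
 qed
 define B where "B = (SUM i:I. pos (- dvs (f i)))"
 have lkB: "lk B P = (SUM i:I. max 0 (- lk (dvs (f i)) P))" for P by (simp add: B_def lookup_sum lk_pos)
 have B: "eff B" using f0 dvs_Dv by (auto simp: eff_def Dv_iff lkB intro!: sum_nonneg)
 have fB: "f i:H B" if i: "i:I" for i unfolding H_iff[OF f0[OF i]]
 proof
 fix P assume P: "P:Pts"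
 have "max 0 (- lk (dvs (f i)) P) <= lk B P" unfolding lkB using I i by (intro member_le_sum) auto
 thus "0 <= lk (B + dvs (f i)) P" by (simp add: lookup_add)
 qed
 \<comment> \<open>Any number above the degree of \<open>B\<close> makes the linear growth
   decide.\<close>
 define m where "m = nat (dgr B + 1)"
 have D: "eff (B + ml m ?A)" using A B by (auto simp: eff_def Dv_add Dv_ml lookup_add lk_ml)
 have "card I * Suc m <= l (B + ml m ?A)"
 proof (rule zind_fam[OF _ I])
 fix i j assume "i:I" "j <= m"
 have "f i * z ^ j:H (B + ml j ?A)" by (intro H_mult fB zpow_H z `i:I`)
 moreover have "H (B + ml j ?A) <= H (B + ml m ?A)" using A `j <= m` by (intro H_mono) (auto simp: lookup_add lk_ml eff_def mult_right_mono)
 ultimately show "f i * z ^ j:H (B + ml m ?A)" by auto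
 qed (use D in \<open>simp add: eff_def\<close>)
 hence "int (card I * Suc m) <= int (l (B + ml m ?A))" by (simp only: of_nat_le_iff)
 hence "int (card I) * (int m + 1) <= 1 + dgr B + int m * dgr ?A" using conjunct2[OF H_eff[OF D H_0(2)]] H_0 by (simp add: dgr_add dgr_ml als)
 moreover have "(dgr ?A + 1) * (int m + 1) <= int (card I) * (int m + 1)" using n by simp
 moreover have "int m = dgr B + 1" using eff_dgr[OF B] by (simp add: m_def)
 ultimately show False using eff_dgr[OF A] by (simp add: als)
qed

text \<open>There is a family independent over the polynomials in \<open>y\<close> as large as the
  number of zeros, and no such family is larger than the number of poles. Exchanging
  \<open>y\<close> and \<open>1/y\<close> gives equality.\<close>

lemma dgr_dvs: assumes z: "z ~= 0" shows "dgr (dvs z) = 0"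
proof -
 have le: "dgr (pos (dvs y)) <= dgr (pos (- dvs y))" if y: "y ~= 0" for y
 proof -
 obtain I :: "('q \<times> nat \<times> nat) set" and w where I: "finite I" "int (card I) = dgr (pos (dvs y))" "zind (inverse y) I w" using zind_family[OF y] .
 hence "zind y I w" using zind_inverse[of "inverse y" I w] y by simp
 thus ?thesis using zind_le[OF y I(1)] I by simp
 qed
 have "dvs z = pos (dvs z) - pos (- dvs z)" by (rule poly_mapping_eqI) (simp add: lookup_minus lk_pos)
 hence "dgr (dvs z) = dgr (pos (dvs z)) - dgr (pos (- dvs z))" using dgr_minus by metis
 thus ?thesis using le[OF z] le[of "inverse z"] z by (simp add: dvs_inv)
qed

end

section \<open>Riemann's theorem\<close>

context ffield
begin

lemma l_pos: assumes "0 < l D" obtains f where "f ~= 0" "f:H D"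
proof -
 have "~ H D <= {0}"
 proof
 assume "H D <= {0}"
 thus False using assms dim_le_card[of "H D" "{}"] by (simp add: l_def)
 qed
 thus ?thesis using that by auto
qed

text \<open>At a pole of \<open>f\<close> where \<open>z\<close> is regular, the quadratic real
  polynomial that annihilates the residue of \<open>z\<close> vanishes after inserting
  \<open>z\<close>. A product of powers of these removes all such poles and leaves only poles of
  \<open>z\<close>.\<close>

lemma clear_poles: assumes z: "z ~= 0" shows "EX g c. g ~= 0 & pev g z * f:H (ml c (pos (- dvs z)))"
proof (cases "f = 0")
 case True thus ?thesis by (intro exI[of _ 1]) (simp add: subspace_0[OF H_sub])
next
 case f0: False
 define T where "T = {Q:Pts. v Q f ~= 0}"
 have T: "finite T" "T <= Pts" using fs[OF f0] by (auto simp: T_def)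
 define q where "q Q = [:(Re (ev Q z))^2 + (Im (ev Q z))^2, - 2 * Re (ev Q z), 1:]" for Q
 have q: "vg Q 1 (pev (q Q) z)" if Q: "Q:Pts" "vg Q 0 z" for Q
 proof -
 have zO: "z:Ol Q" using Q vg0 by simp
 note r = res_pev[OF sub[OF Q(1)] mxI[OF Q(1)] rl[OF Q(1)] rs[OF Q(1)] zO, of "q Q"]
 have "pev (q Q) (ev Q z) = 0" by (simp add: q_def complex_eq_iff p2)
 thus ?thesis using r evf(4)[OF Q(1), of "pev (q Q) z"] vg1[OF Q(1)] by auto
 qed
 define g where "g = (PROD Q:T. q Q ^ nat (- v Q f))"
 have g0: "g ~= 0" using T by (auto simp: g_def q_def)
 define h where "h = pev g z * f"
 have hR: "vg R 0 h" if R: "R:Pts" "vg R 0 z" for R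
 proof -
 have pv: "vg R 0 (pev p z)" for p using res_pev[OF sub[OF R(1)] mxI[OF R(1)] rl[OF R(1)] rs[OF R(1)], of z p] R vg0 by auto
 show ?thesis
 proof (cases "R:T")
  case True
  have "h = pev (PROD Q:T - {R}. q Q ^ nat (- v Q f)) z * (pev (q R) z ^ nat (- v R f) * f)" unfolding h_def g_def prod.remove[OF T(1) True] pev_mult pev_power by simp
  moreover have "vg R (int (nat (- v R f)) * 1 + v R f) (pev (q R) z ^ nat (- v R f) * f)" by (intro vg_mult vg_pow q R) (simp add: vg_def)
  hence "vg R 0 (pev (q R) z ^ nat (- v R f) * f)" by (rule vg_mono[OF R(1)]) simp
  ultimately show ?thesis using vg_mult[OF R(1) pv] by simp
 next
  case False
  hence "vg R 0 f" using R by (simp add: T_def vg_def)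
  thus ?thesis unfolding h_def using vg_mult[OF R(1) pv] by simp
 qed
 qed
 let ?A = "pos (- dvs z)"
 define c where "c = (SUM R:kys ?A. nat (- v R h))"
 have "h:H (ml c ?A)" unfolding H_def
 proof (intro CollectI ballI)
 fix R assume R: "R:Pts"
 show "vg R (- lk (ml c ?A) R) h"
 proof (cases "vg R 0 z")
  case True thus ?thesis using vg_mono[OF R hR[OF R]] by (simp add: lk_ml lk_pos)
 next
  case False
  hence k: "1 <= lk ?A R" using R by (auto simp: vg_def lk_pos lk_dvs)
  hence "nat (- v R h) <= c" unfolding c_def by (intro member_le_sum) (auto simp: in_keys_iff)
  hence "- v R h <= int c * 1" by simp
  also have "int c * 1 <= int c * lk ?A R" using k by (intro mult_left_mono) auto
  finally show ?thesis by (simp add: vg_def lk_ml)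
 qed
 qed
 thus ?thesis using g0 unfolding h_def by auto
qed

text \<open>For multiples of the zero divisor of \<open>y\<close> the powers of \<open>1/y\<close>
  times a maximal independent family already give almost as many functions as the degree. Every
  other divisor lies, up to equivalence, below such a multiple.\<close>

lemma riemann_bound: "EX ga. ALL D:Dv. dgr D - int (l D) <= ga"
proof -
 obtain P where P: "P:Pts" using ne by auto
 define y where "y = tt P"
 define z where "z = inverse y"
 have y: "y ~= 0" and z: "z ~= 0" using tt[OF P] by (auto simp: y_def z_def)
 let ?A = "pos (dvs y)"
 have Az: "pos (- dvs z) = ?A" using y by (simp add: z_def dvs_inv)
 have A: "eff ?A" using y dvs_Dv by (intro eff_pos)
 obtain I :: "('q \<times> nat \<times> nat) set" and w where I: "finite I" "int (card I) = dgr ?A" "zind z I w" using zind_family[OF y] unfolding z_def .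
 define n where "n = card I"
 have "dgr (sgl P 1) <= dgr ?A"
 proof -
 have "eff (?A - pt P)" using A P Dv_minus[OF _ Dv_pt[OF P]] tt by (auto simp: eff_def lookup_minus lk_pos lk_dvs y_def)
 from eff_dgr[OF this] show ?thesis by (simp add: dgr_minus)
 qed
 hence n: "1 <= n" using I dg_pos[of P] by (simp add: dgr_single n_def)
 have "ALL i. EX g c. g ~= 0 & pev g z * w i:H (ml c ?A)" using clear_poles[OF z] Az by simp
 then obtain g c where gc: "!!i. g i ~= 0 & pev (g i) z * w i:H (ml (c i) ?A)" by metis
 define C where "C = (SUM i:I. c i)"
 define u where "u i = pev (g i) z * w i" for i
 have mlm: "H (ml a ?A) <= H (ml b ?A)" if "a <= b" for a b using A that by (intro H_mono) (auto simp: lk_ml eff_def mult_right_mono)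
 have zu: "zind z I u" unfolding zind_def
 proof (intro allI impI)
 fix p assume "(SUM i:I. pev (p i) z * u i) = 0"
 hence "(SUM i:I. pev (p i * g i) z * w i) = 0" by (simp add: u_def pev_mult mult.assoc)
 hence "ALL i:I. p i * g i = 0" using I(3)[unfolded zind_def, rule_format, of "%i. p i * g i"] by simp
 thus "ALL i:I. p i = 0" using gc by simp
 qed
 have big: "n * Suc m <= l (ml (C + m) ?A)" for m unfolding n_def
 proof (rule zind_fam[OF _ I(1) zu])
 fix i j assume i: "i:I" and j: "j <= m"
 have "c i <= C" unfolding C_def using I i by (intro member_le_sum) auto
 hence "u i:H (ml C ?A)" using gc mlm unfolding u_def by fast
 hence "u i * z ^ j:H (ml (C + j) ?A)" using H_mult[OF _ zpow_H[OF z, of j]] Az by (simp add: ml_add)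
 thus "u i * z ^ j:H (ml (C + m) ?A)" using mlm[of "C + j" "C + m"] j by auto
 qed (use A in \<open>simp add: eff_def Dv_ml\<close>)
 have dn: "dgr ?A = int n" using I by (simp add: n_def)
 have "dgr D - int (l D) <= (int C - 1) * int n" if D: "D:Dv" for D
 proof -
 \<comment> \<open>Large enough for the multiple of \<open>?A\<close> minus the positive part of
   \<open>D\<close> to have a section \<open>f\<close>. Then \<open>D\<close> lies below a divisor
   equivalent to this multiple, and \<open>dgr - l\<close> is monotone by
   \<open>l_diff\<close>.\<close>
 define m where "m = nat (dgr (pos D))"
 let ?M = "ml (C + m) ?A"
 have M: "?M:Dv" using A by (simp add: eff_def Dv_ml)
 have e: "eff (pos D)" by (rule eff_pos[OF D])
 have pD: "pos D:Dv" using e by (simp add: eff_def)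
 have mi: "int m = dgr (pos D)" using eff_dgr[OF e] by (simp add: m_def)
 have b: "int n * (int m + 1) <= int (l ?M)" using big by (metis of_nat_Suc of_nat_mult of_nat_le_iff add.commute)
 have "int (l ?M) - int (l (?M - pos D)) <= dgr ?M - dgr (?M - pos D)" using e by (intro l_diff Dv_minus M pD) (auto simp: lookup_minus eff_def)
 hence "int (l (?M - pos D)) >= int n * (int m + 1) - int m" using b mi by (simp add: dgr_minus)
 moreover have "int m + 1 <= int n * (int m + 1)" using n by simp
 ultimately have "int m + 1 - int m <= int (l (?M - pos D))" by (meson diff_right_mono order_trans)
 hence "0 < l (?M - pos D)" by simp
 then obtain f where f: "f ~= 0" "f:H (?M - pos D)" by (rule l_pos)
 have "int (l (?M + dvs f)) - int (l D) <= dgr (?M + dvs f) - dgr D"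
 proof (rule l_diff[OF D Dv_add[OF M dvs_Dv[OF f(1)]]])
  fix Q assume "Q:Pts"
  hence "0 <= lk (?M - pos D + dvs f) Q" using f H_iff by simp
  thus "lk D Q <= lk (?M + dvs f) Q" by (simp add: lookup_add lookup_minus lk_pos)
 qed
 hence "dgr D - int (l D) <= int (C + m) * int n - int (l ?M)" by (simp add: dgr_add dgr_dvs[OF f(1)] l_equiv[OF M f(1)] dgr_ml dn)
 thus ?thesis using b by (simp add: als)
 qed
 thus ?thesis by auto
qed

text \<open>The difference \<open>dgr - l\<close> is bounded, monotone and depends on the class
  only; let \<open>E\<close> attain its maximum \<open>ga\<close>, the genus minus one. If the
  degree of \<open>D\<close> is large, some divisor equivalent to \<open>D\<close> lies above
  \<open>E\<close>, so the maximum is attained at \<open>D\<close> too.\<close>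

theorem riemann: obtains ga d0 where "!!D. D:Dv ==> d0 <= dgr D ==> int (l D) = dgr D - ga"
proof -
 obtain ga where g: "!!D. D:Dv ==> dgr D - int (l D) <= ga" using riemann_bound by auto
 obtain E where E: "E:Dv" "!!D. D:Dv ==> nat (ga - (dgr E - int (l E))) <= nat (ga - (dgr D - int (l D)))"
 using ex_has_least_nat[of "%D. D:Dv" 0 "%D. nat (ga - (dgr D - int (l D)))"] Dv_0 by auto
 have mx: "dgr D - int (l D) <= dgr E - int (l E)" if "D:Dv" for D using E(2)[OF that] g[OF that] by simp
 show ?thesis
 proof (rule that)
 fix D assume D: "D:Dv" and d: "dgr E + ga + 1 <= dgr D"
 have "0 < l (D - E)" using g[OF Dv_minus[OF D E(1)]] d by (simp add: dgr_minus)
 then obtain f where f: "f ~= 0" "f:H (D - E)" by (rule l_pos)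
 have "int (l (D + dvs f)) - int (l E) <= dgr (D + dvs f) - dgr E"
 proof (rule l_diff[OF E(1) Dv_add[OF D dvs_Dv[OF f(1)]]])
  fix Q assume "Q:Pts"
  hence "0 <= lk (D - E + dvs f) Q" using f H_iff by simp
  thus "lk E Q <= lk (D + dvs f) Q" by (simp add: lookup_add lookup_minus)
 qed
 thus "int (l D) = dgr D - (dgr E - int (l E))" using mx[OF D] by (simp add: dgr_add dgr_dvs[OF f(1)] l_equiv[OF D f(1)])
 qed
qed

end

section \<open>Pencils and the criterion for birationality\<close>

lemma subspace_avoid: assumes "finite Z" "subspace V" "!!Q. Q:Z ==> subspace (W Q) & ~ V <= W Q" shows "EX x:V. ALL Q:Z. x ~: W Q" using assms(1,3)
proof (induction Z rule: finite_induct)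
 case empty thus ?case using subspace_0[OF assms(2)] by auto
next
 case (insert R Z)
 then obtain x where x: "x:V" "ALL Q:Z. x ~: W Q" by auto
 obtain y where y: "y:V" "y ~: W R" using insert by auto
 show ?case
 proof (cases "x:W R")
 case True
 have "finite {t. y + t *\<^sub>R x:W Q}" if Q: "Q:Z" for Q
 proof -
  have W: "subspace (W Q)" using insert Q by auto
  have "t = t'" if "y + t *\<^sub>R x:W Q" "y + t' *\<^sub>R x:W Q" for t t'
  proof (rule ccontr)
  assume "t ~= t'"
  have "(1 / (t - t')) *\<^sub>R ((y + t *\<^sub>R x) - (y + t' *\<^sub>R x)):W Q" using that W by (intro subspace_scale subspace_diff)
  moreover have "(1 / (t - t')) *\<^sub>R ((y + t *\<^sub>R x) - (y + t' *\<^sub>R x)) = x" using `t ~= t'` by (simp flip: scaleR_left_diff_distrib)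
  ultimately show False using x Q by auto
  qed
  hence "{t. y + t *\<^sub>R x:W Q} <= {SOME t. y + t *\<^sub>R x:W Q}" by (auto intro: someI2)
  thus ?thesis by (rule finite_subset) simp
 qed
 hence "finite (UN Q:Z. {t. y + t *\<^sub>R x:W Q})" using insert by simp
 then obtain t where "t ~: (UN Q:Z. {t. y + t *\<^sub>R x:W Q})" using infinite_UNIV_char_0 by (metis finite_subset subsetI)
 moreover have "y + t *\<^sub>R x ~: W R"
 proof
  assume "y + t *\<^sub>R x:W R"
  hence "(y + t *\<^sub>R x) - t *\<^sub>R x:W R" using True insert by (intro subspace_diff subspace_scale) auto
  thus False using y by simp
 qed
 ultimately show ?thesis using x y assms by (intro bexI[of _ "y + t *\<^sub>R x"]) (auto intro: subspace_add subspace_scale)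
 qed (use x in auto)
qed

context ffield
begin

text \<open>The span of the \<open>k\<close>-fold products of elements of \<open>V\<close>. With it,
  \<open>rat V\<close> is the function field of the image of the map given by \<open>V\<close>, as
  in \<open>birational_onto_image\<close>.\<close>

fun pw :: "'k set => nat => 'k set" where "pw V 0 = span {1}"
| "pw V (Suc k) = span {a * b |a b. a:V & b:pw V k}"

definition rat :: "'k set => 'k set" where "rat V = {a / b |a b k. a:pw V k & b:pw V k & b ~= 0}"
lemma pw_sub: "subspace (pw V k)" by (cases k) simp_all

lemma pw_mult: "a:pw V j ==> b:pw V k ==> a * b:pw V (j + k)"
proof (induction j arbitrary: a)
 case 0
 then obtain r where "a = of_real r" by (auto simp: span_singleton scr)
 thus ?case using 0 subspace_scale[OF pw_sub, of b V k r] by (simp add: scr)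
next
 case (Suc j)
 have "a:span {a * b |a b. a:V & b:pw V j}" using Suc.prems by simp
 thus ?case
 proof (induction rule: span_induct_alt)
 case base thus ?case using subspace_0[OF pw_sub, of V "Suc j + k"] by simp
 next
 case (step c x y)
 then obtain u w where "x = u * w" "u:V" "w:pw V j" by auto
 hence "x * b:pw V (Suc j + k)" using Suc.IH[OF _ Suc.prems(2), of w] by (auto intro!: span_base simp: mult.assoc)
 hence "c *\<^sub>R (x * b) + y * b:pw V (Suc j + k)" using step by (intro subspace_add[OF pw_sub] subspace_scale[OF pw_sub]) auto
 thus ?case by (simp add: distrib_right)
 qed
qed

lemma pw1: "a:V ==> a:pw V 1"
proof -
 assume "a:V"
 moreover have "1:span {1 :: 'k}" by (rule span_base) simp
 ultimately have "a:{a * b |a b. a:V & b:span {1}}" by force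
 thus ?thesis by (simp add: span_base)
qed

lemma pw_mono: "V <= W ==> pw V k <= pw W k" by (induction k) (auto intro!: span_mono)
lemma rat_mono: "V <= W ==> rat V <= rat W" unfolding rat_def using pw_mono by blast
lemma ratI: "a:V ==> b:V ==> b ~= 0 ==> a / b:rat V" unfolding rat_def using pw1 by blast

text \<open>Numerator and denominator of a sum or product of two quotients have the same degree
  again, namely the sum of the two degrees.\<close>

lemma rat_subr: "subr (rat V)" "a:rat V ==> inverse a:rat V"
proof -
 have one: "1:span {1 :: 'k}" by (rule span_base) simp
 show inv: "inverse a:rat V" if "a:rat V" for a
 proof (cases "a = 0")
 case False thus ?thesis using that unfolding rat_def by force
 qed (use that in simp)
 show "subr (rat V)" unfolding subr_def
 proof (intro conjI ballI)
 have "0 / 1:rat V" "1 / 1:rat V" unfolding rat_def using subspace_0[OF pw_sub, of V 0] one pw.simps[of V] by (metis (mono_tags, lifting) mem_Collect_eq zero_neq_one)+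
 thus "0:rat V" "1:rat V" by auto
 fix a b assume "a:rat V" "b:rat V"
 then obtain x y j z w k where *: "a = x / y" "x:pw V j" "y:pw V j" "y ~= 0" "b = z / w" "z:pw V k" "w:pw V k" "w ~= 0" unfolding rat_def by auto
 have 1: "a + b = (x * w + y * z) / (y * w)" "a * b = (x * z) / (y * w)" unfolding *(1,5) using *(4,8) by (simp_all add: add_divide_distrib)
 have 2: "y * w ~= 0" "y * w:pw V (j + k)" "x * w + y * z:pw V (j + k)" "x * z:pw V (j + k)" using * pw_mult subspace_add[OF pw_sub] by auto
 show "a + b:rat V" "a * b:rat V" unfolding 1 unfolding rat_def using 2 by blast+
 next
 fix a assume "a:rat V"
 then obtain x y j where *: "a = x / y" "x:pw V j" "y:pw V j" "y ~= 0" unfolding rat_def by auto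
 hence "- a = (- x) / y" "- x:pw V j" using subspace_neg[OF pw_sub] by auto
 thus "- a:rat V" unfolding rat_def using * by fast
 qed
qed

definition pencil :: "'q dvt => 'k => 'k => bool" where "pencil A s0 s1 <-> s0:H A & s1:H A & (ALL Q:Pts. ~ vg Q (1 - lk A Q) s0 | ~ vg Q (1 - lk A Q) s1)"

text \<open>At each of the finitely many zeros of \<open>s0\<close>, as a section of
  \<open>A\<close>, the sections vanishing there form a proper subspace; \<open>s1\<close> is chosen
  outside all of these.\<close>

lemma pencil_exists: assumes A: "A:Dv" and bpf: "!!Q. Q:Pts ==> l (A - pt Q) < l A" and s0: "s0:H A" "s0 ~= 0"
 obtains s1 where "pencil A s0 s1"
proof -
 let ?Z = "{Q:Pts. vg Q (1 - lk A Q) s0}"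
 have "?Z <= {Q:Pts. v Q s0 ~= 0} Un kys A" using s0 by (auto simp: vg_def in_keys_iff)
 hence fZ: "finite ?Z" by (rule finite_subset) (use fs[OF s0(2)] in simp)
 obtain s1 where s1: "s1:H A" "ALL Q:?Z. s1 ~: H (A - pt Q)"
 proof -
 have "~ H A <= H (A - pt Q)" if "Q:?Z" for Q
 proof -
  have Q: "Q:Pts" using that by simp
  show ?thesis using bpf[OF Q] dim_mono[OF H_fin[OF Dv_minus[OF A Dv_pt[OF Q]]], of "H A" 1] by (auto simp: l_def)
 qed
 thus ?thesis using subspace_avoid[OF fZ H_sub[of A], of "%Q. H (A - pt Q)"] H_sub that by auto
 qed
 have "vg R (- lk (A - pt Q) R) s1" if "Q:Pts" "vg Q (1 - lk A Q) s1" "R:Pts" for Q R using that s1 by (auto simp: H_def lookup_minus)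
 hence "~ vg Q (1 - lk A Q) s1" if "Q:?Z" for Q using s1 that unfolding H_def by auto
 thus ?thesis using that[of s1] s0 s1 unfolding pencil_def by simp
qed

text \<open>The base point free pencil trick: the kernel of
  \<open>(a, b) \<mapsto> s0 * a + s1 * b\<close> consists of the pairs
  \<open>(s1 * c, - s0 * c)\<close> with \<open>c\<close> in \<open>H (B - A)\<close>, so the map is
  onto by counting dimensions. Riemann's theorem gives the dimension condition in large
  degree.\<close>

lemma pencil_surj: assumes A: "A:Dv" and B: "B:Dv" and p: "pencil A s0 s1" and dim: "int (l (A + B)) = 2 * int (l B) - int (l (B - A))"
 and h: "h:H (A + B)" shows "EX a:H B. EX b:H B. h = s0 * a + s1 * b"
proof -
 define fy where "fy x = s0 * fst x + s1 * snd x" for x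
 have lin: "linear fy" by (rule linearI) (simp_all add: fy_def als)
 have lc: "linear (%c. (s1 * c, - (s0 * c)))" by (rule linearI) (simp_all add: als)
 let ?V = "H B \<times> H B"
 have Vs: "subspace ?V" by (intro subspace_Times H_sub)
 have fB: "fin (H B)" and fA: "fin (H (B - A))" and fC: "fin (H (A + B))" using A B H_fin Dv_minus Dv_add by auto
 have im: "fy ` ?V <= H (A + B)" using p unfolding fy_def pencil_def by (auto intro!: subspace_add[OF H_sub] H_mult)
 have ker: "{x:?V. fy x = 0} <= (%c. (s1 * c, - (s0 * c))) ` H (B - A)"
 proof
 fix x assume x: "x:{x:?V. fy x = 0}"
 obtain a b where ab: "x = (a, b)" "a:H B" "b:H B" "s0 * a = - (s1 * b)" using x by (cases x) (auto simp: fy_def eq_neg_iff_add_eq_0)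
 obtain Q where Q: "Q:Pts" using ne by auto
 have ns: "s0 ~= 0 | s1 ~= 0" using p Q by (auto simp: pencil_def)
 define c where "c = (if s1 = 0 then - b / s0 else a / s1)"
 have c: "a = s1 * c" "b = - (s0 * c)" using ab ns by (auto simp: c_def)
 have "c:H (B - A)" unfolding H_def
 proof (intro CollectI ballI)
  fix Q assume Q: "Q:Pts"
  have nn: "vg Q (- lk A Q) s0" "vg Q (- lk A Q) s1" "~ vg Q (1 - lk A Q) s0 | ~ vg Q (1 - lk A Q) s1" using p Q by (auto simp: pencil_def H_def)
  have "vg Q (- lk B Q) (s0 * c)" "vg Q (- lk B Q) (s1 * c)" using ab c Q vg_neg[OF Q, of _ b] by (auto simp: H_def)
  thus "vg Q (- lk (B - A) Q) c" using nn by (cases "c = 0") (auto simp: vg_def lookup_minus v_mult[OF Q])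
 qed
 thus "x:(%c. (s1 * c, - (s0 * c))) ` H (B - A)" using ab c by auto
 qed
 note dl = dim_linear[OF lc fA]
 have fk: "fin {x:?V. fy x = 0}" using fin_mono[OF dl(1) ker] .
 obtain E where E: "finite E" "fy ` ?V <= span E" "card E = dim (fy ` ?V)" using fin_basis[OF fin_mono[OF fC im]] by metis
 have k: "fin ?V & dim ?V <= dim {x:?V. fy x = 0} + card E" by (rule dim_kernel[OF Vs _ _ fk E(1,2)]) (auto simp: linear_add[OF lin] linear_scale[OF lin])
 obtain C where C: "finite C" "C <= H B" "independent C" "card C = l B" using fin_basis[OF fB] unfolding l_def by metis
 have "card (C \<times> (UNIV :: bool set)) <= dim ?V"
 proof (rule fam_dim[of _ _ "%(c, t). if t then (c, 0) else (0, c)"])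
 fix r assume 0: "(SUM t:C \<times> (UNIV :: bool set). r t *\<^sub>R (case t of (c, t) => if t then (c, 0) else (0, c))) = 0"
 have "(SUM c:C. r (c, True) *\<^sub>R (c, 0) + r (c, False) *\<^sub>R (0, c)) = 0"
 proof -
  have "(SUM c:C. SUM t:UNIV. r (c, t) *\<^sub>R (if t then (c, 0) else (0, c))) = 0" using 0 by (simp add: sum.cartesian_product split_def)
  thus ?thesis by (simp add: UNIV_bool)
 qed
 hence "(SUM c:C. r (c, True) *\<^sub>R c) = 0 & (SUM c:C. r (c, False) *\<^sub>R c) = 0" by (simp add: prod_eq_iff fst_sum snd_sum)
 hence "r (c, True) = 0 & r (c, False) = 0" if "c:C" for c
  using independentD[OF C(3,1) subset_refl, of "%c. r (c, True)"] independentD[OF C(3,1) subset_refl, of "%c. r (c, False)"] that by simp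
 thus "ALL t:C \<times> (UNIV :: bool set). r t = 0" by (auto simp: all_bool_eq)
 qed (use k C subspace_0[OF H_sub] in auto)
 hence "2 * l B <= dim ?V" using C by simp
 hence "l (A + B) <= dim (fy ` ?V)" using k E dim_mono[OF dl(1) ker] dl dim by (simp add: l_def)
 hence "h:fy ` ?V" using dim_strict[OF fC im linear_subspace_image[OF lin Vs] h] by (auto simp: l_def)
 thus ?thesis unfolding fy_def by force
qed

end

context ffield
begin

lemma l_base: "D:Dv ==> P:Pts ==> l (D - pt P) <= l D" by (rule l_mono) (auto simp: lookup_minus)

lemma H_pt: assumes P: "P:Pts" shows "f:H (A - pt P) <-> f:H A & vg P (1 - lk A P) f"
proof
 assume f: "f:H (A - pt P)"
 hence "vg P (1 - lk A P) f" using P by (auto simp: H_def lookup_minus)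
 moreover have "H (A - pt P) <= H A" by (rule H_mono) (simp add: lookup_minus)
 ultimately show "f:H A & vg P (1 - lk A P) f" using f by auto
next
 assume f: "f:H A & vg P (1 - lk A P) f"
 show "f:H (A - pt P)" unfolding H_def
 proof (intro CollectI ballI)
 fix Q assume Q: "Q:Pts"
 show "vg Q (- lk (A - pt P) Q) f" using f Q by (cases "Q = P") (auto simp: H_def lookup_minus)
 qed
qed

lemma dgr_nonneg: assumes "D:Dv" "0 < l D" shows "0 <= dgr D"
proof -
 obtain f where f: "f ~= 0" "f:H D" using l_pos[OF assms(2)] by blast
 have "lk (D + dvs f) P >= 0" for P using f H_iff Dv_add[OF assms(1) dvs_Dv[OF f(1)]] by (cases "P:Pts") (auto simp: Dv_iff)
 hence "eff (D + dvs f)" using Dv_add[OF assms(1) dvs_Dv[OF f(1)]] by (simp add: eff_def)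
 from eff_dgr[OF this] show ?thesis by (simp add: dgr_add dgr_dvs[OF f(1)])
qed

text \<open>By \<open>full\<close>, removing \<open>P\<close> costs the whole dimension of the
  residue field, so the leading coefficients at \<open>P\<close> of the sections of \<open>D\<close>
  fill it.\<close>

lemma lc_surj: assumes D: "D:Dv" and P: "P:Pts" and full: "l D = l (D - pt P) + dg P" and f: "vg P n f" shows "EX s:H D. lc P (- lk D P) s = lc P n f"
proof -
 let ?n = "- lk D P"
 have vH: "vg P ?n s" if "s:H D" for s using that P by (auto simp: H_def)
 obtain E where E: "finite E" "card E = dg P" "!!n f. vg P n f ==> lc P n f:span E" using lc_span[OF P] by auto
 have ker: "{s:H D. lc P ?n s = 0} = H (D - pt P)" using lc_zero[OF P vH] by (auto simp: H_pt[OF P])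
 have sub: "subspace (lc P ?n ` H D)" unfolding subspace_def
 proof (intro conjI ballI allI)
 show "0:lc P ?n ` H D" using lc_zero[OF P, of ?n 0] subspace_0[OF H_sub] vg_zero[OF P] by simp
 fix x y assume "x:lc P ?n ` H D" "y:lc P ?n ` H D"
 then obtain a b where "a:H D" "b:H D" "x = lc P ?n a" "y = lc P ?n b" by auto
 thus "x + y:lc P ?n ` H D" using lc_add[OF P, of ?n a b] vH subspace_add[OF H_sub, of a D b] by force
 next
 fix c x assume "x:lc P ?n ` H D"
 then obtain a where "a:H D" "x = lc P ?n a" by auto
 thus "c *\<^sub>R x:lc P ?n ` H D" using lc_rmult[OF P, of ?n a c] vH subspace_scale[OF H_sub, of a D c] by (metis imageI scr)
 qed
 have fE: "fin (span E)" using E unfolding fin_def by auto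
 have im: "lc P ?n ` H D <= span E" using E vH by auto
 obtain B where B: "finite B" "lc P ?n ` H D <= span B" "card B = dim (lc P ?n ` H D)" using fin_basis[OF fin_mono[OF fE im]] by metis
 have "fin (H D) & dim (H D) <= dim {s:H D. lc P ?n s = 0} + card B"
 by (rule dim_kernel[OF H_sub]) (use lc_add[OF P] lc_rmult[OF P] vH B H_fin[OF Dv_minus[OF D Dv_pt[OF P]]] in \<open>auto simp: ker scr\<close>)
 hence "dg P <= dim (lc P ?n ` H D)" using full by (simp add: ker l_def B)
 moreover have "dim (span E) <= dg P" using dim_le_card[of "span E" E] E by simp
 ultimately have "lc P n f:lc P ?n ` H D" using dim_strict[OF fE im sub E(3)[OF f]] by auto
 thus ?thesis by auto
qed

text \<open>Since the sections of \<open>D - pt P\<close> have no base point, those of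
  \<open>D\<close> separate \<open>P\<close> from all other points and from its tangent direction;
  by \<open>full\<close> they also generate the residue field. In algebraic terms, let
  \<open>L = rat (H D)\<close>. Nakayama's lemma over the local ring of \<open>L\<close> at
  \<open>P\<close> puts all quotients \<open>b / s0^k\<close> with \<open>b\<close> in
  \<open>H (ml k D)\<close> into \<open>L\<close>, and for large \<open>k\<close> every function is
  a quotient of two of these.\<close>

theorem birational_criterion: assumes D: "D:Dv" and bpf: "!!Q. Q:Pts ==> l (D - pt Q) < l D" and P: "P:Pts" and full: "l D = l (D - pt P) + dg P"
 and l1: "1 <= l (D - pt P)" and bpf': "!!Q. Q:Pts ==> l (D - pt P - pt Q) < l (D - pt P)" shows "rat (H D) = UNIV"
proof -
 define D' where "D' = D - pt P"
 have D': "D':Dv" unfolding D'_def by (rule Dv_minus[OF D Dv_pt[OF P]])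
 have H': "H D' <= H D" unfolding D'_def by (rule H_mono) (simp add: lookup_minus)
 have "0 <= dgr D'" using dgr_nonneg[OF D'] l1 by (simp add: D'_def)
 hence d: "dg P <= dgr D" "1 <= dgr D" using dg_pos[of P] by (simp_all add: D'_def dgr_minus dgr_single)
 obtain ga d0 where RR: "!!D. D:Dv ==> d0 <= dgr D ==> int (l D) = dgr D - ga" by (rule riemann) (rule that)
 have sub: "~ H D <= H D'" using bpf[OF P] dim_mono[OF H_fin[OF D'], of "H D"] by (auto simp: l_def D'_def)
 then obtain s0 where s0: "s0:H D" "s0 ~: H D'" by auto
 hence s00: "s0 ~= 0" using subspace_0[OF H_sub] by auto
 have s0P: "v P s0 = - lk D P"
 proof -
 have "~ vg P (1 - lk D P) s0" using s0 by (simp add: D'_def H_pt[OF P])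
 thus ?thesis using s0 P by (auto simp: H_def vg_def)
 qed
 obtain s1 where s1: "pencil D s0 s1" by (rule pencil_exists[OF D bpf s0(1) s00])
 obtain u0 where u0: "u0:H D'" "u0 ~= 0" using l_pos[of D'] l1 unfolding D'_def by force
 obtain u1 where u1: "pencil D' u0 u1" by (rule pencil_exists[OF D' bpf'[folded D'_def] u0])
 have big: "EX k. ALL a:{k..k+2}. d0 + n <= int a * dgr D" for n
 proof (intro exI ballI)
 fix a assume a: "a:{nat (d0 + n)..nat (d0 + n) + 2}"
 hence "d0 + n <= int a * 1" by auto
 also have "... <= int a * dgr D" using d by (intro mult_left_mono) auto
 finally show "d0 + n <= int a * dgr D" .
 qed
 have "h:rat (H D)" for h
 proof (cases "h = 0")
 case True thus ?thesis using subrD[OF rat_subr(1)] by simp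
 next
 case h0: False
 obtain k0 where k0: "!!a. a:{k0..k0+2} ==> d0 + (\<bar> ga\<bar> + dgr (pos (- dvs h)) + \<bar>d0\<bar> + dg P + 1) <= int a * dgr D" using big by fast
 define k where "k = k0 + 1"
 have ph: "eff (pos (- dvs h))" using h0 dvs_Dv by (intro eff_pos) (simp add: Dv_iff)
 have b1: "d0 <= int k0 * dgr D - dg P" "d0 <= int k * dgr D" "d0 <= int k * dgr D - dgr (pos (- dvs h))" "1 <= int k * dgr D - dgr (pos (- dvs h)) - ga" "int k * dgr D = int k0 * dgr D + dgr D"
  using k0[of k0] k0[of k] eff_dgr[OF ph] by (auto simp: k_def als)
 let ?B = "ml k D"
 have B: "?B:Dv" by (rule Dv_ml[OF D])
 have dB: "dgr ?B = int k0 * dgr D + dgr D" by (simp add: dgr_ml b1)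
 have dD': "dgr D' = dgr D - dg P" by (simp add: D'_def dgr_minus dgr_single)
 have S1: "EX a:H ?B. EX b:H ?B. g = u0 * a + u1 * b" if "g:H (D' + ?B)" for g
 proof (rule pencil_surj[OF D' B u1 _ that])
  have "d0 <= dgr (D' + ?B)" "d0 <= dgr ?B" "d0 <= dgr (?B - D')" using b1 d by (simp_all add: dD' dgr_add dgr_minus dB)
  note RR[OF Dv_add[OF D' B] this(1)] RR[OF B this(2)] RR[OF Dv_minus[OF B D'] this(3)]
  thus "int (l (D' + ?B)) = 2 * int (l ?B) - int (l (?B - D'))" by (simp add: dgr_add dgr_minus)
 qed
 obtain Bs where Bs: "finite Bs" "Bs <= H ?B" "H ?B <= span Bs" using fin_basis[OF H_fin[OF B]] by metis
 define L where "L = rat (H D)"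
 have L: "subr L" "!!a. a:L ==> inverse a:L" unfolding L_def by (rule rat_subr)+
 have Lr: "of_real r:L" for r
 proof -
  have "of_real r:span {1 :: 'k}" "1:span {1 :: 'k}" by (auto simp: span_singleton scr)
  hence "of_real r / 1:L" unfolding L_def rat_def using pw.simps[of "H D"] by (metis (mono_tags, lifting) mem_Collect_eq zero_neq_one)
  thus ?thesis by simp
 qed
 let ?O = "L Int Ol P" and ?m = "L Int mx (Ol P)"
 have O: "subr ?O" using L ffield.sub[OF ffield_axioms P] unfolding subr_def by simp
 have m: "idl ?m ?O" using L mxI[OF P] unfolding subr_def idl_def by auto
 have loc: "1 - a ~= 0 & inverse (1 - a):?O" if "a:?m" for a using that mx_local(1)[OF ffield.sub[OF ffield_axioms P] mxI[OF P], of a] L subrD[OF L(1)] by simp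
 have s0k: "s0 ^ j:H (ml j D)" for j
 proof (induction j)
  case 0 thus ?case using vg_real[of _ 1] by (simp add: H_def lk_ml)
 next
  case (Suc j) thus ?case using H_mult[OF s0(1) Suc] by (simp add: ml_simps add.commute)
 qed
 have quot: "vg P (- n - int j * v P s0) (g / s0 ^ j)" if "vg P (- n) g" for g n j
  using vg_mult[OF P that, of "- (int j * v P s0)" "inverse (s0 ^ j)"] s00 by (simp add: vg_def v_inv[OF P] v_pow[OF P] divide_inverse)
 \<comment> \<open>Subtract from \<open>s0 * b\<close> a product \<open>s0^k * s\<close> with the
   same leading term at \<open>P\<close>. The rest is a section of \<open>D' + ?B\<close>, and the
   pencil trick for \<open>D'\<close> expands it in the basis \<open>Bs\<close> with coefficients in
   \<open>H D'\<close>. Divided by \<open>s0\<close> these coefficients vanish at \<open>P\<close>,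
   so they lie in \<open>?m\<close>.\<close>
 have step: "EX p:?O. EX c. (ALL j:Bs. c j:?m) & b / s0 ^ k = p * 1 + (SUM j:Bs. c j * (j / s0 ^ k))" if b: "b:Bs" for b
 proof -
  have bH: "b:H ?B" using b Bs by auto
  have s0b: "s0 * b:H (ml (Suc k) D)" using H_mult[OF s0(1) bH] by (simp add: ml_simps add.commute)
  hence vb: "vg P (int (Suc k) * v P s0) (s0 * b)" using P by (auto simp: H_def lk_ml s0P)
  have vq: "vg P (v P s0) (s0 * b / s0 ^ k)" using quot[of "- (int (Suc k) * v P s0)" "s0 * b" k] vb by (simp add: als)
  obtain s where s: "s:H D" "lc P (v P s0) s = lc P (v P s0) (s0 * b / s0 ^ k)" using lc_surj[OF D P full vq] by (auto simp: s0P)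
  have vs: "vg P (v P s0) s" using s P by (simp add: H_def s0P)
  have "vg P (v P s0 + 1) (s0 * b / s0 ^ k - s)" using lc_eq[OF P vq vs] s by simp
  hence "vg P (int k * v P s0 + (v P s0 + 1)) (s0 ^ k * (s0 * b / s0 ^ k - s))" using s00 by (intro vg_mult[OF P]) (auto simp: vg_def v_pow[OF P])
  moreover have sb: "s0 ^ k * (s0 * b / s0 ^ k - s) = s0 * b - s0 ^ k * s" by (simp add: field_simps)
  ultimately have vd: "vg P (1 - lk (ml (Suc k) D) P) (s0 * b - s0 ^ k * s)" by (simp add: lk_ml s0P als)
  have "s0 * b - s0 ^ k * s:H (ml (Suc k) D)" using s0b H_mult[OF s0k[of k] s(1)] by (intro subspace_diff[OF H_sub]) (auto simp: ml_simps)
  hence "s0 * b - s0 ^ k * s:H (ml (Suc k) D - pt P)" using vd by (simp add: H_pt[OF P])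
  moreover have "ml (Suc k) D - pt P = D' + ?B" by (simp add: ml_simps D'_def)
  ultimately have "s0 * b - s0 ^ k * s:H (D' + ?B)" by simp
  then obtain x y where xy: "x:H ?B" "y:H ?B" "s0 * b - s0 ^ k * s = u0 * x + u1 * y" using S1 by fast
  obtain xq where xq: "x = (SUM j:Bs. xq j *\<^sub>R j)" using xy Bs span_finite[OF Bs(1)] by auto
  obtain et where et: "y = (SUM j:Bs. et j *\<^sub>R j)" using xy Bs span_finite[OF Bs(1)] by auto
  define m' where "m' j = xq j *\<^sub>R u0 + et j *\<^sub>R u1" for j
  have mH: "m' j:H D'" for j unfolding m'_def using u1 by (intro subspace_add[OF H_sub] subspace_scale[OF H_sub]) (auto simp: pencil_def)
  have eq: "s0 * b - s0 ^ k * s = (SUM j:Bs. m' j * j)" unfolding xy xq et m'_def by (simp add: sdl als sum.distrib)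
  have "b / s0 ^ k = (s0 * b) / s0 ^ Suc k" using s00 by simp
  also have "s0 * b = s0 ^ k * s + (SUM j:Bs. m' j * j)" using eq by (simp add: als)
  also have "... / s0 ^ Suc k = s / s0 + (SUM j:Bs. m' j * j) / s0 ^ Suc k" by (simp add: add_divide_distrib)
  also have "... = s / s0 * 1 + (SUM j:Bs. m' j / s0 * (j / s0 ^ k))" by (simp add: sum_divide_distrib)
  finally have 1: "b / s0 ^ k = s / s0 * 1 + (SUM j:Bs. m' j / s0 * (j / s0 ^ k))" .
  have 2: "s / s0:?O" using ratI[OF s(1) s0(1) s00] quot[of "- v P s0" s 1] vs vg0[OF P] by (simp add: L_def)
  have 3: "m' j / s0:?m" for j
  proof -
  have "vg P (- (lk D P - 1)) (m' j)" using mH by (simp add: D'_def H_pt[OF P])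
  from quot[OF this, of 1] show ?thesis using ratI[OF _ s0(1) s00, of "m' j"] mH H' vg1[OF P] by (auto simp: L_def s0P)
  qed
  show ?thesis using 3 by (intro bexI[OF _ 2] exI[of _ "%j. m' j / s0"] conjI ballI 1) auto
 qed
 have "ALL b:Bs. EX p:?O. b / s0 ^ k = p * 1" by (rule nakayama1[OF O m loc _ Bs(1) step]) (use subrD(2)[OF O] in auto)
 hence bL: "b / s0 ^ k:L" if "b:Bs" for b using that by auto
 have HL: "g / s0 ^ k:L" if gH: "g:H ?B" for g
 proof -
  obtain xq where "g = (SUM j:Bs. xq j *\<^sub>R j)" using subsetD[OF Bs(3) gH] unfolding span_finite[OF Bs(1)] by auto
  hence "g / s0 ^ k = (SUM j:Bs. of_real (xq j) * (j / s0 ^ k))" by (simp add: sum_divide_distrib scr)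
  thus ?thesis using bL Lr by (simp del: times_divide_eq_right add: subr_sum[OF L(1)] subrD[OF L(1)])
 qed
 \<comment> \<open>A section \<open>g\<close> that absorbs the poles of \<open>h\<close>: both
   \<open>g\<close> and \<open>h * g\<close> are in \<open>H ?B\<close>, so their quotient
   \<open>h\<close> is in \<open>L\<close>.\<close>
 have "int (l (?B - pos (- dvs h))) = dgr (?B - pos (- dvs h)) - ga" using b1 ph by (intro RR Dv_minus B) (auto simp: dgr_minus dgr_ml eff_def)
 hence "0 < l (?B - pos (- dvs h))" using b1 by (simp add: dgr_minus dgr_ml)
 then obtain g where g: "g ~= 0" "g:H (?B - pos (- dvs h))" by (rule l_pos)
 have "g:H ?B" using g H_mono[of "?B - pos (- dvs h)" ?B] by (auto simp: lookup_minus lk_pos)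
 moreover have "h * g:H ?B"
 proof -
  have "h:H (pos (- dvs h))" unfolding H_iff[OF h0] by (auto simp: lookup_add lk_pos)
  from H_mult[OF this g(2)] show ?thesis by simp
 qed
 ultimately have "(h * g / s0 ^ k) * inverse (g / s0 ^ k):L" using HL by (intro subrD(4)[OF L(1)] L(2)) auto
 thus ?thesis using g s00 by (simp add: L_def)
 qed
 thus ?thesis by auto
qed

end

text \<open>A copy of the space of real functions, since the function type itself is not an instance of
 \<^class>\<open>t2_space\<close>.\<close>

typedef 'a rfun = "UNIV :: ('a => real) set" morphisms rap rabs by simp

instantiation rfun :: (type) topological_space
begin
definition open_rfun :: "'a rfun set => bool" where "open_rfun U <-> open (rabs -` U)"
instance by standard (auto simp: open_rfun_def vimage_Union)
end

lemma rap_rabs [simp]: "rap (rabs f) = f" "rabs (rap x) = x" by (simp_all add: rabs_inverse rap_inverse)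

lemma continuous_rap: "continuous_on S (%x. rap x i)"
proof -
 have "open ((%x. rap x i) -` V)" if "open V" for V using open_vimage[OF that continuous_on_product_coordinates[of i]] by (simp add: open_rfun_def vimage_def)
 hence "continuous_on UNIV (%x :: 'a rfun. rap x i)" by (simp add: continuous_on_open_vimage)
 thus ?thesis by (rule continuous_on_subset) simp
qed

lemma continuous_rabs: "continuous_on S rabs" by (rule continuous_on_subset[of UNIV]) (auto simp: continuous_on_open_vimage open_rfun_def)

instance rfun :: (type) t2_space
proof
 fix x y :: "'a rfun" assume "x ~= y"
 then obtain i where "rap x i ~= rap y i" by (metis ext rap_inject)
 then obtain U V where "open U" "open V" "rap x i:U" "rap y i:V" "U Int V = {}" using hausdorff by metis
 thus "EX U V. open U & open V & x:U & y:V & U Int V = {}" using open_vimage[OF _ continuous_rap[of UNIV i]] by auto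
qed

section \<open>Every proper valuation ring over the reals belongs to a point\<close>

context ffield
begin

lemma conj_poly: assumes Q: "Q:Pts" "z:Ol Q" shows "vg Q 1 (z * z - of_real (2 * Re (ev Q z)) * z + of_real ((Re (ev Q z))^2 + (Im (ev Q z))^2))"
proof -
 let ?q = "[:(Re (ev Q z))^2 + (Im (ev Q z))^2, - 2 * Re (ev Q z), 1:]"
 note r = res_pev[OF sub[OF Q(1)] mxI[OF Q(1)] rl[OF Q(1)] rs[OF Q(1)] Q(2), of ?q]
 have "pev ?q (ev Q z) = 0" by (simp add: complex_eq_iff p2)
 hence "vg Q 1 (pev ?q z)" using r evf(4)[OF Q(1), of "pev ?q z"] vg1[OF Q(1)] by auto
 thus ?thesis by (simp add: als)
qed

text \<open>For large \<open>n\<close> Riemann's theorem is exact for both divisors, so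
  \<open>Q\<close> is not a base point.\<close>

lemma mono_growth: assumes A: "A:Dv" "0 < dgr A" and E: "E:Dv" and Q: "Q:Pts" shows "EX n0. ALL n>=n0. EX s. s:H (ml n A - E) & s ~: H (ml n A - E - pt Q)"
proof -
 obtain ga d0 where RR: "!!D. D:Dv ==> d0 <= dgr D ==> int (l D) = dgr D - ga" by (rule riemann) (rule that)
 have "EX s. s:H (ml n A - E) & s ~: H (ml n A - E - pt Q)" if n: "nat (d0 + dgr E + int (dg Q)) <= n" for n
 proof -
 have "int n * 1 <= int n * dgr A" using A by (intro mult_left_mono) auto
 hence b: "d0 <= dgr (ml n A - E - pt Q)" "d0 <= dgr (ml n A - E)" using n by (auto simp: dgr_minus dgr_ml dgr_single)
 have D: "ml n A - E:Dv" "ml n A - E - pt Q:Dv" using A E Q by (auto intro!: Dv_minus Dv_ml Dv_pt)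
 have "l (ml n A - E - pt Q) < l (ml n A - E)" using RR[OF D(1) b(2)] RR[OF D(2) b(1)] dg_pos[of Q] by (simp add: dgr_minus dgr_single)
 thus ?thesis using dim_mono[OF H_fin[OF D(2)], of "H (ml n A - E)"] by (auto simp: l_def)
 qed
 thus ?thesis by auto
qed

context
 fixes VO :: "'k set" assumes VO: "subr VO" "!!r. of_real r:VO" "!!f. f:VO | inverse f:VO" and VOne: "VO ~= UNIV"
begin

lemma VO_div: "a / b:VO | b / a:VO" using VO(3)[of "a / b"] by simp

lemma VO_mx: "idl (mx VO) VO"
proof -
 have mult: "c * b:mx VO" if "c:VO" "b:mx VO" for c b
 proof (cases "c * b = 0")
 case False
 have "inverse (c * b) ~: VO"
 proof
  assume "inverse (c * b):VO"
  hence "c * inverse (c * b):VO" using that subrD[OF VO(1)] by simp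
  thus False using False that by (auto simp: mx_def field_simps)
 qed
 thus ?thesis using that subrD[OF VO(1)] by (auto simp: mx_def)
 next
 case True show ?thesis unfolding True using subrD[OF VO(1)] by (simp add: mx_def)
 qed
 have one: "a + b:mx VO" if "a:mx VO" "b:mx VO" "a / b:VO" "b ~= 0" for a b using mult[of "a / b + 1" b] that subrD[OF VO(1)] by (simp add: distrib_right)
 have "a + b:mx VO" if "a:mx VO" "b:mx VO" for a b using that one one[of b a] VO_div by (cases "a = 0 | b = 0") (auto simp: add.commute)
 thus ?thesis using mult subrD[OF VO(1)] unfolding idl_def by (auto simp: mx_def)
qed

text \<open>Divisibility over a valuation ring is total, so in a finite set some element divides all
  others.\<close>

lemma VO_max: assumes "finite S" "S ~= {}" shows "EX m:S. ALL b:S. b ~= 0 --> m ~= 0 & b / m:VO" using assms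
proof (induction S rule: finite_ne_induct)
 case (singleton x) thus ?case using subrD[OF VO(1)] by auto
next
 case (insert x S)
 then obtain m where m: "m:S" "!!b. b:S ==> b ~= 0 ==> m ~= 0 & b / m:VO" by auto
 show ?case
 proof (cases "x = 0 | (m ~= 0 & x / m:VO)")
 case False
 hence "m = 0 | m / x:VO" using VO_div by auto
 have "b / x:VO" if "b:S" "b ~= 0" for b
 proof -
  have "b / m * (m / x):VO" using m(2)[OF that] `m = 0 | _` by (intro subrD(4)[OF VO(1)]) auto
  thus ?thesis using m(2)[OF that] by simp
 qed
 thus ?thesis using False subrD[OF VO(1)] by simp
 qed (use m in auto)
qed

text \<open>Pick \<open>y\<close> in the maximal ideal of \<open>VO\<close> and let
  \<open>B1\<close> be the ring of functions whose poles are among those of \<open>y\<close>. It is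
  contained in \<open>VO\<close>, and some zero \<open>Q\<close> of \<open>y\<close> has the
  property that functions in \<open>B1\<close> vanishing at \<open>Q\<close> are nonunits of
  \<open>VO\<close>. Then \<open>Ol Q\<close> is contained in \<open>VO\<close>, and discrete
  valuation rings are maximal.\<close>

theorem place: "EX Q:Pts. VO = Ol Q"
proof -
 obtain x where x: "x ~: VO" using VOne by auto
 define y where "y = inverse x"
 have y: "y:VO" "y ~= 0" "inverse y ~: VO" using x VO subrD by (auto simp: y_def)
 let ?A = "pos (- dvs y)"
 have A: "eff ?A" using y dvs_Dv by (intro eff_pos) (simp add: Dv_iff)
 hence AD: "?A:Dv" by (simp add: eff_def)
 have lkA: "lk ?A P = (if P:Pts then max 0 (- v P y) else 0)" for P using y by (simp add: lk_pos lk_dvs)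
 have yA: "y:H ?A" using zpow_H[OF y(2), of 1] by (simp add: ml_def)
 have dA: "0 < dgr ?A"
 proof (rule ccontr)
 assume "~ ?thesis"
 hence "dgr ?A = 0" using eff_dgr[OF A] by simp
 hence "ALL P:kys ?A. lk ?A P * int (dg P) = 0" unfolding dgr_def using A by (subst (asm) sum_nonneg_eq_0_iff) (auto simp: eff_def)
 hence "P ~: kys ?A" for P using dg_pos[of P] by auto
 hence "?A = 0" by force
 then obtain r where "y = of_real r" using yA H_0 by auto
 hence "inverse y = of_real (inverse r)" by simp
 thus False using y VO by metis
 qed
 obtain ga d0 where RR: "!!D. D:Dv ==> d0 <= dgr D ==> int (l D) = dgr D - ga" by (rule riemann) (rule that)
 define n0 where "n0 = nat (d0 + dgr ?A)"
 have vg1H: "1:H D" if "!!P. 0 <= lk D P" for D using vg_real[of _ 1] vg_mono[of _ 0 1] that by (auto simp: H_def)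
 have A0: "0 <= lk ?A P" for P by (simp add: lkA)
 \<comment> \<open>As sections of \<open>?A\<close>, 1 does not vanish outside the poles of
   \<open>y\<close>, and \<open>y\<close> does not vanish at them. By the pencil trick the functions
   in \<open>H (ml n ?A)\<close> for large \<open>n\<close> are combinations of those in
   \<open>H (ml n0 ?A)\<close> with coefficients polynomial in \<open>y\<close>, hence in
   \<open>VO\<close>.\<close>
 have pc: "pencil ?A 1 y" unfolding pencil_def using yA vg1H y by (auto simp: vg_def lkA)
 have gen: "EX a:H (ml n ?A). EX b:H (ml n ?A). g = a + y * b" if n: "n0 <= n" and g: "g:H (ml (Suc n) ?A)" for n g
 proof -
 have D: "?A + ml n ?A:Dv" "ml n ?A:Dv" "ml n ?A - ?A:Dv" using AD by (auto intro!: Dv_add Dv_minus Dv_ml)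
 have "int n * 1 <= int n * dgr ?A" using dA by (intro mult_left_mono) auto
 hence "d0 <= dgr (?A + ml n ?A)" "d0 <= dgr (ml n ?A)" "d0 <= dgr (ml n ?A - ?A)" using n dA unfolding n0_def by (auto simp: dgr_add dgr_minus dgr_ml)
 note R = RR[OF D(1) this(1)] RR[OF D(2) this(2)] RR[OF D(3) this(3)]
 have "EX a:H (ml n ?A). EX b:H (ml n ?A). g = 1 * a + y * b"
  by (rule pencil_surj[OF AD D(2) pc]) (use R g in \<open>auto simp: dgr_add dgr_minus ml_simps add.commute\<close>)
 thus ?thesis by simp
 qed
 have mlm: "H (ml a ?A) <= H (ml b ?A)" if "a <= b" for a b using A0 that by (intro H_mono) (auto simp: lk_ml mult_right_mono)
 obtain Bs where Bs: "finite Bs" "H (ml n0 ?A) <= span Bs" "Bs <= H (ml n0 ?A)" "independent Bs" using fin_basis[OF H_fin[OF Dv_ml[OF AD]]] by metis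
 have rep: "EX c. (ALL b:Bs. c b:VO) & g = (SUM b:Bs. c b * b)" if "g:H (ml (n0 + j) ?A)" for j g using that
 proof (induction j arbitrary: g)
 case 0
 then obtain r where "g = (SUM b:Bs. r b *\<^sub>R b)" using Bs unfolding span_finite[OF Bs(1)] by auto
 thus ?case using VO by (intro exI[of _ "%b. of_real (r b)"]) (simp add: scr)
 next
 case (Suc j)
 then obtain a b where ab: "a:H (ml (n0 + j) ?A)" "b:H (ml (n0 + j) ?A)" "g = a + y * b" using gen[of "n0 + j" g] by auto
 obtain c where c: "ALL b:Bs. c b:VO" "a = (SUM b:Bs. c b * b)" using Suc.IH[OF ab(1)] by auto
 obtain c' where c': "ALL b:Bs. c' b:VO" "b = (SUM b:Bs. c' b * b)" using Suc.IH[OF ab(2)] by auto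
 have "g = (SUM b:Bs. (c b + y * c' b) * b)" unfolding ab by (subst c(2), subst c'(2)) (simp add: sdl distrib_right sum.distrib mult.assoc)
 thus ?case using c c' y subrD[OF VO(1)] by (intro exI[of _ "%b. c b + y * c' b"]) auto
 qed
 define B1 where "B1 = (\<Union>n. H (ml n ?A))"
 have B1s: "subr B1" unfolding subr_def
 proof (intro conjI ballI)
 show "0:B1" "1:B1" using subspace_0[OF H_sub] vg1H[of "ml 0 ?A"] by (auto simp: B1_def lk_ml)
 fix a b assume "a:B1" "b:B1"
 then obtain m n where mn: "a:H (ml m ?A)" "b:H (ml n ?A)" by (auto simp: B1_def)
 hence "a:H (ml (m + n) ?A)" "b:H (ml (m + n) ?A)" using mlm[of m "m + n"] mlm[of n "m + n"] by auto
 thus "a + b:B1" using subspace_add[OF H_sub] unfolding B1_def by auto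
 show "a * b:B1" using H_mult[OF mn] unfolding B1_def ml_add[symmetric] by auto
 qed (use subspace_neg[OF H_sub] in \<open>auto simp: B1_def\<close>)
 have B1r: "of_real r:B1" for r using H_0 by (auto simp: B1_def ml_simps intro!: exI[of _ 0])
 have "1:H (ml n0 ?A)" by (rule vg1H) (simp add: lk_ml lkA)
 hence "~ H (ml n0 ?A) <= {0}" by auto
 hence "Bs ~= {}" using Bs by auto
 then obtain m where m: "m:Bs" "!!b. b:Bs ==> b ~= 0 ==> m ~= 0 & b / m:VO" using VO_max[OF Bs(1)] by auto
 have m0: "m ~= 0" using m Bs dependent_zero by auto
 \<comment> \<open>\<open>h * m\<close> is a combination of \<open>Bs\<close> with coefficients in
   \<open>VO\<close>, and \<open>m\<close> divides every element of \<open>Bs\<close> over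
   \<open>VO\<close>.\<close>
 have B1V: "h:VO" if "h:B1" for h
 proof -
 obtain n where "h:H (ml n ?A)" using `h:B1` by (auto simp: B1_def)
 hence "h * m:H (ml (n0 + n) ?A)" using H_mult[of h "ml n ?A" m] m Bs by (auto simp: ml_add add.commute)
 then obtain c where c: "ALL b:Bs. c b:VO" "h * m = (SUM b:Bs. c b * b)" using rep by fast
 hence "h = (SUM b:Bs. c b * (b / m))" using m0 by (simp add: field_simps flip: sum_divide_distrib)
 also have "...:VO"
 proof (intro subr_sum[OF VO(1)] subrD(4)[OF VO(1)])
  fix b assume "b:Bs" thus "c b:VO" "b / m:VO" using c m subrD[OF VO(1)] by (cases "b = 0"; simp)+
 qed
 finally show ?thesis .
 qed
 define Z where "Z = {Q:Pts. 0 < v Q y}"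
 have fZ: "finite Z" unfolding Z_def by (rule finite_subset[OF _ fs[OF y(2)]]) auto
 \<comment> \<open>Otherwise every zero \<open>Q\<close> of \<open>y\<close> has some
   \<open>b Q\<close> in \<open>B1\<close> that vanishes at \<open>Q\<close> and is a unit of
   \<open>VO\<close>. A product of powers of these is divisible by \<open>y\<close> in
   \<open>B1\<close>, so \<open>inverse y\<close> would be in \<open>VO\<close>.\<close>
 have "EX Q:Z. ALL b:B1. vg Q 1 b --> b:mx VO"
 proof (rule ccontr)
 assume "~ ?thesis"
 then obtain b where b: "!!Q. Q:Z ==> b Q:B1 & vg Q 1 (b Q) & b Q ~: mx VO" by metis
 define pj where "pj = (PROD Q:Z. b Q ^ nat (v Q y))"
 have "pj:B1" unfolding pj_def using b by (intro subr_prod[OF B1s] subrD(7)[OF B1s]) auto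
 then obtain N where N: "pj:H (ml N ?A)" by (auto simp: B1_def)
 have iy: "vg R (- v R y) (inverse y)" if "R:Pts" for R using v_inv[OF that y(2)] by (simp add: vg_def)
 have "pj * inverse y:H (ml N ?A)" unfolding H_def
 proof (intro CollectI ballI)
  fix R assume R: "R:Pts"
  show "vg R (- lk (ml N ?A) R) (pj * inverse y)"
  proof (cases "R:Z")
  case True
  have "vg R (v R y + 0) (b R ^ nat (v R y) * (PROD Q:Z - {R}. b Q ^ nat (v Q y)))"
  proof (intro vg_mult R vg_prod)
   show "vg R (v R y) (b R ^ nat (v R y))" using vg_pow[OF R, of 1 "b R" "nat (v R y)"] b True by (auto simp: Z_def)
   fix Q assume "Q:Z - {R}"
   then obtain n where "b Q:H (ml n ?A)" using b by (auto simp: B1_def)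
   hence "vg R 0 (b Q)" using True by (auto simp: H_def lk_ml lkA Z_def)
   thus "vg R 0 (b Q ^ nat (v Q y))" using vg_pow[OF R] by force
  qed
  hence "vg R (v R y) pj" unfolding pj_def prod.remove[OF fZ True] by simp
  from vg_mult[OF R this iy[OF R]] show ?thesis using True by (simp add: lk_ml lkA Z_def)
  next
  case False
  hence "vg R (- lk (ml N ?A) R + 0) (pj * inverse y)" using N R vg_mono[OF R iy[OF R], of 0] by (intro vg_mult R) (auto simp: H_def Z_def)
  thus ?thesis by simp
  qed
 qed
 hence "pj * inverse y:B1" unfolding B1_def by auto
 hence "pj * inverse y:VO" using B1V by simp
 moreover have "pj:VO - mx VO"
 proof -
  have "prod (%Q. b Q ^ n Q) Z':VO - mx VO" if "finite Z'" "Z' <= Z" for Z' n using that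
  proof (induction Z' rule: finite_induct)
  case (insert Q Z')
  have bQ: "b Q:VO - mx VO" using b B1V insert by auto
  have "b Q ^ k:VO - mx VO" for k by (induction k) (use unit_mult[OF VO(1) bQ] one_unit[OF VO(1)] in auto)
  thus ?case using unit_mult[OF VO(1)] insert by auto
  qed (use one_unit[OF VO(1)] in auto)
  from this[of Z "%Q. nat (v Q y)"] show ?thesis unfolding pj_def using fZ by simp
 qed
 hence "inverse pj:VO" "pj ~= 0" by (auto simp: mx_def)
 ultimately have "inverse pj * (pj * inverse y):VO" using subrD[OF VO(1)] by simp
 thus False using y `pj ~= 0` by (simp add: mult.assoc[symmetric])
 qed
 then obtain Q where Q: "Q:Pts" "0 < v Q y" "!!b. b:B1 ==> vg Q 1 b ==> b:mx VO" by (auto simp: Z_def)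
 \<comment> \<open>Choose \<open>s\<close> in \<open>B1\<close> that cancels the poles of
   \<open>f\<close> and does not vanish at \<open>Q\<close>, so that \<open>f * s\<close> is in
   \<open>B1\<close>. The quadratic polynomial in \<open>s\<close> that vanishes at \<open>Q\<close>
   is a nonunit of \<open>VO\<close>; as its constant term is a nonzero real number,
   \<open>s\<close> is a unit of \<open>VO\<close>.\<close>
 have QV: "f:VO" if f: "f:Ol Q" for f
 proof (cases "f = 0")
 case False
 let ?E = "pos (- dvs f)"
 have E: "eff ?E" using False dvs_Dv by (intro eff_pos) (simp add: Dv_iff)
 have "vg Q 0 f" using f vg0[OF Q(1)] by simp
 hence EQ: "lk ?E Q = 0" using False by (simp add: lk_pos lk_dvs vg_def)
 obtain n s where s: "s:H (ml n ?A - ?E)" "s ~: H (ml n ?A - ?E - pt Q)" using mono_growth[OF AD dA _ Q(1), of ?E] E unfolding eff_def by auto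
 have "f:H ?E" unfolding H_iff[OF False] by (auto simp: lookup_add lk_pos)
 from H_mult[OF this s(1)] have fsB: "f * s:B1" by (auto simp: B1_def)
 have "H (ml n ?A - ?E) <= H (ml n ?A)" using E by (intro H_mono) (simp add: lookup_minus eff_def)
 hence sB: "s:B1" using s by (auto simp: B1_def)
 have AQ: "lk (ml n ?A - ?E) Q = 0" using EQ Q by (simp add: lookup_minus lk_ml lkA)
 have "vg Q (- lk (ml n ?A - ?E) Q) s" using s Q unfolding H_def by simp
 hence sv: "vg Q 0 s" "~ vg Q 1 s" using s AQ H_pt[OF Q(1), of s "ml n ?A - ?E"] by auto
 have sO: "s:Ol Q" using sv vg0[OF Q(1)] by simp
 have "ev Q s ~= 0" using evf(4)[OF Q(1) sO] sv vg1[OF Q(1)] by simp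
 hence a0: "(Re (ev Q s))^2 + (Im (ev Q s))^2 ~= 0" by (simp add: complex_eq_iff)
 define c where "c = 2 * Re (ev Q s)"
 define n where "n = (Re (ev Q s))^2 + (Im (ev Q s))^2"
 have "s * s - of_real c * s + of_real n:B1" using sB B1r by (intro subrD(3)[OF B1s] subrD(6)[OF B1s] subrD(4)[OF B1s])
 hence q: "s * s - of_real c * s + of_real n:mx VO" using Q conj_poly[OF Q(1) sO] by (simp add: c_def n_def)
 have "s ~: mx VO"
 proof
  assume sm: "s:mx VO"
  have "(s * s - of_real c * s + of_real n) - (s - of_real c) * s:mx VO" using sB B1V VO sm by (intro idl_diff[OF VO(1) VO_mx q] idlD(4)[OF VO_mx] subrD(6)[OF VO(1)])
  hence "of_real n:mx VO" by (simp add: als)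
  thus False using mx_local(3)[OF VO(1) VO_mx VO(2), of n] a0[folded n_def] by simp
 qed
 hence "inverse s:VO" "s ~= 0" using B1V[OF sB] by (auto simp: mx_def)
 hence "f * s * inverse s:VO" using B1V[OF fsB] subrD[OF VO(1)] by simp
 thus ?thesis using `s ~= 0` by (simp add: mult.assoc)
 qed (use subrD(1)[OF VO(1)] in simp)
 \<comment> \<open>If some \<open>f\<close> in \<open>VO\<close> had a pole at \<open>Q\<close>,
   every \<open>g\<close> would be a power of \<open>f\<close> times an element of
   \<open>Ol Q\<close>, and \<open>VO\<close> would be the whole field.\<close>
 have "VO <= Ol Q"
 proof
 fix f assume f: "f:VO"
 show "f:Ol Q"
 proof (rule ccontr)
  assume "f ~: Ol Q"
  hence n: "v Q f < 0" "f ~= 0" using vg0[OF Q(1), of f] by (auto simp: vg_def)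
  have "g:VO" if "g ~= 0" for g
  proof -
  define N where "N = nat (- v Q g)"
  have "v Q (g * inverse (f ^ N)) = v Q g - int N * v Q f" using n that by (simp add: v_mult[OF Q(1)] v_inv[OF Q(1)] v_pow[OF Q(1)])
  moreover have "int N * 1 <= int N * (- v Q f)" using n by (intro mult_left_mono) auto
  ultimately have "vg Q 0 (g * inverse (f ^ N))" by (auto simp: vg_def N_def)
  hence "g * inverse (f ^ N):VO" using QV vg0[OF Q(1)] by simp
  hence "g * inverse (f ^ N) * f ^ N:VO" using f subrD[OF VO(1)] by simp
  thus ?thesis using n by (simp add: mult.assoc)
  qed
  thus False using VOne subrD[OF VO(1)] by (metis UNIV_eq_I)
 qed
 qed
 thus ?thesis using Q QV by auto
qed

end

end

section \<open>The compact space of real points\<close>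

context ffield
begin

definition Rp :: "'q set" where "Rp = {P:Pts. dg P = 1}"
definition rv :: "'q => 'k => real" where "rv P f = Re (ev P f)"
text \<open>The value of \<open>1/(1 + f^2)\<close>, which extends by 0 to the poles of
  \<open>f\<close> and stays bounded. It forgets the sign of \<open>f\<close>, but together with the
  value for \<open>f + 1\<close> it determines the value of \<open>f\<close>.\<close>

definition eo :: "'q => 'k => real" where "eo P f = (if f:Ol P then 1 / (1 + (rv P f)^2) else 0)"
definition em :: "'q => 'k rfun" where "em P = rabs (eo P)"
lemma rap_em [simp]: "rap (em P) = eo P" by (simp add: em_def)
lemma Rp_Pts: "P:Rp ==> P:Pts" by (simp add: Rp_def)
lemma ev_rv: "P:Rp ==> f:Ol P ==> ev P f = of_real (rv P f)" by (auto simp: Rp_def dg_def rv_def complex_eq_iff split: if_splits)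

context
 fixes P assumes P: "P:Rp"
begin

lemma PP: "P:Pts" using P by (rule Rp_Pts)
lemmas Os = sub[OF PP] and Om = mxI[OF PP]

lemma rv_simps: "f:Ol P ==> g:Ol P ==> rv P (f + g) = rv P f + rv P g" "f:Ol P ==> g:Ol P ==> rv P (f * g) = rv P f * rv P g"
 "rv P (of_real r) = r" "f:Ol P ==> rv P (- f) = - rv P f" "rv P 1 = 1"
proof -
 show m: "rv P (f * g) = rv P f * rv P g" if "f:Ol P" "g:Ol P" for f g unfolding rv_def[of P "f * g"] evf(2)[OF PP that] ev_rv[OF P that(1)] ev_rv[OF P that(2)] by simp
 show r: "rv P (of_real r) = r" for r using evf[OF PP] by (simp add: rv_def)
 show "rv P (- f) = - rv P f" if "f:Ol P" using m[OF rl[OF PP] that, of "-1"] r[of "-1"] by simp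
 show "rv P 1 = 1" using r[of 1] by simp
qed (simp add: evf(1)[OF PP] rv_def)

lemma rv_zero: "f:Ol P ==> rv P f = 0 <-> vg P 1 f" using evf[OF PP] ev_rv[OF P] vg1[OF PP] by simp

lemma rv_unit: "f:Ol P ==> rv P f ~= 0 ==> f ~= 0 & v P f = 0 & inverse f:Ol P & rv P (inverse f) = 1 / rv P f"
proof -
 assume f: "f:Ol P" "rv P f ~= 0"
 hence n: "~ vg P 1 f" "vg P 0 f" using rv_zero vg0[OF PP] by auto
 hence v: "f ~= 0" "v P f = 0" by (auto simp: vg_def)
 hence i: "inverse f:Ol P" using v_inv[OF PP, of f] by (simp add: vg_def flip: vg0[OF PP])
 hence "rv P f * rv P (inverse f) = 1" using rv_simps(2)[OF f(1) i] v rv_simps by simp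
 thus ?thesis using v i f by (simp add: field_simps)
qed

lemma not_Ol: "f ~: Ol P ==> f ~= 0 & v P f < 0 & inverse f:Ol P & rv P (inverse f) = 0"
proof -
 assume "f ~: Ol P"
 hence "~ vg P 0 f" using vg0[OF PP] by simp
 hence v: "f ~= 0" "v P f < 0" by (auto simp: vg_def)
 hence "vg P 1 (inverse f)" using v_inv[OF PP, of f] by (simp add: vg_def)
 thus ?thesis using v rv_zero vg0[OF PP] vg_mono[OF PP, of 1 "inverse f" 0] by auto
qed

text \<open>Realizes \<open>eo\<close> by an element of the field: regular at every real point, with
  zeros of even order at the real poles of \<open>f\<close>.\<close>

definition ph :: "'k => 'k" where "ph f = inverse (1 + f * f)"

lemma ph: "1 + f * f ~= 0" "ph f:Ol P" "rv P (ph f) = eo P f" "v P (ph f) = (if f:Ol P then 0 else - 2 * v P f)"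
proof -
 have "1 + f * f ~= 0 & ph f:Ol P & rv P (ph f) = eo P f & v P (ph f) = (if f:Ol P then 0 else - 2 * v P f)"
 proof (cases "f:Ol P")
 case True
 have f2: "1 + f * f:Ol P" using True subrD[OF Os] by auto
 have "rv P (1 + f * f) = 1 + (rv P f)^2" using True subrD[OF Os] by (simp add: rv_simps p2)
 moreover have "1 + (rv P f)^2 ~= 0" using zero_le_power2[of "rv P f"] by linarith
 ultimately show ?thesis using rv_unit[OF f2] True v_inv[OF PP, of "1 + f * f"] by (simp add: ph_def eo_def)
 next
 case False
 note n = not_Ol[OF False]
 let ?g = "inverse f"
 have f2: "1 + ?g * ?g:Ol P" using n subrD[OF Os] by auto
 have "rv P (1 + ?g * ?g) = 1" using n subrD[OF Os] by (simp add: rv_simps)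
 hence u: "1 + ?g * ?g ~= 0" "v P (1 + ?g * ?g) = 0" "inverse (1 + ?g * ?g):Ol P" using rv_unit[OF f2] by auto
 have e: "1 + f * f = f * f * (1 + ?g * ?g)" using n by (simp add: als)
 hence z: "1 + f * f ~= 0" using u n by simp
 have vv: "v P (1 + f * f) = 2 * v P f" unfolding e using u n by (simp add: v_mult[OF PP])
 hence p: "v P (ph f) = - 2 * v P f" using v_inv[OF PP z] by (simp add: ph_def)
 hence "vg P 1 (ph f)" using n by (simp add: vg_def)
 thus ?thesis using z p False rv_zero vg0[OF PP] vg_mono[OF PP, of 1 "ph f" 0] by (auto simp: eo_def)
 qed
 thus "1 + f * f ~= 0" "ph f:Ol P" "rv P (ph f) = eo P f" "v P (ph f) = (if f:Ol P then 0 else - 2 * v P f)" by auto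
qed

lemma eo_pos: "f:Ol P ==> 0 < eo P f" by (auto simp: eo_def intro!: add_pos_nonneg)

lemma eo_range: "0 <= eo P f" "eo P f <= 1"
proof -
 have "0 < 1 + (rv P f)^2" using zero_le_power2[of "rv P f"] by linarith
 thus "0 <= eo P f" "eo P f <= 1" by (simp_all add: eo_def)
qed

text \<open>These are closed conditions, so they persist for limits in the product space; there they
  make the elements with nonzero limit value a ring containing the reals.\<close>

lemma eo_ineq: "eo P f * eo P g <= 2 * eo P (f + g)" "eo P f * eo P g <= eo P (f * g)" "eo P (- f) = eo P f" "eo P (of_real r) = 1 / (1 + r^2)"
proof -
 have p: "0 < 1 + x^2" for x :: real using zero_le_power2[of x] by linarith
 show "eo P (- f) = eo P f" using rv_simps subrD(5)[OF Os, of f] subrD(5)[OF Os, of "- f"] by (auto simp: eo_def)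
 show "eo P (of_real r) = 1 / (1 + r^2)" using rl[OF PP] by (simp add: eo_def rv_simps)
 show "eo P f * eo P g <= 2 * eo P (f + g)"
 proof (cases "f:Ol P & g:Ol P")
 case True
 have "(rv P f + rv P g)^2 + (rv P f - rv P g)^2 = 2 * (rv P f)^2 + 2 * (rv P g)^2" by (simp add: p2 als)
 moreover have "2 * ((1 + (rv P f)^2) * (1 + (rv P g)^2)) = 2 + 2 * (rv P f)^2 + 2 * (rv P g)^2 + 2 * ((rv P f)^2 * (rv P g)^2)" by (simp add: als)
 ultimately have "1 + (rv P f + rv P g)^2 <= 2 * ((1 + (rv P f)^2) * (1 + (rv P g)^2))"
  using zero_le_power2[of "rv P f - rv P g"] mult_nonneg_nonneg[OF zero_le_power2[of "rv P f"] zero_le_power2[of "rv P g"]] by linarith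
 hence "1 / ((1 + (rv P f)^2) * (1 + (rv P g)^2)) <= 2 / (1 + (rv P f + rv P g)^2)" using p by (simp add: divide_simps)
 thus ?thesis using subrD[OF Os] by (simp add: eo_def rv_simps)
 qed (use eo_range[of "f + g"] in \<open>auto simp: eo_def\<close>)
 show "eo P f * eo P g <= eo P (f * g)"
 proof (cases "f:Ol P & g:Ol P")
 case True
 have "1 + (rv P f * rv P g)^2 <= (1 + (rv P f)^2) * (1 + (rv P g)^2)" by (simp add: als)
 hence "1 / ((1 + (rv P f)^2) * (1 + (rv P g)^2)) <= 1 / (1 + (rv P f * rv P g)^2)" using p by (intro divide_left_mono mult_pos_pos) auto
 thus ?thesis using subrD[OF Os] by (simp add: eo_def rv_simps)
 qed (use eo_range[of "f * g"] in \<open>auto simp: eo_def\<close>)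
qed

lemma eo_inv: "f ~= 0 ==> eo P f + eo P (inverse f) = 1"
proof -
 assume f: "f ~= 0"
 have p: "1 + x^2 ~= 0" for x :: real using zero_le_power2[of x] by linarith
 consider "f ~: Ol P" | "inverse f ~: Ol P" | "f:Ol P" "inverse f:Ol P" by auto
 thus ?thesis
 proof cases
 case 1 thus ?thesis using not_Ol by (simp add: eo_def)
 next
 case 2 thus ?thesis using not_Ol[of "inverse f"] by (simp add: eo_def)
 next
 case 3
 hence m: "rv P f * rv P (inverse f) = 1" using rv_simps(2)[of f "inverse f"] f rv_simps by simp
 hence r: "rv P f ~= 0" by auto
 hence "rv P (inverse f) = 1 / rv P f" using m nonzero_eq_divide_eq[of "rv P f" "rv P (inverse f)" 1] by (simp add: mult.commute)
 hence e: "eo P (inverse f) = 1 / (1 + (1 / rv P f)^2)" "eo P f = 1 / (1 + (rv P f)^2)" using 3 by (simp_all add: eo_def)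
 show ?thesis unfolding e using p r by (simp add: field_simps)
 qed
qed

text \<open>For \<open>f\<close> with value \<open>t\<close> put \<open>a = 1 + t^2\<close> and
  \<open>b = 1 + (t + 1)^2\<close>, so that \<open>b - a - 1 = 2 t\<close>. The relations express
  \<open>1 + (t - s)^2\<close> through \<open>a\<close> and \<open>b\<close> and say that
  \<open>4 + (2 t)^2 = 4 a\<close>. Denominators are cleared so that they hold at poles as
  well.\<close>

lemma eo_rel: defines "x == %f. eo P f" shows "x (f - of_real s) * (x (f + 1) - s * (x f - x (f + 1) - x f * x (f + 1)) + s^2 * x f * x (f + 1)) = x f * x (f + 1)"
 "4 * (x f)^2 * (x (f + 1))^2 + (x f - x (f + 1) - x f * x (f + 1))^2 = 4 * x f * (x (f + 1))^2"
proof -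
 have m: "f + of_real c:Ol P <-> f:Ol P" for c using subrD(3)[OF Os _ rl[OF PP], of f c] subrD(3)[OF Os _ rl[OF PP], of "f + of_real c" "- c"] by auto
 have "x (f - of_real s) * (x (f + 1) - s * (x f - x (f + 1) - x f * x (f + 1)) + s^2 * x f * x (f + 1)) = x f * x (f + 1) &
 4 * (x f)^2 * (x (f + 1))^2 + (x f - x (f + 1) - x f * x (f + 1))^2 = 4 * x f * (x (f + 1))^2"
 proof (cases "f:Ol P")
 case True
 define t where "t = rv P f"
 have p: "0 < 1 + y^2" for y :: real using zero_le_power2[of y] by linarith
 have "x f = 1 / (1 + t^2)" "x (f + 1) = 1 / (1 + (t + 1)^2)" "x (f - of_real s) = 1 / (1 + (t - s)^2)"
  using True m[of 1] m[of "- s"] rv_simps(1)[OF True rl[OF PP], of 1] rv_simps(1)[OF True rl[OF PP], of "- s"] rv_simps(3)[of 1] rv_simps(3)[of "-s"]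
  by (simp_all add: x_def eo_def t_def)
 moreover define a b c where "a = 1 + t^2" "b = 1 + (t + 1)^2" "c = 1 + (t - s)^2"
 moreover have "a > 0" "b > 0" "c > 0" using p by (auto simp: a_b_c_def)
 ultimately have e: "x f = 1 / a" "x (f + 1) = 1 / b" "x (f - of_real s) = 1 / c" and n: "a ~= 0" "b ~= 0" "c ~= 0" by auto
 have 1: "1 / c * (1 / b - s * (1 / a - 1 / b - 1 / a * (1 / b)) + s^2 * (1 / a) * (1 / b)) = (a - s * (b - a - 1) + s^2) / c * (1 / a * (1 / b))"
  using n by (simp add: field_simps)
 have 2: "4 * (1 / a)^2 * (1 / b)^2 + (1 / a - 1 / b - 1 / a * (1 / b))^2 = (4 + (b - a - 1)^2) * (1 / a * (1 / b))^2" using n by (simp add: field_simps p2)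
 have 3: "a - s * (b - a - 1) + s^2 = c" "4 + (b - a - 1)^2 = 4 * a" by (simp_all add: a_b_c_def p2 als)
 show ?thesis unfolding e 1 2 3 using n by (simp add: p2)
 qed (use m[of 1] m[of "- s"] in \<open>simp add: x_def eo_def\<close>)
 thus "x (f - of_real s) * (x (f + 1) - s * (x f - x (f + 1) - x f * x (f + 1)) + s^2 * x f * x (f + 1)) = x f * x (f + 1)"
 "4 * (x f)^2 * (x (f + 1))^2 + (x f - x (f + 1) - x f * x (f + 1))^2 = 4 * x f * (x (f + 1))^2" by auto
qed

end

lemma em_inj: "inj_on em Rp"
proof (rule inj_onI, rule ccontr)
 fix P Q assume PQ: "P:Rp" "Q:Rp" "em P = em Q" "P ~= Q"
 then obtain f where f: "f:Ol P" "f ~: Ol Q" using ind[OF Rp_Pts Rp_Pts] by auto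
 have "eo P f = eo Q f" using PQ by (metis rap_em)
 thus False using eo_pos[OF PQ(1) f(1)] f by (simp add: eo_def)
qed

lemma closure_Ball: assumes c: "closed {x. Q x}" and Q: "!!P. P:Rp ==> Q (em P)" and x: "x:closure (em ` Rp)" shows "Q x"
 using closure_minimal[OF _ c, of "em ` Rp"] Q x by auto

text \<open>The values lie in a product of unit intervals, so closedness is what matters. A limit
  \<open>c\<close> satisfies the closed relations above; hence the elements \<open>f\<close> with
  \<open>c f\<close> nonzero form a valuation ring with real residues. By \<open>place\<close> it is
  the ring of a point, and this point is the limit.\<close>

theorem em_compact: "compact (em ` Rp)"
proof -
 note cr = continuous_rap[where S=UNIV]
 have "closure (em ` Rp) <= em ` Rp"
 proof
 fix x assume x: "x:closure (em ` Rp)"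
 define c where "c = rap x"
 note [simp] = c_def[symmetric]
 have 1: "c f * c g <= 2 * c (f + g)" "c f * c g <= c (f * g)" "c (- f) = c f" "c (of_real r) = 1 / (1 + r^2)" "0 <= c f" for f g r
  unfolding c_def by (rule closure_Ball[OF _ _ x], intro closed_Collect_le closed_Collect_eq continuous_intros cr; simp add: eo_ineq eo_range)+
 have 2: "c f + c (inverse f) = 1" if "f ~= 0" for f
  unfolding c_def by (rule closure_Ball[OF _ _ x], intro closed_Collect_eq continuous_intros cr) (simp add: eo_inv that)
 have 3: "c (f - of_real s) * (c (f + 1) - s * (c f - c (f + 1) - c f * c (f + 1)) + s^2 * c f * c (f + 1)) = c f * c (f + 1)" for f s
  unfolding c_def by (rule closure_Ball[OF _ _ x], intro closed_Collect_eq continuous_intros cr) (simp add: eo_rel)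
 have 4: "4 * (c f)^2 * (c (f + 1))^2 + (c f - c (f + 1) - c f * c (f + 1))^2 = 4 * c f * (c (f + 1))^2" for f
  unfolding c_def by (rule closure_Ball[OF _ _ x], intro closed_Collect_eq continuous_intros cr) (simp add: eo_rel)
 define VO where "VO = {f. c f ~= 0}"
 have p: "1 + r^2 ~= 0" for r :: real using zero_le_power2[of r] by linarith
 have VOr: "of_real r:VO" for r using 1 p by (simp add: VO_def)
 have pos: "0 < c f" if "f:VO" for f using that 1(5)[of f] by (simp add: VO_def)
 have VOs: "subr VO" unfolding subr_def
 proof (intro conjI ballI)
  show "0:VO" "1:VO" using VOr[of 0] VOr[of 1] by auto
  fix f g assume "f:VO" "g:VO"
  hence "0 < c f * c g" using pos by simp
  thus "f + g:VO" "f * g:VO" using 1(1,2)[of f g] by (auto simp: VO_def)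
 qed (use 1(3) in \<open>simp add: VO_def\<close>)
 have VOi: "f:VO | inverse f:VO" for f using 2[of f] VOr[of 0] by (cases "f = 0") (auto simp: VO_def)
 \<comment> \<open>Via \<open>eo_rel\<close> the prospective value \<open>r\<close> of
   \<open>f\<close> is computed from \<open>c f\<close> and \<open>c (f + 1)\<close>.\<close>
 have resid: "EX r. c (f - of_real r) = 1 & c f = 1 / (1 + r^2)" if f: "f:VO" for f
 proof -
  have "f + of_real 1:VO" by (rule subrD(3)[OF VOs f VOr])
  hence xy: "c f > 0" "c (f + 1) > 0" using pos f by auto
  define r where "r = (1 / c (f + 1) - 1 / c f - 1) / 2"
  define X Y where "X = c f" "Y = c (f + 1)"
  have XY: "X > 0" "Y > 0" using xy by (auto simp: X_Y_def)
  have r: "X - Y - X * Y = 2 * r * (X * Y)" unfolding r_def X_Y_def[symmetric] using XY by (simp add: field_simps)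
  have "4 * X^2 * Y^2 + (2 * r * (X * Y))^2 = 4 * X * Y^2" using 4[of f] unfolding X_Y_def[symmetric] r by simp
  hence "(4 * X * Y^2) * (X * (1 + r^2)) = (4 * X * Y^2) * 1" by (simp add: p2 als)
  hence x1: "X * (1 + r^2) = 1" using XY by simp
  have "c (f - of_real r) * (Y - r * (2 * r * (X * Y)) + r^2 * X * Y) = X * Y" using 3[of f r] unfolding X_Y_def[symmetric] r by simp
  hence "Y * (c (f - of_real r) * (1 - r^2 * X)) = Y * X" by (simp add: p2 als)
  hence "c (f - of_real r) * (1 - r^2 * X) = X" using XY by simp
  moreover have "1 - r^2 * X = X" using x1 by (simp add: als)
  ultimately have "c (f - of_real r) = 1" using XY by simp
  moreover have "c f = 1 / (1 + r^2)" using x1 p by (simp add: X_Y_def field_simps)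
  ultimately show ?thesis by auto
 qed
 have mxV: "f:mx VO <-> c f = 1" for f using 2[of f] 1[of 0] by (cases "f = 0") (auto simp: mx_def VO_def)
 \<comment> \<open>Otherwise a uniformizer at some point would differ from a real number by an
   element of the zero ideal.\<close>
 have "VO ~= UNIV"
 proof
  assume V: "VO = UNIV"
  obtain P where P: "P:Pts" using ne by auto
  obtain r where "c (tt P - of_real r) = 1" using resid V by auto
  hence "tt P - of_real r:mx VO" using mxV by simp
  hence "tt P = of_real r" using V by (simp add: mx_def)
  hence "vg P 0 (inverse (tt P))" using vg_real[OF P, of "inverse r"] by simp
  thus False using tt[OF P] v_inv[OF P, of "tt P"] by (simp add: vg_def)
 qed
 then obtain Q where Q: "Q:Pts" "VO = Ol Q" using place[OF VOs VOr VOi] by auto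
 have val: "ev Q f = of_real r" if "f:Ol Q" "c (f - of_real r) = 1" for f r
 proof -
  have m: "f - of_real r:mx (Ol Q)" using that mxV Q by simp
  hence "ev Q (f - of_real r) = 0" using evf[OF Q(1)] by (simp add: mx_def)
  moreover have "ev Q f = ev Q (f - of_real r) + ev Q (of_real r)" using evf(1)[OF Q(1) _ rl[OF Q(1)], of "f - of_real r" r] m by (simp add: mx_def)
  ultimately show ?thesis using evf[OF Q(1)] by simp
 qed
 have "Im (ev Q f) = 0" if "f:Ol Q" for f using resid[of f] val that Q by auto
 hence QR: "Q:Rp" using Q by (simp add: Rp_def dg_def)
 have "c f = eo Q f" for f
 proof (cases "f:Ol Q")
  case True
  then obtain r where "c (f - of_real r) = 1" "c f = 1 / (1 + r^2)" using resid Q by auto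
  thus ?thesis using True val by (simp add: eo_def rv_def)
 qed (use Q in \<open>auto simp: eo_def VO_def\<close>)
 hence "x = em Q" unfolding em_def c_def by (metis ext rap_rabs)
 thus "x:em ` Rp" using QR by simp
 qed
 hence cl: "closed (em ` Rp)" by (metis closure_subset_eq)
 have "compact (\<Pi>\<^sub>E i\<in>(UNIV :: 'k set). {0..1 :: real})"
 using compactin_PiE[of "%_ :: 'k. euclideanreal" UNIV "%_. {0..1}"] by (simp add: euclidean_product_topology)
 hence "compact (rabs ` (\<Pi>\<^sub>E i\<in>(UNIV :: 'k set). {0..1 :: real}))" by (rule compact_continuous_image[OF continuous_rabs])
 moreover have "em ` Rp <= rabs ` (\<Pi>\<^sub>E i\<in>(UNIV :: 'k set). {0..1 :: real})" using eo_range unfolding em_def by auto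
 ultimately show ?thesis using cl by (metis inf.absorb1 compact_Int_closed Int_commute)
qed

text \<open>For real \<open>t\<close>, half of \<open>(1 + (t + 1)^2) - (1 + t^2) - 1\<close> is
  \<open>t\<close>; so values are continuous functions of the coordinates in the embedding, away
  from poles.\<close>

lemma continuous_rv: assumes "S <= Rp" "!!P. P:S ==> f:Ol P"
 shows "continuous_on (em ` S) (%x. (1 / rap x (f + 1) - 1 / rap x f - 1) / 2)" "!!P. P:S ==> (1 / rap (em P) (f + 1) - 1 / rap (em P) f - 1) / 2 = rv P f"
proof -
 have f1: "f + 1:Ol P" if "P:S" for P using assms that subrD[OF sub[OF Rp_Pts]] by auto
 have nz: "eo P (f + 1) ~= 0" "eo P f ~= 0" if "P:S" for P using eo_pos f1 assms that by (auto simp: less_le)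
 show "continuous_on (em ` S) (%x. (1 / rap x (f + 1) - 1 / rap x f - 1) / 2)" by (intro continuous_intros continuous_rap) (use nz in auto)
 fix P assume P: "P:S"
 have PR: "P:Rp" using P assms by auto
 have "rv P (f + 1) = rv P f + 1" using rv_simps(1)[OF PR assms(2)[OF P], of 1] rv_simps[OF PR] subrD[OF sub[OF Rp_Pts[OF PR]]] by simp
 thus "(1 / rap (em P) (f + 1) - 1 / rap (em P) f - 1) / 2 = rv P f" using assms(2)[OF P] f1[OF P] by (simp add: eo_def p2 als)
qed

end

section \<open>Functions have even degree on open and closed sets of real points\<close>

context ffield
begin

text \<open>Riemann's theorem for multiples of a single point.\<close>

lemma pole_only: assumes P: "P:Pts" obtains w where "w ~: Ol P" "!!Q. Q:Pts ==> Q ~= P ==> w:Ol Q"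
proof -
 have "0 < dgr (pt P)" using dg_pos by (simp add: dgr_single)
 from mono_growth[OF Dv_pt[OF P] this Dv_0 P] obtain n0 where n0: "!!n. n >= n0 ==> EX s. s:H (ml n (pt P) - 0) & s ~: H (ml n (pt P) - 0 - pt P)" by auto
 obtain s where s: "s:H (ml (Suc n0) (pt P))" "s ~: H (ml (Suc n0) (pt P) - pt P)" using n0[of "Suc n0"] by auto
 show ?thesis
 proof (rule that[of s])
 have "~ vg P (1 - lk (ml (Suc n0) (pt P)) P) s" using s H_pt[OF P] by simp
 hence "~ vg P 0 s" using vg_mono[OF P, of 0 s] by (force simp: lk_ml)
 thus "s ~: Ol P" using vg0[OF P] by simp
 fix Q assume Q: "Q:Pts" "Q ~= P"
 have "vg Q (- lk (ml (Suc n0) (pt P)) Q) s" using s Q unfolding H_def by simp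
 thus "s:Ol Q" using Q vg0 by (simp add: lk_ml)
 qed
qed

text \<open>The total degree is zero, and points that are not real contribute even numbers to
  it.\<close>

lemma real_degree_even: assumes "f ~= 0" shows "even (SUM P:{P:Rp. v P f ~= 0}. v P f)"
proof -
 let ?N = "{P:Pts. v P f ~= 0}"
 have fin: "finite ?N" using fs[OF assms] .
 have "kys (dvs f) = ?N" using assms by (auto simp: in_keys_iff lk_dvs split: if_splits)
 hence "0 = (SUM P:?N. v P f * int (dg P))" using dgr_dvs[OF assms] assms by (simp add: dgr_def lk_dvs)
 also have "... = (SUM P:?N Int Rp. v P f * int (dg P)) + (SUM P:?N - Rp. v P f * int (dg P))" using sum.Int_Diff[OF fin] by simp
 also have "(SUM P:?N Int Rp. v P f * int (dg P)) = (SUM P:{P:Rp. v P f ~= 0}. v P f)" by (intro sum.cong) (auto simp: Rp_def)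
 also have "(SUM P:?N - Rp. v P f * int (dg P)) = (SUM P:?N - Rp. v P f * 2)" by (intro sum.cong) (auto simp: Rp_def dg_def split: if_splits)
 finally show ?thesis unfolding sdr[symmetric] by presburger
qed

text \<open>The function \<open>f + N k a^2\<close> has on \<open>S\<close> the same orders as
  \<open>f\<close> and has no real zeros outside \<open>S\<close>, so its even total real degree is
  the degree of \<open>f\<close> on \<open>S\<close>. For this \<open>k\<close> is nonnegative and
  divisible by \<open>f\<close> on \<open>S\<close>, and \<open>a\<close> is close to 0 on
  \<open>S\<close> and close to 1 outside.\<close>

lemma parity_bounded: assumes S: "S <= Rp" "closed (em ` S)" "closed (em ` (Rp - S))" and f: "f ~= 0" "!!P. P:Rp ==> f:Ol P" shows "even (SUM P:{P:S. v P f ~= 0}. v P f)"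
proof -
 define S' where "S' = Rp - S"
 define A where "A = {g. ALL P:Rp. g:Ol P}"
 define nv where "nv g x = (1 / rap x (g + 1) - 1 / rap x g - 1) / 2" for g and x :: "'k rfun"
 have nv: "nv g (em P) = rv P g" if "g:Ol P" "P:Rp" for g P unfolding nv_def by (rule continuous_rv(2)[of "{P}"]) (use that in auto)
 have A: "subr A" unfolding subr_def A_def using subrD(1-5)[OF sub[OF Rp_Pts]] by auto
 have Ar: "of_real r:A" for r unfolding A_def using rl[OF Rp_Pts] by auto
 have phA: "ph g:A" for g unfolding A_def using ph by auto
 have cl: "EX M. M > 0 & (ALL P:T. \<bar>rv P g\<bar> <= M)" if T: "T <= Rp" "closed (em ` T)" "!!P. P:T ==> g:Ol P" for T g
 proof -
 have "em ` T = em ` Rp Int em ` T" using T by auto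
 hence "compact (em ` T)" using compact_Int_closed[OF em_compact T(2)] by simp
 hence "compact (nv g ` em ` T)" unfolding nv_def using continuous_rv[OF T(1,3)] by (intro compact_continuous_image) auto
 hence "bounded (nv g ` em ` T)" by (rule compact_imp_bounded)
 then obtain M where "M > 0" "!!x. x:em ` T ==> \<bar>nv g x\<bar> <= M" unfolding bounded_pos by auto
 thus ?thesis using nv T by force
 qed
 \<comment> \<open>The values of functions regular at all real points form an algebra that separates
   points, as Stone-Weierstrass requires; \<open>ph\<close> provides the separating
   functions.\<close>
 interpret W: function_ring_on "{g. EX a:A. ALL x:em ` Rp. g x = nv a x}" "em ` Rp"
 proof
 show "compact (em ` Rp)" by (rule em_compact)
 fix g h assume g: "g:{g. EX a:A. ALL x:em ` Rp. g x = nv a x}"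
 then obtain a where a: "a:A" "!!x. x:em ` Rp ==> g x = nv a x" by auto
 have "continuous_on (em ` Rp) (nv a)" unfolding nv_def using continuous_rv a by (auto simp: A_def)
 thus "continuous_on (em ` Rp) g" using a by simp
 assume "h:{g. EX a:A. ALL x:em ` Rp. g x = nv a x}"
 then obtain b where b: "b:A" "!!x. x:em ` Rp ==> h x = nv b x" by auto
 have ab: "a + b:A" "a * b:A" using a b subrD[OF A] by auto
 show "(%x. g x + h x):{g. EX a:A. ALL x:em ` Rp. g x = nv a x}" using ab a b by (intro CollectI bexI[of _ "a + b"] ballI) (auto simp: nv A_def rv_simps)
 show "(%x. g x * h x):{g. EX a:A. ALL x:em ` Rp. g x = nv a x}" using ab a b by (intro CollectI bexI[of _ "a * b"] ballI) (auto simp: nv A_def rv_simps)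
 next
 fix c show "(%_. c):{g. EX a:A. ALL x:em ` Rp. g x = nv a x}" using Ar by (intro CollectI bexI[of _ "of_real c"] ballI) (auto simp: nv A_def rv_simps)
 next
 fix x y assume xy: "x:em ` Rp" "y:em ` Rp" "x ~= y"
 then obtain P Q where PQ: "P:Rp" "Q:Rp" "x = em P" "y = em Q" by auto
 have "eo P ~= eo Q" using xy unfolding PQ by (metis em_def)
 then obtain g where g: "eo P g ~= eo Q g" by auto
 have "nv (ph g) x ~= nv (ph g) y" using g PQ ph by (simp add: nv)
 thus "EX f:{g. EX a:A. ALL x:em ` Rp. g x = nv a x}. f x ~= f y" using phA by auto
 qed
 define Z where "Z = {P:S. v P f ~= 0}"
 have Zf: "finite Z" unfolding Z_def by (rule finite_subset[OF _ fs[OF f(1)]]) (use S Rp_Pts in auto)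
 have ZP: "P:Rp" "P:Pts" "P:S" if "P:Z" for P using that S Rp_Pts by (auto simp: Z_def)
 have "EX w. P:Pts --> w ~: Ol P & (ALL Q:Pts. Q ~= P --> w:Ol Q)" for P using pole_only by metis
 then obtain w where w: "!!P. P:Pts ==> w P ~: Ol P" "!!P Q. P:Pts ==> Q:Pts ==> Q ~= P ==> w P:Ol Q" by metis
 \<comment> \<open>Its zeros among the real points are exactly those of \<open>f\<close> in
   \<open>S\<close>, with at least twice the order, because \<open>ph (w P)\<close> has order at
   least 2 at \<open>P\<close> and is positive at the other real points.\<close>
 define k where "k = (PROD P:Z. ph (w P) ^ nat (v P f))"
 have k: "k:A" unfolding k_def using phA by (intro subr_prod[OF A] subrD(7)[OF A])
 have pr: "rv P (PROD Q:Z'. g Q) = (PROD Q:Z'. rv P (g Q)) & (PROD Q:Z'. g Q):Ol P" if "P:Rp" "!!Q. g Q:Ol P" "finite Z'" for P g Z'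
 using that(3) by (induction Z' rule: finite_induct) (use that rv_simps(2,5) subrD(2,4)[OF sub[OF Rp_Pts]] in auto)
 have pwr: "rv P (g ^ n) = rv P g ^ n" if "P:Rp" "g:Ol P" for P g n using pr[OF that(1), of "%_. g" "{..<n}"] that by simp
 have rk: "rv P k = (PROD Q:Z. eo P (w Q) ^ nat (v Q f))" if P: "P:Rp" for P
 proof -
 have "rv P k = (PROD Q:Z. rv P (ph (w Q) ^ nat (v Q f)))" unfolding k_def by (intro conjunct1[OF pr[OF P]] subrD(7)[OF sub[OF Rp_Pts[OF P]]] ph(2) P Zf)
 thus ?thesis using pwr[OF P ph(2)[OF P]] by (simp add: ph[OF P])
 qed
 have kpos: "0 < rv P k" if "P:Rp" "P ~: Z" for P unfolding rk[OF that(1)] using that w[OF ZP(2)] Rp_Pts by (intro prod_pos zero_less_power eo_pos) auto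
 have kf: "k / f:Ol P" if P: "P:S" for P
 proof -
 have PP: "P:Rp" "P:Pts" using P S Rp_Pts by auto
 have "vg P (v P f) k"
 proof (cases "P:Z")
  case True
  have "vg P 2 (ph (w P))" using ph[OF PP(1), of "w P"] w[OF PP(2)] not_Ol[OF PP(1), of "w P"] by (simp add: vg_def)
  hence "vg P (int (nat (v P f)) * 2 + 0) (ph (w P) ^ nat (v P f) * (PROD Q:Z - {P}. ph (w Q) ^ nat (v Q f)))"
  using ph[OF PP(1)] by (intro vg_mult vg_pow vg_prod PP) (auto simp: vg0[OF PP(2)] subrD[OF sub[OF PP(2)]])
  thus ?thesis using vg_mono[OF PP(2)] unfolding k_def prod.remove[OF Zf True] by simp
 qed (use P k PP vg0[OF PP(2), of k] in \<open>auto simp: Z_def A_def\<close>)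
 moreover have "vg P (- v P f) (inverse f)" using v_inv[OF PP(2) f(1)] by (simp add: vg_def)
 ultimately have "vg P 0 (k * inverse f)" using vg_mult[OF PP(2)] by force
 thus ?thesis using vg0[OF PP(2)] by (simp add: divide_inverse)
 qed
 have S'R: "S' <= Rp" by (auto simp: S'_def)
 have kS': "0 < rv P k" "inverse k:Ol P" "rv P (inverse k) = 1 / rv P k" if "P:S'" for P
 proof -
 have PR: "P:Rp" "P ~: Z" using that ZP by (auto simp: S'_def)
 thus "0 < rv P k" "inverse k:Ol P" "rv P (inverse k) = 1 / rv P k" using kpos[OF PR] rv_unit k by (simp_all add: A_def)
 qed
 obtain M where M: "M > 0" "!!P. P:S' ==> \<bar>rv P f\<bar> <= M" using cl[of S' f] S f by (auto simp: S'_def)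
 obtain M' where M': "M' > 0" "!!P. P:S ==> \<bar>rv P (k / f)\<bar> <= M'" using cl[of S "k / f"] S kf by auto
 obtain L where L: "L > 0" "!!P. P:S' ==> \<bar>rv P (inverse k)\<bar> <= L" using cl[of S' "inverse k"] S kS' by (auto simp: S'_def)
 \<comment> \<open>Outside \<open>S\<close>, \<open>k\<close> is at least \<open>1/L\<close> and
   \<open>a\<close> at least 1/2, so \<open>N k a^2\<close> is at least \<open>M + 1\<close> and
   exceeds the absolute value of \<open>f\<close>. On \<open>S\<close>, \<open>ep\<close> keeps the
   absolute value of \<open>N (k/f) a^2\<close> below 1.\<close>
 define N where "N = 4 * L * (M + 1)"
 define ep where "ep = min (1 / 2) (1 / (N * M' + 1))"
 have N: "0 < N" "0 < N * M' + 1" using M L M' by (auto simp: N_def add_pos_pos)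
 hence ep: "0 < ep" "ep <= 1 / 2" "ep * (N * M') < 1"
 proof -
 show e: "0 < ep" "ep <= 1 / 2" using N by (auto simp: ep_def)
 have "ep <= 1 / (N * M' + 1)" by (simp add: ep_def)
 hence "ep * (N * M' + 1) <= 1" using N by (simp add: pos_le_divide_eq)
 thus "ep * (N * M') < 1" using e by (simp add: als)
 qed
 have disj: "em ` S Int em ` S' = {}" using em_inj S unfolding inj_on_def S'_def by auto
 obtain g where g: "g:{g. EX a:A. ALL x:em ` Rp. g x = nv a x}" "g ` em ` Rp <= {0..1}" "!!x. x:em ` S ==> g x < ep" "!!x. x:em ` S' ==> g x > 1 - ep"
 using W.two[OF S(2) image_mono[OF S(1)] S(3)[folded S'_def] image_mono[OF S'R] disj ep(1) order.strict_trans1[OF ep(2)]] by (simp del: mem_Collect_eq) blast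
 then obtain a where a: "a:A" "!!P. P:Rp ==> g (em P) = rv P a" using nv by (auto simp: A_def)
 define q where "q = f + of_real N * (k * (a * a))"
 have qS': "v P q = 0 & q ~= 0" if P: "P:S'" for P
 proof -
 have PR: "P:Rp" using P by (auto simp: S'_def)
 have m: "f:Ol P" "k:Ol P" "a:Ol P" using f k a PR by (auto simp: A_def)
 note s = subrD(3,4)[OF sub[OF Rp_Pts[OF PR]]] rl[OF Rp_Pts[OF PR]]
 have "1 <= rv P k * L" using L(2)[OF P] kS'[OF P] by (simp add: pos_divide_le_eq mult.commute)
 moreover have "1 / 2 <= rv P a" using g(4)[of "em P"] a(2)[OF PR] P ep by auto
 hence "1 / 4 <= rv P a * rv P a" using mult_mono[of "1 / 2" "rv P a" "1 / 2" "rv P a"] by simp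
 ultimately have "1 * (1 / 4) <= (rv P k * L) * (rv P a * rv P a)" by (intro mult_mono) auto
 hence "4 * (M + 1) * (1 / 4) <= 4 * (M + 1) * ((rv P k * L) * (rv P a * rv P a))" using M by simp
 hence "M + 1 <= N * (rv P k * (rv P a * rv P a))" by (simp add: N_def als)
 moreover have "rv P q = rv P f + N * (rv P k * (rv P a * rv P a))" using m s by (simp add: q_def rv_simps[OF PR])
 ultimately have "rv P q ~= 0" using M(2)[OF P] by simp
 moreover have "q:Ol P" using m s by (simp add: q_def)
 ultimately show ?thesis using rv_unit[OF PR] by simp
 qed
 have qS: "v P q = v P f & q ~= 0" if P: "P:S" for P
 proof -
 have PR: "P:Rp" "P:Pts" using P S Rp_Pts by auto
 let ?u = "1 + of_real N * (k / f * (a * a))"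
 have aO: "a:Ol P" using a PR by (auto simp: A_def)
 note s = subrD(2-4)[OF sub[OF PR(2)]] rl[OF PR(2)] kf[OF P]
 have x: "0 <= rv P a" "rv P a < ep" using g(2) g(3)[of "em P"] a(2) P PR by force+
 hence "rv P a * rv P a <= ep * 1" using ep by (intro mult_mono) auto
 hence "\<bar>rv P (k / f)\<bar> * (rv P a * rv P a) <= M' * ep" using M'(2)[OF P] by (intro mult_mono) auto
 hence "\<bar>N * (rv P (k / f) * (rv P a * rv P a))\<bar> <= N * (M' * ep)" using N by (simp add: abs_mult)
 also have "... < 1" using ep by (simp add: als)
 finally have "\<bar>N * (rv P (k / f) * (rv P a * rv P a))\<bar> < 1" .
 moreover have "rv P ?u = 1 + N * (rv P (k / f) * (rv P a * rv P a))" using aO s by (simp add: rv_simps[OF PR(1)] del: times_divide_eq_left)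
 ultimately have "rv P ?u ~= 0" by simp
 moreover have "?u:Ol P" using aO s by (simp del: times_divide_eq_left)
 ultimately have u: "?u ~= 0" "v P ?u = 0" using rv_unit[OF PR(1)] by auto
 have "q = f * ?u" using f by (simp add: q_def als)
 thus ?thesis using u f v_mult[OF PR(2) f(1) u(1)] by simp
 qed
 show ?thesis
 proof (cases "S = {}")
 case False
 hence q0: "q ~= 0" using qS by auto
 have "v P q ~= 0 <-> P:S & v P f ~= 0" if "P:Rp" for P using qS qS' that by (cases "P:S") (auto simp: S'_def)
 hence "{P:Rp. v P q ~= 0} = {P:S. v P f ~= 0}" using S by auto
 hence "(SUM P:{P:Rp. v P q ~= 0}. v P q) = (SUM P:{P:S. v P f ~= 0}. v P f)" using qS by simp
 thus ?thesis using real_degree_even[OF q0] by simp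
 qed simp
qed

text \<open>Multiplication by \<open>ph f\<close> turns real poles of \<open>f\<close> into zeros of
  the same order, which does not change parities.\<close>

theorem parity: assumes S: "S <= Rp" "closed (em ` S)" "closed (em ` (Rp - S))" and f: "f ~= 0" shows "even (SUM P:{P:S. v P f ~= 0}. v P f)"
proof (cases "S = {}")
 case False
 then obtain P0 where P0: "P0:Rp" using S by auto
 let ?g = "f * ph f"
 have p0: "ph f ~= 0" using ph[OF P0, of f] ph_def[OF P0] by simp
 have vg: "v P ?g = (if f:Ol P then v P f else - v P f)" if P: "P:Rp" for P using v_mult[OF Rp_Pts[OF P] f p0] ph[OF P, of f] by simp
 have "?g:Ol P" if P: "P:Rp" for P using vg[OF P] vg0[OF Rp_Pts[OF P], of ?g] vg0[OF Rp_Pts[OF P], of f] by (auto simp: vg_def)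
 hence "even (SUM P:{P:S. v P ?g ~= 0}. v P ?g)" using f p0 by (intro parity_bounded[OF S]) auto
 moreover have "{P:S. v P ?g ~= 0} = {P:S. v P f ~= 0}" using vg S by (auto split: if_splits)
 moreover have "even ((SUM P:T. v P ?g) - (SUM P:T. v P f))" if "T <= S" for T
 proof -
 have "even (v P ?g - v P f)" if "P:T" for P using vg S that `T <= S` by (cases "f:Ol P") auto
 thus ?thesis unfolding sum_subtractf[symmetric] by (intro dvd_sum)
 qed
 ultimately show ?thesis by simp
qed simp

end

section \<open>Parities on components and the bound for non-birational divisors\<close>

locale ffield_comps = ffield +
 fixes CC :: "'a set set" assumes CR: "C:CC ==> C <= Rp" and Cne: "C:CC ==> C ~= {}" and Cdisj: "C:CC ==> C':CC ==> P:C ==> P:C' ==> C = C'"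
 and Ccov: "P:Rp ==> EX C:CC. P:C" and Cpar: "C:CC ==> f ~= 0 ==> even (SUM P:{P:C. v P f ~= 0}. v P f)"
begin

definition pr :: "'a set => 'a dvt => int" where "pr C D = (SUM P:kys D Int C. lk D P)"
definition oc :: "'a dvt => 'a set set" where "oc D = {C:CC. odd (pr C D)}"
text \<open>Twice the number with which \<open>very_special\<close> compares the dimension.\<close>

definition aa :: "'a dvt => int" where "aa D = dgr D - int (card (oc D))"
lemma pr_superset: "finite S ==> kys D <= S ==> pr C D = (SUM P:S Int C. lk D P)" unfolding pr_def by (rule sum.mono_neutral_left) (auto simp: in_keys_iff)
lemma pr_add: "pr C (A + B) = pr C A + pr C B" using keys_add[of A B] by (simp add: pr_superset[of "kys A Un kys B"] lookup_add sum.distrib)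
lemma pr_pt: "pr C (pt Q) = (if Q:C then 1 else 0)" by (simp add: pr_def)

lemma oc_fin: "finite (oc D)"
proof -
 have "oc D <= (UN P:kys D. {C:CC. P:C})" unfolding oc_def pr_def
 proof
 fix C assume C: "C:{C:CC. odd (SUM P:kys D Int C. lk D P)}"
 hence "kys D Int C ~= {}" by auto
 thus "C:(UN P:kys D. {C:CC. P:C})" using C by auto
 qed
 moreover have "finite {C:CC. P:C}" for P
 proof (cases "EX C:CC. P:C")
 case True
 then obtain C where "C:CC" "P:C" by auto
 hence "{C:CC. P:C} <= {C}" using Cdisj by auto
 thus ?thesis by (rule finite_subset) simp
 next
 case False
 hence e: "{C:CC. P:C} = {}" by simp
 show ?thesis unfolding e by simp
 qed
 ultimately show ?thesis by (auto intro: finite_subset[OF _ finite_UN_I[OF finite_keys]])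
qed

lemma aa_equiv: assumes "f ~= 0" shows "oc (D + dvs f) = oc D" "aa (D + dvs f) = aa D"
proof -
 have "even (pr C (dvs f))" if "C:CC" for C
 proof -
 have "kys (dvs f) Int C = {P:C. v P f ~= 0}" using assms CR[OF that] Rp_Pts by (auto simp: in_keys_iff lk_dvs)
 hence "pr C (dvs f) = (SUM P:{P:C. v P f ~= 0}. v P f)" unfolding pr_def using CR[OF that] Rp_Pts assms by (intro sum.cong) (auto simp: lk_dvs)
 thus ?thesis using Cpar[OF that assms] by simp
 qed
 thus o: "oc (D + dvs f) = oc D" unfolding oc_def by (auto simp: pr_add)
 show "aa (D + dvs f) = aa D" unfolding aa_def o by (simp add: dgr_add dgr_dvs[OF assms])
qed

lemma step_complex: assumes "P:Pts" "P ~: Rp" shows "oc (D + pt P) = oc D" "aa (D + pt P) = aa D + 2"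
proof -
 show o: "oc (D + pt P) = oc D" unfolding oc_def using CR assms by (auto simp: pr_add pr_pt)
 show "aa (D + pt P) = aa D + 2" unfolding aa_def o using assms by (simp add: dgr_add dgr_single Rp_def dg_def split: if_splits)
qed

text \<open>The new point flips the parity on \<open>C\<close> and on no other component, so the
  gain of 1 in degree is doubled or cancelled by the change in the number of odd components.\<close>

lemma step_real: assumes C: "C:CC" "P:C" shows "C:oc D ==> aa (D + pt P) = aa D + 2 & C ~: oc (D + pt P)" "C ~: oc D ==> aa (D + pt P) = aa D & C:oc (D + pt P)"
proof -
 have d: "dgr (D + pt P) = dgr D + 1" using CR[OF C(1)] C by (auto simp: dgr_add dgr_single Rp_def)
 have q: "odd (pr C' (D + pt P)) <-> (odd (pr C' D) ~= (C' = C))" if "C':CC" for C' using Cdisj[OF C(1) that C(2)] C by (auto simp: pr_add pr_pt)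
 { assume "C:oc D"
 hence "oc (D + pt P) = oc D - {C}" "C:oc D" using q by (auto simp: oc_def)
 thus "aa (D + pt P) = aa D + 2 & C ~: oc (D + pt P)" using card_Suc_Diff1[OF oc_fin, of C D] d by (simp add: aa_def) }
 { assume "C ~: oc D"
 hence "oc (D + pt P) = insert C (oc D)" "C ~: oc D" using q C by (auto simp: oc_def)
 thus "aa (D + pt P) = aa D & C:oc (D + pt P)" using oc_fin d by (simp add: aa_def) }
qed

lemma aa_cases: assumes "P:Pts" shows "aa (D + pt P) = aa D | aa (D + pt P) = aa D + 2"
proof (cases "P:Rp")
 case True
 then obtain C where "C:CC" "P:C" using Ccov by auto
 thus ?thesis using step_real[of C P D] by auto
qed (use step_complex assms in auto)

lemma aa_eff: "eff D ==> 0 <= aa D & even (aa D)"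
proof (induction rule: eff_induct)
 case 0
 have "oc 0 = {}" by (simp add: oc_def pr_def)
 thus ?case by (simp add: aa_def)
next
 case (add C Q) thus ?case using aa_cases[of Q C] by auto
qed

text \<open>With \<open>r = l D - 1\<close> the bounds are \<open>2 r - 2\<close> and
  \<open>2 r\<close>. The sharper one belongs to the induction hypothesis: if subtracting a real
  point \<open>P\<close> lowers \<open>r\<close> by one, the rest has a base point by
  \<open>birational_criterion\<close>, and its sharper bound \<open>2 (r - 1)\<close> is the general
  bound for \<open>D\<close>.\<close>

theorem nonbirational_bound: assumes "D:Dv" "rat (H D) ~= UNIV" "1 <= l D"
 shows "2 * int (l D) - 4 <= aa D & ((EX C:CC. C ~: oc D) | (EX Q:Pts. l (D - pt Q) = l D) --> 2 * int (l D) - 2 <= aa D)" using assms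
proof (induction "nat (dgr D)" arbitrary: D rule: less_induct)
 case less
 note D = less.prems(1)
 have d0: "0 <= dgr D" using dgr_nonneg[OF D] less.prems by simp
 have DP: "D - pt P:Dv" "rat (H (D - pt P)) ~= UNIV" "D = D - pt P + pt P" if P: "P:Pts" for P
 proof -
 show "D - pt P:Dv" using Dv_minus[OF D Dv_pt[OF P]] .
 have "H (D - pt P) <= H D" using H_pt[OF P] by auto
 from rat_mono[OF this] show "rat (H (D - pt P)) ~= UNIV" using less.prems by auto
 qed simp
 have IH: "2 * int (l (D - pt P)) - 4 <= aa (D - pt P) & ((EX C:CC. C ~: oc (D - pt P)) | (EX Q:Pts. l (D - pt P - pt Q) = l (D - pt P)) --> 2 * int (l (D - pt P)) - 2 <= aa (D - pt P))"
 if P: "P:Pts" and l1: "1 <= l (D - pt P)" for P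
 proof -
 have "0 <= dgr (D - pt P)" using dgr_nonneg[OF DP(1)[OF P]] l1 by simp
 hence "nat (dgr (D - pt P)) < nat (dgr D)" using dg_pos[of P] by (simp add: dgr_minus dgr_single)
 from less.hyps[OF this DP(1,2)[OF P] l1] show ?thesis .
 qed
 show ?case
 proof (cases "EX Q:Pts. l (D - pt Q) = l D")
 case True
 then obtain Q where Q: "Q:Pts" "l (D - pt Q) = l D" by auto
 note I = IH[OF Q(1)]
 \<comment> \<open>Removing a base point \<open>Q\<close> keeps \<open>l\<close>. Either
   \<open>Q\<close> lies on a component that is even for \<open>D - pt Q\<close>, where the sharper
   bound holds by induction, or \<open>aa\<close> drops by 2.\<close>
 have "2 * int (l D) - 2 <= aa D"
 proof (cases "EX C:CC. Q:C & C ~: oc (D - pt Q)")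
  case True
  then obtain C where C: "C:CC" "Q:C" "C ~: oc (D - pt Q)" by auto
  hence "aa D = aa (D - pt Q)" using step_real(2)[OF C(1,2,3)] by simp
  thus ?thesis using I C Q less.prems by auto
 next
  case False
  have "aa D = aa (D - pt Q) + 2"
  proof (cases "Q:Rp")
  case True
  then obtain C where C: "C:CC" "Q:C" using Ccov by auto
  thus ?thesis using False step_real[OF C, of "D - pt Q"] by auto
  qed (use step_complex(2)[OF Q(1), of "D - pt Q"] in simp)
  thus ?thesis using I Q less.prems by auto
 qed
 thus ?thesis by simp
 next
 case nb: False
 have bpf: "l (D - pt Q) < l D" if "Q:Pts" for Q using nb that l_base[OF D that] by auto
 \<comment> \<open>If removing \<open>P\<close> costs its full degree, then the absence of base
   points in \<open>D - pt P\<close> would make \<open>D\<close> birational.\<close>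
 have base: "EX Q:Pts. l (D - pt P - pt Q) = l (D - pt P)" if P: "P:Pts" "l D = l (D - pt P) + dg P" "1 <= l (D - pt P)" for P
  using birational_criterion[OF D bpf P] less.prems l_base[OF DP(1)[OF P(1)]] by force
 show ?thesis
 proof (cases "l D = 1")
  case True
  then obtain f where f: "f ~= 0" "f:H D" using l_pos[of D] by auto
  have "lk (D + dvs f) P >= 0" for P using f H_iff Dv_add[OF D dvs_Dv[OF f(1)]] by (cases "P:Pts") (auto simp: Dv_iff)
  hence "eff (D + dvs f)" using Dv_add[OF D dvs_Dv[OF f(1)]] by (simp add: eff_def)
  from aa_eff[OF this] show ?thesis using True aa_equiv[OF f(1)] by simp
 next
  case l2: False
  show ?thesis
  proof (cases "Rp = {}")
  case True
  hence CE: "CC = {}" using CR Cne by auto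
  \<comment> \<open>Without real points a point of degree 2 is removed. Then \<open>aa\<close> drops
    by 2 and \<open>l\<close> by at most 2, and the sharper bound is used only when \<open>l\<close>
    drops by 2.\<close>
  obtain P where P: "P:Pts" using ne by auto
  hence d2: "dg P = 2" using True by (auto simp: Rp_def dg_def split: if_splits)
  have a2: "aa D = aa (D - pt P) + 2" using step_complex[OF P, of "D - pt P"] True by simp
  have "2 * int (l D) - 4 <= aa D"
  proof (cases "l (D - pt P) = 0")
   case True
   hence "l D <= 2" using l_step[OF D P] d2 by simp
   moreover have "oc D = {}" using CE unfolding oc_def by simp
   hence "aa D = dgr D" by (simp add: aa_def)
   ultimately show ?thesis using d0 by simp
  next
   case False
   hence I: "2 * int (l (D - pt P)) - 4 <= aa (D - pt P)" "l D = l (D - pt P) + 2 ==> 2 * int (l (D - pt P)) - 2 <= aa (D - pt P)" using IH[OF P] base[OF P] d2 by auto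
   show ?thesis using I a2 l_step[OF D P] d2 by force
  qed
  thus ?thesis using CE nb by simp
  next
  case False
  \<comment> \<open>A component that is even for \<open>D\<close> is preferred. It is odd for
    \<open>D - pt P\<close>, so \<open>aa\<close> drops by 2, which yields the sharper
    bound.\<close>
  obtain C where C: "C:CC" "(EX C:CC. C ~: oc D) ==> C ~: oc D" using False Ccov by blast
  obtain P where P: "P:C" using Cne[OF C(1)] by auto
  have PP: "P:Pts" "dg P = 1" using CR[OF C(1)] P by (auto simp: Rp_def)
  have lP: "l D = l (D - pt P) + dg P" "1 <= l (D - pt P)" using bpf[OF PP(1)] l_step[OF D PP(1)] PP l2 by auto
  have I: "2 * int (l (D - pt P)) - 2 <= aa (D - pt P)" using IH[OF PP(1) lP(2)] base[OF PP(1) lP] by simp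
  have st: "C:oc (D - pt P) ==> aa D = aa (D - pt P) + 2 & C ~: oc D" "C ~: oc (D - pt P) ==> aa D = aa (D - pt P) & C:oc D"
   using step_real[OF C(1) P, of "D - pt P"] by auto
  show ?thesis using I st C lP PP nb by force
  qed
 qed
 qed
qed

end

section \<open>Dimension and span in ring records and in type classes\<close>

abbreviation "rdim V == dim V"
abbreviation "rind B == independent B"

lemma span_insert_eq: "{r *\<^sub>R v + e |r e. e:span B} = span (insert v B)"
proof (intro Set.set_eqI iffI)
 fix x assume "x:{r *\<^sub>R v + e |r e. e:span B}"
 then obtain r e where "x = r *\<^sub>R v + e" "e:span B" by auto
 thus "x:span (insert v B)" unfolding span_insert by (auto intro!: exI[of _ r])
next
 fix x assume "x:span (insert v B)"
 then obtain r where r: "x - r *\<^sub>R v:span B" unfolding span_insert by auto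
 have "x = r *\<^sub>R v + (x - r *\<^sub>R v)" by simp
 thus "x:{r *\<^sub>R v + e |r e. e:span B}" using r by fast
qed

lemma dim_extend: assumes V: "fin V" "subspace V" and v: "v ~: V"
 shows "fin {r *\<^sub>R v + e |r e. e:V}" "subspace {r *\<^sub>R v + e |r e. e:V}" "dim {r *\<^sub>R v + e |r e. e:V} = Suc (dim V)"
proof -
 obtain B where B: "finite B" "B <= V" "independent B" "V <= span B" "card B = dim V" using fin_basis[OF V(1)] .
 have sB: "span B = V" using B V by (simp add: span_minimal subset_antisym)
 note e = span_insert_eq[of v B, unfolded sB]
 show "fin {r *\<^sub>R v + e |r e. e:V}" unfolding e fin_def using B by auto
 show "subspace {r *\<^sub>R v + e |r e. e:V}" unfolding e by simp
 have i: "independent (insert v B)" using B v sB by (simp add: independent_insertI)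
 have "v ~: B" using v B by auto
 thus "dim {r *\<^sub>R v + e |r e. e:V} = Suc (dim V)" unfolding e dim_span_eq_card_independent[OF i] using B by simp
qed

locale real_model = ring S for S (structure) +
 fixes c :: "real => 'a" and ka :: "'a => 'v::real_vector" assumes c: "c r:carrier S" and kadd: "a:carrier S ==> b:carrier S ==> ka (a \<oplus> b) = ka a + ka b"
 and kmul: "a:carrier S ==> ka (c r \<otimes> a) = r *\<^sub>R ka a" and kinj: "inj_on ka (carrier S)"
begin

lemma kzero: "ka \<zero> = 0" using kadd[of \<zero> \<zero>] by simp

lemma le_image: assumes "a:carrier S" "E <= carrier S"
 shows "line_extension (range c) a E <= carrier S" "ka ` line_extension (range c) a E = {r *\<^sub>R ka a + e |r e. e:ka ` E}"
proof -
 have e: "line_extension (range c) a E = {c r \<otimes> a \<oplus> w |r w. w:E}" by (rule Set.set_eqI) (unfold line_extension_mem_iff, blast)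
 show "line_extension (range c) a E <= carrier S" unfolding e using assms c by auto
 have "ka (c r \<otimes> a \<oplus> w) = r *\<^sub>R ka a + ka w" if "w:E" for r w using that assms c kadd kmul by auto
 thus "ka ` line_extension (range c) a E = {r *\<^sub>R ka a + e |r e. e:ka ` E}" unfolding e by (auto simp: image_iff) metis+
qed

lemma dimension_image: "dimension n (range c) E ==> E <= carrier S & fin (ka ` E) & subspace (ka ` E) & rdim (ka ` E) = n"
proof (induction n "range c" E rule: dimension.induct)
 case zero_dim
 have "rdim {0 :: 'v} = 0" using dim_le_card[of "{0 :: 'v}" "{}"] by simp
 thus ?case by (auto simp: kzero fin_def)
next
 case (Suc_dim v E n)
 have "ka v ~: ka ` E" using Suc_dim kinj by (auto dest: inj_onD)
 thus ?case using Suc_dim le_image dim_extend[of "ka ` E" "ka v"] by simp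
qed

lemma span_list: assumes "rind (set bs)" "distinct bs" "set bs <= ka ` carrier S"
 defines "s == map (inv_into (carrier S) ka) bs"
 shows "set s <= carrier S & ka ` Span (range c) s = span (set bs) & independent (range c) s & dimension (length bs) (range c) (Span (range c) s)"
 using assms(1-3) unfolding s_def
proof (induction bs)
 case Nil thus ?case by (simp add: kzero)
next
 case (Cons b bs)
 let ?i = "inv_into (carrier S) ka" and ?sp = "Span (range c) (map (inv_into (carrier S) ka) bs)"
 have IH: "set (map ?i bs) <= carrier S" "ka ` ?sp = span (set bs)" "independent (range c) (map ?i bs)" "dimension (length bs) (range c) ?sp"
 using Cons independent_mono by auto
 have spc: "?sp <= carrier S" using dimension_image[OF IH(4)] by simp
 have b: "?i b:carrier S" "ka (?i b) = b" using Cons.prems by (auto intro: inv_into_into f_inv_into_f)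
 have nb: "b ~: span (set bs)" using Cons.prems by (auto simp: independent_insert)
 hence ns: "?i b ~: ?sp" using IH(2) b by force
 have e: "Span (range c) (map ?i (b # bs)) = line_extension (range c) (?i b) ?sp" by simp
 have "ka ` Span (range c) (map ?i (b # bs)) = {r *\<^sub>R b + e |r e. e:span (set bs)}" unfolding e le_image(2)[OF b(1) spc] IH(2) b(2) ..
 also have "... = span (insert b (set bs))" by (rule span_insert_eq)
 finally show ?case using IH b Suc_dim[OF b(1) ns IH(4)] li_Cons[OF b(1) ns IH(3)] by simp
qed

text \<open>The dimension is compared through the injective linear map \<open>ka\<close>. The second
  claim provides an ordered basis, which the definition of a simple divisor asks for.\<close>

lemma real_dim_eq: assumes E: "E <= carrier S" "fin (ka ` E)" "subspace (ka ` E)" shows "real_dim S c E = rdim (ka ` E)"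
 "EX s. set s <= carrier S & independent (range c) s & Span (range c) s = E & span (ka ` set s) = ka ` E"
proof -
 obtain B where B: "finite B" "B <= ka ` E" "rind B" "ka ` E <= span B" "card B = rdim (ka ` E)" using fin_basis[OF E(2)] .
 obtain bs where bs: "set bs = B" "distinct bs" using finite_distinct_list[OF B(1)] by auto
 let ?s = "map (inv_into (carrier S) ka) bs"
 have sl: "set ?s <= carrier S & ka ` Span (range c) ?s = span (set bs) & independent (range c) ?s & dimension (length bs) (range c) (Span (range c) ?s)"
 by (rule span_list) (use bs B(2,3) image_mono[OF E(1), of ka] in auto)
 have sp: "span B = ka ` E" using B E by (simp add: span_minimal subset_antisym)
 have "Span (range c) ?s <= carrier S" using dimension_image sl by auto
 hence eq: "Span (range c) ?s = E" using sl sp bs inj_on_image_eq_iff[OF kinj _ E(1), of "Span (range c) ?s"] by simp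
 have "dimension (rdim (ka ` E)) (range c) E" using sl eq bs B distinct_card[of bs] by simp
 thus "real_dim S c E = rdim (ka ` E)" unfolding real_dim_def by (rule the_equality) (use dimension_image in blast)
 have "ka ` set ?s = B" using bs B E by (force simp: f_inv_into_f intro!: image_eqI)
 thus "EX s. set s <= carrier S & independent (range c) s & Span (range c) s = E & span (ka ` set s) = ka ` E" using sl eq sp by blast
qed

end

section \<open>The notions of the theorem expressed in the function field\<close>

context curve_model
begin

lemma cp_ne: "cp ~= {}"
proof
 assume "cp = {}"
 hence t: "topX = {gp}" using gp_top by (auto simp: cp_def)
 obtain Z0 Z1 where "irreducible_closed (space_top X) Z0" "irreducible_closed (space_top X) Z1" "Z0 \<subset> Z1" using curveD unfolding krull_dim_one_def by auto
 thus False using t closedin_subset[of "space_top X" Z0] closedin_subset[of "space_top X" Z1] unfolding irreducible_closed_def by auto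
qed

sublocale F: ffield cp Ost using cp_dvr Ost_real finite_support indep regular_const cp_ne by unfold_locales (auto simp: cp_def)

sublocale KM: real_model K "ff_const X" h
proof
 show "ff_const X r:carrier K" for r using shom_const(1)[OF gp_top] .
 show "inj_on h (carrier K)" using h_bij by (simp add: bij_betw_def)
qed (simp_all add: h_add h_mult h_real scr shom_const(1)[OF gp_top])

lemma hK: "h ` carrier K = UNIV" using h_bij by (simp add: bij_betw_def)

lemma h_inv: "a:carrier K ==> h a ~= 0 ==> inv$$K a:carrier K & h (inv$$K a) = inverse (h a)"
proof -
 assume a: "a:carrier K" "h a ~= 0"
 hence "a:Units K" using h_zero K.field_Units by auto
 hence i: "inv$$K a:carrier K" "a \<otimes>$$K inv$$K a = \<one>$$K" by auto
 hence "h a * h (inv$$K a) = 1" using h_mult[of a "inv$$K a"] h_one a by simp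
 thus ?thesis using i inverse_unique[of "h a" "h (inv$$K a)"] by simp
qed

lemma h_pow: "a:carrier K ==> a [^]$$K (n::nat):carrier K & h (a [^]$$K n) = h a ^ n" by (induction n) (simp_all add: h_one h_mult)

lemma h_powi: "a:carrier K ==> h a ~= 0 ==> a [^]$$K (n::int):carrier K & h (a [^]$$K n) = h a powi n"
 using h_pow h_inv unfolding int_pow_def2 by (simp add: power_int_def power_inverse del: pow_nat)

lemma stalk_ff: assumes P: "P:topX" shows "a:carrier (stalk X P) ==> stalk_to_ff X a:carrier K"
proof -
 assume "a:carrier (stalk X P)"
 then obtain U s where U: "opn U" "P:U" "s:car U" "a = germ X P U s" unfolding stalk_def by auto
 thus ?thesis using germ_gp germ_car[OF U(1) _ U(3), of gp] gp[OF U(1)] by auto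
qed

text \<open>\<open>h\<close> is injective, so the equality of two sets of rational functions can be
  tested on their images.\<close>

lemma uniformizer_iff: assumes P: "P:cp" shows "uniformizer X P t <-> t:carrier K & unf (Ost P) (h t)"
proof -
 have PX: "P:topX" using P by (simp add: cp_def)
 note s = stalk_ff[OF PX]
 let ?L = "stalk_to_ff X ` stalk_max X P" and ?R = "{t \<otimes>$$K a |a. a:stalk_to_ff X ` carrier (stalk X P)}"
 have L: "?L <= carrier K" "h ` ?L = mx (Ost P)" using s shom_max[OF PX] by (auto simp: stalk_max_def image_image shom_def Mst_mx)
 have R: "?R <= carrier K & h ` ?R = {h t * a |a. a:Ost P}" if t: "t:carrier K"
 proof -
 have "h (t \<otimes>$$K stalk_to_ff X a) = h t * shom a" if "a:carrier (stalk X P)" for a using h_mult[OF t s[OF that]] by (simp add: shom_def)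
 thus ?thesis using t s unfolding shom_img[of P, symmetric] by (auto simp: image_iff) metis+
 qed
 have "mx (Ost P) ~= {0}" using F.vg1[OF P, of "F.tt P"] F.tt[OF P] by (auto simp: F.vg_def)
 hence nz: "h t ~= 0" if "mx (Ost P) = {h t * a |a. a:Ost P}" using that subrD[OF F.sub[OF P]] by auto
 have eq: "?L = ?R <-> mx (Ost P) = {h t * a |a. a:Ost P}" if "t:carrier K" using R[OF that] inj_on_image_eq_iff[OF KM.kinj L(1), of ?R] by (simp only: L(2))
 show ?thesis unfolding uniformizer_def unf_def
 proof (intro iffI; elim conjE)
 assume t: "t:carrier K" and "?L = ?R"
 hence "mx (Ost P) = {h t * a |a. a:Ost P}" by (simp only: eq)
 thus "t:carrier K & h t ~= 0 & mx (Ost P) = {h t * a |a. a:Ost P}" by (intro conjI t nz)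
 next
 assume t: "t:carrier K" and "mx (Ost P) = {h t * a |a. a:Ost P}"
 thus "t:carrier K & ?L = ?R" by (simp only: eq simp_thms)
 qed
qed

text \<open>The two orders are defined by conditions on the exponent that correspond to each other
  under \<open>h\<close>.\<close>

lemma ord_vl: assumes P: "P:cp" and f: "f:carrier K" shows "ord_at X P f = F.v P (h f)"
proof -
 have PX: "P:topX" using P by (simp add: cp_def)
 have U: "h ` stalk_to_ff X ` Units (stalk X P) = {u:Ost P. u ~: mx (Ost P)}"
 proof -
 have Uc: "a:carrier (stalk X P)" if "a:Units (stalk X P)" for a using that by (simp add: Units_def)
 have O: "u:Ost P <-> (EX a:carrier (stalk X P). u = shom a)" for u using shom_img by auto
 have "u:shom ` Units (stalk X P) <-> u:Ost P & u ~: mx (Ost P)" for u unfolding O Mst_mx[symmetric] using shom_unit[OF PX] Uc by auto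
 hence "shom ` Units (stalk X P) = {u:Ost P. u ~: mx (Ost P)}" by auto
 thus ?thesis by (simp add: image_image shom_def)
 qed
 have Uc: "stalk_to_ff X ` Units (stalk X P) <= carrier K" using stalk_ff[OF PX] by (auto simp: Units_def)
 have "(EX t u. uniformizer X P t & u:stalk_to_ff X ` Units (stalk X P) & f = u \<otimes>$$K (t [^]$$K n)) <->
  (EX t u. unf (Ost P) t & u:Ost P & u ~: mx (Ost P) & h f = u * t powi n)" (is "?l <-> ?r") for n :: int
 proof
 assume ?l
 then obtain t u where t: "t:carrier K" "unf (Ost P) (h t)" and u: "u:stalk_to_ff X ` Units (stalk X P)" "f = u \<otimes>$$K (t [^]$$K n)" unfolding uniformizer_iff[OF P] by auto
 hence "h f = h u * h t powi n" using h_powi Uc h_mult by (auto simp: unf_def)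
 thus ?r using t u U by fast
 next
 assume ?r
 then obtain t u where t: "unf (Ost P) t" "u:Ost P" "u ~: mx (Ost P)" "h f = u * t powi n" by auto
 obtain t' where t': "t':carrier K" "h t' = t" using hK by (metis UNIV_I imageE)
 obtain u' where u': "u':stalk_to_ff X ` Units (stalk X P)" "h u' = u" using t(2,3) U by (metis (mono_tags, lifting) imageE mem_Collect_eq)
 have tp: "t' [^]$$K n:carrier K" "h (t' [^]$$K n) = t powi n" using h_powi t' t by (auto simp: unf_def)
 have "h f = h (u' \<otimes>$$K (t' [^]$$K n))" using t u' tp Uc h_mult by auto
 hence "f = u' \<otimes>$$K (t' [^]$$K n)" by (rule h_inj[OF f K.m_closed[OF subsetD[OF Uc u'(1)] tp(1)]])
 thus ?l using uniformizer_iff[OF P, of t'] t' t u' by auto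
 qed
 thus ?thesis unfolding ord_at_def vl_def by simp
qed

lemma gs_H: "global_sections X D <= carrier K" "h ` global_sections X D = F.H D"
proof -
 have "f:global_sections X D <-> f:carrier K & h f:F.H D" for f
 unfolding global_sections_def F.H_def F.vg_def closed_points_cp using ord_vl h_zero h_inj[of f "\<zero>$$K"] by auto
 thus "global_sections X D <= carrier K" "h ` global_sections X D = F.H D" using hK by (auto simp: set_eq_iff image_iff) metis
qed

lemma Div_Dv: "Div X = F.Dv" by (auto simp: F.Dv_def closed_points_cp)
lemma ell_l: "D:F.Dv ==> ell X D = F.l D" unfolding ell_def F.l_def using KM.real_dim_eq[OF gs_H(1), of D] gs_H F.H_fin F.H_sub by simp
text \<open>The residue at \<open>x\<close> carried by a coset in the residue field; by
  \<open>coset_eq\<close> the chosen representative does not matter.\<close>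

definition kr :: "'p => ('p, 's) ffg set => complex" where "kr x c = F.ev x (shom (SOME a. a:cst x & c = stalk_max X x +>$$(st x) a))"

context
 fixes x assumes x: "x:cp"
begin

abbreviation "rc a == stalk_max X x +>$$(st x) a"
lemma xX: "x:topX" using x by (simp add: cp_def)

interpretation SX: cring "st x" by (rule stalk_cring[OF xX])

lemma max_mem: "a:cst x ==> a:stalk_max X x <-> shom a:mx (Ost x)" using shom_stalk_max[OF xX] by (simp add: Mst_mx)

lemma max_ideal: "ideal (stalk_max X x) (st x)"
proof (rule ideal_from[OF SX.is_cring])
 note m = idlD[OF F.mxI[OF x]]
 have c: "shom a:Ost x" if "a:cst x" for a using shom_img that by auto
 show s: "stalk_max X x <= cst x" by (auto simp: stalk_max_def)
 interpret E: mp_emb "st x" shom by (rule stalk_emb[OF xX])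
 show "\<zero>$$(st x):stalk_max X x" using max_mem E.k_zero m by simp
 show "a \<oplus>$$(st x) b:stalk_max X x" if "a:stalk_max X x" "b:stalk_max X x" for a b
 proof -
 have "a:cst x" "b:cst x" using that s by auto
 thus ?thesis using that max_mem shom_add m by simp
 qed
 show "a \<otimes>$$(st x) b:stalk_max X x" if "a:cst x" "b:stalk_max X x" for a b
 proof -
 have "b:cst x" using that s by auto
 thus ?thesis using that max_mem shom_mult m(4)[OF c[OF that(1)]] by simp
 qed
qed

interpretation I: ideal "stalk_max X x" "st x" by (rule max_ideal)

lemma coset_eq: assumes "a:cst x" "b:cst x" shows "rc a = rc b <-> F.ev x (shom a) = F.ev x (shom b)"
proof -
 have c: "shom a:Ost x" "shom b:Ost x" using shom_img assms by auto
 interpret E: mp_emb "st x" shom by (rule stalk_emb[OF xX])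
 have "rc a = rc b <-> a \<ominus>$$(st x) b:stalk_max X x" using SX.quotient_eq_iff_same_a_r_cos[OF max_ideal assms] by simp
 also have "... <-> shom a - shom b:mx (Ost x)" using max_mem[of "a \<ominus>$$(st x) b"] assms by (simp add: SX.minus_eq E.k_add E.k_neg)
 also have "... <-> F.ev x (shom a - shom b) = 0" using F.evf[OF x] c subrD[OF F.sub[OF x]] by simp
 also have "F.ev x (shom a) = F.ev x (shom a - shom b) + F.ev x (shom b)" using F.evf(1)[OF x, of "shom a - shom b" "shom b"] c subrD[OF F.sub[OF x]] by simp
 hence "F.ev x (shom a - shom b) = 0 <-> F.ev x (shom a) = F.ev x (shom b)" by simp
 finally show ?thesis .
qed

lemma kr_coset: assumes "a:cst x" shows "kr x (rc a) = F.ev x (shom a)"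
proof -
 have "EX b. b:cst x & rc a = rc b" using assms by auto
 from someI_ex[OF this] have b: "(SOME b. b:cst x & rc a = rc b):cst x" "rc a = stalk_max X x +>$$(st x) (SOME b. b:cst x & rc a = rc b)" by auto
 show ?thesis unfolding kr_def using b unfolding coset_eq[OF assms b(1)] by simp
qed

lemma res_car: "carrier (residue_field X x) = {rc a |a. a:cst x}" unfolding residue_field_def FactRing_def A_RCOSETS_def' by auto

lemma res_const: "residue_const X x r = stalk_max X x +>$$(st x) const_germ X x r" "kr x (residue_const X x r) = of_real r"
 unfolding residue_const_def using kr_coset shom_const[OF xX] F.evf[OF x] by auto

lemma residue_model: "real_model (residue_field X x) (residue_const X x) (kr x)"
proof (intro real_model.intro real_model_axioms.intro)
 show "ring (residue_field X x)" unfolding residue_field_def by (rule I.quotient_is_ring)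
 note c = shom_img[of x]
 show "residue_const X x r:carrier (residue_field X x)" for r using shom_const[OF xX] res_car res_const by auto
 show "inj_on (kr x) (carrier (residue_field X x))"
 proof (rule inj_onI)
 fix A B assume "A:carrier (residue_field X x)" "B:carrier (residue_field X x)" "kr x A = kr x B"
 thus "A = B" unfolding res_car using kr_coset coset_eq by force
 qed
 fix A B assume "A:carrier (residue_field X x)"
 then obtain a where a: "a:cst x" "A = rc a" unfolding res_car by auto
 have Oa: "shom a:Ost x" using c a by auto
 { assume "B:carrier (residue_field X x)"
 then obtain b where b: "b:cst x" "B = rc b" unfolding res_car by auto
 have Ob: "shom b:Ost x" using c b by auto
 have "A \<oplus>$$(residue_field X x) B = stalk_max X x +>$$(st x) (a \<oplus>$$(st x) b)"
  unfolding a b residue_field_def FactRing_def using I.a_rcos_sum[OF a(1) b(1)] by simp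
 thus "kr x (A \<oplus>$$(residue_field X x) B) = kr x A + kr x B" using a b by (simp add: kr_coset shom_add F.evf(1)[OF x Oa Ob]) }
 fix r
 have "residue_const X x r \<otimes>$$(residue_field X x) A = stalk_max X x +>$$(st x) (const_germ X x r \<otimes>$$(st x) a)"
 unfolding a res_const residue_field_def FactRing_def using I.rcoset_mult_add[OF shom_const(1)[OF xX] a(1)] by simp
 thus "kr x (residue_const X x r \<otimes>$$(residue_field X x) A) = r *\<^sub>R kr x A"
 using a shom_const[OF xX, of r] by (simp add: kr_coset shom_mult F.evf(2)[OF x Ost_real[OF xX] Oa] F.evf[OF x] scr)
qed

lemma point_degree_dg: "point_degree X x = F.dg x"
proof -
 interpret RM: real_model "residue_field X x" "residue_const X x" "kr x" by (rule residue_model)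
 have img: "kr x ` carrier (residue_field X x) = F.ev x ` Ost x"
 proof -
 have "kr x ` carrier (residue_field X x) = (%a. F.ev x (shom a)) ` cst x" unfolding res_car by (force simp: kr_coset)
 thus ?thesis unfolding shom_img[of x, symmetric] by auto
 qed
 have "F.ev x ` Ost x = (if ALL b:Ost x. Im (F.ev x b) = 0 then span {1} else UNIV)"
 proof (cases "ALL b:Ost x. Im (F.ev x b) = 0")
 case True
 have "z:F.ev x ` Ost x <-> z:span {1}" for z
 proof
  assume "z:F.ev x ` Ost x"
  hence "z = Re z *\<^sub>R 1" using True by (auto simp: complex_eq_iff)
  thus "z:span {1}" unfolding span_singleton by simp
 next
  assume "z:span {1}"
  then obtain r where "z = of_real r" unfolding span_singleton by (auto simp: scr)
  thus "z:F.ev x ` Ost x" using F.evf(3)[OF x, of r] Ost_real[OF xX, of r] by force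
 qed
 thus ?thesis using True by auto
 next
 case False thus ?thesis using F.evf[OF x] by (auto simp: image_iff) metis
 qed
 hence s: "subspace (F.ev x ` Ost x)" "dim (F.ev x ` Ost x) = F.dg x" by (auto simp: F.dg_def)
 have "fin (F.ev x ` Ost x)" unfolding fin_def using finite_Basis span_Basis by fast
 thus ?thesis unfolding point_degree_def using RM.real_dim_eq[OF subset_refl] s unfolding img by simp
qed

lemma real_point_iff: "x:real_points X <-> x:F.Rp"
proof -
 interpret RM: real_model "residue_field X x" "residue_const X x" "kr x" by (rule residue_model)
 have c: "residue_const X x r:carrier (residue_field X x)" for r by (rule RM.c)
 have O: "shom ` cst x = Ost x" by (rule shom_img)
 have "x:real_points X <-> carrier (residue_field X x) <= range (residue_const X x)" using c xX unfolding real_points_def by auto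
 also have "... <-> (ALL a:cst x. EX r. rc a = residue_const X x r)" unfolding res_car by auto
 also have "... <-> (ALL a:cst x. EX r. F.ev x (shom a) = of_real r)" using coset_eq shom_const[OF xX] F.evf[OF x] by (simp add: res_const)
 also have "... <-> (ALL b:Ost x. Im (F.ev x b) = 0)" unfolding O[symmetric] by (auto simp: complex_eq_iff)
 finally show ?thesis using x by (simp add: F.Rp_def F.dg_def)
qed

lemma real_value_rv: assumes U: "opn U" "x:U" "s:car U" and xR: "x:F.Rp" shows "real_value X U s x = F.rv x (sval U s)"
proof -
 have m: "sval U s:Ost x" using Ost_mem[OF U] .
 have "residue_const X x r = stalk_max X x +>$$(st x) germ X x U s <-> r = F.rv x (sval U s)" for r
 unfolding res_const using coset_eq[OF shom_const(1)[OF xX] germ_car[OF U]] shom_const[OF xX] shom_germ[OF U] F.evf[OF x] F.ev_rv[OF xR m] by simp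
 thus ?thesis unfolding real_value_def by simp
qed

end

text \<open>The residue field at the generic point is the function field itself, and a uniformizer
  of a closed point is not a real constant.\<close>

lemma gp_not_real: "gp ~: real_points X"
proof
 assume "gp:real_points X"
 hence e: "range (residue_const X gp) = carrier (residue_field X gp)" by (simp add: real_points_def)
 obtain P where P: "P:cp" using cp_ne by auto
 obtain a where a: "a:carrier K" "h a = F.tt P" using hK by (metis UNIV_I imageE)
 have m: "stalk_max X gp = {\<zero>$$K}" using K.field_Units by (auto simp: stalk_max_def)
 have "stalk_max X gp +>$$K a:carrier (residue_field X gp)" unfolding residue_field_def FactRing_def A_RCOSETS_def' using a by auto
 then obtain r where "stalk_max X gp +>$$K a = stalk_max X gp +>$$K const_germ X gp r" unfolding e[symmetric] by (auto simp: residue_const_def)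
 hence "a = const_germ X gp r" unfolding m using a KM.c by (simp add: a_r_coset_def')
 hence "F.tt P = of_real r" using a h_real by simp
 hence "F.vg P 0 (inverse (F.tt P))" using F.vg_real[OF P, of "inverse r"] by simp
 thus False using F.tt[OF P] F.v_inv[OF P, of "F.tt P"] by (simp add: F.vg_def)
qed

lemma real_points_Rp: "real_points X = F.Rp"
proof -
 have "real_points X <= cp" using gp_not_real by (auto simp: real_points_def cp_def)
 thus ?thesis using real_point_iff F.Rp_Pts by auto
qed

text \<open>Inside each affine piece of a finite cover, \<open>U\<close> contains the complement of
  the zeros of a nonzero function.\<close>

lemma cofinite: assumes U: "opn U" "U ~= {}" shows "finite (cp - U)"
proof -
 obtain UU where u: "finite UU" "\<Union>UU = topX" "!!W. W:UU ==> goodU W" using good_cover by auto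
 have "finite (W Int cp - U)" if "W:UU" for W
 proof -
 note g = goodUD[OF u(3)[OF that]]
 have "opn (W Int U)" "gp:W Int U" using g U gp by auto
 then obtain f where f: "f:AA W" "f ~: Mst gp" "{y:W. f ~: Mst y} <= W Int U" using aff_basis[OF g(1,2), of "W Int U" gp] by auto
 hence "finite {x:W Int cp. f:Mst x}" using finite_zeros[OF u(3)[OF that], of f] Ost_gp by auto
 thus ?thesis by (rule finite_subset[rotated]) (use f(3) in auto)
 qed
 hence "finite (UN W:UU. W Int cp - U)" using u by blast
 thus ?thesis by (rule finite_subset[rotated]) (use u(2) in \<open>auto simp: cp_def\<close>)
qed

abbreviation "RT == real_points_top X"

lemma RT_open: "opn U ==> s:car U ==> open V ==> openin RT {x:F.Rp Int U. F.rv x (sval U s):V}"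
proof -
 assume a: "opn U" "s:car U" "open V"
 hence "openin RT {x:real_points X Int U. real_value X U s x:V}" unfolding real_points_top_def by (intro topology_generated_by_Basis) blast
 moreover have "{x:real_points X Int U. real_value X U s x:V} = {x:F.Rp Int U. F.rv x (sval U s):V}" using real_value_rv a F.Rp_Pts unfolding real_points_Rp by auto
 ultimately show ?thesis by simp
qed

lemma RT_topspace: "topspace RT = F.Rp"
proof
 show "topspace RT <= F.Rp" unfolding real_points_top_def real_points_Rp by auto
 have "openin RT {x:F.Rp Int topX. F.rv x (sval topX (structure_hom X 0)):UNIV}" by (rule RT_open[OF openin_topspace struct_car open_UNIV])
 thus "F.Rp <= topspace RT" using openin_subset F.Rp_Pts by (fastforce simp: cp_def)
qed

text \<open>Near a point where \<open>f\<close> is regular this is continuity of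
  \<open>1/(1 + t^2)\<close>; near a pole \<open>eo\<close> of \<open>f\<close> is 1 minus
  \<open>eo\<close> of the inverse, which is regular there.\<close>

lemma eo_RT_open: assumes V: "open V" shows "openin RT {P:F.Rp. F.eo P f:V}"
proof -
 have 1: "EX N. openin RT N & P:N & (ALL Q:N. Q:F.Rp & F.eo Q g:V)" if V: "open V" and P: "P:F.Rp" "g:Ost P" "F.eo P g:V" for V P g
 proof -
 obtain U s where U: "opn U" "P:U" "s:car U" "g = sval U s" using P unfolding Ost_def by auto
 have "1 + t^2 ~= 0" for t :: real using zero_le_power2[of t] by linarith
 hence "open ((%t :: real. 1 / (1 + t^2)) -` V)" by (intro open_vimage V continuous_intros) auto
 from RT_open[OF U(1,3) this] show ?thesis using U P Ost_mem by (intro exI[of _ "{x:F.Rp Int U. F.rv x (sval U s):(%t. 1 / (1 + t^2)) -` V}"]) (auto simp: F.eo_def)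
 qed
 have "EX N. openin RT N & P:N & N <= {P:F.Rp. F.eo P f:V}" if P: "P:F.Rp" "F.eo P f:V" for P
 proof (cases "f:Ost P")
 case True thus ?thesis using 1[OF V P(1) True P(2)] by auto
 next
 case False
 note n = F.not_Ol[OF P(1) False]
 have e: "F.eo Q f = 1 - F.eo Q (inverse f)" if "Q:F.Rp" for Q using F.eo_inv[OF that, of f] n by simp
 have "open ((%t :: real. 1 - t) -` V)" by (intro open_vimage V continuous_intros)
 from 1[OF this P(1), of "inverse f"] obtain N where "openin RT N" "P:N" "ALL Q:N. Q:F.Rp & F.eo Q (inverse f):(%t :: real. 1 - t) -` V" using n e P by auto
 thus ?thesis using e by auto
 qed
 thus ?thesis by (subst openin_subopen) blast
qed

text \<open>Compactness is known for the embedded space, while components refer to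
  \<open>real_points_top\<close>. The coordinates \<open>eo\<close> are continuous by
  \<open>eo_RT_open\<close>. Conversely, Zariski open sets omit finitely many real points, and
  values of regular functions are continuous by \<open>continuous_rv\<close>.\<close>

lemma em_homeo: "homeomorphic_map RT (top_of_set (F.em ` F.Rp)) F.em"
proof -
 let ?E = "top_of_set (F.em ` F.Rp)" and ?g = "the_inv_into F.Rp F.em"
 have g: "?g (F.em P) = P" if "P:F.Rp" for P using the_inv_into_f_f[OF F.em_inj that] .
 have "continuous_map RT euclideanreal (%P. F.eo P f)" for f unfolding continuous_map_def RT_topspace using eo_RT_open by auto
 hence "continuous_map RT euclidean F.eo" unfolding euclidean_product_topology[symmetric] continuous_map_componentwise_UNIV by simp
 moreover have "continuous_map euclidean euclidean (rabs :: ('k => real) => 'k rfun)" using continuous_rabs by simp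
 ultimately have "continuous_map RT euclidean (rabs o F.eo)" by (rule continuous_map_compose)
 hence c1: "continuous_map RT ?E F.em" by (simp add: continuous_map_in_subtopology RT_topspace F.em_def[abs_def] comp_def)
 have op: "openin ?E (F.em ` {x:F.Rp Int U. F.rv x (sval U s):V})" if U: "opn U" "s:car U" and V: "open V" for U s V
 proof (cases "U = {}")
 case False
 let ?f = "sval U s" and ?S = "{Q:F.Rp. sval U s:Ost Q}"
 let ?n = "%x. (1 / rap x (?f + 1) - 1 / rap x ?f - 1) / 2"
 have "finite (F.em ` (F.Rp - U))" using cofinite[OF U(1) False] F.Rp_Pts by (intro finite_imageI finite_subset[of "F.Rp - U" "cp - U"]) auto
 hence A: "openin ?E (F.em ` F.Rp Int - F.em ` (F.Rp - U))" using finite_imp_closed by auto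
 have S: "F.em ` ?S = F.em ` F.Rp Int (%x. rap x ?f) -` (- {0})" using F.eo_pos by (fastforce simp: F.eo_def)
 have "openin ?E (F.em ` ?S)" unfolding S by (intro continuous_openin_preimage_gen continuous_rap) auto
 moreover have "openin (top_of_set (F.em ` ?S)) (F.em ` ?S Int ?n -` V)" by (intro continuous_openin_preimage_gen V F.continuous_rv(1)) auto
 ultimately have "openin ?E (F.em ` ?S Int ?n -` V)" by (rule openin_trans[rotated])
 hence "openin ?E ((F.em ` F.Rp Int - F.em ` (F.Rp - U)) Int (F.em ` ?S Int ?n -` V))" using A by auto
 moreover have "F.em ` {x:F.Rp Int U. F.rv x ?f:V} = (F.em ` F.Rp Int - F.em ` (F.Rp - U)) Int (F.em ` ?S Int ?n -` V)" (is "?L = ?R")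
 proof
  have m: "P:U ==> ?f:Ost P" for P using Ost_mem[OF U(1) _ U(2)] .
  have n: "?n (F.em P) = F.rv P ?f" if "P:?S" for P by (rule F.continuous_rv(2)[of ?S]) (use that in auto)
  show "?L <= ?R" using m n F.em_inj by (auto dest: inj_onD)
  show "?R <= ?L"
  proof
  fix x assume x: "x:?R"
  then obtain P where P: "P:?S" "x = F.em P" "?n x:V" by auto
  hence "P:U" using x by auto
  thus "x:?L" using P n by auto
  qed
 qed
 ultimately show ?thesis by simp
 qed simp
 have c2: "continuous_map ?E RT ?g" unfolding real_points_top_def continuous_on_generated_topo_iff
 proof (intro conjI allI impI)
 fix W assume "W:{{x:real_points X Int U. real_value X U f x:V} |U f V. opn U & f:car U & open V}"
 then obtain U s V where U: "opn U" "s:car U" "open V" "W = {x:real_points X Int U. real_value X U s x:V}" by auto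
 hence W: "W = {x:F.Rp Int U. F.rv x (sval U s):V}" using real_value_rv F.Rp_Pts unfolding real_points_Rp by auto
 have "?g -` W Int topspace ?E = F.em ` W" using g W by auto
 thus "openin ?E (?g -` W Int topspace ?E)" using op[OF U(1-3)] W by simp
 next
 show "?g ` topspace ?E <= \<Union>{{x:real_points X Int U. real_value X U f x:V} |U f V. opn U & f:car U & open V}"
  using RT_topspace g unfolding real_points_top_def by auto
 qed
 show ?thesis unfolding homeomorphic_map_maps homeomorphic_maps_def using c1 c2 g by (intro exI[of _ ?g]) (auto simp: RT_topspace)
qed

text \<open>Openness of \<open>C\<close> is not at hand, but in a compact Hausdorff space components
  are quasi-components. So \<open>C\<close> is separated from the finitely many zeros and poles of
  \<open>f\<close> outside it by a set that is open and closed, and \<open>parity\<close> applies to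
  that set.\<close>

lemma component_parity: assumes C: "C:real_components X" and f: "f ~= 0" shows "even (SUM P:{P:C. F.v P f ~= 0}. F.v P f)"
proof -
 have "Hausdorff_space (top_of_set (F.em ` F.Rp))" by (rule Hausdorff_space_subtopology) (unfold Hausdorff_space_def disjnt_def, simp, metis hausdorff)
 moreover have "compact_space (top_of_set (F.em ` F.Rp))" using F.em_compact by (simp add: compact_space_subtopology)
 ultimately have H: "Hausdorff_space RT" "compact_space RT"
 using em_homeo homeomorphic_map_imp_homeomorphic_space homeomorphic_Hausdorff_space homeomorphic_compact_space by blast+
 have q: "quasi_component_of RT x = connected_component_of RT x" for x by (rule quasi_eq_connected_component_of) (simp add: H)
 obtain p where p: "p:F.Rp" "C = Collect (connected_component_of RT p)" using C unfolding real_components_def connected_components_of_def RT_topspace by auto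
 let ?N = "{P:F.Rp. F.v P f ~= 0} - C"
 have fin: "finite ?N" by (rule finite_subset[OF _ F.fs[OF f]]) (use F.Rp_Pts in auto)
 have "ALL q:?N. EX S. closedin RT S & openin RT S & p:S & q ~: S" using p unfolding q[symmetric] quasi_component_of RT_topspace by auto
 from bchoice[OF this] obtain S where S: "!!q. q:?N ==> closedin RT (S q) & openin RT (S q) & p:S q & q ~: S q" by auto
 define T where "T = \<Inter>(insert (topspace RT) (S ` ?N))"
 have Tc: "closedin RT T" unfolding T_def using S by blast
 have To: "openin RT T" unfolding T_def using S fin by blast
 have CT: "C <= T"
 proof
 fix x assume x: "x:C"
 hence "quasi_component_of RT p x" using p q by simp
 thus "x:T" using S unfolding T_def quasi_component_of by simp
 qed
 have cl: "closed (F.em ` A)" if "closedin RT A" for A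
 proof -
 have "closedin (top_of_set (F.em ` F.Rp)) (F.em ` A)" using em_homeo that homeomorphic_map_closedness_eq by auto
 thus ?thesis by (rule closedin_closed_trans) (rule compact_imp_closed[OF F.em_compact])
 qed
 have "closedin RT (F.Rp - T)" using To by (simp add: openin_closedin_eq RT_topspace)
 hence "even (SUM P:{P:T. F.v P f ~= 0}. F.v P f)" using cl Tc f by (intro F.parity) (auto simp: T_def RT_topspace)
 moreover have "{P:T. F.v P f ~= 0} = {P:C. F.v P f ~= 0}"
 proof -
 have "P:C" if "P:T" "F.v P f ~= 0" for P
 proof (rule ccontr)
  assume n: "P ~: C"
  have "P:F.Rp" using that by (simp add: T_def RT_topspace)
  hence "P:?N" using n that by simp
  thus False using S[of P] that by (simp add: T_def)
 qed
 thus ?thesis using CT by auto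
 qed
 ultimately show ?thesis by simp
qed

sublocale FC: ffield_comps cp Ost "real_components X"
proof
 have c: "C:real_components X <-> (EX p:F.Rp. C = Collect (connected_component_of RT p))" for C
 unfolding real_components_def connected_components_of_def RT_topspace by auto
 show "C <= F.Rp" if "C:real_components X" for C using that connected_component_of_subset_topspace[of RT] unfolding c RT_topspace by auto
 show "C ~= {}" if "C:real_components X" for C using that nonempty_connected_components_of unfolding real_components_def by auto
 show "C = C'" if "C:real_components X" "C':real_components X" "P:C" "P:C'" for C C' P using that connected_components_of_overlap unfolding real_components_def by auto
 show "EX C:real_components X. P:C" if "P:F.Rp" for P using that Union_connected_components_of[of RT] unfolding real_components_def RT_topspace by auto
 show "even (SUM P:{P:C. F.v P f ~= 0}. F.v P f)" if "C:real_components X" "f ~= 0" for C f using component_parity that .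
qed

end

section \<open>Simple divisors, and the conclusion for a curve with a model\<close>

context ffield
begin

text \<open>Base points are removed one at a time; the degree stays nonnegative, so this
  stops.\<close>

lemma base_part: assumes "D:Dv" "0 < l D" shows "EX E. eff E & H (D - E) = H D & (ALL P:Pts. l (D - E - pt P) ~= l (D - E))" using assms
proof (induction "nat (dgr D)" arbitrary: D rule: less_induct)
 case less
 show ?case
 proof (cases "ALL P:Pts. l (D - pt P) ~= l D")
 case True thus ?thesis by (intro exI[of _ 0]) (simp add: eff_def Dv_0)
 next
 case False
 then obtain P where P: "P:Pts" "l (D - pt P) = l D" by auto
 note D = Dv_minus[OF less.prems(1) Dv_pt[OF P(1), of 1]]
 have "0 <= dgr (D - pt P)" by (rule dgr_nonneg[OF D]) (use P(2) less.prems(2) in simp)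
 hence "nat (dgr (D - pt P)) < nat (dgr D)" using dg_pos[of P] by (simp add: dgr_minus dgr_single)
 from less.hyps[OF this D] obtain E where E: "eff E" "H (D - pt P - E) = H (D - pt P)" "ALL Q:Pts. l (D - pt P - E - pt Q) ~= l (D - pt P - E)" using P less.prems by auto
 have "H (D - pt P) <= H D" using H_pt[OF P(1)] by auto
 hence "H (D - pt P) = H D" using dim_strict[OF H_fin[OF less.prems(1)] _ H_sub, of "D - pt P"] P unfolding l_def by auto
 moreover have "eff (E + pt P)" using E Dv_add[OF _ Dv_pt[OF P(1)]] by (auto simp: eff_def lookup_add)
 ultimately show ?thesis using E by (intro exI[of _ "E + pt P"]) (simp add: als)
 qed
qed

text \<open>The values at \<open>t\<close> of the forms of degree \<open>k\<close> make up a
  subspace, and products add degrees, so these subspaces contain the spaces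
  \<open>pw\<close>.\<close>

lemma pw_forms: assumes "a:pw (span (t ` {..<n})) k" shows "EX F:mp n. homogeneous k F & mev of_real t (toE F) = a"
proof -
 define G where "G k = {p:VS n. ALL m:kys p. size m = k}" for k
 define I where "I k = mev of_real t ` G k" for k
 have add: "p + q:G k" if "p:G k" "q:G k" for p q k using that keys_add[of p q] VS_add unfolding G_def by auto
 have mult: "p * q:G (j + k)" if "p:G j" "q:G k" for p q j k using that keys_mult[of p q] VS_mult unfolding G_def by auto
 have sing: "set_mset m <= {..<n} ==> sgl m r:G (size m)" for m r unfolding G_def using VS_single by auto
 have I_add: "a + b:I k" if "a:I k" "b:I k" for a b k using that add unfolding I_def by (force simp: mev_r)
 have I_mult: "a * b:I (j + k)" if "a:I j" "b:I k" for a b j k using that mult unfolding I_def by (force simp: mev_r)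
 have c: "of_real r:I 0" for r using sing[of "{#}" r] unfolding I_def by (intro image_eqI[of _ _ "sgl {#} r"]) (simp_all add: mev_r)
 have sub: "subspace (I k)" for k
 proof (rule subspaceI)
 show "0:I k" unfolding I_def by (intro image_eqI[of _ _ 0]) (simp_all add: G_def VS_zero mev_r)
 show "r *\<^sub>R a:I k" if "a:I k" for r a using I_mult[OF c that] by (simp add: scr)
 qed (rule I_add)
 have V: "span (t ` {..<n}) <= I 1"
 proof (rule span_minimal[OF _ sub], rule image_subsetI)
 fix i assume "i:{..<n}"
 thus "t i:I 1" using sing[of "{#i#}" 1] unfolding I_def by (intro image_eqI[of _ _ "sgl {#i#} 1"]) (simp_all add: mev_r)
 qed
 have "pw (span (t ` {..<n})) k <= I k"
 proof (induction k)
 case 0 show ?case using c[of 1] span_minimal[OF _ sub, of "{1}" 0] by simp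
 next
 case (Suc k)
 have "a * b:I (Suc k)" if "a:span (t ` {..<n})" "b:pw (span (t ` {..<n})) k" for a b using I_mult[of a 1 b k] that V Suc by auto
 thus ?case unfolding pw.simps by (intro span_minimal[OF _ sub]) blast
 qed
 then obtain p where p: "p:G k" "a = mev of_real t p" using assms unfolding I_def by auto
 thus ?thesis using VS_mp by (intro bexI[of _ "lk p"]) (auto simp: homogeneous_def G_def in_keys_iff)
qed

end

context curve_model
begin

text \<open>The base point free part has the same space of functions as \<open>D\<close>. An ordered
  basis of it gives the morphism, and the elements of \<open>rat\<close> are quotients of forms in
  this basis.\<close>

lemma simple_if_rational: assumes D: "D:F.Dv" "2 <= F.l D" and r: "F.rat (F.H D) = UNIV" shows "simple_divisor X D"
proof -
 obtain E where E: "F.eff E" "F.H (D - E) = F.H D" "!!P. P:cp ==> F.l (D - E - F.pt P) ~= F.l (D - E)" using F.base_part[OF D(1)] D by auto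
 have Dv: "E:F.Dv" "D - E:F.Dv" using E F.Dv_minus[OF D(1)] by (auto simp: F.eff_def)
 have LS: "A:linear_system X B <-> A:F.Dv & effective A & (EX f:carrier K - {\<zero>$$K}. ALL P:cp. lk A P = lk B P + ord_at X P f)" for A B
 unfolding linear_system_def Div_Dv unfolding closed_points_cp by simp
 have "base_decomposition X D E (D - E)" unfolding base_decomposition_def Div_Dv
 proof (intro conjI Dv)
 show "effective E" using E by (simp add: effective_def F.eff_def)
 show "base_point_free X (D - E)" using E Dv F.Dv_minus F.Dv_pt by (simp add: base_point_free_def closed_points_cp ell_l)
 show "linear_system X D = (%D'. E + D') ` linear_system X (D - E)"
 proof
  show "(%D'. E + D') ` linear_system X (D - E) <= linear_system X D"
  proof (rule image_subsetI)
  fix D' assume "D':linear_system X (D - E)"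
  then obtain f where "D':F.Dv" "effective D'" "f:carrier K - {\<zero>$$K}" "ALL P:cp. lk D' P = lk (D - E) P + ord_at X P f" unfolding LS by auto
  thus "E + D':linear_system X D" unfolding LS using E F.Dv_add by (intro conjI bexI[of _ f]) (simp_all add: lookup_add lookup_minus effective_def F.eff_def)
  qed
  show "linear_system X D <= (%D'. E + D') ` linear_system X (D - E)"
  proof
  fix D' assume "D':linear_system X D"
  then obtain f where D': "D':F.Dv" "effective D'" and f: "f:carrier K" "f ~= \<zero>$$K" "!!P. P:cp ==> lk D' P = lk D P + ord_at X P f" unfolding LS by auto
  have hf: "h f ~= 0" using f h_zero h_inj[of f "\<zero>$$K"] by auto
  have o: "lk D' P = lk D P + F.v P (h f)" if "P:cp" for P using f(3)[OF that] ord_vl[OF that f(1)] by simp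
  have "h f:F.H D" using D' unfolding F.H_iff[OF hf] by (simp add: effective_def lookup_add F.lk_dvs[OF hf] flip: o)
  hence z: "0 <= lk (D - E + F.dvs (h f)) P" if "P:cp" for P using that unfolding E(2)[symmetric] F.H_iff[OF hf] by simp
  have "0 <= lk (D' - E) P" for P using z[of P] o Dv D' by (cases "P:cp") (auto simp: lookup_add lookup_minus F.lk_dvs[OF hf] F.Dv_iff)
  hence "D' - E:linear_system X (D - E)" unfolding LS using f D' Dv F.Dv_minus by (auto simp: effective_def lookup_minus)
  thus "D':(%D'. E + D') ` linear_system X (D - E)" by force
  qed
 qed
 qed
 moreover obtain s where s: "set s <= carrier K" "ring.independent K (range (ff_const X)) s" "ring.Span K (range (ff_const X)) s = global_sections X (D - E)"
  "span (h ` set s) = h ` global_sections X (D - E)" using KM.real_dim_eq[OF gs_H(1), of "D - E"] gs_H F.H_fin[OF Dv(2)] F.H_sub by auto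
 moreover have "birational_onto_image X s"
 proof -
 let ?t = "h o (!) s" and ?n = "length s" and ?ev = "real_poly_eval K (ff_const X) (%i. s ! i)"
 interpret E: mp_emb K h using K.is_cring h_mult h_add h_one h_inj by (simp add: mp_emb_def mp_emb_axioms_def)
 have sc: "s ! i:carrier K" if "i < ?n" for i using s nth_mem[OF that] by auto
 have ev: "h (?ev F) = mev of_real ?t (toE F)" "?ev F:carrier K" if "F:mp ?n" for F using E.eval_link[OF that KM.c h_real sc] by auto
 have q: "?ev F \<otimes>$$K inv$$K (?ev G):carrier K & h (?ev F \<otimes>$$K inv$$K (?ev G)) = h (?ev F) / h (?ev G)" if "F:mp ?n" "G:mp ?n" "?ev G ~= \<zero>$$K" for F G
 proof -
  have "h (?ev G) ~= 0" using that ev h_zero h_inj[of "?ev G" "\<zero>$$K"] by auto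
  thus ?thesis using h_inv[OF ev(2)[OF that(2)]] ev[OF that(1)] h_mult by (simp add: divide_inverse)
 qed
 have "?t ` {..<?n} = h ` set s" by (auto simp: set_conv_nth)
 hence H: "F.H D = span (?t ` {..<?n})" using s gs_H E by simp
 show ?thesis unfolding birational_onto_image_def Let_def
 proof (intro subset_antisym subsetI)
  fix a assume a: "a:carrier K"
  have "h a:F.rat (F.H D)" using r by simp
  then obtain x y k where x: "h a = x / y" "x:F.pw (F.H D) k" "y:F.pw (F.H D) k" "y ~= 0" unfolding F.rat_def by auto
  obtain F G where F: "F:mp ?n" "homogeneous k F" "mev of_real ?t (toE F) = x" and G: "G:mp ?n" "homogeneous k G" "mev of_real ?t (toE G) = y"
  using F.pw_forms[OF x(2)[unfolded H]] F.pw_forms[OF x(3)[unfolded H]] by auto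
  have nz: "?ev G ~= \<zero>$$K" using ev[OF G(1)] G x h_zero by auto
  have "a = ?ev F \<otimes>$$K inv$$K (?ev G)" using q[OF F(1) G(1) nz] ev F G x a h_inj by auto
  thus "a:{?ev F \<otimes>$$K inv$$K (?ev G) |F G k. F:mp ?n & G:mp ?n & homogeneous k F & homogeneous k G & ?ev G ~= \<zero>$$K}" using F G nz by auto
 qed (use q in blast)
 qed
 ultimately show ?thesis unfolding simple_divisor_def dim_linear_system_def using ell_l D by auto
qed

theorem non_simple_very_special: assumes D: "D:Div X" "very_special X D" "non_simple_divisor X D" shows "delta X D = card (real_components X) &
 real_of_int (dim_linear_system X D) = (real_of_int (div_degree X D) - real (delta X D)) / 2 + 1 & base_point_free X D"
proof -
 have Dv: "D:F.Dv" using D Div_Dv by simp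
 have l: "dim_linear_system X D = int (F.l D) - 1" by (simp add: dim_linear_system_def ell_l[OF Dv])
 have l2: "2 <= F.l D" using D l by (simp add: non_simple_divisor_def)
 have "F.rat (F.H D) ~= UNIV" using D simple_if_rational[OF Dv l2] by (auto simp: non_simple_divisor_def)
 with Dv have b: "2 * int (F.l D) - 4 <= FC.aa D" "(EX C:real_components X. C ~: FC.oc D) | (EX Q:cp. F.l (D - F.pt Q) = F.l D) ==> 2 * int (F.l D) - 2 <= FC.aa D"
 using FC.nonbirational_bound[of D] l2 by auto
 have "kys D <= cp" using Dv by (simp add: F.Dv_def)
 hence deg: "div_degree X D = F.dgr D" unfolding div_degree_def F.dgr_def using point_degree_dg by (intro sum.cong) auto
 have del: "delta X D = card (FC.oc D)" by (simp add: delta_def FC.oc_def FC.pr_def)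
 have "real_of_int (FC.aa D) = real_of_int (div_degree X D) - real (delta X D)" by (simp add: FC.aa_def deg del)
 moreover have "real_of_int (dim_linear_system X D) > (real_of_int (div_degree X D) - real (delta X D)) / 2" using D by (simp add: very_special_def)
 ultimately have "real_of_int (FC.aa D) < real_of_int (2 * int (F.l D) - 2)" using l by simp
 hence lt: "FC.aa D < 2 * int (F.l D) - 2" by simp
 have "F.eff D" using D Dv by (simp add: very_special_def effective_def F.eff_def)
 hence "even (FC.aa D)" using FC.aa_eff by simp
 \<comment> \<open>An even number that is at least \<open>2 l - 4\<close> and less than
   \<open>2 l - 2\<close>. So the sharper bound fails, and with it each of the two conditions that
   would imply it.\<close>
 hence "FC.aa D = 2 * int (F.l D) - 4" using b lt by presburger
 hence "real_of_int (dim_linear_system X D) = (real_of_int (div_degree X D) - real (delta X D)) / 2 + 1" using l `real_of_int (FC.aa D) = _` by (simp add: field_simps)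
 moreover have "FC.oc D = real_components X" using b lt by (force simp: FC.oc_def)
 moreover have "base_point_free X D" using b lt F.Dv_minus[OF Dv F.Dv_pt] by (auto simp: base_point_free_def closed_points_cp ell_l Dv)
 ultimately show ?thesis using del by simp
qed

end

section \<open>A field type for the function field of a counterexample\<close>

definition exceptional :: "('p, 's) real_space => bool" where "exceptional X <-> real_algebraic_curve X & (EX D:Div X. very_special X D & non_simple_divisor X D &
 ~ (delta X D = card (real_components X) &
  real_of_int (dim_linear_system X D) = (real_of_int (div_degree X D) - real (delta X D)) / 2 + 1 & base_point_free X D))"

text \<open>Type classes need the function field as a type.  Since a type cannot depend on the curve, it is
 taken to be the function field of one chosen counterexample, and the real numbers if there is none.\<close>

definition exc_field :: "('p, 's) exr ring" where "exc_field = (if EX X :: ('p, 's) real_space. exceptional X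
 then image_ring Inl (function_field (SOME X :: ('p, 's) real_space. exceptional X)) else image_ring Inr real_ring)"

definition exc_const :: "real => ('p, 's) exr" where "exc_const r = (if EX X :: ('p, 's) real_space. exceptional X
 then Inl (ff_const (SOME X :: ('p, 's) real_space. exceptional X) r) else Inr r)"

lemma ff_const_hom: assumes "real_algebraic_curve X" shows "ff_const X:ring_hom real_ring (function_field X)"
proof -
 interpret integral_scheme X by (rule curve_integral[OF assms])
 have "structure_hom X:ring_hom real_ring (Sec (topspace (space_top X)))" using assms by (simp add: real_algebraic_curve_def is_real_scheme_def)
 hence "structure_hom X r:car (topspace (space_top X))" "structure_hom X (r + t) = structure_hom X r \<oplus>$$(Sec (topspace (space_top X))) structure_hom X t"
 "structure_hom X (r * t) = structure_hom X r \<otimes>$$(Sec (topspace (space_top X))) structure_hom X t" "structure_hom X 1 = \<one>$$(Sec (topspace (space_top X)))" for r t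
 by (auto simp: ring_hom_def real_ring_def)
 thus ?thesis unfolding const_germ_def using germ_car[OF topspace_opn gp_top]
 by (intro ring_hom_memI) (auto simp: real_ring_def stalk_add1[OF topspace_opn gp_top] stalk_mult1[OF topspace_opn gp_top] stalk_one[OF topspace_opn gp_top])
qed

lemma real_ring_field: "field real_ring" by (rule cring.cring_fieldI2[OF real_ring_cring]) (auto simp: real_ring_def intro: right_inverse)

lemma exc_field_props: "field (exc_field :: ('p, 's) exr ring)" "exc_const:ring_hom real_ring (exc_field :: ('p, 's) exr ring)"
proof -
 have "field (exc_field :: ('p, 's) exr ring) & exc_const:ring_hom real_ring (exc_field :: ('p, 's) exr ring)"
 proof (cases "EX X :: ('p, 's) real_space. exceptional X")
 case True
 define X where "X = (SOME X :: ('p, 's) real_space. exceptional X)"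
 have X: "real_algebraic_curve X" using someI_ex[OF True] unfolding X_def exceptional_def by fast
 interpret K: field "function_field X" by (rule integral_scheme.ff_field[OF curve_integral[OF X]])
 have e: "exc_field = image_ring Inl (function_field X)" "exc_const = Inl o ff_const X" using True by (simp_all add: exc_field_def exc_const_def X_def fun_eq_iff)
 have "Inl:ring_hom (function_field X) (image_ring (Inl :: _ => _ + real) (function_field X))" using inj_imp_image_ring_iso[of "Inl :: _ => _ + real" "function_field X"] by (simp add: ring_iso_def)
 thus ?thesis unfolding e using K.inj_imp_image_ring_is_field[of "Inl :: _ => _ + real"] ring_hom_trans[OF ff_const_hom[OF X]] by simp
 next
 case False
 interpret K: field real_ring by (rule real_ring_field)
 have e: "exc_field = image_ring (Inr :: real => ('p, 's) exr) real_ring" "exc_const = (Inr :: real => ('p, 's) exr)"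
  using False by (simp_all add: exc_field_def exc_const_def fun_eq_iff)
 show ?thesis unfolding e using K.inj_imp_image_ring_is_field[of "Inr :: real => ('p, 's) exr"] inj_imp_image_ring_iso[of "Inr :: real => ('p, 's) exr" real_ring] by (simp add: ring_iso_def)
 qed
 thus "field (exc_field :: ('p, 's) exr ring)" "exc_const:ring_hom real_ring (exc_field :: ('p, 's) exr ring)" by auto
qed

typedef ('p, 's) exc = "carrier (exc_field :: ('p, 's) exr ring)" morphisms rep abs
proof -
 interpret field "exc_field :: ('p, 's) exr ring" by (rule exc_field_props(1))
 show "EX x. x:carrier (exc_field :: ('p, 's) exr ring)" by auto
qed

instantiation exc :: (type, type) real_field
begin

abbreviation "EF == exc_field :: (('a set \<times> 'b) set + real) ring"
definition zero_exc :: "('a, 'b) exc" where "0 = abs \<zero>$$EF"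
definition one_exc :: "('a, 'b) exc" where "1 = abs \<one>$$EF"
definition plus_exc :: "('a, 'b) exc => ('a, 'b) exc => ('a, 'b) exc" where "x + y = abs (rep x \<oplus>$$EF rep y)"
definition uminus_exc :: "('a, 'b) exc => ('a, 'b) exc" where "- x = abs (\<ominus>$$EF rep x)"
definition minus_exc :: "('a, 'b) exc => ('a, 'b) exc => ('a, 'b) exc" where "x - y = x + - (y :: ('a, 'b) exc)"
definition times_exc :: "('a, 'b) exc => ('a, 'b) exc => ('a, 'b) exc" where "x * y = abs (rep x \<otimes>$$EF rep y)"
definition inverse_exc :: "('a, 'b) exc => ('a, 'b) exc" where "inverse x = (if x = 0 then 0 else abs (inv$$EF rep x))"
definition divide_exc :: "('a, 'b) exc => ('a, 'b) exc => ('a, 'b) exc" where "x div y = x * inverse (y :: ('a, 'b) exc)"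
definition scaleR_exc :: "real => ('a, 'b) exc => ('a, 'b) exc" where "r *\<^sub>R x = abs (exc_const r \<otimes>$$EF rep x)"

instance
proof
 interpret F: field EF by (rule exc_field_props(1))
 note [simp] = abs_inverse rep[simplified]
 have r: "rep (0 :: ('a, 'b) exc) = \<zero>$$EF" "rep (1 :: ('a, 'b) exc) = \<one>$$EF" "rep (x + y) = rep x \<oplus>$$EF rep y"
 "rep (- x) = \<ominus>$$EF rep x" "rep (x * y) = rep x \<otimes>$$EF rep y" for x y :: "('a, 'b) exc"
 by (simp_all add: zero_exc_def one_exc_def plus_exc_def uminus_exc_def times_exc_def)
 have c: "exc_const t:carrier EF" "exc_const (s + t) = exc_const s \<oplus>$$EF exc_const t" "exc_const (s * t) = exc_const s \<otimes>$$EF exc_const t"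
 "exc_const 1 = \<one>$$EF" for s t using exc_field_props by (auto simp: ring_hom_def real_ring_def)
 have s: "rep (t *\<^sub>R x) = exc_const t \<otimes>$$EF rep x" for t and x :: "('a, 'b) exc" by (simp add: scaleR_exc_def c)
 have e: "x = y <-> rep x = rep y" for x y :: "('a, 'b) exc" by (simp add: rep_inject)
 fix x y z :: "('a, 'b) exc" and t u :: real
 show "x + y + z = x + (y + z)" "x + y = y + x" "0 + x = x" "- x + x = 0" "x - y = x + - y" "x * y * z = x * (y * z)"
 "x * y = y * x" "1 * x = x" "x * 1 = x" "x * (y + z) = x * y + x * z" "(x + y) * z = x * z + y * z" "x div y = x * inverse y" "inverse (0 :: ('a, 'b) exc) = 0"
 by (simp_all add: e r minus_exc_def divide_exc_def inverse_exc_def F.a_ac F.m_ac F.r_distr F.r_neg)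
 show "(0 :: ('a, 'b) exc) ~= 1" by (simp add: e r)
 show "x ~= 0 ==> inverse x * x = 1" "x ~= 0 ==> x * inverse x = 1"
 proof -
 assume "x ~= 0"
 moreover from this have "rep x:Units EF" using F.field_Units by (simp add: e r)
 ultimately show "inverse x * x = 1" "x * inverse x = 1" by (simp_all add: inverse_exc_def e r)
 qed
 show "t *\<^sub>R (x + y) = t *\<^sub>R x + t *\<^sub>R y" "(t + u) *\<^sub>R x = t *\<^sub>R x + u *\<^sub>R x" "t *\<^sub>R u *\<^sub>R x = (t * u) *\<^sub>R x" "1 *\<^sub>R x = x"
 "t *\<^sub>R x * y = t *\<^sub>R (x * y)" "x * t *\<^sub>R y = t *\<^sub>R (x * y)" by (simp_all add: e r s c F.r_distr F.m_ac)
qed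

end

theorem theorem2p5:
  fixes X :: "('p, 's) real_space" and D :: "'p \<Rightarrow>\<^sub>0 int"
  assumes "real_algebraic_curve X"
    and "D \<in> Div X"
    and "very_special X D"
    and "non_simple_divisor X D"
  shows "delta X D = card (real_components X) \<and>
    real_of_int (dim_linear_system X D) = (real_of_int (div_degree X D) - real (delta X D)) / 2 + 1 \<and>
    base_point_free X D"
proof (rule ccontr)
 assume "~ ?thesis"
 hence "exceptional X" using assms unfolding exceptional_def by auto
 hence ex: "EX X :: ('p, 's) real_space. exceptional X" by auto
 \<comment> \<open>The contradiction is derived for the chosen counterexample \<open>Y\<close>,
   whose function field underlies the type \<open>exc\<close>, instead of for
   \<open>X\<close>.\<close>
 define Y where "Y = (SOME X :: ('p, 's) real_space. exceptional X)"
 have Y: "exceptional Y" using someI_ex[OF ex] unfolding Y_def .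
 hence cY: "real_algebraic_curve Y" by (simp add: exceptional_def)
 interpret I: integral_scheme Y by (rule curve_integral[OF cY])
 interpret K: field "function_field Y" by (rule I.ff_field)
 let ?h = "%a. abs (Inl a) :: ('p, 's) exc"
 have e: "(exc_field :: ('p, 's) exr ring) = image_ring Inl (function_field Y)" "exc_const r = (Inl (ff_const Y r) :: ('p, 's) exr)" for r
 using ex by (simp_all add: exc_field_def exc_const_def Y_def)
 have iso: "(Inl :: _ => ('p, 's) exr):ring_iso (function_field Y) exc_field" unfolding e by (rule inj_imp_image_ring_iso) simp
 hence ih: "(Inl :: _ => ('p, 's) exr):ring_hom (function_field Y) exc_field" by (simp add: ring_iso_def)
 have hom: "Inl a:carrier (exc_field :: ('p, 's) exr ring)" if "a:carrier (function_field Y)" for a by (rule ring_hom_closed[OF ih that])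
 have rep: "rep (?h a) = Inl a" if "a:carrier (function_field Y)" for a using hom[OF that] by (rule abs_inverse)
 have "curve_model Y ?h"
 proof (intro curve_model.intro scheme_model.intro scheme_model_axioms.intro curve_model_axioms.intro I.integral_scheme_axioms cY)
 have "bij_betw Inl (carrier (function_field Y)) (carrier (exc_field :: ('p, 's) exr ring))" using iso by (simp add: ring_iso_def)
 moreover have "bij_betw abs (carrier (exc_field :: ('p, 's) exr ring)) UNIV"
  by (simp add: bij_betw_def inj_on_def abs_inject type_definition.Abs_image[OF type_definition_exc])
 ultimately have "bij_betw (abs o Inl) (carrier (function_field Y)) (UNIV :: ('p, 's) exc set)" by (rule bij_betw_trans)
 thus "bij_betw ?h (carrier (function_field Y)) UNIV" by (simp add: comp_def)
 show "?h (a \<otimes>$$(function_field Y) b) = ?h a * ?h b" "?h (a \<oplus>$$(function_field Y) b) = ?h a + ?h b"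
  if "a:carrier (function_field Y)" "b:carrier (function_field Y)" for a b
  using that ring_hom_mult[OF ih that] ring_hom_add[OF ih that] by (simp_all add: times_exc_def plus_exc_def rep)
 show "?h \<one>$$(function_field Y) = 1" using ring_hom_one[OF ih] by (simp add: one_exc_def)
 interpret E: field "exc_field :: ('p, 's) exr ring" by (rule exc_field_props(1))
 have "exc_const r:carrier (exc_field :: ('p, 's) exr ring)" for r using exc_field_props by (auto simp: real_ring_def dest: ring_hom_closed)
 thus "?h (ff_const Y r) = of_real r" for r by (simp add: of_real_def scaleR_exc_def one_exc_def abs_inverse flip: e)
 qed
 thus False using curve_model.non_simple_very_special Y unfolding exceptional_def by fast
qed

end
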